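(* Let $k$ be a commutative ring. Assume the following data are given: (1) compactly generated triangulated $k$-categories $\mathcal{T}$, $\mathcal{T}'$, $\mathcal{T}''$ together with a recollement $(i^*,i_*,i^!;j_!,j^*,j_* )$ of $\mathcal{T}$ in terms of $\mathcal{T}'$ and $\mathcal{T}''$, where $\mathcal{T}$ is algebraic; (2) skeletally small triangulated subcategories $\mathcal{S}$, $\mathcal{S}'$ and $\mathcal{S}''$ of $\mathcal{T}$, $\mathcal{T}'$ and $\mathcal{T}''$, which contain $\mathcal{T}^c$, $\mathcal{T}'^c$ and $\mathcal{T}''^c$, respectively; (3) the first row $\mathcal{T}'\xleftarrow{i^*}\mathcal{T}\xleftarrow{j_!}\mathcal{T}''$ of the recollement restricts to a short exact sequence up to direct summands $\mathcal{S}'\leftarrow\mathcal{S}\leftarrow\mathcal{S}''$. Then the first row of the recollement induces a short exact sequence of triangulated categories up to direct summands $$\mathcal{S}'/\mathcal{T}'^c\longleftarrow\mathcal{S}/\mathcal{T}^c\longleftarrow\mathcal{S}''/\mathcal{T}''^c.$$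
   Context: All categories and functors are $k$-linear; triangulated subcategories are full. For a triangulated category $\mathcal{T}$ with infinite direct sums, $\mathcal{T}^c$ denotes the full subcategory of compact objects, i.e. objects $X$ such that $\mathrm{Hom}_{\mathcal{T}}(X,?)$ commutes with infinite direct sums. A compactly generated triangulated category has infinite direct sums and is generated by a set of compact objects. A triangulated category is algebraic if it is triangle equivalent to the stable category of a Frobenius category. A recollement of a triangulated category $\mathcal{T}$ in terms of triangulated categories $\mathcal{T}'$ and $\mathcal{T}''$ consists of six triangle functors $i^*,i^!\colon\mathcal{T}\to\mathcal{T}'$, $i_*\colon\mathcal{T}'\to\mathcal{T}$, $j^*\colon\mathcal{T}\to\mathcal{T}''$, $j_!,j_*\colon\mathcal{T}''\to\mathcal{T}$ such that: (R1) $(i^*,i_*,i^!)$ and $(j_!,j^*,j_* )$ are adjoint triples; (R2) $i_*,j_*,j_!$ are fully faithful; (R3) $j^*\circ i_*=0$; (R4) for every object $X$ of $\mathcal{T}$ there are triangles $i_*i^!X\to X\to j_*j^*X\to i_*i^!X[1]$ and $j_!j^*X\to X\to i_*i^*X\to j_!j^*X[1]$ whose first two morphisms are given by the units and counits. A sequence of triangle functors $\mathcal{T}'\xleftarrow{F}\mathcal{T}\xleftarrow{G}\mathcal{T}''$ is a short exact sequence up to direct summands if $G$ is fully faithful, $F\circ G=0$ and the induced functor $\overline{F}\colon\mathcal{T}/\mathcal{T}''\to\mathcal{T}'$ is an equivalence up to direct summands, i.e. it is fully faithful and every object of $\mathcal{T}'$ is a direct summand of an object in its image. Quotients are Verdier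 quotients. *)

theory Defs
  imports "HOL-Algebra.Module" "HOL-Library.FuncSet"
begin

text \<open>
  Conventions. A regular uncountable cardinal \<open>\<kappa>\<close> (a well-order on a type \<open>'u\<close>) plays the role of
  the universe: a set is small if it has fewer than \<open>\<kappa>\<close> elements. For \<open>\<kappa>\<close> strongly inaccessible
  this is the usual notion of a set in a Grothendieck universe. Infinite direct sums are
  coproducts of small families. All Hom-sets are small, but object classes need not be.
  The ground ring \<open>k\<close> is a HOL-Algebra ring, so the zero ring is allowed.
\<close>

definition universe_card :: "'u rel \<Rightarrow> bool" where
  "universe_card \<kappa> \<longleftrightarrow> Card_order \<kappa> \<and> regularCard \<kappa> \<and> (natLeq, \<kappa>) \<in> ordLess"

definition small :: "'u rel \<Rightarrow> 'a set \<Rightarrow> bool" where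
  "small \<kappa> A \<longleftrightarrow> (card_of A, \<kappa>) \<in> ordLess"


section \<open>Linear categories\<close>

record ('o, 'm) cat =
  Ob :: "'o set"
  Arr :: "'m set"
  Dom :: "'m \<Rightarrow> 'o"
  Cod :: "'m \<Rightarrow> 'o"
  Id :: "'o \<Rightarrow> 'm"
  Comp :: "'m \<Rightarrow> 'm \<Rightarrow> 'm" (infixl \<open>\<cdot>\<index>\<close> 70)

record ('r, 'o, 'm) lcat = "('o, 'm) cat" +
  Add :: "'m \<Rightarrow> 'm \<Rightarrow> 'm"
  Zer :: "'o \<Rightarrow> 'o \<Rightarrow> 'm"
  Smul :: "'r \<Rightarrow> 'm \<Rightarrow> 'm"

definition Hom :: "('o, 'm, 'z) cat_scheme \<Rightarrow> 'o \<Rightarrow> 'o \<Rightarrow> 'm set" where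
  "Hom C X Y = {f \<in> Arr C. Dom C f = X \<and> Cod C f = Y}"

text \<open>
  The Hom-module as a record of HOL-Algebra; that record type extends the one for rings, and the
  ring multiplication and unit in it are irrelevant for modules.
\<close>

definition Hom_module :: "('r, 'o, 'm, 'z) lcat_scheme \<Rightarrow> 'o \<Rightarrow> 'o \<Rightarrow> ('r, 'm) module" where
  "Hom_module C X Y =
    \<lparr>carrier = Hom C X Y, mult = undefined, one = undefined,
     zero = Zer C X Y, add = Add C, smult = Smul C\<rparr>"

locale category =
  fixes C :: "('o, 'm, 'z) cat_scheme" (structure)
  assumes Dom_in: "f \<in> Arr C \<Longrightarrow> Dom C f \<in> Ob C"
    and Cod_in: "f \<in> Arr C \<Longrightarrow> Cod C f \<in> Ob C"
    and Id_in: "X \<in> Ob C \<Longrightarrow> Id C X \<in> Hom C X X"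
    and Comp_in: "\<lbrakk>f \<in> Hom C X Y; g \<in> Hom C Y Z\<rbrakk> \<Longrightarrow> g \<cdot> f \<in> Hom C X Z"
    and Comp_assoc:
      "\<lbrakk>f \<in> Hom C W X; g \<in> Hom C X Y; h \<in> Hom C Y Z\<rbrakk> \<Longrightarrow> (h \<cdot> g) \<cdot> f = h \<cdot> (g \<cdot> f)"
    and Comp_Id_right: "f \<in> Hom C X Y \<Longrightarrow> f \<cdot> Id C X = f"
    and Comp_Id_left: "f \<in> Hom C X Y \<Longrightarrow> Id C Y \<cdot> f = f"

locale lin_category = category C
  for \<kappa> :: "'u rel" and k :: "'r ring" and C :: "('r, 'o, 'm, 'z) lcat_scheme" (structure) +
  assumes ground_ring: "cring k"
    and Hom_small: "\<lbrakk>X \<in> Ob C; Y \<in> Ob C\<rbrakk> \<Longrightarrow> small \<kappa> (Hom C X Y)"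
    and Hom_is_module: "\<lbrakk>X \<in> Ob C; Y \<in> Ob C\<rbrakk> \<Longrightarrow> module k (Hom_module C X Y)"
    and Comp_Add_right: "\<lbrakk>f \<in> Hom C X Y; f' \<in> Hom C X Y; g \<in> Hom C Y Z\<rbrakk>
      \<Longrightarrow> g \<cdot> Add C f f' = Add C (g \<cdot> f) (g \<cdot> f')"
    and Comp_Add_left: "\<lbrakk>f \<in> Hom C X Y; g \<in> Hom C Y Z; g' \<in> Hom C Y Z\<rbrakk>
      \<Longrightarrow> Add C g g' \<cdot> f = Add C (g \<cdot> f) (g' \<cdot> f)"
    and Comp_Smul_right: "\<lbrakk>a \<in> carrier k; f \<in> Hom C X Y; g \<in> Hom C Y Z\<rbrakk>
      \<Longrightarrow> g \<cdot> Smul C a f = Smul C a (g \<cdot> f)"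
    and Comp_Smul_left: "\<lbrakk>a \<in> carrier k; f \<in> Hom C X Y; g \<in> Hom C Y Z\<rbrakk>
      \<Longrightarrow> Smul C a g \<cdot> f = Smul C a (g \<cdot> f)"

definition neg :: "('r, 'o, 'm, 'z) lcat_scheme \<Rightarrow> 'm \<Rightarrow> 'm" where
  "neg C f = a_inv (Hom_module C (Dom C f) (Cod C f)) f"

definition inverse_arrows :: "('o, 'm, 'z) cat_scheme \<Rightarrow> 'm \<Rightarrow> 'm \<Rightarrow> bool" where
  "inverse_arrows C f g \<longleftrightarrow> f \<in> Arr C \<and> g \<in> Hom C (Cod C f) (Dom C f)
     \<and> g \<cdot>\<^bsub>C\<^esub> f = Id C (Dom C f) \<and> f \<cdot>\<^bsub>C\<^esub> g = Id C (Cod C f)"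

definition is_iso :: "('o, 'm, 'z) cat_scheme \<Rightarrow> 'm \<Rightarrow> bool" where
  "is_iso C f \<longleftrightarrow> (\<exists>g. inverse_arrows C f g)"

definition inv_arrow :: "('o, 'm, 'z) cat_scheme \<Rightarrow> 'm \<Rightarrow> 'm" where
  "inv_arrow C f = (THE g. inverse_arrows C f g)"

definition isomorphic :: "('o, 'm, 'z) cat_scheme \<Rightarrow> 'o \<Rightarrow> 'o \<Rightarrow> bool" where
  "isomorphic C X Y \<longleftrightarrow> (\<exists>f \<in> Hom C X Y. is_iso C f)"

definition zero_object :: "('r, 'o, 'm, 'z) lcat_scheme \<Rightarrow> 'o \<Rightarrow> bool" where
  "zero_object C X \<longleftrightarrow> X \<in> Ob C \<and> Id C X = Zer C X X"

definition biproduct ::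
    "('r, 'o, 'm, 'z) lcat_scheme \<Rightarrow> 'o \<Rightarrow> 'o \<Rightarrow> 'o \<Rightarrow> bool" where
  "biproduct C X Y B \<longleftrightarrow>
    (\<exists>i1 \<in> Hom C X B. \<exists>i2 \<in> Hom C Y B. \<exists>p1 \<in> Hom C B X. \<exists>p2 \<in> Hom C B Y.
      p1 \<cdot>\<^bsub>C\<^esub> i1 = Id C X \<and> p2 \<cdot>\<^bsub>C\<^esub> i2 = Id C Y \<and>
      p2 \<cdot>\<^bsub>C\<^esub> i1 = Zer C X Y \<and> p1 \<cdot>\<^bsub>C\<^esub> i2 = Zer C Y X \<and>
      Add C (i1 \<cdot>\<^bsub>C\<^esub> p1) (i2 \<cdot>\<^bsub>C\<^esub> p2) = Id C B)"

definition direct_summand :: "('r, 'o, 'm, 'z) lcat_scheme \<Rightarrow> 'o \<Rightarrow> 'o \<Rightarrow> bool" where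
  "direct_summand C X B \<longleftrightarrow> B \<in> Ob C \<and> (\<exists>Y \<in> Ob C. biproduct C X Y B)"

locale additive_category = lin_category \<kappa> k C
  for \<kappa> :: "'u rel" and k :: "'r ring" and C :: "('r, 'o, 'm, 'z) lcat_scheme" (structure) +
  assumes ex_zero_object: "\<exists>Z. zero_object C Z"
    and ex_biproduct: "\<lbrakk>X \<in> Ob C; Y \<in> Ob C\<rbrakk> \<Longrightarrow> \<exists>B \<in> Ob C. biproduct C X Y B"


section \<open>Linear functors and adjunctions\<close>

record ('o, 'm, 'p, 'q) ftr =
  Obf :: "'o \<Rightarrow> 'p"
  Arf :: "'m \<Rightarrow> 'q"

definition lin_functor ::
    "'r ring \<Rightarrow> ('r, 'o, 'm, 'y) lcat_scheme \<Rightarrow> ('r, 'p, 'q, 'z) lcat_scheme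
      \<Rightarrow> ('o, 'm, 'p, 'q, 'w) ftr_scheme \<Rightarrow> bool" where
  "lin_functor k C D F \<longleftrightarrow>
    (\<forall>X \<in> Ob C. Obf F X \<in> Ob D) \<and>
    (\<forall>X \<in> Ob C. \<forall>Y \<in> Ob C. \<forall>f \<in> Hom C X Y. Arf F f \<in> Hom D (Obf F X) (Obf F Y)) \<and>
    (\<forall>X \<in> Ob C. Arf F (Id C X) = Id D (Obf F X)) \<and>
    (\<forall>f \<in> Arr C. \<forall>g \<in> Arr C. Dom C g = Cod C f \<longrightarrow>
      Arf F (g \<cdot>\<^bsub>C\<^esub> f) = Arf F g \<cdot>\<^bsub>D\<^esub> Arf F f) \<and>
    (\<forall>f \<in> Arr C. \<forall>g \<in> Arr C. Dom C f = Dom C g \<and> Cod C f = Cod C g \<longrightarrow>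
      Arf F (Add C f g) = Add D (Arf F f) (Arf F g)) \<and>
    (\<forall>a \<in> carrier k. \<forall>f \<in> Arr C. Arf F (Smul C a f) = Smul D a (Arf F f))"

definition fully_faithful ::
    "('o, 'm, 'y) cat_scheme \<Rightarrow> ('p, 'q, 'z) cat_scheme \<Rightarrow> ('o, 'm, 'p, 'q, 'w) ftr_scheme \<Rightarrow> bool"
  where
  "fully_faithful C D F \<longleftrightarrow>
    (\<forall>X \<in> Ob C. \<forall>Y \<in> Ob C. bij_betw (Arf F) (Hom C X Y) (Hom D (Obf F X) (Obf F Y)))"

definition essentially_surjective ::
    "('o, 'm, 'y) cat_scheme \<Rightarrow> ('p, 'q, 'z) cat_scheme \<Rightarrow> ('o, 'm, 'p, 'q, 'w) ftr_scheme \<Rightarrow> bool"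
  where
  "essentially_surjective C D F \<longleftrightarrow> (\<forall>Y \<in> Ob D. \<exists>X \<in> Ob C. isomorphic D (Obf F X) Y)"

definition equivalence_up_to_summands ::
    "('r, 'o, 'm, 'y) lcat_scheme \<Rightarrow> ('r, 'p, 'q, 'z) lcat_scheme
      \<Rightarrow> ('o, 'm, 'p, 'q, 'w) ftr_scheme \<Rightarrow> bool" where
  "equivalence_up_to_summands C D F \<longleftrightarrow>
    fully_faithful C D F \<and> (\<forall>Y \<in> Ob D. \<exists>X \<in> Ob C. direct_summand D Y (Obf F X))"

text \<open>\<open>F : C \<rightarrow> D\<close> is left adjoint to \<open>G : D \<rightarrow> C\<close> with unit \<open>\<eta>\<close> and counit \<open>\<epsilon>\<close>.\<close>

definition adjunction ::
    "('o, 'm, 'y) cat_scheme \<Rightarrow> ('p, 'q, 'z) cat_scheme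
      \<Rightarrow> ('o, 'm, 'p, 'q, 'v) ftr_scheme \<Rightarrow> ('p, 'q, 'o, 'm, 'w) ftr_scheme
      \<Rightarrow> ('o \<Rightarrow> 'm) \<Rightarrow> ('p \<Rightarrow> 'q) \<Rightarrow> bool" where
  "adjunction C D F G \<eta> \<epsilon> \<longleftrightarrow>
    (\<forall>X \<in> Ob C. \<eta> X \<in> Hom C X (Obf G (Obf F X))) \<and>
    (\<forall>Y \<in> Ob D. \<epsilon> Y \<in> Hom D (Obf F (Obf G Y)) Y) \<and>
    (\<forall>f \<in> Arr C. \<eta> (Cod C f) \<cdot>\<^bsub>C\<^esub> f = Arf G (Arf F f) \<cdot>\<^bsub>C\<^esub> \<eta> (Dom C f)) \<and>
    (\<forall>g \<in> Arr D. \<epsilon> (Cod D g) \<cdot>\<^bsub>D\<^esub> Arf F (Arf G g) = g \<cdot>\<^bsub>D\<^esub> \<epsilon> (Dom D g)) \<and>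
    (\<forall>X \<in> Ob C. \<epsilon> (Obf F X) \<cdot>\<^bsub>D\<^esub> Arf F (\<eta> X) = Id D (Obf F X)) \<and>
    (\<forall>Y \<in> Ob D. Arf G (\<epsilon> Y) \<cdot>\<^bsub>C\<^esub> \<eta> (Obf G Y) = Id C (Obf G Y))"


section \<open>Triangulated categories\<close>

text \<open>
  The shift is a self-equivalence, not necessarily an automorphism. A triangle
  \<open>X \<rightarrow> Y \<rightarrow> Z \<rightarrow> X[1]\<close> is given by its three morphisms.
\<close>

record ('r, 'o, 'm) tcat = "('r, 'o, 'm) lcat" +
  ShO :: "'o \<Rightarrow> 'o"
  ShA :: "'m \<Rightarrow> 'm"
  Tri :: "('m \<times> 'm \<times> 'm) set"

definition shift :: "('r, 'o, 'm, 'z) tcat_scheme \<Rightarrow> ('o, 'm, 'o, 'm) ftr" where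
  "shift T = \<lparr>Obf = ShO T, Arf = ShA T\<rparr>"

definition candidate_triangle ::
    "('r, 'o, 'm, 'z) tcat_scheme \<Rightarrow> 'm \<times> 'm \<times> 'm \<Rightarrow> bool" where
  "candidate_triangle T = (\<lambda>(f, g, h). f \<in> Arr T \<and> g \<in> Arr T \<and> h \<in> Arr T \<and>
     Dom T g = Cod T f \<and> Dom T h = Cod T g \<and> Cod T h = ShO T (Dom T f))"

definition triangle_iso ::
    "('r, 'o, 'm, 'z) tcat_scheme \<Rightarrow> 'm \<times> 'm \<times> 'm \<Rightarrow> 'm \<times> 'm \<times> 'm \<Rightarrow> bool" where
  "triangle_iso T = (\<lambda>(f, g, h) (f', g', h').
     candidate_triangle T (f, g, h) \<and> candidate_triangle T (f', g', h') \<and>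
     (\<exists>a \<in> Hom T (Dom T f) (Dom T f'). \<exists>b \<in> Hom T (Dom T g) (Dom T g').
      \<exists>c \<in> Hom T (Dom T h) (Dom T h').
        is_iso T a \<and> is_iso T b \<and> is_iso T c \<and>
        f' \<cdot>\<^bsub>T\<^esub> a = b \<cdot>\<^bsub>T\<^esub> f \<and> g' \<cdot>\<^bsub>T\<^esub> b = c \<cdot>\<^bsub>T\<^esub> g \<and> h' \<cdot>\<^bsub>T\<^esub> c = ShA T a \<cdot>\<^bsub>T\<^esub> h))"

locale tri_category = additive_category \<kappa> k T
  for \<kappa> :: "'u rel" and k :: "'r ring" and T :: "('r, 'o, 'm, 'z) tcat_scheme" (structure) +
  assumes shift_functor: "lin_functor k T T (shift T)"
    and shift_fully_faithful: "fully_faithful T T (shift T)"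
    and shift_essentially_surjective: "essentially_surjective T T (shift T)"
    and Tri_candidate: "t \<in> Tri T \<Longrightarrow> candidate_triangle T t"
    and Tri_iso_closed: "\<lbrakk>t \<in> Tri T; triangle_iso T t t'\<rbrakk> \<Longrightarrow> t' \<in> Tri T"
    and TR1_Id: "\<lbrakk>X \<in> Ob T; zero_object T Z\<rbrakk>
      \<Longrightarrow> (Id T X, Zer T X Z, Zer T Z (ShO T X)) \<in> Tri T"
    and TR1_cone: "f \<in> Arr T \<Longrightarrow> \<exists>g h. (f, g, h) \<in> Tri T"
    and TR2: "candidate_triangle T (f, g, h)
      \<Longrightarrow> (f, g, h) \<in> Tri T \<longleftrightarrow> (g, h, neg T (ShA T f)) \<in> Tri T"
    and TR3: "\<lbrakk>(f, g, h) \<in> Tri T; (f', g', h') \<in> Tri T;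
        a \<in> Hom T (Dom T f) (Dom T f'); b \<in> Hom T (Dom T g) (Dom T g'); f' \<cdot> a = b \<cdot> f\<rbrakk>
      \<Longrightarrow> \<exists>c \<in> Hom T (Dom T h) (Dom T h'). g' \<cdot> b = c \<cdot> g \<and> h' \<cdot> c = ShA T a \<cdot> h"
    and TR4: "\<lbrakk>f \<in> Hom T X Y; g \<in> Hom T Y Z;
        (f, a, b) \<in> Tri T; (g, c, d) \<in> Tri T; (g \<cdot> f, e, l) \<in> Tri T\<rbrakk>
      \<Longrightarrow> \<exists>u \<in> Hom T (Cod T a) (Cod T e). \<exists>v \<in> Hom T (Cod T e) (Cod T c).
            (u, v, ShA T a \<cdot> d) \<in> Tri T \<and> u \<cdot> a = e \<cdot> g \<and> l \<cdot> u = b \<and>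
            v \<cdot> e = c \<and> d \<cdot> v = ShA T f \<cdot> l"

text \<open>
  A triangle functor is a functor \<open>F\<close> together with a natural isomorphism
  \<open>Shf F X : F (X[1]) \<rightarrow> (F X)[1]\<close>.
\<close>

record ('o, 'm, 'p, 'q) tftr = "('o, 'm, 'p, 'q) ftr" +
  Shf :: "'o \<Rightarrow> 'q"

definition tri_functor ::
    "'r ring \<Rightarrow> ('r, 'o, 'm, 'y) tcat_scheme \<Rightarrow> ('r, 'p, 'q, 'z) tcat_scheme
      \<Rightarrow> ('o, 'm, 'p, 'q, 'w) tftr_scheme \<Rightarrow> bool" where
  "tri_functor k T U F \<longleftrightarrow>
    lin_functor k T U F \<and>
    (\<forall>X \<in> Ob T. Shf F X \<in> Hom U (Obf F (ShO T X)) (ShO U (Obf F X)) \<and> is_iso U (Shf F X)) \<and>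
    (\<forall>f \<in> Arr T. Shf F (Cod T f) \<cdot>\<^bsub>U\<^esub> Arf F (ShA T f) = ShA U (Arf F f) \<cdot>\<^bsub>U\<^esub> Shf F (Dom T f)) \<and>
    (\<forall>f g h. (f, g, h) \<in> Tri T
      \<longrightarrow> (Arf F f, Arf F g, Shf F (Dom T f) \<cdot>\<^bsub>U\<^esub> Arf F h) \<in> Tri U)"

text \<open>The composite \<open>G \<circ> F\<close> of triangle functors, where \<open>V\<close> is the target of \<open>G\<close>.\<close>

definition tri_comp ::
    "('r, 's, 't, 'z) tcat_scheme \<Rightarrow> ('p, 'q, 's, 't) tftr \<Rightarrow> ('o, 'm, 'p, 'q) tftr
      \<Rightarrow> ('o, 'm, 's, 't) tftr" where
  "tri_comp V G F =
    \<lparr>Obf = Obf G \<circ> Obf F, Arf = Arf G \<circ> Arf F,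
     Shf = (\<lambda>X. Shf G (Obf F X) \<cdot>\<^bsub>V\<^esub> Arf G (Shf F X))\<rparr>"

definition triangle_equivalence ::
    "'r ring \<Rightarrow> ('r, 'o, 'm, 'y) tcat_scheme \<Rightarrow> ('r, 'p, 'q, 'z) tcat_scheme
      \<Rightarrow> ('o, 'm, 'p, 'q, 'w) tftr_scheme \<Rightarrow> bool" where
  "triangle_equivalence k T U F \<longleftrightarrow>
    tri_functor k T U F \<and> fully_faithful T U F \<and> essentially_surjective T U F"

text \<open>
  Full triangulated subcategories are given by their classes of objects. They are not required
  to be closed under isomorphism; the definition covers the strict and the non-strict case.
\<close>

definition full_subcat :: "('r, 'o, 'm) tcat \<Rightarrow> 'o set \<Rightarrow> ('r, 'o, 'm) tcat" where
  "full_subcat T S = T\<lparr>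
     Ob := S,
     Arr := {f \<in> Arr T. Dom T f \<in> S \<and> Cod T f \<in> S},
     Tri := {(f, g, h) \<in> Tri T. Dom T f \<in> S \<and> Dom T g \<in> S \<and> Dom T h \<in> S}\<rparr>"

definition tri_subcat :: "('r, 'o, 'm, 'z) tcat_scheme \<Rightarrow> 'o set \<Rightarrow> bool" where
  "tri_subcat T S \<longleftrightarrow> S \<subseteq> Ob T \<and> S \<noteq> {} \<and>
    (\<forall>X \<in> S. ShO T X \<in> S) \<and>
    (\<forall>X \<in> S. \<exists>Y \<in> S. isomorphic T (ShO T Y) X) \<and>
    (\<forall>X \<in> S. \<forall>Y \<in> S. \<forall>f \<in> Hom T X Y. \<exists>g h. (f, g, h) \<in> Tri T \<and> Cod T g \<in> S)"

definition skeletally_small ::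
    "'u rel \<Rightarrow> ('o, 'm, 'z) cat_scheme \<Rightarrow> bool" where
  "skeletally_small \<kappa> C \<longleftrightarrow>
    (\<exists>R \<subseteq> Ob C. small \<kappa> R \<and> (\<forall>X \<in> Ob C. \<exists>Y \<in> R. isomorphic C X Y))"


section \<open>Compact generation\<close>

definition coproduct ::
    "('o, 'm, 'z) cat_scheme \<Rightarrow> 'i set \<Rightarrow> ('i \<Rightarrow> 'o) \<Rightarrow> 'o \<Rightarrow> ('i \<Rightarrow> 'm) \<Rightarrow> bool" where
  "coproduct C I Y B \<iota> \<longleftrightarrow> B \<in> Ob C \<and> (\<forall>i \<in> I. \<iota> i \<in> Hom C (Y i) B) \<and>
    (\<forall>Z \<in> Ob C. \<forall>g. (\<forall>i \<in> I. g i \<in> Hom C (Y i) Z)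
      \<longrightarrow> (\<exists>!h. h \<in> Hom C B Z \<and> (\<forall>i \<in> I. h \<cdot>\<^bsub>C\<^esub> \<iota> i = g i)))"

text \<open>
  Since \<open>\<kappa>\<close> is a cardinal on the type \<open>'u\<close>, every small set is in bijection with a set of
  elements of \<open>'u\<close>, so it suffices to index families by subsets of \<open>'u\<close>.
\<close>

definition has_direct_sums :: "'u rel \<Rightarrow> ('o, 'm, 'z) cat_scheme \<Rightarrow> bool" where
  "has_direct_sums \<kappa> C \<longleftrightarrow> (\<forall>(I :: 'u set) Y. small \<kappa> I \<and> (\<forall>i \<in> I. Y i \<in> Ob C)
     \<longrightarrow> (\<exists>B \<iota>. coproduct C I Y B \<iota>))"

text \<open>
  \<open>X\<close> is compact if for every small coproduct \<open>B\<close> of objects \<open>Y i\<close> the canonical map from the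
  direct sum of the modules \<open>Hom X (Y i)\<close> (families of finite support) to \<open>Hom X B\<close> is bijective.
\<close>

definition compact_object ::
    "'u rel \<Rightarrow> ('r, 'o, 'm, 'z) lcat_scheme \<Rightarrow> 'o \<Rightarrow> bool" where
  "compact_object \<kappa> C X \<longleftrightarrow> X \<in> Ob C \<and>
    (\<forall>(I :: 'u set) Y B \<iota>. small \<kappa> I \<and> (\<forall>i \<in> I. Y i \<in> Ob C) \<and> coproduct C I Y B \<iota> \<longrightarrow>
      bij_betw
        (\<lambda>f. \<Oplus>\<^bsub>Hom_module C X B\<^esub> i \<in> {i \<in> I. f i \<noteq> Zer C X (Y i)}. \<iota> i \<cdot>\<^bsub>C\<^esub> f i)
        {f \<in> (\<Pi>\<^sub>E i \<in> I. Hom C X (Y i)). finite {i \<in> I. f i \<noteq> Zer C X (Y i)}}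
        (Hom C X B))"

definition compacts :: "'u rel \<Rightarrow> ('r, 'o, 'm, 'z) lcat_scheme \<Rightarrow> 'o set" where
  "compacts \<kappa> T = {X. compact_object \<kappa> T X}"

text \<open>
  The set \<open>G\<close> generates if an object \<open>X\<close> with \<open>Hom(g[n], X) = 0\<close> for all \<open>g \<in> G\<close> and all integers
  \<open>n\<close> is zero. For negative \<open>n\<close> we use \<open>Hom(g, X[-n])\<close>, which avoids choosing an inverse shift.
\<close>

definition generates :: "('r, 'o, 'm, 'z) tcat_scheme \<Rightarrow> 'o set \<Rightarrow> bool" where
  "generates T G \<longleftrightarrow> (\<forall>X \<in> Ob T.
     (\<forall>g \<in> G. \<forall>n :: nat.
        Hom T ((ShO T ^^ n) g) X = {Zer T ((ShO T ^^ n) g) X} \<and>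
        Hom T g ((ShO T ^^ n) X) = {Zer T g ((ShO T ^^ n) X)})
     \<longrightarrow> zero_object T X)"

definition compactly_generated ::
    "'u rel \<Rightarrow> 'r ring \<Rightarrow> ('r, 'o, 'm, 'z) tcat_scheme \<Rightarrow> bool" where
  "compactly_generated \<kappa> k T \<longleftrightarrow>
    tri_category \<kappa> k T \<and> has_direct_sums \<kappa> T \<and>
    (\<exists>G \<subseteq> compacts \<kappa> T. small \<kappa> G \<and> generates T G)"


section \<open>Frobenius categories and algebraic triangulated categories\<close>

text \<open>Exact categories in the sense of Quillen; \<open>Conf\<close> is the class of conflations.\<close>

record ('r, 'o, 'm) ecat = "('r, 'o, 'm) lcat" +
  Conf :: "('m \<times> 'm) set"

definition is_kernel :: "('r, 'o, 'm, 'z) lcat_scheme \<Rightarrow> 'm \<Rightarrow> 'm \<Rightarrow> bool" where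
  "is_kernel C i p \<longleftrightarrow> i \<in> Arr C \<and> p \<in> Arr C \<and> Cod C i = Dom C p \<and>
    p \<cdot>\<^bsub>C\<^esub> i = Zer C (Dom C i) (Cod C p) \<and>
    (\<forall>g \<in> Arr C. Cod C g = Dom C p \<and> p \<cdot>\<^bsub>C\<^esub> g = Zer C (Dom C g) (Cod C p)
      \<longrightarrow> (\<exists>!h. h \<in> Hom C (Dom C g) (Dom C i) \<and> i \<cdot>\<^bsub>C\<^esub> h = g))"

definition is_cokernel :: "('r, 'o, 'm, 'z) lcat_scheme \<Rightarrow> 'm \<Rightarrow> 'm \<Rightarrow> bool" where
  "is_cokernel C i p \<longleftrightarrow> i \<in> Arr C \<and> p \<in> Arr C \<and> Cod C i = Dom C p \<and>
    p \<cdot>\<^bsub>C\<^esub> i = Zer C (Dom C i) (Cod C p) \<and>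
    (\<forall>g \<in> Arr C. Dom C g = Cod C i \<and> g \<cdot>\<^bsub>C\<^esub> i = Zer C (Dom C i) (Cod C g)
      \<longrightarrow> (\<exists>!h. h \<in> Hom C (Cod C p) (Cod C g) \<and> h \<cdot>\<^bsub>C\<^esub> p = g))"

text \<open>\<open>i' \<cdot> f = f' \<cdot> i\<close> is a pushout of \<open>i\<close> and \<open>f\<close>; \<open>p \<cdot> f' = f \<cdot> p'\<close> is a pullback of \<open>p\<close> and \<open>f\<close>.\<close>

definition is_pushout :: "('o, 'm, 'z) cat_scheme \<Rightarrow> 'm \<Rightarrow> 'm \<Rightarrow> 'm \<Rightarrow> 'm \<Rightarrow> bool" where
  "is_pushout C i f i' f' \<longleftrightarrow>
    i \<in> Arr C \<and> f \<in> Arr C \<and> i' \<in> Arr C \<and> f' \<in> Arr C \<and> Dom C i = Dom C f \<and>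
    Dom C i' = Cod C f \<and> Dom C f' = Cod C i \<and> Cod C i' = Cod C f' \<and>
    i' \<cdot>\<^bsub>C\<^esub> f = f' \<cdot>\<^bsub>C\<^esub> i \<and>
    (\<forall>a \<in> Arr C. \<forall>b \<in> Arr C. Dom C a = Cod C f \<and> Dom C b = Cod C i \<and> Cod C a = Cod C b \<and>
        a \<cdot>\<^bsub>C\<^esub> f = b \<cdot>\<^bsub>C\<^esub> i
      \<longrightarrow> (\<exists>!h. h \<in> Hom C (Cod C i') (Cod C a) \<and> h \<cdot>\<^bsub>C\<^esub> i' = a \<and> h \<cdot>\<^bsub>C\<^esub> f' = b))"

definition is_pullback :: "('o, 'm, 'z) cat_scheme \<Rightarrow> 'm \<Rightarrow> 'm \<Rightarrow> 'm \<Rightarrow> 'm \<Rightarrow> bool" where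
  "is_pullback C p f p' f' \<longleftrightarrow>
    p \<in> Arr C \<and> f \<in> Arr C \<and> p' \<in> Arr C \<and> f' \<in> Arr C \<and> Cod C p = Cod C f \<and>
    Cod C p' = Dom C f \<and> Cod C f' = Dom C p \<and> Dom C p' = Dom C f' \<and>
    p \<cdot>\<^bsub>C\<^esub> f' = f \<cdot>\<^bsub>C\<^esub> p' \<and>
    (\<forall>a \<in> Arr C. \<forall>b \<in> Arr C. Cod C a = Dom C f \<and> Cod C b = Dom C p \<and> Dom C a = Dom C b \<and>
        f \<cdot>\<^bsub>C\<^esub> a = p \<cdot>\<^bsub>C\<^esub> b
      \<longrightarrow> (\<exists>!h. h \<in> Hom C (Dom C a) (Dom C p') \<and> p' \<cdot>\<^bsub>C\<^esub> h = a \<and> f' \<cdot>\<^bsub>C\<^esub> h = b))"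

definition inflation :: "('r, 'o, 'm, 'z) ecat_scheme \<Rightarrow> 'm \<Rightarrow> bool" where
  "inflation E i \<longleftrightarrow> (\<exists>p. (i, p) \<in> Conf E)"

definition deflation :: "('r, 'o, 'm, 'z) ecat_scheme \<Rightarrow> 'm \<Rightarrow> bool" where
  "deflation E p \<longleftrightarrow> (\<exists>i. (i, p) \<in> Conf E)"

definition projective :: "('r, 'o, 'm, 'z) ecat_scheme \<Rightarrow> 'o \<Rightarrow> bool" where
  "projective E P \<longleftrightarrow> P \<in> Ob E \<and>
    (\<forall>p f. deflation E p \<and> f \<in> Hom E P (Cod E p) \<longrightarrow> (\<exists>g \<in> Hom E P (Dom E p). p \<cdot>\<^bsub>E\<^esub> g = f))"

definition injective :: "('r, 'o, 'm, 'z) ecat_scheme \<Rightarrow> 'o \<Rightarrow> bool" where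
  "injective E J \<longleftrightarrow> J \<in> Ob E \<and>
    (\<forall>i f. inflation E i \<and> f \<in> Hom E (Dom E i) J \<longrightarrow> (\<exists>g \<in> Hom E (Cod E i) J. g \<cdot>\<^bsub>E\<^esub> i = f))"

locale exact_category = additive_category \<kappa> k E
  for \<kappa> :: "'u rel" and k :: "'r ring" and E :: "('r, 'o, 'm, 'z) ecat_scheme" (structure) +
  assumes Conf_kernel: "(i, p) \<in> Conf E \<Longrightarrow> is_kernel E i p"
    and Conf_cokernel: "(i, p) \<in> Conf E \<Longrightarrow> is_cokernel E i p"
    and Conf_iso_closed: "\<lbrakk>(i, p) \<in> Conf E; i' \<in> Arr E; p' \<in> Arr E; Cod E i' = Dom E p';
        a \<in> Hom E (Dom E i) (Dom E i'); b \<in> Hom E (Dom E p) (Dom E p');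
        c \<in> Hom E (Cod E p) (Cod E p'); is_iso E a; is_iso E b; is_iso E c;
        i' \<cdot> a = b \<cdot> i; p' \<cdot> b = c \<cdot> p\<rbrakk> \<Longrightarrow> (i', p') \<in> Conf E"
    and Id_inflation: "X \<in> Ob E \<Longrightarrow> inflation E (Id E X)"
    and Id_deflation: "X \<in> Ob E \<Longrightarrow> deflation E (Id E X)"
    and inflation_Comp: "\<lbrakk>inflation E i; inflation E j; Dom E j = Cod E i\<rbrakk> \<Longrightarrow> inflation E (j \<cdot> i)"
    and deflation_Comp: "\<lbrakk>deflation E p; deflation E q; Dom E q = Cod E p\<rbrakk> \<Longrightarrow> deflation E (q \<cdot> p)"
    and inflation_pushout: "\<lbrakk>inflation E i; f \<in> Arr E; Dom E f = Dom E i\<rbrakk>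
      \<Longrightarrow> \<exists>i' f'. is_pushout E i f i' f' \<and> inflation E i'"
    and deflation_pullback: "\<lbrakk>deflation E p; f \<in> Arr E; Cod E f = Cod E p\<rbrakk>
      \<Longrightarrow> \<exists>p' f'. is_pullback E p f p' f' \<and> deflation E p'"

locale frobenius_category = exact_category \<kappa> k E
  for \<kappa> :: "'u rel" and k :: "'r ring" and E :: "('r, 'o, 'm, 'z) ecat_scheme" (structure) +
  assumes enough_projectives:
      "X \<in> Ob E \<Longrightarrow> \<exists>p. deflation E p \<and> projective E (Dom E p) \<and> Cod E p = X"
    and enough_injectives:
      "X \<in> Ob E \<Longrightarrow> \<exists>i. inflation E i \<and> Dom E i = X \<and> injective E (Cod E i)"
    and projective_iff_injective: "projective E X \<longleftrightarrow> injective E X"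

text \<open>
  A chosen conflation \<open>X \<rightarrow> I X \<rightarrow> \<Sigma> X\<close> with \<open>I X\<close> injective. The stable category does not depend on
  this choice up to triangle equivalence.
\<close>

definition inj_conf :: "('r, 'o, 'm, 'z) ecat_scheme \<Rightarrow> 'o \<Rightarrow> 'm \<times> 'm" where
  "inj_conf E X = (SOME c. c \<in> Conf E \<and> Dom E (fst c) = X \<and> injective E (Cod E (fst c)))"

definition cosyzygy :: "('r, 'o, 'm, 'z) ecat_scheme \<Rightarrow> 'o \<Rightarrow> 'o" where
  "cosyzygy E X = Cod E (snd (inj_conf E X))"

text \<open>The class of \<open>f\<close> modulo morphisms factoring through a projective object.\<close>

definition stable_class :: "('r, 'o, 'm, 'z) ecat_scheme \<Rightarrow> 'm \<Rightarrow> 'm set" where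
  "stable_class E f = {g \<in> Hom E (Dom E f) (Cod E f).
     \<exists>P. projective E P \<and>
       (\<exists>a \<in> Hom E (Dom E f) P. \<exists>b \<in> Hom E P (Cod E f). f = Add E g (b \<cdot>\<^bsub>E\<^esub> a))}"

text \<open>
  Operations on equivalence classes are written as the union of the classes of the results over
  all choices of representatives; all of these classes coincide. The following
  structure is completed by the distinguished triangles below.
\<close>

definition stable_precat :: "('r, 'o, 'm, 'z) ecat_scheme \<Rightarrow> ('r, 'o, 'm set) tcat" where
  "stable_precat E = \<lparr>
     Ob = Ob E,
     Arr = stable_class E ` Arr E,
     Dom = (\<lambda>c. the_elem (Dom E ` c)),
     Cod = (\<lambda>c. the_elem (Cod E ` c)),
     Id = (\<lambda>X. stable_class E (Id E X)),
     Comp = (\<lambda>d c. \<Union>{stable_class E (g \<cdot>\<^bsub>E\<^esub> f) | f g. f \<in> c \<and> g \<in> d}),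
     Add = (\<lambda>c d. \<Union>{stable_class E (Add E f g) | f g. f \<in> c \<and> g \<in> d}),
     Zer = (\<lambda>X Y. stable_class E (Zer E X Y)),
     Smul = (\<lambda>a c. \<Union>{stable_class E (Smul E a f) | f. f \<in> c}),
     ShO = cosyzygy E,
     ShA = (\<lambda>c. \<Union>{stable_class E g | f h g. f \<in> c \<and>
       h \<in> Hom E (Cod E (fst (inj_conf E (Dom E f)))) (Cod E (fst (inj_conf E (Cod E f)))) \<and>
       g \<in> Hom E (cosyzygy E (Dom E f)) (cosyzygy E (Cod E f)) \<and>
       h \<cdot>\<^bsub>E\<^esub> fst (inj_conf E (Dom E f)) = fst (inj_conf E (Cod E f)) \<cdot>\<^bsub>E\<^esub> f \<and>
       g \<cdot>\<^bsub>E\<^esub> snd (inj_conf E (Dom E f)) = snd (inj_conf E (Cod E f)) \<cdot>\<^bsub>E\<^esub> h}),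
     Tri = {}\<rparr>"

text \<open>
  The standard triangle of \<open>u : X \<rightarrow> Y\<close> comes from a conflation \<open>Y \<rightarrow> C \<rightarrow> \<Sigma> X\<close> that receives a
  morphism from \<open>X \<rightarrow> I X \<rightarrow> \<Sigma> X\<close> which is \<open>u\<close> on the left and the identity on the right; equivalently,
  \<open>C\<close> is the pushout of \<open>X \<rightarrow> I X\<close> along \<open>u\<close>.
\<close>

definition standard_triangles ::
    "('r, 'o, 'm, 'z) ecat_scheme \<Rightarrow> ('m set \<times> 'm set \<times> 'm set) set" where
  "standard_triangles E = {(stable_class E u, stable_class E v, stable_class E w) | u v w.
     u \<in> Arr E \<and> (v, w) \<in> Conf E \<and> Dom E v = Cod E u \<and> Cod E w = cosyzygy E (Dom E u) \<and>
     (\<exists>u' \<in> Hom E (Cod E (fst (inj_conf E (Dom E u)))) (Cod E v).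
        v \<cdot>\<^bsub>E\<^esub> u = u' \<cdot>\<^bsub>E\<^esub> fst (inj_conf E (Dom E u)) \<and>
        w \<cdot>\<^bsub>E\<^esub> u' = snd (inj_conf E (Dom E u)))}"

definition stable_category :: "('r, 'o, 'm, 'z) ecat_scheme \<Rightarrow> ('r, 'o, 'm set) tcat" where
  "stable_category E = (stable_precat E)\<lparr>
     Tri := {t. \<exists>t' \<in> standard_triangles E. triangle_iso (stable_precat E) t' t}\<rparr>"

text \<open>
  HOL cannot quantify over types inside a formula, so the Frobenius category witnessing that \<open>T\<close> is
  algebraic is an argument. In the hypothesis of a theorem, leaving it (and its
  types) free is the same as assuming that some such category exists.
\<close>

definition algebraic_via ::
    "'u rel \<Rightarrow> 'r ring \<Rightarrow> ('r, 'o, 'm, 'y) tcat_scheme \<Rightarrow> ('r, 'p, 'q, 'z) ecat_scheme \<Rightarrow> bool" where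
  "algebraic_via \<kappa> k T E \<longleftrightarrow> frobenius_category \<kappa> k E \<and>
    (\<exists>F :: ('o, 'm, 'p, 'q set) tftr. triangle_equivalence k T (stable_category E) F)"


section \<open>Recollements\<close>

definition recollement ::
    "'r ring \<Rightarrow> ('r, 'o, 'm) tcat \<Rightarrow> ('r, 'o1, 'm1) tcat \<Rightarrow> ('r, 'o2, 'm2) tcat
      \<Rightarrow> ('o, 'm, 'o1, 'm1) tftr \<Rightarrow> ('o1, 'm1, 'o, 'm) tftr \<Rightarrow> ('o, 'm, 'o1, 'm1) tftr
      \<Rightarrow> ('o2, 'm2, 'o, 'm) tftr \<Rightarrow> ('o, 'm, 'o2, 'm2) tftr \<Rightarrow> ('o2, 'm2, 'o, 'm) tftr \<Rightarrow> bool" where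
  "recollement k T T' T'' i_up i_low i_shriek j_shriek j_up j_low \<longleftrightarrow>
    tri_functor k T T' i_up \<and> tri_functor k T' T i_low \<and> tri_functor k T T' i_shriek \<and>
    tri_functor k T'' T j_shriek \<and> tri_functor k T T'' j_up \<and> tri_functor k T'' T j_low \<and>
    fully_faithful T' T i_low \<and> fully_faithful T'' T j_low \<and> fully_faithful T'' T j_shriek \<and>
    (\<forall>X \<in> Ob T'. zero_object T'' (Obf j_up (Obf i_low X))) \<and>
    (\<exists>\<eta>1 \<epsilon>1 \<eta>2 \<epsilon>2 \<eta>3 \<epsilon>3 \<eta>4 \<epsilon>4.
      adjunction T T' i_up i_low \<eta>1 \<epsilon>1 \<and> adjunction T' T i_low i_shriek \<eta>2 \<epsilon>2 \<and>
      adjunction T'' T j_shriek j_up \<eta>3 \<epsilon>3 \<and> adjunction T T'' j_up j_low \<eta>4 \<epsilon>4 \<and>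
      (\<forall>X \<in> Ob T. (\<exists>h. (\<epsilon>2 X, \<eta>4 X, h) \<in> Tri T) \<and> (\<exists>h. (\<epsilon>3 X, \<eta>1 X, h) \<in> Tri T)))"


section \<open>Verdier quotients\<close>

text \<open>
  The morphisms to be inverted: those having a cone in \<open>N\<close>. As triangles are closed under
  isomorphism, \<open>N\<close> and its closure under isomorphism give the same morphisms.
\<close>

definition cone_in :: "('r, 'o, 'm, 'z) tcat_scheme \<Rightarrow> 'o set \<Rightarrow> 'm set" where
  "cone_in T N = {s. \<exists>g h. (s, g, h) \<in> Tri T \<and> Cod T g \<in> N}"

text \<open>
  Morphisms \<open>X \<rightarrow> Y\<close> of the quotient are classes of roofs \<open>X \<leftarrow> Z \<rightarrow> Y\<close>, written as pairs \<open>(s, f)\<close>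
  representing \<open>f \<cdot> s\<^sup>-\<^sup>1\<close>. Operations on classes are unions over representatives, as above.
\<close>

definition roofs :: "('r, 'o, 'm, 'z) tcat_scheme \<Rightarrow> 'o set \<Rightarrow> ('m \<times> 'm) set" where
  "roofs T N = {(s, f). s \<in> cone_in T N \<and> f \<in> Arr T \<and> Dom T s = Dom T f}"

definition roof_class ::
    "('r, 'o, 'm, 'z) tcat_scheme \<Rightarrow> 'o set \<Rightarrow> 'm \<Rightarrow> 'm \<Rightarrow> ('m \<times> 'm) set" where
  "roof_class T N s f = {(s', f') \<in> roofs T N.
     Cod T s' = Cod T s \<and> Cod T f' = Cod T f \<and>
     (\<exists>u \<in> Arr T. \<exists>v \<in> Arr T. Dom T u = Dom T v \<and> Cod T u = Dom T s \<and> Cod T v = Dom T s' \<and>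
        s \<cdot>\<^bsub>T\<^esub> u = s' \<cdot>\<^bsub>T\<^esub> v \<and> s \<cdot>\<^bsub>T\<^esub> u \<in> cone_in T N \<and> f \<cdot>\<^bsub>T\<^esub> u = f' \<cdot>\<^bsub>T\<^esub> v)}"

definition quotient_arrow ::
    "('r, 'o, 'm, 'z) tcat_scheme \<Rightarrow> 'o set \<Rightarrow> 'm \<Rightarrow> ('m \<times> 'm) set" where
  "quotient_arrow T N f = roof_class T N (Id T (Dom T f)) f"

definition verdier_precat ::
    "('r, 'o, 'm) tcat \<Rightarrow> 'o set \<Rightarrow> ('r, 'o, ('m \<times> 'm) set) tcat" where
  "verdier_precat T N = \<lparr>
     Ob = Ob T,
     Arr = {roof_class T N s f | s f. (s, f) \<in> roofs T N},
     Dom = (\<lambda>c. the_elem ((\<lambda>(s, f). Cod T s) ` c)),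
     Cod = (\<lambda>c. the_elem ((\<lambda>(s, f). Cod T f) ` c)),
     Id = (\<lambda>X. quotient_arrow T N (Id T X)),
     Comp = (\<lambda>d c. \<Union>{roof_class T N (s \<cdot>\<^bsub>T\<^esub> u) (g \<cdot>\<^bsub>T\<^esub> v) | s f t g u v.
       (s, f) \<in> c \<and> (t, g) \<in> d \<and> u \<in> cone_in T N \<and> v \<in> Arr T \<and> Dom T u = Dom T v \<and>
       Cod T u = Dom T s \<and> Cod T v = Dom T t \<and> f \<cdot>\<^bsub>T\<^esub> u = t \<cdot>\<^bsub>T\<^esub> v}),
     Add = (\<lambda>c d. \<Union>{roof_class T N s (Add T f g) | s f g. (s, f) \<in> c \<and> (s, g) \<in> d}),
     Zer = (\<lambda>X Y. quotient_arrow T N (Zer T X Y)),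
     Smul = (\<lambda>a c. \<Union>{roof_class T N s (Smul T a f) | s f. (s, f) \<in> c}),
     ShO = ShO T,
     ShA = (\<lambda>c. \<Union>{roof_class T N (ShA T s) (ShA T f) | s f. (s, f) \<in> c}),
     Tri = {}\<rparr>"

definition verdier_quotient ::
    "('r, 'o, 'm) tcat \<Rightarrow> 'o set \<Rightarrow> ('r, 'o, ('m \<times> 'm) set) tcat" where
  "verdier_quotient T N = (verdier_precat T N)\<lparr>
     Tri := {t. \<exists>(f, g, h) \<in> Tri T.
       triangle_iso (verdier_precat T N)
         (quotient_arrow T N f, quotient_arrow T N g, quotient_arrow T N h) t}\<rparr>"

definition quotient_functor ::
    "('r, 'o, 'm) tcat \<Rightarrow> 'o set \<Rightarrow> ('o, 'm, 'o, ('m \<times> 'm) set) tftr" where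
  "quotient_functor T N =
    \<lparr>Obf = (\<lambda>X. X), Arf = quotient_arrow T N, Shf = (\<lambda>X. quotient_arrow T N (Id T (ShO T X)))\<rparr>"

text \<open>
  The factorisation through a Verdier quotient of a triangle functor \<open>F\<close> with target \<open>U\<close>
  which kills the subcategory: the roof \<open>(s, f)\<close> is sent to \<open>F f \<cdot> (F s)\<^sup>-\<^sup>1\<close>.
\<close>

definition factor_quotient ::
    "('r, 'p, 'q, 'z) tcat_scheme \<Rightarrow> ('o, 'm, 'p, 'q) tftr \<Rightarrow> ('o, ('m \<times> 'm) set, 'p, 'q) tftr" where
  "factor_quotient U F =
    \<lparr>Obf = Obf F,
     Arf = (\<lambda>c. the_elem ((\<lambda>(s, f). Arf F f \<cdot>\<^bsub>U\<^esub> inv_arrow U (Arf F s)) ` c)),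
     Shf = Shf F\<rparr>"

text \<open>The functor \<open>T/N \<rightarrow> U/M\<close> induced by \<open>F : T \<rightarrow> U\<close> with \<open>F N \<subseteq> M\<close>.\<close>

definition induced_functor ::
    "('r, 'p, 'q) tcat \<Rightarrow> 'p set \<Rightarrow> ('o, 'm, 'p, 'q) tftr
      \<Rightarrow> ('o, ('m \<times> 'm) set, 'p, ('q \<times> 'q) set) tftr" where
  "induced_functor U M F =
    factor_quotient (verdier_quotient U M)
      (tri_comp (verdier_quotient U M) (quotient_functor U M) F)"


section \<open>Short exact sequences up to direct summands\<close>

text \<open>
  The sequence \<open>T' \<leftarrow> T \<leftarrow> T''\<close> given by \<open>F\<close> and \<open>G\<close>. The quotient \<open>T/T''\<close> is formed with respect to
  the image of \<open>G\<close>.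
\<close>

definition short_exact_up_to_summands ::
    "'u rel \<Rightarrow> 'r ring \<Rightarrow> ('r, 'o1, 'm1) tcat \<Rightarrow> ('o, 'm, 'o1, 'm1) tftr \<Rightarrow> ('r, 'o, 'm) tcat
      \<Rightarrow> ('o2, 'm2, 'o, 'm) tftr \<Rightarrow> ('r, 'o2, 'm2) tcat \<Rightarrow> bool" where
  "short_exact_up_to_summands \<kappa> k T' F T G T'' \<longleftrightarrow>
    tri_category \<kappa> k T' \<and> tri_category \<kappa> k T \<and> tri_category \<kappa> k T'' \<and>
    tri_functor k T T' F \<and> tri_functor k T'' T G \<and>
    fully_faithful T'' T G \<and>
    (\<forall>X \<in> Ob T''. zero_object T' (Obf F (Obf G X))) \<and>
    equivalence_up_to_summands (verdier_quotient T (Obf G ` Ob T'')) T' (factor_quotient T' F)"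

end

theory Submission
  imports Defs
begin

text \<open>
  Let \<open>F\<close> be a triangle functor with a right adjoint, defined on a compactly generated category, and let \<open>C\<close> be a
  compact object of its target. Then every morphism \<open>C \<rightarrow> F X\<close> factors through \<open>F d\<close> for some \<open>d : D \<rightarrow> X\<close> with \<open>D\<close>
  compact: the tower \<open>X = X\<^sub>0 \<rightarrow> X\<^sub>1 \<rightarrow> \<dots>\<close>, in which each step kills all morphisms from a set of compact
  generators, has vanishing homotopy colimit, so the morphism dies in some \<open>F X\<^sub>n\<close>, and the factorisation is
  found by descending the tower. This replaces the localisation theorem of Thomason and Neeman.

  For \<open>F = j\<^sub>!\<close> it says that a morphism from a compact object to \<open>j\<^sub>! X\<close> factors through \<open>j\<^sub>!\<close> of a compact object.
  Hence a left fraction of morphisms between objects in the image of \<open>j\<^sub>!\<close> whose denominator has a compact cone can be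
  replaced by one in the image of \<open>j\<^sub>!\<close>, and \<open>S''/T''\<^sup>c \<rightarrow> S/T\<^sup>c\<close> is fully faithful. For \<open>F = i\<^sup>*\<close> and
  \<open>X = i\<^sub>* B\<close> with \<open>B\<close> compact it says that \<open>B\<close> is a retract of some \<open>i\<^sup>* D\<close> with \<open>D\<close> compact. Since morphisms
  \<open>i\<^sup>* X \<rightarrow> i\<^sup>* Y\<close> in \<open>S'\<close> lift to \<open>S\<close> up to denominators with cone in \<open>S''\<close>, this allows one to lift
  roofs and relations from \<open>S'/T'\<^sup>c\<close> to \<open>S/T\<^sup>c\<close>.

  A functor out of a Verdier quotient is fully faithful iff morphisms and their vanishing lift along
  denominators. This criterion is applied to both functors and to the hypothesis, so that the iterated
  quotients need not be identified with each other.
\<close>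


section \<open>Arrows, isomorphisms and additive structure\<close>

text \<open>The conclusion asserts that the three quotients are triangulated with small Hom-sets, so
  the model by roofs must be shown to be so: skeletal smallness bounds the roofs, and TR4 is lifted
  to the given category and transported back. \<open>i_up\<close> and \<open>j_shriek\<close>
  preserve compact objects because their right adjoints have right adjoints themselves and therefore
  preserve coproducts. The homotopy colimit vanishes because a map from a generator to the coproduct
  of the tower has finite support and so is killed by the map \<open>\<sigma>\<close> assembled from
  the transition maps; hence the cone of \<open>1 - \<sigma>\<close> receives only zero maps from
  generators. One step of the tower can be undone because its fibre is a coproduct of compact
  objects: finite support there corrects the approximation. Only the existence of factorisations is
  used, never their uniqueness, since fullness and the vanishing of a morphism in a quotient both
  reduce to a factorisation through a killed object.\<close>

context category begin

lemma in_Hom: "f \<in> Hom C X Y \<longleftrightarrow> f \<in> Arr C \<and> Dom C f = X \<and> Cod C f = Y"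
  by (auto simp: Hom_def)

declare Dom_in [simp] Cod_in [simp]

lemma Id_Arr [simp]: "X \<in> Ob C \<Longrightarrow> Id C X \<in> Arr C"
  and Dom_Id [simp]: "X \<in> Ob C \<Longrightarrow> Dom C (Id C X) = X"
  and Cod_Id [simp]: "X \<in> Ob C \<Longrightarrow> Cod C (Id C X) = X"
  using Id_in by (auto simp: in_Hom)

lemma Comp_Arr [simp]: "\<lbrakk>f \<in> Arr C; g \<in> Arr C; Dom C g = Cod C f\<rbrakk> \<Longrightarrow> g \<cdot> f \<in> Arr C"
  and Dom_Comp [simp]: "\<lbrakk>f \<in> Arr C; g \<in> Arr C; Dom C g = Cod C f\<rbrakk> \<Longrightarrow> Dom C (g \<cdot> f) = Dom C f"
  and Cod_Comp [simp]: "\<lbrakk>f \<in> Arr C; g \<in> Arr C; Dom C g = Cod C f\<rbrakk> \<Longrightarrow> Cod C (g \<cdot> f) = Cod C g"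
  using Comp_in[of f "Dom C f" "Cod C f" g "Cod C g"] by (auto simp: in_Hom)

lemma assoc [simp]: "\<lbrakk>f \<in> Arr C; g \<in> Arr C; h \<in> Arr C; Dom C g = Cod C f; Dom C h = Cod C g\<rbrakk>
    \<Longrightarrow> (h \<cdot> g) \<cdot> f = h \<cdot> (g \<cdot> f)"
  using Comp_assoc[of f "Dom C f" "Cod C f" g "Cod C g" h "Cod C h"] by (auto simp: in_Hom)

lemma Id_right [simp]: "\<lbrakk>f \<in> Arr C; Dom C f = X\<rbrakk> \<Longrightarrow> f \<cdot> Id C X = f"
  and Id_left [simp]: "\<lbrakk>f \<in> Arr C; Cod C f = Y\<rbrakk> \<Longrightarrow> Id C Y \<cdot> f = f"
  using Comp_Id_right[of f "Dom C f" "Cod C f"] Comp_Id_left[of f "Dom C f" "Cod C f"]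
  by (auto simp: in_Hom)

text \<open>The simplifier brackets composites to the right, which hides a known product
  \<open>a \<cdot> b\<close> at the head of a longer chain. This puts such an equation back into
  usable form.\<close>

lemma Comp_lift:
  assumes "a \<cdot> b = c" "a \<in> Arr C" "b \<in> Arr C" "Dom C a = Cod C b"
    "x \<in> Arr C" "Dom C b = Cod C x"
  shows "a \<cdot> (b \<cdot> x) = c \<cdot> x"
  using assms assoc[of x b a] by simp

lemma isoI:
  assumes "f \<in> Arr C" "g \<in> Arr C" "Dom C g = Cod C f" "Cod C g = Dom C f"
    "g \<cdot> f = Id C (Dom C f)" "f \<cdot> g = Id C (Cod C f)"
  shows "is_iso C f"
  using assms unfolding is_iso_def inverse_arrows_def by (auto simp: in_Hom)

lemma inverse_arrows_unique:
  assumes "inverse_arrows C f g" "inverse_arrows C f h" shows "g = h"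
proof -
  have "g = g \<cdot> (f \<cdot> h)" using assms by (auto simp: inverse_arrows_def in_Hom)
  also have "\<dots> = (g \<cdot> f) \<cdot> h" using assms by (intro assoc[symmetric]) (auto simp: inverse_arrows_def in_Hom)
  also have "\<dots> = h" using assms by (auto simp: inverse_arrows_def in_Hom)
  finally show ?thesis .
qed

lemma inverse_inv_arrow: "is_iso C f \<Longrightarrow> inverse_arrows C f (inv_arrow C f)"
  unfolding is_iso_def inv_arrow_def by (rule theI') (blast intro: inverse_arrows_unique)

lemma inv_arrow_eq: "inverse_arrows C f g \<Longrightarrow> inv_arrow C f = g"
  by (rule inverse_arrows_unique[OF inverse_inv_arrow]) (auto simp: is_iso_def)

lemma iso_Arr: "is_iso C f \<Longrightarrow> f \<in> Arr C"
  by (auto simp: is_iso_def inverse_arrows_def)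

lemma inv_Arr [simp]: "is_iso C f \<Longrightarrow> inv_arrow C f \<in> Arr C"
  and Dom_inv [simp]: "is_iso C f \<Longrightarrow> Dom C (inv_arrow C f) = Cod C f"
  and Cod_inv [simp]: "is_iso C f \<Longrightarrow> Cod C (inv_arrow C f) = Dom C f"
  and inv_left [simp]: "is_iso C f \<Longrightarrow> inv_arrow C f \<cdot> f = Id C (Dom C f)"
  and inv_right [simp]: "is_iso C f \<Longrightarrow> f \<cdot> inv_arrow C f = Id C (Cod C f)"
  using inverse_inv_arrow[of f] by (auto simp: inverse_arrows_def in_Hom)

lemma inv_left' [simp]: "\<lbrakk>is_iso C f; x \<in> Arr C; Cod C x = Dom C f\<rbrakk> \<Longrightarrow> inv_arrow C f \<cdot> (f \<cdot> x) = x"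
  by (subst Comp_lift[OF inv_left]) (insert iso_Arr[of f], auto)

lemma inv_right' [simp]: "\<lbrakk>is_iso C f; x \<in> Arr C; Cod C x = Cod C f\<rbrakk> \<Longrightarrow> f \<cdot> (inv_arrow C f \<cdot> x) = x"
  by (subst Comp_lift[OF inv_right]) (insert iso_Arr[of f], auto)

lemma iso_inv [simp]: "is_iso C f \<Longrightarrow> is_iso C (inv_arrow C f)"
  by (rule isoI[of _ f]) (insert iso_Arr[of f], auto)

lemma iso_Id [simp]: "X \<in> Ob C \<Longrightarrow> is_iso C (Id C X)"
  by (rule isoI[of _ "Id C X"]) auto

lemma inv_Id [simp]: "X \<in> Ob C \<Longrightarrow> inv_arrow C (Id C X) = Id C X"
  by (rule inv_arrow_eq) (auto simp: inverse_arrows_def in_Hom)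

lemma iso_Comp [simp]: "\<lbrakk>is_iso C f; is_iso C g; Dom C g = Cod C f\<rbrakk> \<Longrightarrow> is_iso C (g \<cdot> f)"
  by (rule isoI[of _ "inv_arrow C f \<cdot> inv_arrow C g"]) (insert iso_Arr[of f] iso_Arr[of g], auto)

lemma iso_cancel_left:
  assumes "is_iso C f" "x \<in> Arr C" "y \<in> Arr C" "Cod C x = Dom C f" "Cod C y = Dom C f" "f \<cdot> x = f \<cdot> y"
  shows "x = y"
proof -
  have "x = inv_arrow C f \<cdot> (f \<cdot> x)" using assms(1-5) by simp
  also have "\<dots> = y" unfolding assms(6) using assms(1-5) by simp
  finally show ?thesis .
qed

lemma iso_cancel_right:
  assumes "is_iso C f" "x \<in> Arr C" "y \<in> Arr C" "Dom C x = Cod C f" "Dom C y = Cod C f" "x \<cdot> f = y \<cdot> f"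
  shows "x = y"
proof -
  have "x = (x \<cdot> f) \<cdot> inv_arrow C f" using assms(1-5) iso_Arr[of f] by simp
  also have "\<dots> = y" unfolding assms(6) using assms(1-5) iso_Arr[of f] by simp
  finally show ?thesis .
qed

lemma isomorphicI: "\<lbrakk>is_iso C f; Dom C f = X; Cod C f = Y\<rbrakk> \<Longrightarrow> isomorphic C X Y"
  using iso_Arr[of f] by (auto simp: isomorphic_def in_Hom)

lemma isomorphicE:
  assumes "isomorphic C X Y"
  obtains f where "is_iso C f" "f \<in> Arr C" "Dom C f = X" "Cod C f = Y"
  using assms by (auto simp: isomorphic_def in_Hom)

lemma isomorphic_refl: "X \<in> Ob C \<Longrightarrow> isomorphic C X X"
  by (rule isomorphicI[of "Id C X"]) auto

lemma isomorphic_sym: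
  assumes "isomorphic C X Y" shows "isomorphic C Y X"
proof -
  obtain f where f: "is_iso C f" "f \<in> Arr C" "Dom C f = X" "Cod C f = Y"
    using assms by (rule isomorphicE)
  then show ?thesis using isomorphicI[OF iso_inv[OF f(1)]] by simp
qed

lemma isomorphic_trans:
  assumes "isomorphic C X Y" "isomorphic C Y Z" shows "isomorphic C X Z"
proof -
  obtain f g where "is_iso C f" "Dom C f = X" "Cod C f = Y" "is_iso C g" "Dom C g = Y" "Cod C g = Z"
    using assms by (auto elim!: isomorphicE)
  then show ?thesis by (intro isomorphicI[OF iso_Comp[of f g]]) (insert iso_Arr[of f] iso_Arr[of g], auto)
qed

lemma isomorphic_Ob: "isomorphic C X Y \<Longrightarrow> X \<in> Ob C \<and> Y \<in> Ob C"
  by (auto elim!: isomorphicE)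

end

context lin_category begin

lemma Hom_group: "\<lbrakk>X \<in> Ob C; Y \<in> Ob C\<rbrakk> \<Longrightarrow> abelian_group (Hom_module C X Y)"
  using Hom_is_module module.axioms(2) by blast

lemma Hom_module_sel [simp]: "carrier (Hom_module C X Y) = Hom C X Y"
  "zero (Hom_module C X Y) = Zer C X Y" "add (Hom_module C X Y) = Add C"
  "smult (Hom_module C X Y) = Smul C"
  by (auto simp: Hom_module_def)

lemma Add_Hom: "\<lbrakk>f \<in> Hom C X Y; g \<in> Hom C X Y\<rbrakk> \<Longrightarrow> Add C f g \<in> Hom C X Y"
  using abelian_monoid.a_closed[OF abelian_group.axioms(1)[OF Hom_group], of X Y f g]
  by (auto simp: in_Hom)

lemma Add_Arr [simp]:
  assumes "f \<in> Arr C" "g \<in> Arr C" "Dom C g = Dom C f" "Cod C g = Cod C f"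
  shows "Add C f g \<in> Arr C" "Dom C (Add C f g) = Dom C f" "Cod C (Add C f g) = Cod C f"
  using Add_Hom[of f "Dom C f" "Cod C f" g] assms by (auto simp: in_Hom)

lemma Zer_Arr [simp]:
  assumes "X \<in> Ob C" "Y \<in> Ob C"
  shows "Zer C X Y \<in> Arr C" "Dom C (Zer C X Y) = X" "Cod C (Zer C X Y) = Y"
  using abelian_monoid.zero_closed[OF abelian_group.axioms(1)[OF Hom_group[OF assms]]]
  by (auto simp: in_Hom)

lemma Add_assoc:
  assumes "f \<in> Arr C" "g \<in> Arr C" "h \<in> Arr C" "Dom C g = Dom C f" "Cod C g = Cod C f"
    "Dom C h = Dom C f" "Cod C h = Cod C f"
  shows "Add C (Add C f g) h = Add C f (Add C g h)"
  using abelian_monoid.a_assoc[OF abelian_group.axioms(1)[OF Hom_group], of "Dom C f" "Cod C f" f g h] assms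
  by (auto simp: in_Hom)

lemma Add_commute:
  assumes "f \<in> Arr C" "g \<in> Arr C" "Dom C g = Dom C f" "Cod C g = Cod C f"
  shows "Add C f g = Add C g f"
  using abelian_monoid.a_comm[OF abelian_group.axioms(1)[OF Hom_group], of "Dom C f" "Cod C f" f g] assms
  by (auto simp: in_Hom)

lemma Add_Zer [simp]:
  assumes "f \<in> Arr C" "Dom C f = X" "Cod C f = Y"
  shows "Add C (Zer C X Y) f = f" "Add C f (Zer C X Y) = f"
  using abelian_monoid.l_zero[OF abelian_group.axioms(1)[OF Hom_group], of "Dom C f" "Cod C f" f]
    abelian_monoid.r_zero[OF abelian_group.axioms(1)[OF Hom_group], of "Dom C f" "Cod C f" f] assms
  by (auto simp: in_Hom)

lemma neg_Arr [simp]: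
  assumes "f \<in> Arr C"
  shows "neg C f \<in> Arr C" "Dom C (neg C f) = Dom C f" "Cod C (neg C f) = Cod C f"
  using abelian_group.a_inv_closed[OF Hom_group, of "Dom C f" "Cod C f" f] assms
  by (auto simp: in_Hom neg_def)

lemma Add_neg [simp]:
  assumes "f \<in> Arr C"
  shows "Add C f (neg C f) = Zer C (Dom C f) (Cod C f)" "Add C (neg C f) f = Zer C (Dom C f) (Cod C f)"
  using abelian_group.r_neg[OF Hom_group, of "Dom C f" "Cod C f" f]
    abelian_group.l_neg[OF Hom_group, of "Dom C f" "Cod C f" f] assms
  by (auto simp: in_Hom neg_def)

lemma Add_right_cancel:
  assumes "f \<in> Arr C" "g \<in> Arr C" "h \<in> Arr C" "Dom C g = Dom C f" "Cod C g = Cod C f"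
    "Dom C h = Dom C f" "Cod C h = Cod C f" "Add C f h = Add C g h"
  shows "f = g"
proof -
  have "f = Add C (Add C f h) (neg C h)" using assms(1-7) by (simp add: Add_assoc)
  also have "\<dots> = Add C (Add C g h) (neg C h)" using assms(8) by simp
  also have "\<dots> = g" using assms(1-7) by (simp add: Add_assoc)
  finally show ?thesis .
qed

lemma neg_unique:
  assumes "f \<in> Arr C" "g \<in> Arr C" "Dom C g = Dom C f" "Cod C g = Cod C f"
    "Add C g f = Zer C (Dom C f) (Cod C f)"
  shows "g = neg C f"
  by (rule Add_right_cancel[of _ _ f]) (use assms in auto)

lemma neg_neg [simp]: "f \<in> Arr C \<Longrightarrow> neg C (neg C f) = f"
  by (rule neg_unique[symmetric]) auto

lemma neg_Zer [simp]: "\<lbrakk>X \<in> Ob C; Y \<in> Ob C\<rbrakk> \<Longrightarrow> neg C (Zer C X Y) = Zer C X Y"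
  by (rule neg_unique[symmetric]) auto

lemma Add_neg_eq_Zer:
  assumes "f \<in> Arr C" "g \<in> Arr C" "Dom C g = Dom C f" "Cod C g = Cod C f"
    "Add C f (neg C g) = Zer C X Y" "X = Dom C f" "Y = Cod C f"
  shows "f = g"
  using neg_unique[of "neg C g" f] assms by simp

lemma Add_neg_cancel [simp]:
  assumes "f \<in> Arr C" "g \<in> Arr C" "Dom C g = Dom C f" "Cod C g = Cod C f"
  shows "Add C g (Add C f (neg C g)) = f" "Add C (Add C f (neg C g)) g = f"
proof -
  show "Add C (Add C f (neg C g)) g = f" using assms by (simp add: Add_assoc)
  then show "Add C g (Add C f (neg C g)) = f" using assms by (subst Add_commute) auto
qed

lemma Comp_Add [simp]:
  assumes "f \<in> Arr C" "f' \<in> Arr C" "g \<in> Arr C" "Dom C f' = Dom C f" "Cod C f' = Cod C f" "Dom C g = Cod C f"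
  shows "g \<cdot> Add C f f' = Add C (g \<cdot> f) (g \<cdot> f')"
  using Comp_Add_right[of f "Dom C f" "Cod C f" f' g "Cod C g"] assms by (auto simp: in_Hom)

lemma Add_Comp [simp]:
  assumes "f \<in> Arr C" "g \<in> Arr C" "g' \<in> Arr C" "Dom C g' = Dom C g" "Cod C g' = Cod C g" "Dom C g = Cod C f"
  shows "Add C g g' \<cdot> f = Add C (g \<cdot> f) (g' \<cdot> f)"
  using Comp_Add_left[of f "Dom C f" "Cod C f" g "Cod C g" g'] assms by (auto simp: in_Hom)

text \<open>In a group only the neutral element is idempotent. Bilinearity makes composites with
  zero idempotent for addition, and additivity does the same for images of zero under
  functors.\<close>

lemma Add_idem_Zer: "\<lbrakk>f \<in> Arr C; Add C f f = f\<rbrakk> \<Longrightarrow> f = Zer C (Dom C f) (Cod C f)"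
  by (rule Add_right_cancel[of _ _ f]) auto

lemma Comp_Zer [simp]: "\<lbrakk>g \<in> Arr C; X \<in> Ob C; Dom C g = Y\<rbrakk> \<Longrightarrow> g \<cdot> Zer C X Y = Zer C X (Cod C g)"
  using Add_idem_Zer[of "g \<cdot> Zer C X Y"] by (auto simp flip: Comp_Add)

lemma Zer_Comp [simp]: "\<lbrakk>f \<in> Arr C; Z \<in> Ob C; Cod C f = Y\<rbrakk> \<Longrightarrow> Zer C Y Z \<cdot> f = Zer C (Dom C f) Z"
  using Add_idem_Zer[of "Zer C Y Z \<cdot> f"] by (auto simp flip: Add_Comp)

lemma Comp_neg [simp]: "\<lbrakk>f \<in> Arr C; g \<in> Arr C; Dom C g = Cod C f\<rbrakk> \<Longrightarrow> g \<cdot> neg C f = neg C (g \<cdot> f)"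
  by (rule neg_unique) (auto simp flip: Comp_Add)

lemma neg_Comp [simp]: "\<lbrakk>f \<in> Arr C; g \<in> Arr C; Dom C g = Cod C f\<rbrakk> \<Longrightarrow> neg C g \<cdot> f = neg C (g \<cdot> f)"
  by (rule neg_unique) (auto simp flip: Add_Comp)

lemma Smul_Hom: "\<lbrakk>a \<in> carrier k; f \<in> Hom C X Y\<rbrakk> \<Longrightarrow> Smul C a f \<in> Hom C X Y"
  using module.smult_closed[OF Hom_is_module, of X Y a f] by (auto simp: in_Hom)

lemma Smul_Arr [simp]:
  assumes "a \<in> carrier k" "f \<in> Arr C"
  shows "Smul C a f \<in> Arr C" "Dom C (Smul C a f) = Dom C f" "Cod C (Smul C a f) = Cod C f"
  using Smul_Hom[of a f "Dom C f" "Cod C f"] assms by (auto simp: in_Hom)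

lemma Comp_Smul [simp]:
  assumes "a \<in> carrier k" "f \<in> Arr C" "g \<in> Arr C" "Dom C g = Cod C f"
  shows "g \<cdot> Smul C a f = Smul C a (g \<cdot> f)" "Smul C a g \<cdot> f = Smul C a (g \<cdot> f)"
  using Comp_Smul_right[of a f "Dom C f" "Cod C f" g "Cod C g"]
    Comp_Smul_left[of a f "Dom C f" "Cod C f" g "Cod C g"] assms by (auto simp: in_Hom)

lemma iso_neg [simp]: "is_iso C f \<Longrightarrow> is_iso C (neg C f)"
  by (rule isoI[of _ "neg C (inv_arrow C f)"]) (insert iso_Arr[of f], auto)

lemma zero_object_Dom:
  assumes "zero_object C Z" "f \<in> Arr C" "Dom C f = Z"
  shows "f = Zer C Z (Cod C f)"
  using assms Id_right[of f Z] by (simp add: zero_object_def)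

lemma zero_object_Cod:
  assumes "zero_object C Z" "f \<in> Arr C" "Cod C f = Z"
  shows "f = Zer C (Dom C f) Z"
  using assms Id_left[of f Z] by (simp add: zero_object_def)

lemma zero_object_retract:
  assumes "zero_object C Z" "i \<in> Hom C X Z" "p \<in> Hom C Z X" "p \<cdot> i = Id C X"
  shows "zero_object C X"
proof -
  have "i = Zer C X Z" using zero_object_Cod[of Z i] assms by (auto simp: in_Hom)
  then have "Id C X = Zer C X X" using assms by (auto simp: in_Hom)
  then show ?thesis using assms unfolding zero_object_def in_Hom by auto
qed

lemma zero_object_iso:
  assumes "zero_object C Z" "isomorphic C X Z" shows "zero_object C X"
proof -
  obtain f where "is_iso C f" "f \<in> Arr C" "Dom C f = X" "Cod C f = Z" using assms(2) by (auto elim!: isomorphicE)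
  then show ?thesis by (intro zero_object_retract[OF assms(1), of f _ "inv_arrow C f"]) (auto simp: in_Hom)
qed

lemma zero_objects_iso:
  assumes "zero_object C Z" "zero_object C Z'"
  shows "is_iso C (Zer C Z Z')"
  by (rule isoI[of _ "Zer C Z' Z"]) (use assms in \<open>auto simp: zero_object_def\<close>)

end

locale lin_functor_pair = C: lin_category \<kappa> k C + D: lin_category \<kappa> k D
  for \<kappa> :: "'u rel" and k :: "'r ring" and C :: "('r, 'o, 'm, 'y) lcat_scheme" (structure)
    and D :: "('r, 'p, 'q, 'z) lcat_scheme" +
  fixes F :: "('o, 'm, 'p, 'q, 'w) ftr_scheme"
  assumes lin: "lin_functor k C D F"
begin

lemma F_Ob [simp]: "X \<in> Ob C \<Longrightarrow> Obf F X \<in> Ob D"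
  using lin by (simp add: lin_functor_def)

lemma F_Hom: "f \<in> Hom C X Y \<Longrightarrow> Arf F f \<in> Hom D (Obf F X) (Obf F Y)"
  using lin C.Dom_in[of f] C.Cod_in[of f] by (auto simp: lin_functor_def C.in_Hom)

lemma F_Arr [simp]:
  assumes "f \<in> Arr C"
  shows "Arf F f \<in> Arr D" "Dom D (Arf F f) = Obf F (Dom C f)" "Cod D (Arf F f) = Obf F (Cod C f)"
  using F_Hom[of f "Dom C f" "Cod C f"] assms by (auto simp: C.in_Hom D.in_Hom)

lemma F_Id [simp]: "X \<in> Ob C \<Longrightarrow> Arf F (Id C X) = Id D (Obf F X)"
  using lin by (simp add: lin_functor_def)

lemma F_Comp [simp]: "\<lbrakk>f \<in> Arr C; g \<in> Arr C; Dom C g = Cod C f\<rbrakk> \<Longrightarrow> Arf F (g \<cdot> f) = Arf F g \<cdot>\<^bsub>D\<^esub> Arf F f"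
  using lin by (simp add: lin_functor_def)

lemma F_Add [simp]: "\<lbrakk>f \<in> Arr C; g \<in> Arr C; Dom C g = Dom C f; Cod C g = Cod C f\<rbrakk>
    \<Longrightarrow> Arf F (Add C f g) = Add D (Arf F f) (Arf F g)"
  using lin by (simp add: lin_functor_def)

lemma F_Smul [simp]: "\<lbrakk>a \<in> carrier k; f \<in> Arr C\<rbrakk> \<Longrightarrow> Arf F (Smul C a f) = Smul D a (Arf F f)"
  using lin by (simp add: lin_functor_def)

lemma F_Zer [simp]: "\<lbrakk>X \<in> Ob C; Y \<in> Ob C\<rbrakk> \<Longrightarrow> Arf F (Zer C X Y) = Zer D (Obf F X) (Obf F Y)"
  using D.Add_idem_Zer[of "Arf F (Zer C X Y)"] F_Add[of "Zer C X Y" "Zer C X Y"] by simp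

lemma F_neg [simp]: "f \<in> Arr C \<Longrightarrow> Arf F (neg C f) = neg D (Arf F f)"
  by (rule D.neg_unique) (auto simp flip: F_Add)

lemma F_inverse: "is_iso C f \<Longrightarrow> inverse_arrows D (Arf F f) (Arf F (inv_arrow C f))"
  by (insert C.iso_Arr[of f], auto simp: inverse_arrows_def D.in_Hom simp flip: F_Comp)

lemma F_iso [simp]: "is_iso C f \<Longrightarrow> is_iso D (Arf F f)"
  unfolding is_iso_def[of D] by (rule exI, rule F_inverse)

lemma F_inv: "is_iso C f \<Longrightarrow> Arf F (inv_arrow C f) = inv_arrow D (Arf F f)"
  by (rule D.inv_arrow_eq[OF F_inverse, symmetric])

lemma F_isomorphic:
  assumes "isomorphic C X Y" shows "isomorphic D (Obf F X) (Obf F Y)"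
proof -
  obtain f where f: "is_iso C f" "f \<in> Arr C" "Dom C f = X" "Cod C f = Y"
    using assms by (rule C.isomorphicE)
  then show ?thesis using D.isomorphicI[OF F_iso[OF f(1)]] by simp
qed

lemma F_zero_object [simp]: "zero_object C X \<Longrightarrow> zero_object D (Obf F X)"
  using F_Id[of X] F_Zer[of X X] by (simp add: zero_object_def)

lemma F_biproduct:
  assumes "biproduct C X Y B" shows "biproduct D (Obf F X) (Obf F Y) (Obf F B)"
proof -
  obtain i1 i2 p1 p2 where h: "i1 \<in> Arr C" "i2 \<in> Arr C" "p1 \<in> Arr C" "p2 \<in> Arr C"
    "Dom C i1 = X" "Cod C i1 = B" "Dom C i2 = Y" "Cod C i2 = B"
    "Dom C p1 = B" "Cod C p1 = X" "Dom C p2 = B" "Cod C p2 = Y"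
    and e: "p1 \<cdot> i1 = Id C X" "p2 \<cdot> i2 = Id C Y" "p2 \<cdot> i1 = Zer C X Y" "p1 \<cdot> i2 = Zer C Y X"
      "Add C (i1 \<cdot> p1) (i2 \<cdot> p2) = Id C B"
    using assms by (auto simp: biproduct_def C.in_Hom)
  have o: "X \<in> Ob C" "Y \<in> Ob C" "B \<in> Ob C" using h C.Dom_in[of i1] C.Dom_in[of i2] C.Dom_in[of p1] by auto
  have "Arf F p1 \<cdot>\<^bsub>D\<^esub> Arf F i1 = Id D (Obf F X)" using F_Comp[of i1 p1] h o unfolding e by simp
  moreover have "Arf F p2 \<cdot>\<^bsub>D\<^esub> Arf F i2 = Id D (Obf F Y)" using F_Comp[of i2 p2] h o unfolding e by simp
  moreover have "Arf F p2 \<cdot>\<^bsub>D\<^esub> Arf F i1 = Zer D (Obf F X) (Obf F Y)"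
    using F_Comp[of i1 p2] h o unfolding e by simp
  moreover have "Arf F p1 \<cdot>\<^bsub>D\<^esub> Arf F i2 = Zer D (Obf F Y) (Obf F X)"
    using F_Comp[of i2 p1] h o unfolding e by simp
  moreover have "Add D (Arf F i1 \<cdot>\<^bsub>D\<^esub> Arf F p1) (Arf F i2 \<cdot>\<^bsub>D\<^esub> Arf F p2) = Id D (Obf F B)"
    using F_Add[of "i1 \<cdot> p1" "i2 \<cdot> p2"] h o unfolding e by simp
  moreover have "Arf F i1 \<in> Hom D (Obf F X) (Obf F B)" "Arf F i2 \<in> Hom D (Obf F Y) (Obf F B)"
    "Arf F p1 \<in> Hom D (Obf F B) (Obf F X)" "Arf F p2 \<in> Hom D (Obf F B) (Obf F Y)"
    using h by (auto simp: D.in_Hom)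
  ultimately show ?thesis unfolding biproduct_def by blast
qed

end

section \<open>Triangulated categories\<close>

lemma shift_sel [simp]: "Obf (shift T) = ShO T" "Arf (shift T) = ShA T"
  by (simp_all add: shift_def)

text \<open>Only the shift, no triangles: in a Verdier quotient desuspension is needed while the
  triangulated axioms are still being proved.\<close>

locale shift_category = additive_category \<kappa> k T
  for \<kappa> :: "'u rel" and k :: "'r ring" and T :: "('r, 'o, 'm, 'z) tcat_scheme" (structure) +
  assumes sh_functor: "lin_functor k T T (shift T)"
    and sh_fully_faithful: "fully_faithful T T (shift T)"
    and sh_essentially_surjective: "essentially_surjective T T (shift T)"
begin

interpretation shift: lin_functor_pair \<kappa> k T T "shift T"
  by unfold_locales (rule sh_functor)

lemmas ShO_Ob [simp] = shift.F_Ob[simplified]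
  and ShA_Arr [simp] = shift.F_Arr[simplified]
  and ShA_Id [simp] = shift.F_Id[simplified]
  and ShA_Comp [simp] = shift.F_Comp[simplified]
  and ShA_Add [simp] = shift.F_Add[simplified]
  and ShA_Smul [simp] = shift.F_Smul[simplified]
  and ShA_Zer [simp] = shift.F_Zer[simplified]
  and ShA_neg [simp] = shift.F_neg[simplified]
  and ShA_iso [simp] = shift.F_iso[simplified]
  and ShO_isomorphic = shift.F_isomorphic[simplified]
  and ShO_zero_object [simp] = shift.F_zero_object[simplified]

lemma ShA_inj:
  assumes "f \<in> Arr T" "g \<in> Arr T" "Dom T f = Dom T g" "Cod T f = Cod T g" "ShA T f = ShA T g"
  shows "f = g"
proof -
  have "inj_on (ShA T) (Hom T (Dom T f) (Cod T f))"
    using sh_fully_faithful assms(1) by (simp add: fully_faithful_def bij_betw_def)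
  then show ?thesis by (rule inj_onD) (use assms in \<open>simp_all add: in_Hom\<close>)
qed

lemma ShA_full:
  assumes "g \<in> Arr T" "Dom T g = ShO T X" "Cod T g = ShO T Y" "X \<in> Ob T" "Y \<in> Ob T"
  obtains f where "f \<in> Arr T" "Dom T f = X" "Cod T f = Y" "ShA T f = g"
proof -
  have "ShA T ` Hom T X Y = Hom T (ShO T X) (ShO T Y)"
    using sh_fully_faithful assms(4,5) by (simp add: fully_faithful_def bij_betw_def)
  moreover have "g \<in> Hom T (ShO T X) (ShO T Y)" using assms by (simp add: in_Hom)
  ultimately have "g \<in> ShA T ` Hom T X Y" by simp
  then show ?thesis using that by (auto simp: in_Hom)
qed

text \<open>The shift is only an equivalence, so an object is a shift only up to an isomorphism
  \<open>w\<close>. Every later argument with an inverse shift carries such a \<open>w\<close>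
  along.\<close>

lemma ShO_ess:
  assumes "Y \<in> Ob T"
  obtains X w where "X \<in> Ob T" "is_iso T w" "w \<in> Arr T" "Dom T w = ShO T X" "Cod T w = Y"
  using sh_essentially_surjective assms unfolding essentially_surjective_def
  by (auto elim!: isomorphicE)

lemma ShA_reflect_iso:
  assumes "f \<in> Arr T" "is_iso T (ShA T f)"
  shows "is_iso T f"
proof -
  obtain g where g: "g \<in> Arr T" "Dom T g = Cod T f" "Cod T g = Dom T f" "ShA T g = inv_arrow T (ShA T f)"
    using ShA_full[of "inv_arrow T (ShA T f)" "Cod T f" "Dom T f"] assms by auto
  have "ShA T (g \<cdot> f) = ShA T (Id T (Dom T f))" "ShA T (f \<cdot> g) = ShA T (Id T (Cod T f))"
    using g assms by simp_all
  then have "g \<cdot> f = Id T (Dom T f)" "f \<cdot> g = Id T (Cod T f)"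
    using g assms by (auto intro: ShA_inj[of "g \<cdot> f" "Id T (Dom T f)"] ShA_inj[of "f \<cdot> g" "Id T (Cod T f)"])
  then show ?thesis using g assms isoI[of f g] by simp
qed

lemma ShO_reflect_isomorphic:
  assumes "X \<in> Ob T" "Y \<in> Ob T" "isomorphic T (ShO T X) (ShO T Y)"
  shows "isomorphic T X Y"
proof -
  obtain g where g: "is_iso T g" "g \<in> Arr T" "Dom T g = ShO T X" "Cod T g = ShO T Y"
    using assms(3) by (rule isomorphicE)
  obtain f where f: "f \<in> Arr T" "Dom T f = X" "Cod T f = Y" "ShA T f = g"
    using ShA_full[OF g(2-4)] assms by auto
  then show ?thesis using ShA_reflect_iso[of f] g by (auto intro: isomorphicI)
qed

end

text \<open>The octahedral axiom is split off because transporting it along isomorphisms of triangles already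
  needs the five lemma.\<close>

locale pretri_category = shift_category \<kappa> k T
  for \<kappa> :: "'u rel" and k :: "'r ring" and T :: "('r, 'o, 'm, 'z) tcat_scheme" (structure) +
  assumes pre_candidate: "t \<in> Tri T \<Longrightarrow> candidate_triangle T t"
    and pre_iso_closed: "\<lbrakk>t \<in> Tri T; triangle_iso T t t'\<rbrakk> \<Longrightarrow> t' \<in> Tri T"
    and pre_TR1_Id: "\<lbrakk>X \<in> Ob T; zero_object T Z\<rbrakk>
      \<Longrightarrow> (Id T X, Zer T X Z, Zer T Z (ShO T X)) \<in> Tri T"
    and pre_TR1_cone: "f \<in> Arr T \<Longrightarrow> \<exists>g h. (f, g, h) \<in> Tri T"
    and pre_TR2: "candidate_triangle T (f, g, h)
      \<Longrightarrow> (f, g, h) \<in> Tri T \<longleftrightarrow> (g, h, neg T (ShA T f)) \<in> Tri T"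
    and pre_TR3: "\<lbrakk>(f, g, h) \<in> Tri T; (f', g', h') \<in> Tri T;
        a \<in> Hom T (Dom T f) (Dom T f'); b \<in> Hom T (Dom T g) (Dom T g'); f' \<cdot> a = b \<cdot> f\<rbrakk>
      \<Longrightarrow> \<exists>c \<in> Hom T (Dom T h) (Dom T h'). g' \<cdot> b = c \<cdot> g \<and> h' \<cdot> c = ShA T a \<cdot> h"
begin

section \<open>Consequences of TR1 to TR3\<close>

lemma tri_Arr:
  assumes "(f, g, h) \<in> Tri T"
  shows "f \<in> Arr T" "g \<in> Arr T" "h \<in> Arr T" "Dom T g = Cod T f" "Dom T h = Cod T g"
    "Cod T h = ShO T (Dom T f)"
  using pre_candidate[OF assms] by (auto simp: candidate_triangle_def)

lemma tri_isoI:
  assumes "(f, g, h) \<in> Tri T" "f' \<in> Arr T" "g' \<in> Arr T" "h' \<in> Arr T"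
    "Dom T g' = Cod T f'" "Dom T h' = Cod T g'" "Cod T h' = ShO T (Dom T f')"
    and "is_iso T a" "is_iso T b" "is_iso T c"
    and "Dom T a = Dom T f" "Cod T a = Dom T f'" "Dom T b = Cod T f" "Cod T b = Cod T f'"
      "Dom T c = Cod T g" "Cod T c = Cod T g'"
    and "f' \<cdot> a = b \<cdot> f" "g' \<cdot> b = c \<cdot> g" "h' \<cdot> c = ShA T a \<cdot> h"
  shows "(f', g', h') \<in> Tri T"
proof (rule pre_iso_closed[OF assms(1)])
  show "triangle_iso T (f, g, h) (f', g', h')"
    unfolding triangle_iso_def prod.case candidate_triangle_def
    using assms tri_Arr[OF assms(1)] iso_Arr[of a] iso_Arr[of b] iso_Arr[of c]
    by (intro conjI bexI[of _ a] bexI[of _ b] bexI[of _ c]) (simp_all add: in_Hom)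
qed

lemma tri_rotate: "(f, g, h) \<in> Tri T \<Longrightarrow> (g, h, neg T (ShA T f)) \<in> Tri T"
  using pre_TR2[OF pre_candidate] by blast

lemma tri_mor:
  assumes "(f, g, h) \<in> Tri T" "(f', g', h') \<in> Tri T" "a \<in> Arr T" "b \<in> Arr T"
    "Dom T a = Dom T f" "Cod T a = Dom T f'" "Dom T b = Cod T f" "Cod T b = Cod T f'" "f' \<cdot> a = b \<cdot> f"
  obtains c where "c \<in> Arr T" "Dom T c = Cod T g" "Cod T c = Cod T g'" "g' \<cdot> b = c \<cdot> g" "h' \<cdot> c = ShA T a \<cdot> h"
  using pre_TR3[OF assms(1,2), of a b] assms(3-) tri_Arr[OF assms(1)] tri_Arr[OF assms(2)]
  by (auto simp: in_Hom)

text \<open>The pair consisting of the identity and \<open>f\<close> maps the trivial triangle of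
  \<open>Dom T f\<close> to the given one, and the fill-in makes \<open>g \<cdot> f\<close> factor
  through a zero object.\<close>

lemma tri_comp_Zer:
  assumes "(f, g, h) \<in> Tri T"
  shows "g \<cdot> f = Zer T (Dom T f) (Cod T g)"
proof -
  note t = tri_Arr[OF assms]
  obtain Z where Z: "zero_object T Z" using ex_zero_object by blast
  then have ZO: "Z \<in> Ob T" by (simp add: zero_object_def)
  obtain c where "c \<in> Arr T" "Dom T c = Z" "g \<cdot> f = c \<cdot> Zer T (Dom T f) Z" "Cod T c = Cod T g"
    by (rule tri_mor[OF pre_TR1_Id[OF _ Z, of "Dom T f"] assms, of "Id T (Dom T f)" f]) (use t ZO in simp_all)
  then show ?thesis using t ZO by simp
qed

lemma tri_comp_Zer':
  assumes "(f, g, h) \<in> Tri T"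
  shows "h \<cdot> g = Zer T (Cod T f) (Cod T h)" "ShA T f \<cdot> h = Zer T (Cod T g) (ShO T (Cod T f))"
proof -
  note t = tri_Arr[OF assms]
  show "h \<cdot> g = Zer T (Cod T f) (Cod T h)" using tri_comp_Zer[OF tri_rotate[OF assms]] t by simp
  have "neg T (ShA T f \<cdot> h) = Zer T (Cod T g) (ShO T (Cod T f))"
    using tri_comp_Zer[OF tri_rotate[OF tri_rotate[OF assms]]] t by simp
  then have "neg T (neg T (ShA T f \<cdot> h)) = neg T (Zer T (Cod T g) (ShO T (Cod T f)))" by simp
  then show "ShA T f \<cdot> h = Zer T (Cod T g) (ShO T (Cod T f))" using t by simp
qed

text \<open>Exactness of Hom into \<open>Cod T x\<close>: the arrow \<open>x\<close> is the middle
  part of a morphism into a trivial triangle that begins with a zero object, and TR3 supplies the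
  third part.\<close>

lemma weak_cokernel:
  assumes "(f, g, h) \<in> Tri T" "x \<in> Arr T" "Dom T x = Cod T f" "x \<cdot> f = Zer T (Dom T f) (Cod T x)"
  obtains y where "y \<in> Arr T" "Dom T y = Cod T g" "Cod T y = Cod T x" "y \<cdot> g = x"
proof -
  note t = tri_Arr[OF assms(1)]
  obtain Z where Z: "zero_object T Z" using ex_zero_object by blast
  then have ZO: "Z \<in> Ob T" by (simp add: zero_object_def)
  let ?V = "Cod T x"
  \<comment> \<open>The zero object is taken to be a shift, so that TR2 can be read backwards and
    the rotated triangle begins with \<open>Z\<close>.\<close>
  have "(Id T ?V, Zer T ?V (ShO T Z), Zer T (ShO T Z) (ShO T ?V)) \<in> Tri T"
    using pre_TR1_Id[of ?V "ShO T Z"] Z assms(2) by simp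
  then have 1: "(Zer T Z ?V, Id T ?V, Zer T ?V (ShO T Z)) \<in> Tri T"
    using ZO assms(2) by (subst pre_TR2) (simp_all add: candidate_triangle_def)
  have 2: "Zer T Z ?V \<cdot> Zer T (Dom T f) Z = x \<cdot> f" using assms(2-) ZO t by simp
  obtain c where c: "c \<in> Arr T" "Dom T c = Cod T g" "Cod T c = ?V" "Id T ?V \<cdot> x = c \<cdot> g"
    using tri_mor[OF assms(1) 1, of "Zer T (Dom T f) Z" x, OF _ _ _ _ _ _ 2] assms(2,3) ZO t
    by (metis Zer_Arr Cod_Id Cod_in Dom_in)
  have "c \<cdot> g = x" unfolding c(4)[symmetric] using assms(2) by simp
  with c show ?thesis using that by blast
qed

text \<open>TR3 only completes to the right. After one rotation it yields the shift of the desired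
  arrow, up to sign, and full faithfulness of the shift brings it back.\<close>

lemma weak_kernel:
  assumes "(f, g, h) \<in> Tri T" "x \<in> Arr T" "Cod T x = Dom T g" "g \<cdot> x = Zer T (Dom T x) (Cod T g)"
  obtains y where "y \<in> Arr T" "Dom T y = Dom T x" "Cod T y = Dom T f" "f \<cdot> y = x"
proof -
  note t = tri_Arr[OF assms(1)]
  obtain Z where Z: "zero_object T Z" using ex_zero_object by blast
  then have ZO: "Z \<in> Ob T" by (simp add: zero_object_def)
  let ?V = "Dom T x"
  have "(Id T ?V, Zer T ?V Z, Zer T Z (ShO T ?V)) \<in> Tri T"
    using pre_TR1_Id[OF _ Z] assms(2) by simp
  from tri_rotate[OF this] have 1: "(Zer T ?V Z, Zer T Z (ShO T ?V), neg T (Id T (ShO T ?V))) \<in> Tri T"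
    using assms(2) by simp
  obtain c where c: "c \<in> Arr T" "Dom T c = ShO T ?V" "Cod T c = ShO T (Dom T f)"
      "neg T (ShA T f) \<cdot> c = ShA T x \<cdot> neg T (Id T (ShO T ?V))"
    by (rule tri_mor[OF 1 tri_rotate[OF assms(1)], of x "Zer T Z (Cod T g)"]) (use assms ZO t in simp_all)
  obtain y where y: "y \<in> Arr T" "Dom T y = ?V" "Cod T y = Dom T f" "ShA T y = c"
    using ShA_full[OF c(1-3)] assms(2) t by auto
  have "neg T (ShA T f \<cdot> c) = neg T (ShA T x)" using c t assms(2,3) by simp
  then have "neg T (neg T (ShA T f \<cdot> c)) = neg T (neg T (ShA T x))" by simp
  then have "ShA T f \<cdot> c = ShA T x" using c(1-3) t assms(2,3) by (subst (asm) (1 2) neg_neg) simp_all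
  then have "ShA T (f \<cdot> y) = ShA T x" using y t assms(2,3) by simp
  then have "f \<cdot> y = x" by (intro ShA_inj[of "f \<cdot> y" x]) (use y t assms in auto)
  then show ?thesis using that[OF y(1-3)] by simp
qed

lemma weak_kernel':
  assumes "(f, g, h) \<in> Tri T" "x \<in> Arr T" "Cod T x = Dom T h" "h \<cdot> x = Zer T (Dom T x) (Cod T h)"
  obtains y where "y \<in> Arr T" "Dom T y = Dom T x" "Cod T y = Dom T g" "g \<cdot> y = x"
  using weak_kernel[OF tri_rotate[OF assms(1)] assms(2-4)] .

lemma weak_kernel'':
  assumes "(f, g, h) \<in> Tri T" "x \<in> Arr T" "Cod T x = Cod T h"
    "ShA T f \<cdot> x = Zer T (Dom T x) (ShO T (Cod T f))"
  obtains y where "y \<in> Arr T" "Dom T y = Dom T x" "Cod T y = Dom T h" "h \<cdot> y = x"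
proof (rule weak_kernel[OF tri_rotate[OF tri_rotate[OF assms(1)]] assms(2)])
  note t = tri_Arr[OF assms(1)]
  show "Cod T x = Dom T (neg T (ShA T f))" using assms t by simp
  show "neg T (ShA T f) \<cdot> x = Zer T (Dom T x) (Cod T (neg T (ShA T f)))" using assms t by simp
qed (rule that)

lemma weak_cokernel':
  assumes "(f, g, h) \<in> Tri T" "x \<in> Arr T" "Dom T x = Cod T g" "x \<cdot> g = Zer T (Dom T g) (Cod T x)"
  obtains y where "y \<in> Arr T" "Dom T y = Cod T h" "Cod T y = Cod T x" "y \<cdot> h = x"
  using weak_cokernel[OF tri_rotate[OF assms(1)] assms(2-4)] .

text \<open>A diagram chase with arrows as generalised elements: \<open>inj\<close> says that
  \<open>c\<close> is a monomorphism, and a section \<open>s\<close> of \<open>c\<close> is built by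
  lifting and correcting.\<close>

lemma five_lemma:
  assumes t: "(f, g, h) \<in> Tri T" and t': "(f', g', h') \<in> Tri T"
    and "is_iso T a" "is_iso T b" "c \<in> Arr T"
    and "Dom T a = Dom T f" "Cod T a = Dom T f'" "Dom T b = Cod T f" "Cod T b = Cod T f'"
      "Dom T c = Cod T g" "Cod T c = Cod T g'"
    and e: "f' \<cdot> a = b \<cdot> f" "g' \<cdot> b = c \<cdot> g" "h' \<cdot> c = ShA T a \<cdot> h"
  shows "is_iso T c"
proof -
  note T = tri_Arr[OF t] tri_Arr[OF t'] assms(3-11) iso_Arr[OF assms(3)] iso_Arr[OF assms(4)]
  have inj: "x = Zer T (Dom T x) (Cod T g)"
    if x: "x \<in> Arr T" "Cod T x = Cod T g" "c \<cdot> x = Zer T (Dom T x) (Cod T g')" for x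
  proof -
    have "ShA T a \<cdot> (h \<cdot> x) = h' \<cdot> (c \<cdot> x)" using x(1,2) T e(3) Comp_lift[OF e(3), of x] by simp
    also have "\<dots> = ShA T a \<cdot> Zer T (Dom T x) (Cod T h)" using x T by simp
    finally have "h \<cdot> x = Zer T (Dom T x) (Cod T h)"
      by (intro iso_cancel_left[of "ShA T a" "h \<cdot> x"]) (use x T in auto)
    then obtain y where y: "y \<in> Arr T" "Dom T y = Dom T x" "Cod T y = Dom T g" "g \<cdot> y = x"
      using weak_kernel'[OF t x(1)] x T by auto
    have "g' \<cdot> (b \<cdot> y) = c \<cdot> x" unfolding y(4)[symmetric] using y T Comp_lift[OF e(2), of y] by simp
    then obtain z where z: "z \<in> Arr T" "Dom T z = Dom T x" "Cod T z = Dom T f'" "f' \<cdot> z = b \<cdot> y"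
      using weak_kernel[OF t', of "b \<cdot> y"] y x T by auto
    have "b \<cdot> y = f' \<cdot> (a \<cdot> (inv_arrow T a \<cdot> z))" unfolding z(4)[symmetric] using z(1-3) T by simp
    also have "\<dots> = b \<cdot> (f \<cdot> (inv_arrow T a \<cdot> z))"
      using z T Comp_lift[OF e(1), of "inv_arrow T a \<cdot> z"] by simp
    finally have "y = f \<cdot> (inv_arrow T a \<cdot> z)" by (intro iso_cancel_left[of b y]) (use z y T in auto)
    then have "x = (g \<cdot> f) \<cdot> (inv_arrow T a \<cdot> z)" unfolding y(4)[symmetric] using T z(1-3) by simp
    then show ?thesis unfolding tri_comp_Zer[OF t] using T z by simp
  qed
  \<comment> \<open>The third component of the sought section. Its image under
    \<open>ShA T f\<close> vanishes, so it comes from some \<open>x\<close>, and \<open>x\<close> is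
    a section of \<open>c\<close> up to an error annihilated by \<open>h'\<close>.\<close>
  define u where "u = inv_arrow T (ShA T a) \<cdot> h'"
  have u: "u \<in> Arr T" "Dom T u = Cod T g'" "Cod T u = Cod T h" unfolding u_def using T by auto
  have "ShA T b \<cdot> (ShA T f \<cdot> u) = ShA T (b \<cdot> f) \<cdot> u" using T u by simp
  also have "\<dots> = ShA T f' \<cdot> (ShA T a \<cdot> u)" unfolding e(1)[symmetric] using T u by simp
  also have "\<dots> = ShA T f' \<cdot> h'" unfolding u_def using T by simp
  also have "\<dots> = ShA T b \<cdot> Zer T (Dom T u) (ShO T (Cod T f))" using tri_comp_Zer'[OF t'] T u by simp
  finally have "ShA T f \<cdot> u = Zer T (Dom T u) (ShO T (Cod T f))"
    by (intro iso_cancel_left[of "ShA T b" "ShA T f \<cdot> u"]) (use T u in auto)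
  then obtain x where x: "x \<in> Arr T" "Dom T x = Cod T g'" "Cod T x = Cod T g" "h \<cdot> x = u"
    using weak_kernel''[OF t u(1)] u T by auto
  have "h' \<cdot> (c \<cdot> x) = ShA T a \<cdot> (h \<cdot> x)" using x T Comp_lift[OF e(3), of x] by simp
  also have "\<dots> = h'" unfolding x(4) u_def using T by simp
  finally have hc: "h' \<cdot> (c \<cdot> x) = h'" .
  \<comment> \<open>The error comes from \<open>y\<close> through \<open>g'\<close>; transporting
    \<open>y\<close> back along \<open>b\<close> corrects \<open>x\<close> to an actual
    section.\<close>
  let ?d = "Add T (Id T (Cod T g')) (neg T (c \<cdot> x))"
  have "h' \<cdot> ?d = Zer T (Cod T g') (Cod T h')" using x T hc by simp
  then obtain y where y: "y \<in> Arr T" "Dom T y = Cod T g'" "Cod T y = Dom T g'" "g' \<cdot> y = ?d"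
    using weak_kernel'[OF t', of ?d] x T by auto
  define s where "s = Add T x (g \<cdot> (inv_arrow T b \<cdot> y))"
  have s: "s \<in> Arr T" "Dom T s = Cod T g'" "Cod T s = Cod T g" unfolding s_def using x y T by auto
  have "c \<cdot> (g \<cdot> (inv_arrow T b \<cdot> y)) = g' \<cdot> (b \<cdot> (inv_arrow T b \<cdot> y))"
    using T y Comp_lift[OF e(2), of "inv_arrow T b \<cdot> y"] by simp
  also have "\<dots> = ?d" unfolding y(4)[symmetric] using T y(1-3) by simp
  finally have "c \<cdot> s = Id T (Cod T g')" unfolding s_def using x y T by simp
  note cs = this
  let ?e = "Add T (s \<cdot> c) (neg T (Id T (Cod T g)))"
  have "c \<cdot> ?e = Zer T (Cod T g) (Cod T g')" using T s Comp_lift[OF cs, of c] by simp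
  then have "?e = Zer T (Cod T g) (Cod T g)" using inj[of ?e] T s by simp
  then have "s \<cdot> c = Id T (Cod T g)" by (intro Add_neg_eq_Zer[of "s \<cdot> c"]) (use T s in auto)
  then show ?thesis by (intro isoI[of c s]) (use T s cs in auto)
qed

lemma cone_mor_iso:
  assumes "(f, g, h) \<in> Tri T" "(f', g', h') \<in> Tri T" "is_iso T a" "is_iso T b"
    "Dom T a = Dom T f" "Cod T a = Dom T f'" "Dom T b = Cod T f" "Cod T b = Cod T f'" "f' \<cdot> a = b \<cdot> f"
  obtains c where "is_iso T c" "c \<in> Arr T" "Dom T c = Cod T g" "Cod T c = Cod T g'"
    "g' \<cdot> b = c \<cdot> g" "h' \<cdot> c = ShA T a \<cdot> h"
proof -
  obtain c where "c \<in> Arr T" "Dom T c = Cod T g" "Cod T c = Cod T g'" "g' \<cdot> b = c \<cdot> g" "h' \<cdot> c = ShA T a \<cdot> h"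
    using tri_mor[OF assms(1,2) iso_Arr[OF assms(3)] iso_Arr[OF assms(4)] assms(5-9)] by blast
  moreover from this have "is_iso T c"
    using five_lemma[OF assms(1-4), of c] assms(5-) by simp
  ultimately show ?thesis using that by blast
qed

lemma cone_unique:
  assumes "(f, g, h) \<in> Tri T" "(f, g', h') \<in> Tri T"
  shows "isomorphic T (Cod T g) (Cod T g')"
proof -
  note t = tri_Arr[OF assms(1)]
  obtain c where "is_iso T c" "Dom T c = Cod T g" "Cod T c = Cod T g'"
    by (rule cone_mor_iso[OF assms, of "Id T (Dom T f)" "Id T (Cod T f)"]) (use t in simp_all)
  then show ?thesis by (rule isomorphicI)
qed

text \<open>Rotating backwards needs \<open>Cod T h\<close> to be a shift, which it is only up to
  \<open>w\<close>; the last arrow of the new triangle is corrected by the inverse of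
  \<open>w\<close>.\<close>

lemma unrotate:
  assumes "(g, h, l) \<in> Tri T"
  obtains f w where "f \<in> Arr T" "Cod T f = Dom T g" "is_iso T w" "w \<in> Arr T" "Dom T w = ShO T (Dom T f)"
    "Cod T w = Cod T h" "(f, g, inv_arrow T w \<cdot> h) \<in> Tri T" "neg T (ShA T f) = l \<cdot> w"
proof -
  note t = tri_Arr[OF assms]
  obtain X w where w: "X \<in> Ob T" "is_iso T w" "w \<in> Arr T" "Dom T w = ShO T X" "Cod T w = Cod T h"
    using ShO_ess[of "Cod T h"] t by auto
  obtain f where f: "f \<in> Arr T" "Dom T f = X" "Cod T f = Dom T g" "ShA T f = neg T (l \<cdot> w)"
    using ShA_full[of "neg T (l \<cdot> w)" X "Dom T g"] t w by auto
  have n: "neg T (ShA T f) = l \<cdot> w" using f w t by simp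
  have "(g, inv_arrow T w \<cdot> h, neg T (ShA T f)) \<in> Tri T"
    unfolding n by (rule tri_isoI[OF assms, of _ _ _ "Id T (Dom T g)" "Id T (Cod T g)" "inv_arrow T w"])
      (use t w in simp_all)
  then have "(f, g, inv_arrow T w \<cdot> h) \<in> Tri T"
    using f w t by (subst pre_TR2) (auto simp: candidate_triangle_def)
  then show ?thesis using that[of f w] f w n by simp
qed

lemma fibre:
  assumes "g \<in> Arr T" obtains f h where "(f, g, h) \<in> Tri T"
proof -
  obtain h l where "(g, h, l) \<in> Tri T" using pre_TR1_cone[OF assms] by blast
  then show ?thesis by (rule unrotate) (rule that)
qed

text \<open>Three rotations put a sign on each of the three arrows. The isomorphism that is minus
  the identity on the middle object removes two of them.\<close>

lemma tri_shift:
  assumes "(f, g, h) \<in> Tri T"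
  shows "(ShA T f, ShA T g, neg T (ShA T h)) \<in> Tri T"
proof -
  note t = tri_Arr[OF assms]
  have "(neg T (ShA T f), neg T (ShA T g), neg T (ShA T h)) \<in> Tri T"
    using tri_rotate[OF tri_rotate[OF tri_rotate[OF assms]]] t by simp
  then show ?thesis
    by (rule tri_isoI[of _ _ _ _ _ _ "Id T (ShO T (Dom T f))" "neg T (Id T (ShO T (Cod T f)))"
      "Id T (ShO T (Cod T g))"]) (use t in simp_all)
qed

lemma tri_iso_zero:
  assumes "is_iso T f" "zero_object T Z"
  shows "(f, Zer T (Cod T f) Z, Zer T Z (ShO T (Dom T f))) \<in> Tri T"
proof -
  have f: "f \<in> Arr T" "Z \<in> Ob T" using iso_Arr assms by (auto simp: zero_object_def)
  show ?thesis
    by (rule tri_isoI[OF pre_TR1_Id[OF _ assms(2), of "Dom T f"], of _ _ _ "Id T (Dom T f)" f "Id T Z"])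
       (use f assms zero_objects_iso[OF assms(2,2)] in \<open>simp_all add: zero_object_def\<close>)
qed

text \<open>As \<open>g\<close> is zero, \<open>f\<close> has a section \<open>y\<close>. The error
  \<open>y \<cdot> f - 1\<close> is killed by \<open>f\<close>, so its shift factors through
  \<open>h\<close>, which is zero as well.\<close>

lemma zero_cone_iso:
  assumes "(f, g, h) \<in> Tri T" "zero_object T (Cod T g)"
  shows "is_iso T f"
proof -
  note t = tri_Arr[OF assms(1)]
  let ?X = "Dom T f" and ?Y = "Cod T f"
  have "g = Zer T ?Y (Cod T g)" using zero_object_Cod[OF assms(2) t(2)] t by simp
  then obtain y where y: "y \<in> Arr T" "Dom T y = ?Y" "Cod T y = ?X" "f \<cdot> y = Id T ?Y"
    using weak_kernel[OF assms(1), of "Id T ?Y"] t by auto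
  have h: "h = Zer T (Cod T g) (ShO T ?X)" using zero_object_Dom[OF assms(2) t(3)] t by simp
  let ?e = "Add T (y \<cdot> f) (neg T (Id T ?X))"
  have "f \<cdot> ?e = Zer T ?X ?Y" using t y Comp_lift[OF y(4), of f] by simp
  then have "ShA T f \<cdot> ShA T ?e = Zer T (ShO T ?X) (ShO T ?Y)"
    using t y by (subst ShA_Comp[symmetric]) simp_all
  then obtain z where z: "z \<in> Arr T" "Dom T z = ShO T ?X" "Cod T z = Cod T g" "h \<cdot> z = ShA T ?e"
    using weak_kernel''[OF assms(1), of "ShA T ?e"] t y by auto
  have "ShA T ?e = ShA T (Zer T ?X ?X)" unfolding z(4)[symmetric] h using t z by simp
  then have "?e = Zer T ?X ?X" by (intro ShA_inj[of ?e "Zer T ?X ?X"]) (use t y in auto)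
  then have "y \<cdot> f = Id T ?X" by (intro Add_neg_eq_Zer[of "y \<cdot> f"]) (use t y in auto)
  then show ?thesis by (intro isoI[of f y]) (use y t in auto)
qed

lemma iso_zero_cone:
  assumes "(f, g, h) \<in> Tri T" "is_iso T f"
  shows "zero_object T (Cod T g)"
proof -
  obtain Z where Z: "zero_object T Z" using ex_zero_object by blast
  then have ZO: "Z \<in> Ob T" by (simp add: zero_object_def)
  have "isomorphic T (Cod T g) Z"
    using cone_unique[OF assms(1) tri_iso_zero[OF assms(2) Z]] iso_Arr[OF assms(2)] ZO by simp
  then show ?thesis using zero_object_iso Z by blast
qed

text \<open>TR4 speaks about arbitrary cones of three arrows, but cones are unique only up to
  non-canonical isomorphism. An octahedron on one pair of arrows with some cones is moved to an
  isomorphic pair with any cones by conjugating with the cone isomorphisms \<open>\<phi>\<close>,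
  \<open>\<psi>\<close>, \<open>\<chi>\<close>.\<close>

lemma octahedron_transport:
  assumes F: "(F, A, B) \<in> Tri T" and G: "(G, C, D) \<in> Tri T" and GF: "(G \<cdot> F, E, L) \<in> Tri T"
    and fg: "Dom T G = Cod T F" "Dom T g = Cod T f"
    and UV: "U \<in> Arr T" "V \<in> Arr T" "Dom T U = Cod T A" "Cod T U = Cod T E" "Dom T V = Cod T E" "Cod T V = Cod T C"
      "(U, V, ShA T A \<cdot> D) \<in> Tri T" "U \<cdot> A = E \<cdot> G" "L \<cdot> U = B" "V \<cdot> E = C" "D \<cdot> V = ShA T F \<cdot> L"
    and f: "(f, a, b) \<in> Tri T" and g: "(g, c, d) \<in> Tri T" and gf: "(g \<cdot> f, e, l) \<in> Tri T"
    and iso: "is_iso T \<alpha>" "is_iso T \<beta>" "is_iso T \<gamma>"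
      "Dom T \<alpha> = Dom T F" "Cod T \<alpha> = Dom T f" "Dom T \<beta> = Cod T F" "Cod T \<beta> = Cod T f"
      "Dom T \<gamma> = Cod T G" "Cod T \<gamma> = Cod T g" "f \<cdot> \<alpha> = \<beta> \<cdot> F" "g \<cdot> \<beta> = \<gamma> \<cdot> G"
  shows "\<exists>u \<in> Hom T (Cod T a) (Cod T e). \<exists>v \<in> Hom T (Cod T e) (Cod T c).
            (u, v, ShA T a \<cdot> d) \<in> Tri T \<and> u \<cdot> a = e \<cdot> g \<and> l \<cdot> u = b \<and> v \<cdot> e = c \<and> d \<cdot> v = ShA T f \<cdot> l"
proof -
  note AA = tri_Arr[OF F] tri_Arr[OF G] tri_Arr[OF f] tri_Arr[OF g] fg iso(1-9)
    iso_Arr[OF iso(1)] iso_Arr[OF iso(2)] iso_Arr[OF iso(3)]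
  note AA = AA tri_Arr(2-6)[OF GF, simplified Dom_Comp[OF AA(1,7,25)] Cod_Comp[OF AA(1,7,25)]]
    tri_Arr(2-6)[OF gf, simplified Dom_Comp[OF AA(13,19,26)] Cod_Comp[OF AA(13,19,26)]] UV(1-6)
  have i3: "(g \<cdot> f) \<cdot> \<alpha> = \<gamma> \<cdot> (G \<cdot> F)"
  proof -
    have "(g \<cdot> f) \<cdot> \<alpha> = g \<cdot> (f \<cdot> \<alpha>)" using AA by simp
    also have "\<dots> = (g \<cdot> \<beta>) \<cdot> F" unfolding iso(10) using AA by simp
    also have "\<dots> = \<gamma> \<cdot> (G \<cdot> F)" unfolding iso(11) using AA by simp
    finally show ?thesis .
  qed
  obtain \<phi> where p: "is_iso T \<phi>" "\<phi> \<in> Arr T" "Dom T \<phi> = Cod T A" "Cod T \<phi> = Cod T a"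
      and p1: "a \<cdot> \<beta> = \<phi> \<cdot> A" and p2: "b \<cdot> \<phi> = ShA T \<alpha> \<cdot> B"
    by (rule cone_mor_iso[OF F f iso(1,2)]) (use AA iso in simp_all)
  obtain \<psi> where s: "is_iso T \<psi>" "\<psi> \<in> Arr T" "Dom T \<psi> = Cod T C" "Cod T \<psi> = Cod T c"
      and s1: "c \<cdot> \<gamma> = \<psi> \<cdot> C" and s2: "d \<cdot> \<psi> = ShA T \<beta> \<cdot> D"
    by (rule cone_mor_iso[OF G g iso(2,3)]) (use AA iso in simp_all)
  obtain \<chi> where x: "is_iso T \<chi>" "\<chi> \<in> Arr T" "Dom T \<chi> = Cod T E" "Cod T \<chi> = Cod T e"
      and x1: "e \<cdot> \<gamma> = \<chi> \<cdot> E" and x2: "l \<cdot> \<chi> = ShA T \<alpha> \<cdot> L"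
    by (rule cone_mor_iso[OF GF gf iso(1,3)]) (use AA i3 in simp_all)
  define u where "u = \<chi> \<cdot> (U \<cdot> inv_arrow T \<phi>)"
  define v where "v = \<psi> \<cdot> (V \<cdot> inv_arrow T \<chi>)"
  have u: "u \<in> Arr T" "Dom T u = Cod T a" "Cod T u = Cod T e" using AA p x by (simp_all add: u_def)
  have v: "v \<in> Arr T" "Dom T v = Cod T e" "Cod T v = Cod T c" using AA x s by (simp_all add: v_def)
  have up: "u \<cdot> \<phi> = \<chi> \<cdot> U" using AA p x by (simp add: u_def)
  have vx: "v \<cdot> \<chi> = \<psi> \<cdot> V" using AA s x by (simp add: v_def)
  note AA = AA p x s u v
  have t1: "(ShA T a \<cdot> d) \<cdot> \<psi> = ShA T \<phi> \<cdot> (ShA T A \<cdot> D)"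
  proof -
    have "(ShA T a \<cdot> d) \<cdot> \<psi> = ShA T a \<cdot> (d \<cdot> \<psi>)" using AA by simp
    also have "\<dots> = ShA T (a \<cdot> \<beta>) \<cdot> D" unfolding s2 using AA by simp
    also have "\<dots> = ShA T \<phi> \<cdot> (ShA T A \<cdot> D)" unfolding p1 using AA by simp
    finally show ?thesis .
  qed
  have "(u, v, ShA T a \<cdot> d) \<in> Tri T"
    by (rule tri_isoI[OF UV(7), of _ _ _ \<phi> \<chi> \<psi>]) (use AA up vx t1 in simp_all)
  moreover have "u \<cdot> a = e \<cdot> g"
  proof (rule iso_cancel_right[OF iso(2)])
    have "(u \<cdot> a) \<cdot> \<beta> = u \<cdot> (a \<cdot> \<beta>)" using AA by simp
    also have "\<dots> = (u \<cdot> \<phi>) \<cdot> A" unfolding p1 using AA by simp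
    also have "\<dots> = \<chi> \<cdot> (U \<cdot> A)" unfolding up using AA by simp
    also have "\<dots> = (\<chi> \<cdot> E) \<cdot> G" unfolding UV(8) using AA by simp
    also have "\<dots> = e \<cdot> (\<gamma> \<cdot> G)" unfolding x1[symmetric] using AA by simp
    also have "\<dots> = (e \<cdot> g) \<cdot> \<beta>" unfolding iso(11)[symmetric] using AA by simp
    finally show "(u \<cdot> a) \<cdot> \<beta> = (e \<cdot> g) \<cdot> \<beta>" .
  qed (use AA in simp_all)
  moreover have "l \<cdot> u = b"
  proof (rule iso_cancel_right[OF p(1)])
    have "(l \<cdot> u) \<cdot> \<phi> = l \<cdot> (u \<cdot> \<phi>)" using AA by simp
    also have "\<dots> = (l \<cdot> \<chi>) \<cdot> U" unfolding up using AA by simp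
    also have "\<dots> = ShA T \<alpha> \<cdot> (L \<cdot> U)" unfolding x2 using AA by simp
    also have "\<dots> = b \<cdot> \<phi>" unfolding UV(9) p2 ..
    finally show "(l \<cdot> u) \<cdot> \<phi> = b \<cdot> \<phi>" .
  qed (use AA in simp_all)
  moreover have "v \<cdot> e = c"
  proof (rule iso_cancel_right[OF iso(3)])
    have "(v \<cdot> e) \<cdot> \<gamma> = v \<cdot> (e \<cdot> \<gamma>)" using AA by simp
    also have "\<dots> = (v \<cdot> \<chi>) \<cdot> E" unfolding x1 using AA by simp
    also have "\<dots> = \<psi> \<cdot> (V \<cdot> E)" unfolding vx using AA by simp
    also have "\<dots> = c \<cdot> \<gamma>" unfolding UV(10) s1 ..
    finally show "(v \<cdot> e) \<cdot> \<gamma> = c \<cdot> \<gamma>" .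
  qed (use AA in simp_all)
  moreover have "d \<cdot> v = ShA T f \<cdot> l"
  proof (rule iso_cancel_right[OF x(1)])
    have "(d \<cdot> v) \<cdot> \<chi> = d \<cdot> (v \<cdot> \<chi>)" using AA by simp
    also have "\<dots> = (d \<cdot> \<psi>) \<cdot> V" unfolding vx using AA by simp
    also have "\<dots> = ShA T \<beta> \<cdot> (D \<cdot> V)" unfolding s2 using AA by simp
    also have "\<dots> = ShA T (\<beta> \<cdot> F) \<cdot> L" unfolding UV(11) using AA by simp
    also have "\<dots> = ShA T f \<cdot> (ShA T \<alpha> \<cdot> L)" unfolding iso(10)[symmetric] using AA by simp
    also have "\<dots> = (ShA T f \<cdot> l) \<cdot> \<chi>" unfolding x2[symmetric] using AA by simp
    finally show "(d \<cdot> v) \<cdot> \<chi> = (ShA T f \<cdot> l) \<cdot> \<chi>" .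
  qed (use AA in simp_all)
  ultimately show ?thesis using u v by (intro bexI[of _ u] bexI[of _ v]) (auto simp: in_Hom)
qed

end

sublocale tri_category \<subseteq> pretri_category
  by unfold_locales
    (fact shift_functor shift_fully_faithful shift_essentially_surjective
      Tri_candidate Tri_iso_closed TR1_Id TR1_cone TR2 TR3)+

section \<open>Small sets\<close>

lemma small_mono: "\<lbrakk>small \<kappa> B; A \<subseteq> B\<rbrakk> \<Longrightarrow> small \<kappa> A"
  unfolding small_def using card_of_mono1 ordLeq_ordLess_trans by blast

lemma small_image: "small \<kappa> A \<Longrightarrow> small \<kappa> (f ` A)"
  unfolding small_def using card_of_image ordLeq_ordLess_trans by blast

lemma universe_Cinfinite:
  assumes "universe_card \<kappa>" shows "Cinfinite \<kappa>"
  using assms cinfinite_mono[OF ordLess_imp_ordLeq natLeq_cinfinite]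
  by (auto simp: universe_card_def)

text \<open>This closure property is what regularity of \<open>\<kappa>\<close> provides.\<close>

lemma small_UN: "\<lbrakk>universe_card \<kappa>; small \<kappa> I; \<And>i. i \<in> I \<Longrightarrow> small \<kappa> (A i)\<rbrakk> \<Longrightarrow> small \<kappa> (\<Union>i\<in>I. A i)"
  unfolding small_def
  by (rule regularCard_UNION_bound[OF universe_Cinfinite]) (auto simp: universe_card_def)

text \<open>Here \<open>\<kappa>\<close> being uncountable enters; it makes the countable coproduct
  of a tower available.\<close>

lemma small_nat: "universe_card \<kappa> \<Longrightarrow> small \<kappa> (A :: nat set)"
  by (rule small_mono[of _ UNIV])
     (auto simp: small_def universe_card_def intro: ordIso_ordLess_trans[OF card_of_nat])

lemma small_finite:
  fixes A :: "'a set" assumes "universe_card \<kappa>" "finite A" shows "small \<kappa> A"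
proof -
  obtain n and f :: "nat \<Rightarrow> 'a" where "A = f ` {i. i < n}"
    using finite_imp_nat_seg_image_inj_on[OF assms(2)] by auto
  then show ?thesis using small_image[OF small_nat[OF assms(1)]] by simp
qed

section \<open>The calculus of roofs\<close>

text \<open>Operations on classes are unions over all representatives. Each is evaluated by showing
  that all members of the family coincide.\<close>

lemma Union_single: "\<lbrakk>\<And>x. x \<in> A \<Longrightarrow> x = c; a \<in> A\<rbrakk> \<Longrightarrow> \<Union>A = c"
  by blast

text \<open>Closure of \<open>N\<close> under isomorphism makes membership of a cone independent of
  the cone chosen, and the equivalence in \<open>N_shift\<close> stands in for closure under an
  inverse shift. Skeletal smallness serves the Hom-sets of the quotient.\<close>

locale verdier = tri_category \<kappa> k T
  for \<kappa> :: "'u rel" and k :: "'r ring" and T :: "('r, 'o, 'm) tcat" (structure) +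
  fixes N :: "'o set"
  assumes univ: "universe_card \<kappa>" and skel: "skeletally_small \<kappa> T"
    and N_Ob: "X \<in> N \<Longrightarrow> X \<in> Ob T"
    and N_iso: "\<lbrakk>X \<in> N; isomorphic T X Y\<rbrakk> \<Longrightarrow> Y \<in> N"
    and N_zero: "zero_object T Z \<Longrightarrow> Z \<in> N"
    and N_shift: "X \<in> Ob T \<Longrightarrow> ShO T X \<in> N \<longleftrightarrow> X \<in> N"
    and N_cone: "\<lbrakk>(f, g, h) \<in> Tri T; Dom T f \<in> N; Cod T f \<in> N\<rbrakk> \<Longrightarrow> Cod T g \<in> N"
begin

abbreviation "W \<equiv> cone_in T N"
abbreviation "Q \<equiv> verdier_quotient T N"
abbreviation "q \<equiv> quotient_arrow T N"
abbreviation "cls \<equiv> roof_class T N"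

lemma N_cone': "\<lbrakk>(f, g, h) \<in> Tri T; Dom T f \<in> N; Cod T g \<in> N\<rbrakk> \<Longrightarrow> Cod T f \<in> N"
  using N_cone[OF tri_rotate[OF tri_rotate], of f g h] tri_Arr[of f g h] N_shift by simp

lemma N_fibre: "\<lbrakk>(f, g, h) \<in> Tri T; Cod T f \<in> N; Cod T g \<in> N\<rbrakk> \<Longrightarrow> Dom T f \<in> N"
  using N_cone[OF tri_rotate, of f g h] tri_Arr[of f g h] N_shift by simp

section \<open>Denominators and the Ore conditions\<close>

lemma W_I: "\<lbrakk>(s, g, h) \<in> Tri T; Cod T g \<in> N\<rbrakk> \<Longrightarrow> s \<in> W"
  by (auto simp: cone_in_def)

lemma W_Arr [simp]: "s \<in> W \<Longrightarrow> s \<in> Arr T"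
  by (auto simp: cone_in_def dest: tri_Arr)

lemma W_cone: "\<lbrakk>s \<in> W; (s, g, h) \<in> Tri T\<rbrakk> \<Longrightarrow> Cod T g \<in> N"
  unfolding cone_in_def using N_iso cone_unique by blast

lemma W_iso: "is_iso T s \<Longrightarrow> s \<in> W"
  using TR1_cone[of s] iso_Arr[of s] iso_zero_cone N_zero W_I by blast

lemma W_Id [simp]: "X \<in> Ob T \<Longrightarrow> Id T X \<in> W"
  by (rule W_iso) simp

text \<open>By the octahedral axiom the cone of a composite is an extension of the two
  cones.\<close>

lemma W_Comp:
  assumes "f \<in> W" "g \<in> W" "Dom T g = Cod T f" shows "g \<cdot> f \<in> W"
proof -
  obtain a b c d e l where t: "(f, a, b) \<in> Tri T" "(g, c, d) \<in> Tri T" "(g \<cdot> f, e, l) \<in> Tri T"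
    using TR1_cone assms by (metis W_Arr Comp_Arr)
  have "f \<in> Hom T (Dom T f) (Cod T f)" "g \<in> Hom T (Cod T f) (Cod T g)"
    using assms by (auto simp: in_Hom)
  from TR4[OF this t] obtain u v w where "u \<in> Hom T (Cod T a) (Cod T e)"
    "v \<in> Hom T (Cod T e) (Cod T c)" "(u, v, w) \<in> Tri T" by blast
  then have "Cod T e \<in> N"
    using N_cone'[of u v w] W_cone[OF assms(1) t(1)] W_cone[OF assms(2) t(2)] by (auto simp: in_Hom)
  then show ?thesis using W_I t(3) by blast
qed

text \<open>A homotopy pullback: \<open>s'\<close> is the fibre of \<open>g \<cdot> f\<close>, so it
  has the same cone as \<open>s\<close>, and \<open>f \<cdot> s'\<close> is killed by
  \<open>g\<close> and therefore lifts along \<open>s\<close>.\<close>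

lemma ore:
  assumes "s \<in> W" "f \<in> Arr T" "Cod T f = Cod T s"
  obtains s' f' where "s' \<in> W" "f' \<in> Arr T" "Dom T f' = Dom T s'" "Cod T s' = Dom T f"
    "Cod T f' = Dom T s" "s \<cdot> f' = f \<cdot> s'"
proof -
  obtain g h where t: "(s, g, h) \<in> Tri T" "Cod T g \<in> N" using assms(1) by (auto simp: cone_in_def)
  note a = tri_Arr[OF t(1)]
  obtain s' h' where t': "(s', g \<cdot> f, h') \<in> Tri T" using fibre[of "g \<cdot> f"] assms a by auto
  note a' = tri_Arr[OF t']
  have "g \<cdot> (f \<cdot> s') = Zer T (Dom T s') (Cod T g)" using tri_comp_Zer[OF t'] a a' assms by simp
  then obtain f' where "f' \<in> Arr T" "Dom T f' = Dom T s'" "Cod T f' = Dom T s" "s \<cdot> f' = f \<cdot> s'"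
    using weak_kernel[OF t(1), of "f \<cdot> s'"] a a' assms by auto
  then show ?thesis using that[of s' f'] W_I[OF t'] t a a' assms by simp
qed

lemma W_weak_kernel:
  assumes "s \<in> W" obtains n h where "(n, s, h) \<in> Tri T" "Dom T n \<in> N"
proof -
  obtain n h where t: "(n, s, h) \<in> Tri T" using fibre[of s] assms by auto
  then have "Cod T h \<in> N" using W_cone[OF assms tri_rotate] by simp
  then show ?thesis using that t tri_Arr[OF t] N_shift by auto
qed

lemma W_I': "\<lbrakk>(n, s, h) \<in> Tri T; Dom T n \<in> N\<rbrakk> \<Longrightarrow> s \<in> W"
  using W_I[OF tri_rotate, of n s h] tri_Arr[of n s h] N_shift by simp

text \<open>The dual construction: \<open>n\<close> is the fibre of \<open>s\<close> and
  \<open>s'\<close> is the second arrow of a triangle on \<open>f \<cdot> n\<close>, so the fibre of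
  \<open>s'\<close> is again the source of \<open>n\<close>.\<close>

lemma ore_left:
  assumes "s \<in> W" "f \<in> Arr T" "Dom T f = Dom T s"
  obtains s' f' where "s' \<in> W" "f' \<in> Arr T" "Cod T f' = Cod T s'" "Dom T s' = Cod T f"
    "Dom T f' = Cod T s" "f' \<cdot> s = s' \<cdot> f"
proof -
  obtain n h where t: "(n, s, h) \<in> Tri T" "Dom T n \<in> N" using W_weak_kernel[OF assms(1)] .
  note a = tri_Arr[OF t(1)]
  obtain s' h' where t': "(f \<cdot> n, s', h') \<in> Tri T" using TR1_cone[of "f \<cdot> n"] assms a by auto
  note a' = tri_Arr[OF t']
  have "(s' \<cdot> f) \<cdot> n = Zer T (Dom T n) (Cod T s')" using tri_comp_Zer[OF t'] a a' assms by simp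
  then obtain f' where "f' \<in> Arr T" "Dom T f' = Cod T s" "Cod T f' = Cod T s'" "f' \<cdot> s = s' \<cdot> f"
    using weak_cokernel[OF t(1), of "s' \<cdot> f"] a a' assms by auto
  then show ?thesis using that[of s' f'] W_I'[OF t'] t a a' assms by simp
qed

text \<open>The fibre \<open>r\<close> of \<open>x\<close> has \<open>Cod T x\<close> as its cone,
  hence is a denominator.\<close>

lemma kill:
  assumes "x \<in> Arr T" "y \<in> Arr T" "Dom T y = Cod T x" "Cod T x \<in> N"
  obtains r where "r \<in> W" "Cod T r = Dom T x" "(y \<cdot> x) \<cdot> r = Zer T (Dom T r) (Cod T y)"
proof -
  obtain r h where t: "(r, x, h) \<in> Tri T" using fibre[of x] assms by auto
  then show ?thesis using that[of r] W_I[OF t] tri_comp_Zer[OF t] tri_Arr[OF t] assms by simp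
qed

text \<open>The difference of the two arrows factors through the fibre of \<open>s\<close>, an
  object of \<open>N\<close>, so \<open>kill\<close> applies to it.\<close>

lemma cancel:
  assumes "s \<in> W" "f \<in> Arr T" "f' \<in> Arr T" "Dom T f' = Dom T f" "Cod T f = Dom T s" "Cod T f' = Dom T s"
    "s \<cdot> f = s \<cdot> f'"
  obtains r where "r \<in> W" "Cod T r = Dom T f" "f \<cdot> r = f' \<cdot> r"
proof -
  obtain n h where t: "(n, s, h) \<in> Tri T" "Dom T n \<in> N" using W_weak_kernel[OF assms(1)] .
  note a = tri_Arr[OF t(1)]
  let ?d = "Add T f (neg T f')"
  have d: "?d \<in> Arr T" "Dom T ?d = Dom T f" "Cod T ?d = Dom T s" using assms by auto
  have "s \<cdot> ?d = Zer T (Dom T ?d) (Cod T s)" using assms by simp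
  then obtain y where y: "y \<in> Arr T" "Dom T y = Dom T f" "Cod T y = Dom T n" "n \<cdot> y = ?d"
    using weak_kernel[OF t(1), of ?d] d by auto
  obtain r where r: "r \<in> W" "Cod T r = Dom T f" "(n \<cdot> y) \<cdot> r = Zer T (Dom T r) (Cod T n)"
    using kill[of y n] y a t(2) by auto
  have "Add T (f \<cdot> r) (neg T (f' \<cdot> r)) = Zer T (Dom T r) (Cod T n)"
    using r(3) unfolding y(4) using r(1,2) assms by simp
  then have "f \<cdot> r = f' \<cdot> r"
    using r(1,2) assms(1-6) a by (intro Add_neg_eq_Zer[of "f \<cdot> r" "f' \<cdot> r"]) auto
  then show ?thesis using that r by blast
qed

text \<open>Converse of \<open>kill\<close>: an arrow annihilated by a denominator factors through
  the cone of that denominator. This is how vanishing in a quotient is turned into a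
  factorisation.\<close>

lemma W_factor:
  assumes "r \<in> W" "f \<in> Arr T" "Cod T r = Dom T f" "f \<cdot> r = Zer T (Dom T r) (Cod T f)"
  obtains x y where "x \<in> Arr T" "y \<in> Arr T" "Dom T x = Dom T f" "Cod T x = Dom T y" "Cod T y = Cod T f"
    "Cod T x \<in> N" "y \<cdot> x = f"
proof -
  obtain g h where t: "(r, g, h) \<in> Tri T" "Cod T g \<in> N" using assms(1) by (auto simp: cone_in_def)
  obtain y where "y \<in> Arr T" "Dom T y = Cod T g" "Cod T y = Cod T f" "y \<cdot> g = f"
    using weak_cokernel[OF t(1), of f] assms by auto
  then show ?thesis using that[of g y] t tri_Arr[OF t(1)] assms by simp
qed

text \<open>Common refinement of two arrows into the source of \<open>s\<close>, where
  \<open>u\<close> itself need not be a denominator. The Ore condition gives equality after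
  \<open>s\<close>, and \<open>cancel\<close> removes \<open>s\<close>.\<close>

lemma join:
  assumes "s \<in> W" "s \<cdot> u \<in> W" "u \<in> Arr T" "a \<in> Arr T" "Cod T u = Dom T s" "Cod T a = Dom T s"
  obtains m n where "m \<in> Arr T" "n \<in> W" "Dom T m = Dom T n" "Cod T m = Dom T u" "Cod T n = Dom T a"
    "u \<cdot> m = a \<cdot> n"
proof -
  obtain n m where 1: "n \<in> W" "m \<in> Arr T" "Dom T m = Dom T n" "Cod T n = Dom T a" "Cod T m = Dom T u"
    "(s \<cdot> u) \<cdot> m = (s \<cdot> a) \<cdot> n"
    using ore[OF assms(2), of "s \<cdot> a"] assms by auto
  obtain r where "r \<in> W" "Cod T r = Dom T m" "(u \<cdot> m) \<cdot> r = (a \<cdot> n) \<cdot> r"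
    using cancel[OF assms(1), of "u \<cdot> m" "a \<cdot> n"] 1 assms by auto
  then show ?thesis using that[of "m \<cdot> r" "n \<cdot> r"] 1 assms by (simp add: W_Comp)
qed

section \<open>Equivalence of roofs\<close>

definition roof :: "'m \<Rightarrow> 'm \<Rightarrow> bool" where
  "roof s f \<longleftrightarrow> s \<in> W \<and> f \<in> Arr T \<and> Dom T f = Dom T s"

text \<open>The relation underlying \<open>roof_class\<close>. Only the common denominator
  \<open>s \<cdot> u\<close> has to lie in \<open>W\<close>, not the comparison arrows
  \<open>u\<close> and \<open>v\<close>.\<close>

definition roof_eq :: "'m \<Rightarrow> 'm \<Rightarrow> 'm \<Rightarrow> 'm \<Rightarrow> bool" where
  "roof_eq s f s' f' \<longleftrightarrow> roof s f \<and> roof s' f' \<and> Cod T s' = Cod T s \<and> Cod T f' = Cod T f \<and>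
     (\<exists>u v. u \<in> Arr T \<and> v \<in> Arr T \<and> Dom T u = Dom T v \<and> Cod T u = Dom T s \<and> Cod T v = Dom T s' \<and>
        s \<cdot> u = s' \<cdot> v \<and> s \<cdot> u \<in> W \<and> f \<cdot> u = f' \<cdot> v)"

lemma roofD: "roof s f \<Longrightarrow> s \<in> W" "roof s f \<Longrightarrow> f \<in> Arr T" "roof s f \<Longrightarrow> Dom T f = Dom T s"
  by (auto simp: roof_def)

lemma roof_eqI:
  assumes "roof s f" "roof s' f'" "Cod T s' = Cod T s" "Cod T f' = Cod T f"
    "u \<in> Arr T" "v \<in> Arr T" "Dom T u = Dom T v" "Cod T u = Dom T s" "Cod T v = Dom T s'"
    "s \<cdot> u = s' \<cdot> v" "s \<cdot> u \<in> W" "f \<cdot> u = f' \<cdot> v"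
  shows "roof_eq s f s' f'"
  using assms unfolding roof_eq_def by blast

lemma roof_eqE:
  assumes "roof_eq s f s' f'"
  obtains u v where "u \<in> Arr T" "v \<in> Arr T" "Dom T v = Dom T u" "Cod T u = Dom T s" "Cod T v = Dom T s'"
    "s \<cdot> u = s' \<cdot> v" "s \<cdot> u \<in> W" "f \<cdot> u = f' \<cdot> v"
  using assms unfolding roof_eq_def by metis

lemma mem_cls: "roof s f \<Longrightarrow> (s', f') \<in> cls s f \<longleftrightarrow> roof_eq s f s' f'"
  unfolding roof_class_def roof_eq_def roof_def roofs_def by auto

lemma roof_eq_refl: "roof s f \<Longrightarrow> roof_eq s f s f"
  by (rule roof_eqI[of _ _ _ _ "Id T (Dom T s)" "Id T (Dom T s)"]) (auto simp: roof_def)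

lemma roof_eq_sym: "roof_eq s f s' f' \<Longrightarrow> roof_eq s' f' s f"
  unfolding roof_eq_def by metis

text \<open>Both comparisons pass through the source of \<open>s'\<close>; \<open>join\<close>
  refines them there until they agree.\<close>

lemma roof_eq_trans:
  assumes "roof_eq s f s' f'" "roof_eq s' f' s'' f''"
  shows "roof_eq s f s'' f''"
proof -
  have r: "roof s f" "roof s' f'" "roof s'' f''" "Cod T s' = Cod T s" "Cod T f' = Cod T f"
    "Cod T s'' = Cod T s" "Cod T f'' = Cod T f"
    using assms by (auto simp: roof_eq_def)
  obtain u v where u: "u \<in> Arr T" "v \<in> Arr T" "Dom T v = Dom T u" "Cod T u = Dom T s" "Cod T v = Dom T s'"
    "s \<cdot> u = s' \<cdot> v" "s \<cdot> u \<in> W" "f \<cdot> u = f' \<cdot> v" using roof_eqE[OF assms(1)] .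
  obtain u' v' where u': "u' \<in> Arr T" "v' \<in> Arr T" "Dom T v' = Dom T u'" "Cod T u' = Dom T s'"
    "Cod T v' = Dom T s''" "s' \<cdot> u' = s'' \<cdot> v'" "s' \<cdot> u' \<in> W" "f' \<cdot> u' = f'' \<cdot> v'"
    using roof_eqE[OF assms(2)] .
  note R = roofD[OF r(1)] roofD[OF r(2)] roofD[OF r(3)]
  obtain m n where m: "m \<in> Arr T" "n \<in> W" "Dom T m = Dom T n" "Cod T m = Dom T u'" "Cod T n = Dom T v"
    "u' \<cdot> m = v \<cdot> n"
    using join[of s' u' v] R u u' by auto
  show ?thesis
  proof (rule roof_eqI[OF r(1,3), of "u \<cdot> n" "v' \<cdot> m"])
    have "(s \<cdot> u) \<cdot> n \<in> W" by (rule W_Comp) (use u(1-5,7) m R in auto)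
    then show "s \<cdot> (u \<cdot> n) \<in> W" using u(1-5) m R by simp
    have "s \<cdot> (u \<cdot> n) = s' \<cdot> (v \<cdot> n)" using R u(1-5) m Comp_lift[OF u(6), of n] by simp
    also have "\<dots> = s'' \<cdot> (v' \<cdot> m)"
      unfolding m(6)[symmetric] using R u(1-5) u'(1-5) m(1-5) Comp_lift[OF u'(6), of m] by simp
    finally show "s \<cdot> (u \<cdot> n) = s'' \<cdot> (v' \<cdot> m)" .
    have "f \<cdot> (u \<cdot> n) = f' \<cdot> (v \<cdot> n)" using R u(1-5) m Comp_lift[OF u(8), of n] by simp
    also have "\<dots> = f'' \<cdot> (v' \<cdot> m)"
      unfolding m(6)[symmetric] using R u(1-5) u'(1-5) m(1-5) Comp_lift[OF u'(8), of m] by simp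
    finally show "f \<cdot> (u \<cdot> n) = f'' \<cdot> (v' \<cdot> m)" .
  qed (use R r u(1-5) u'(1-5) m(1-5) in auto)
qed

lemma cls_eq_iff:
  assumes "roof s f" "roof s' f'"
  shows "cls s f = cls s' f' \<longleftrightarrow> roof_eq s f s' f'"
proof
  assume "cls s f = cls s' f'"
  then show "roof_eq s f s' f'" using mem_cls[OF assms(1), of s' f'] mem_cls[OF assms(2), of s' f']
    roof_eq_refl[OF assms(2)] by simp
next
  assume e: "roof_eq s f s' f'"
  have "p \<in> cls s f \<longleftrightarrow> p \<in> cls s' f'" for p
    using mem_cls[OF assms(1), of "fst p" "snd p"] mem_cls[OF assms(2), of "fst p" "snd p"]
      roof_eq_trans[OF e] roof_eq_trans[OF roof_eq_sym[OF e]] by auto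
  then show "cls s f = cls s' f'" by blast
qed

lemma cls_eqI:
  assumes "roof s f" "roof s' f'" "Cod T s' = Cod T s" "Cod T f' = Cod T f"
    "u \<in> Arr T" "v \<in> Arr T" "Dom T u = Dom T v" "Cod T u = Dom T s" "Cod T v = Dom T s'"
    "s \<cdot> u = s' \<cdot> v" "s \<cdot> u \<in> W" "f \<cdot> u = f' \<cdot> v"
  shows "cls s f = cls s' f'"
  using roof_eqI[OF assms] cls_eq_iff assms(1,2) by blast

lemma cls_refine:
  assumes "roof s f" "u \<in> Arr T" "Cod T u = Dom T s" "s \<cdot> u \<in> W"
  shows "roof (s \<cdot> u) (f \<cdot> u)" "cls (s \<cdot> u) (f \<cdot> u) = cls s f"
proof -
  note R = roofD[OF assms(1)]
  show r: "roof (s \<cdot> u) (f \<cdot> u)" using assms R by (simp add: roof_def)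
  show "cls (s \<cdot> u) (f \<cdot> u) = cls s f"
    by (rule cls_eqI[OF r assms(1), of "Id T (Dom T u)" u]) (use assms R in auto)
qed

text \<open>Independence of a composite from all choices at once: representatives of both factors
  and both Ore squares. The arrows \<open>m\<close>, \<open>n\<close> and then \<open>x\<close>,
  \<open>y\<close> reconcile the squares with the comparison of the first factor, \<open>p\<close>,
  \<open>p'\<close> bring in the comparison of the second factor, and the remaining equality after
  \<open>t'\<close> is cancelled by \<open>r\<close>.\<close>

lemma roof_comp_eq:
  assumes "roof_eq s f s' f'" "roof_eq t g t' g'" "Cod T f = Cod T t"
    and u: "u \<in> W" "v \<in> Arr T" "Dom T v = Dom T u" "Cod T u = Dom T s" "Cod T v = Dom T t" "f \<cdot> u = t \<cdot> v"
    and u': "u' \<in> W" "v' \<in> Arr T" "Dom T v' = Dom T u'" "Cod T u' = Dom T s'" "Cod T v' = Dom T t'"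
      "f' \<cdot> u' = t' \<cdot> v'"
  shows "roof_eq (s \<cdot> u) (g \<cdot> v) (s' \<cdot> u') (g' \<cdot> v')"
proof -
  have r: "roof s f" "roof s' f'" "roof t g" "roof t' g'" "Cod T s' = Cod T s" "Cod T f' = Cod T f"
    "Cod T t' = Cod T t" "Cod T g' = Cod T g"
    using assms by (auto simp: roof_eq_def)
  note R = roofD[OF r(1)] roofD[OF r(2)] roofD[OF r(3)] roofD[OF r(4)] r(5-8) assms(3)
  obtain a b where a: "a \<in> Arr T" "b \<in> Arr T" "Dom T b = Dom T a" "Cod T a = Dom T s" "Cod T b = Dom T s'"
    and a': "s \<cdot> a = s' \<cdot> b" "s \<cdot> a \<in> W" "f \<cdot> a = f' \<cdot> b" using roof_eqE[OF assms(1)] .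
  obtain c d where c: "c \<in> Arr T" "d \<in> Arr T" "Dom T d = Dom T c" "Cod T c = Dom T t" "Cod T d = Dom T t'"
    and c': "t \<cdot> c = t' \<cdot> d" "t \<cdot> c \<in> W" "g \<cdot> c = g' \<cdot> d" using roof_eqE[OF assms(2)] .
  obtain m n where m: "m \<in> Arr T" "n \<in> W" "Dom T m = Dom T n" "Cod T m = Dom T u" "Cod T n = Dom T a"
    and m': "u \<cdot> m = a \<cdot> n"
    using join[of s u a] R u a W_Comp[of u s] by auto
  obtain x y where x: "x \<in> Arr T" "y \<in> W" "Dom T x = Dom T y" "Cod T x = Dom T u'" "Cod T y = Dom T n"
    and x': "u' \<cdot> x = (b \<cdot> n) \<cdot> y"
    using join[of s' u' "b \<cdot> n"] R u' a m W_Comp[of u' s'] by auto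
  note A = R u(1-5) u'(1-5) a c m x
  have e1: "t \<cdot> (v \<cdot> (m \<cdot> y)) = t' \<cdot> (v' \<cdot> x)"
  proof -
    have "t \<cdot> (v \<cdot> (m \<cdot> y)) = (f \<cdot> u) \<cdot> (m \<cdot> y)" unfolding u(6) using A by simp
    also have "\<dots> = f \<cdot> ((u \<cdot> m) \<cdot> y)" using A by simp
    also have "\<dots> = (f \<cdot> a) \<cdot> (n \<cdot> y)" unfolding m' using A by simp
    also have "\<dots> = f' \<cdot> ((b \<cdot> n) \<cdot> y)" unfolding a'(3) using A by simp
    also have "\<dots> = (f' \<cdot> u') \<cdot> x" unfolding x'[symmetric] using A by simp
    also have "\<dots> = t' \<cdot> (v' \<cdot> x)" unfolding u'(6) using A by simp
    finally show ?thesis .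
  qed
  \<comment> \<open>The comparison \<open>c\<close> of the second factor and the arrow obtained so
    far both end at the source of \<open>t\<close>, so they can be refined to agree there.\<close>
  obtain p p' where p: "p \<in> Arr T" "p' \<in> W" "Dom T p = Dom T p'" "Cod T p = Dom T c" "Cod T p' = Dom T y"
    and p': "c \<cdot> p = (v \<cdot> (m \<cdot> y)) \<cdot> p'"
    using join[of t c "v \<cdot> (m \<cdot> y)"] A c'(2) by auto
  note A = A p
  have "t' \<cdot> (v' \<cdot> (x \<cdot> p')) = (t \<cdot> (v \<cdot> (m \<cdot> y))) \<cdot> p'" unfolding e1 using A by simp
  also have "\<dots> = t \<cdot> (c \<cdot> p)" unfolding p' using A by simp
  also have "\<dots> = (t \<cdot> c) \<cdot> p" using A by simp
  also have "\<dots> = t' \<cdot> (d \<cdot> p)" unfolding c' using A by simp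
  finally have "t' \<cdot> (v' \<cdot> (x \<cdot> p')) = t' \<cdot> (d \<cdot> p)" .
  then obtain r where z: "r \<in> W" "Cod T r = Dom T p'" and z': "(v' \<cdot> (x \<cdot> p')) \<cdot> r = (d \<cdot> p) \<cdot> r"
    using cancel[of t' "v' \<cdot> (x \<cdot> p')" "d \<cdot> p"] A by auto
  note A = A z
  have s1: "(s \<cdot> u) \<cdot> (m \<cdot> (y \<cdot> (p' \<cdot> r))) = (s \<cdot> a) \<cdot> (n \<cdot> (y \<cdot> (p' \<cdot> r)))"
  proof -
    have "(s \<cdot> u) \<cdot> (m \<cdot> (y \<cdot> (p' \<cdot> r))) = s \<cdot> ((u \<cdot> m) \<cdot> (y \<cdot> (p' \<cdot> r)))" using A by simp
    also have "\<dots> = (s \<cdot> a) \<cdot> (n \<cdot> (y \<cdot> (p' \<cdot> r)))" unfolding m' using A by simp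
    finally show ?thesis .
  qed
  show ?thesis
  proof (rule roof_eqI[of _ _ _ _ "m \<cdot> (y \<cdot> (p' \<cdot> r))" "x \<cdot> (p' \<cdot> r)"])
    show "roof (s \<cdot> u) (g \<cdot> v)" "roof (s' \<cdot> u') (g' \<cdot> v')" using A by (auto simp: roof_def W_Comp)
    have "n \<cdot> (y \<cdot> (p' \<cdot> r)) \<in> W" using A by (auto intro!: W_Comp)
    then show "(s \<cdot> u) \<cdot> (m \<cdot> (y \<cdot> (p' \<cdot> r))) \<in> W"
      unfolding s1 by (rule W_Comp) (use a'(2) A in auto)
    have "(s \<cdot> a) \<cdot> (n \<cdot> (y \<cdot> (p' \<cdot> r))) = s' \<cdot> (((b \<cdot> n) \<cdot> y) \<cdot> (p' \<cdot> r))" unfolding a' using A by simp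
    also have "\<dots> = (s' \<cdot> u') \<cdot> (x \<cdot> (p' \<cdot> r))" unfolding x'[symmetric] using A by simp
    finally show "(s \<cdot> u) \<cdot> (m \<cdot> (y \<cdot> (p' \<cdot> r))) = (s' \<cdot> u') \<cdot> (x \<cdot> (p' \<cdot> r))" using s1 by simp
    have "(g \<cdot> v) \<cdot> (m \<cdot> (y \<cdot> (p' \<cdot> r))) = g \<cdot> (((v \<cdot> (m \<cdot> y)) \<cdot> p') \<cdot> r)" using A by simp
    also have "\<dots> = (g \<cdot> c) \<cdot> (p \<cdot> r)" unfolding p'[symmetric] using A by simp
    also have "\<dots> = g' \<cdot> ((d \<cdot> p) \<cdot> r)" unfolding c' using A by simp
    also have "\<dots> = (g' \<cdot> v') \<cdot> (x \<cdot> (p' \<cdot> r))" unfolding z'[symmetric] using A by simp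
    finally show "(g \<cdot> v) \<cdot> (m \<cdot> (y \<cdot> (p' \<cdot> r))) = (g' \<cdot> v') \<cdot> (x \<cdot> (p' \<cdot> r))" .
  qed (use A in auto)
qed

section \<open>The Verdier quotient is a linear category\<close>

lemma Ob_Q [simp]: "Ob Q = Ob T"
  and ShO_Q [simp]: "ShO Q = ShO T"
  and Id_Q [simp]: "Id Q X = q (Id T X)"
  and Zer_Q [simp]: "Zer Q X Y = q (Zer T X Y)"
  and Arr_Q: "Arr Q = {cls s f | s f. (s, f) \<in> roofs T N}"
  and Add_Q: "Add Q c d = \<Union>{cls s (Add T f g) | s f g. (s, f) \<in> c \<and> (s, g) \<in> d}"
  and Smul_Q: "Smul Q a c = \<Union>{cls s (Smul T a f) | s f. (s, f) \<in> c}"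
  and ShA_Q: "ShA Q c = \<Union>{cls (ShA T s) (ShA T f) | s f. (s, f) \<in> c}"
  by (simp_all add: verdier_quotient_def verdier_precat_def)

lemma q_def: "q f = cls (Id T (Dom T f)) f"
  by (simp add: quotient_arrow_def)

lemma roofs_iff: "(s, f) \<in> roofs T N \<longleftrightarrow> roof s f"
  by (auto simp: roofs_def roof_def)

lemma cls_Arr [simp]: "roof s f \<Longrightarrow> cls s f \<in> Arr Q"
  by (auto simp: Arr_Q roofs_iff)

lemma Arr_Q_E:
  assumes "\<phi> \<in> Arr Q" obtains s f where "roof s f" "\<phi> = cls s f"
  using assms by (auto simp: Arr_Q roofs_iff)

lemma cls_memD:
  assumes "roof s f" "(s', f') \<in> cls s f"
  shows "roof s' f' \<and> cls s' f' = cls s f \<and> Cod T s' = Cod T s \<and> Cod T f' = Cod T f \<and> roof_eq s f s' f'"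
proof -
  have e: "roof_eq s f s' f'" using mem_cls[OF assms(1)] assms(2) by simp
  then have r: "roof s' f'" "Cod T s' = Cod T s" "Cod T f' = Cod T f" by (simp_all add: roof_eq_def)
  then show ?thesis using cls_eq_iff[OF assms(1) r(1)] e by simp
qed

lemma cls_eq: "roof_eq s f s' f' \<Longrightarrow> cls s f = cls s' f'"
  using cls_eq_iff[of s f s' f'] by (simp add: roof_eq_def)

lemma cls_self: "roof s f \<Longrightarrow> (s, f) \<in> cls s f"
  using mem_cls[of s f s f] roof_eq_refl[of s f] by simp

lemma the_elem_cls:
  assumes "roof s f" "\<And>s' f'. (s', f') \<in> cls s f \<Longrightarrow> h (s', f') = h (s, f)"
  shows "the_elem (h ` cls s f) = h (s, f)"
proof -
  have ne: "cls s f \<noteq> {}" using cls_self[OF assms(1)] by blast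
  show ?thesis by (rule the_elem_image_unique[OF ne]) (metis assms(2) surj_pair)
qed

lemma Dom_cls [simp]:
  assumes "roof s f" shows "Dom Q (cls s f) = Cod T s"
proof -
  have "the_elem ((\<lambda>(s, f). Cod T s) ` cls s f) = (\<lambda>(s, f). Cod T s) (s, f)"
    by (rule the_elem_cls[OF assms]) (drule cls_memD[OF assms], simp)
  then show ?thesis by (simp add: verdier_quotient_def verdier_precat_def)
qed

lemma Cod_cls [simp]:
  assumes "roof s f" shows "Cod Q (cls s f) = Cod T f"
proof -
  have "the_elem ((\<lambda>(s, f). Cod T f) ` cls s f) = (\<lambda>(s, f). Cod T f) (s, f)"
    by (rule the_elem_cls[OF assms]) (drule cls_memD[OF assms], simp)
  then show ?thesis by (simp add: verdier_quotient_def verdier_precat_def)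
qed

text \<open>Any one Ore square computes the composite, since all others give an equivalent
  roof.\<close>

lemma Comp_cls:
  assumes "roof s f" "roof t g" "Cod T f = Cod T t"
    "u \<in> W" "v \<in> Arr T" "Dom T v = Dom T u" "Cod T u = Dom T s" "Cod T v = Dom T t" "f \<cdot> u = t \<cdot> v"
  shows "cls t g \<cdot>\<^bsub>Q\<^esub> cls s f = cls (s \<cdot> u) (g \<cdot> v)"
proof -
  let ?A = "{roof_class T N (s' \<cdot> u') (g' \<cdot> v') | s' f' t' g' u' v'.
       (s', f') \<in> cls s f \<and> (t', g') \<in> cls t g \<and> u' \<in> W \<and> v' \<in> Arr T \<and> Dom T u' = Dom T v' \<and>
       Cod T u' = Dom T s' \<and> Cod T v' = Dom T t' \<and> f' \<cdot> u' = t' \<cdot> v'}"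
  have "\<Union> ?A = cls (s \<cdot> u) (g \<cdot> v)"
  proof (rule Union_single)
    fix x assume "x \<in> ?A"
    then obtain s' f' t' g' u' v' where x: "x = cls (s' \<cdot> u') (g' \<cdot> v')"
      "(s', f') \<in> cls s f" "(t', g') \<in> cls t g" "u' \<in> W" "v' \<in> Arr T" "Dom T v' = Dom T u'"
      "Cod T u' = Dom T s'" "Cod T v' = Dom T t'" "f' \<cdot> u' = t' \<cdot> v'"
      by auto
    have "roof_eq (s \<cdot> u) (g \<cdot> v) (s' \<cdot> u') (g' \<cdot> v')"
      by (rule roof_comp_eq[OF _ _ assms(3-9) x(4-9)])
         (use cls_memD[OF assms(1) x(2)] cls_memD[OF assms(2) x(3)] in simp_all)
    then show "x = cls (s \<cdot> u) (g \<cdot> v)" unfolding x(1) by (rule cls_eq[symmetric])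
  next
    show "cls (s \<cdot> u) (g \<cdot> v) \<in> ?A" 
      unfolding mem_Collect_eq using assms cls_self[OF assms(1)] cls_self[OF assms(2)]
      by (intro exI[of _ s] exI[of _ f] exI[of _ t] exI[of _ g] exI[of _ u] exI[of _ v]) simp
  qed
  then show ?thesis by (simp add: verdier_quotient_def verdier_precat_def)
qed

lemma roof_Id [simp]: "f \<in> Arr T \<Longrightarrow> roof (Id T (Dom T f)) f"
  by (simp add: roof_def)

lemma q_Arr [simp]: "f \<in> Arr T \<Longrightarrow> q f \<in> Arr Q"
  and Dom_q [simp]: "f \<in> Arr T \<Longrightarrow> Dom Q (q f) = Dom T f"
  and Cod_q [simp]: "f \<in> Arr T \<Longrightarrow> Cod Q (q f) = Cod T f"
  by (simp_all add: q_def)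

lemma Comp_q_cls:
  assumes "roof s f" "g \<in> Arr T" "Dom T g = Cod T f"
  shows "q g \<cdot>\<^bsub>Q\<^esub> cls s f = cls s (g \<cdot> f)"
proof -
  note R = roofD[OF assms(1)]
  have "q g \<cdot>\<^bsub>Q\<^esub> cls s f = cls (s \<cdot> Id T (Dom T s)) (g \<cdot> f)"
    unfolding q_def by (rule Comp_cls[OF assms(1) roof_Id[OF assms(2)]]) (use assms(2,3) R in simp_all)
  then show ?thesis using R by simp
qed

lemma Comp_cls_q:
  assumes "roof s f" "h \<in> Arr T" "Cod T h = Dom T s"
  shows "cls s f \<cdot>\<^bsub>Q\<^esub> q (s \<cdot> h) = q (f \<cdot> h)"
proof -
  note R = roofD[OF assms(1)]
  have r: "roof (Id T (Dom T h)) (s \<cdot> h)" using assms(2,3) R by (simp add: roof_def)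
  have d: "Dom T (s \<cdot> h) = Dom T h" "Dom T (f \<cdot> h) = Dom T h" using assms(2,3) R by simp_all
  have "cls s f \<cdot>\<^bsub>Q\<^esub> q (s \<cdot> h) = cls (Id T (Dom T h) \<cdot> Id T (Dom T h)) (f \<cdot> h)"
    unfolding q_def d by (rule Comp_cls[OF r assms(1)]) (use assms(2,3) R in simp_all)
  then show ?thesis unfolding q_def d using assms(2) by simp
qed

lemma q_Comp [simp]:
  assumes "f \<in> Arr T" "g \<in> Arr T" "Dom T g = Cod T f"
  shows "q (g \<cdot> f) = q g \<cdot>\<^bsub>Q\<^esub> q f"
  using Comp_q_cls[OF roof_Id[OF assms(1)] assms(2,3)] assms by (simp add: q_def)

lemma category_Q: "category Q"
proof
  fix \<phi> assume "\<phi> \<in> Arr Q"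
  then obtain s f where "roof s f" "\<phi> = cls s f" using Arr_Q_E by blast
  then show "Dom Q \<phi> \<in> Ob Q" "Cod Q \<phi> \<in> Ob Q" using roofD[of s f] by simp_all
next
  show "Id Q X \<in> Hom Q X X" if "X \<in> Ob Q" for X
    using that by (simp add: Hom_def)
next
  fix \<phi> X Y \<psi> Z assume h: "\<phi> \<in> Hom Q X Y" "\<psi> \<in> Hom Q Y Z"
  obtain s f where s: "roof s f" "\<phi> = cls s f" using h by (auto simp: Hom_def elim: Arr_Q_E)
  obtain t g where t: "roof t g" "\<psi> = cls t g" using h by (auto simp: Hom_def elim: Arr_Q_E)
  have c: "Cod T f = Cod T t" "X = Cod T s" "Z = Cod T g" using h s t by (auto simp: Hom_def)
  obtain u v where u: "u \<in> W" "v \<in> Arr T" "Dom T v = Dom T u" "Cod T u = Dom T s" "Cod T v = Dom T t"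
    "t \<cdot> v = f \<cdot> u"
    by (rule ore[of t f]) (use c roofD[OF s(1)] roofD[OF t(1)] in auto)
  have "roof (s \<cdot> u) (g \<cdot> v)" using roofD[OF s(1)] roofD[OF t(1)] u c by (simp add: roof_def W_Comp)
  then show "\<psi> \<cdot>\<^bsub>Q\<^esub> \<phi> \<in> Hom Q X Z"
    using Comp_cls[OF s(1) t(1) c(1) u(1-5) u(6)[symmetric]] roofD[OF s(1)] roofD[OF t(1)] u s t c
    by (simp add: Hom_def)
next
  fix \<phi> X Y \<psi> Z \<chi> V assume h: "\<phi> \<in> Hom Q V X" "\<psi> \<in> Hom Q X Y" "\<chi> \<in> Hom Q Y Z"
  obtain s f where s: "roof s f" "\<phi> = cls s f" using h by (auto simp: Hom_def elim: Arr_Q_E)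
  obtain t g where t: "roof t g" "\<psi> = cls t g" using h by (auto simp: Hom_def elim: Arr_Q_E)
  obtain r h' where r: "roof r h'" "\<chi> = cls r h'" using h by (auto simp: Hom_def elim: Arr_Q_E)
  have c: "Cod T f = Cod T t" "Cod T g = Cod T r" using h s t r by (auto simp: Hom_def)
  note R = roofD[OF s(1)] roofD[OF t(1)] roofD[OF r(1)] c
  \<comment> \<open>Both bracketings are computed from the same two Ore squares: one for the last
    two factors, and one for \<open>f\<close> against the resulting denominator
    \<open>t \<cdot> w\<close>.\<close>
  obtain w x where w: "w \<in> W" "x \<in> Arr T" "Dom T x = Dom T w" "Cod T w = Dom T t" "Cod T x = Dom T r"
    "r \<cdot> x = g \<cdot> w"
    by (rule ore[of r g]) (use R in auto)
  have tw: "t \<cdot> w \<in> W" "roof (t \<cdot> w) (h' \<cdot> x)" using R w by (auto simp: roof_def W_Comp)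
  obtain u v where u: "u \<in> W" "v \<in> Arr T" "Dom T v = Dom T u" "Cod T u = Dom T s" "Cod T v = Dom T w"
    "(t \<cdot> w) \<cdot> v = f \<cdot> u"
    using ore[OF tw(1), of f] R w by auto
  have "f \<cdot> u = t \<cdot> (w \<cdot> v)" unfolding u(6)[symmetric] using R w u(1-5) by simp
  note fu = this
  have 1: "\<chi> \<cdot>\<^bsub>Q\<^esub> \<psi> = cls (t \<cdot> w) (h' \<cdot> x)"
    unfolding t r using Comp_cls[OF t(1) r(1) c(2) w(1-5) w(6)[symmetric]] .
  have 2: "(\<chi> \<cdot>\<^bsub>Q\<^esub> \<psi>) \<cdot>\<^bsub>Q\<^esub> \<phi> = cls (s \<cdot> u) ((h' \<cdot> x) \<cdot> v)"
    unfolding 1 s by (rule Comp_cls[OF s(1) tw(2)]) (use R w(1-5) u in auto)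
  have 3: "\<psi> \<cdot>\<^bsub>Q\<^esub> \<phi> = cls (s \<cdot> u) (g \<cdot> (w \<cdot> v))"
    unfolding s t by (rule Comp_cls[OF s(1) t(1)]) (use R w(1-5) u(1-5) fu in auto)
  have su: "roof (s \<cdot> u) (g \<cdot> (w \<cdot> v))" using R w(1-5) u(1-5) by (simp add: roof_def W_Comp)
  have gw: "g \<cdot> (w \<cdot> v) = r \<cdot> (x \<cdot> v)" using Comp_lift[OF w(6)[symmetric], of v] R w(1-5) u(1-5) by simp
  have "\<chi> \<cdot>\<^bsub>Q\<^esub> (\<psi> \<cdot>\<^bsub>Q\<^esub> \<phi>) = cls ((s \<cdot> u) \<cdot> Id T (Dom T u)) (h' \<cdot> (x \<cdot> v))"
    unfolding 3 r by (rule Comp_cls[OF su r(1)]) (use R w(1-5) u(1-5) gw in auto)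
  then show "(\<chi> \<cdot>\<^bsub>Q\<^esub> \<psi>) \<cdot>\<^bsub>Q\<^esub> \<phi> = \<chi> \<cdot>\<^bsub>Q\<^esub> (\<psi> \<cdot>\<^bsub>Q\<^esub> \<phi>)" unfolding 2 using R w(1-5) u(1-5) by simp
next
  fix \<phi> X Y assume h: "\<phi> \<in> Hom Q X Y"
  obtain s f where s: "roof s f" "\<phi> = cls s f" using h by (auto simp: Hom_def elim: Arr_Q_E)
  have c: "X = Cod T s" "Y = Cod T f" using h s by (auto simp: Hom_def)
  note R = roofD[OF s(1)]
  have "roof (Id T (Cod T s)) (Id T (Cod T s))" using R by (simp add: roof_def)
  from Comp_cls[OF this s(1), of s "Id T (Dom T s)"]
  show "\<phi> \<cdot>\<^bsub>Q\<^esub> Id Q X = \<phi>" using R c by (simp add: q_def s)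
  show "Id Q Y \<cdot>\<^bsub>Q\<^esub> \<phi> = \<phi>" using Comp_q_cls[OF s(1), of "Id T Y"] R c s by simp
qed

sublocale Q: category Q by (rule category_Q)

text \<open>From here on the normal form is the identity or zero of \<open>Q\<close> rather than the
  image of one from \<open>T\<close>, so that the general rules for linear categories apply in
  \<open>Q\<close>.\<close>

declare Id_Q [simp del] Zer_Q [simp del]

lemmas q_Id [simp] = Id_Q [symmetric] and q_Zer [simp] = Zer_Q [symmetric]

text \<open>Both denominators are identities, so the two comparison arrows coincide and form the
  denominator \<open>r\<close>.\<close>

lemma q_eq_iff:
  assumes "f \<in> Arr T" "g \<in> Arr T" "Dom T g = Dom T f" "Cod T g = Cod T f"
  shows "q f = q g \<longleftrightarrow> (\<exists>r \<in> W. Cod T r = Dom T f \<and> f \<cdot> r = g \<cdot> r)"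
proof
  assume "q f = q g"
  then have "roof_eq (Id T (Dom T f)) f (Id T (Dom T f)) g"
    using cls_eq_iff[of "Id T (Dom T f)" f "Id T (Dom T f)" g] roof_Id[OF assms(1)] roof_Id[OF assms(2)] assms
    by (simp add: q_def)
  then obtain u v where u: "u \<in> Arr T" "v \<in> Arr T" "Dom T v = Dom T u" "Cod T u = Dom T (Id T (Dom T f))"
    "Cod T v = Dom T (Id T (Dom T f))" "Id T (Dom T f) \<cdot> u = Id T (Dom T f) \<cdot> v"
    "Id T (Dom T f) \<cdot> u \<in> W" "f \<cdot> u = g \<cdot> v"
    by (rule roof_eqE)
  then have "u \<in> W" "u = v" "Cod T u = Dom T f" using assms by simp_all
  then show "\<exists>r \<in> W. Cod T r = Dom T f \<and> f \<cdot> r = g \<cdot> r" using u(8) by blast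
next
  assume "\<exists>r \<in> W. Cod T r = Dom T f \<and> f \<cdot> r = g \<cdot> r"
  then obtain r where r: "r \<in> W" "Cod T r = Dom T f" "f \<cdot> r = g \<cdot> r" by blast
  then show "q f = q g" unfolding q_def using assms
    by (intro cls_eqI[of _ _ _ _ r r]) (auto simp: roof_def)
qed

lemma q_iso [simp]:
  assumes "s \<in> W" shows "is_iso Q (q s)"
proof -
  have r: "roof s (Id T (Dom T s))" "roof (Id T (Dom T s)) s" using assms by (auto simp: roof_def)
  have "cls s (Id T (Dom T s)) \<cdot>\<^bsub>Q\<^esub> q s = Id Q (Dom T s)"
    using Comp_cls_q[OF r(1), of "Id T (Dom T s)"] assms by simp
  moreover have "q s \<cdot>\<^bsub>Q\<^esub> cls s (Id T (Dom T s)) = cls s s"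
    using Comp_q_cls[OF r(1), of s] assms by simp
  moreover have "cls s s = Id Q (Cod T s)"
    using cls_refine[of "Id T (Cod T s)" "Id T (Cod T s)" s] assms by (simp add: Id_Q q_def roof_def)
  ultimately show ?thesis using r(1) assms by (intro Q.isoI[of _ "cls s (Id T (Dom T s))"]) auto
qed

lemma cls_q_mult: "roof s f \<Longrightarrow> cls s f \<cdot>\<^bsub>Q\<^esub> q s = q f"
  using Comp_cls_q[of s f "Id T (Dom T s)"] by (simp add: roof_def)

lemma cls_fraction: "roof s f \<Longrightarrow> cls s f = q f \<cdot>\<^bsub>Q\<^esub> inv_arrow Q (q s)"
  using roofD[of s f] cls_q_mult[of s f]
  by (intro Q.iso_cancel_right[of "q s" "cls s f"]) auto

lemma fraction:
  assumes "\<phi> \<in> Arr Q"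
  obtains s f where "s \<in> W" "f \<in> Arr T" "Dom T f = Dom T s" "Cod T s = Dom Q \<phi>" "Cod T f = Cod Q \<phi>"
    "\<phi> \<cdot>\<^bsub>Q\<^esub> q s = q f" "\<phi> = cls s f"
proof -
  obtain s f where s: "roof s f" "\<phi> = cls s f" using Arr_Q_E[OF assms] .
  then show ?thesis using that[of s f] roofD[OF s(1)] cls_q_mult[OF s(1)] by simp
qed

section \<open>Common denominators and the linear structure\<close>

lemma common_fraction:
  assumes "\<phi> \<in> Arr Q" "\<psi> \<in> Arr Q" "Dom Q \<psi> = Dom Q \<phi>"
  obtains s f g where "roof s f" "roof s g" "\<phi> = cls s f" "\<psi> = cls s g"
proof -
  obtain s f where s: "roof s f" "\<phi> = cls s f" using Arr_Q_E[OF assms(1)] .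
  obtain t g where t: "roof t g" "\<psi> = cls t g" using Arr_Q_E[OF assms(2)] .
  note R = roofD[OF s(1)] roofD[OF t(1)]
  have c: "Cod T t = Cod T s" using assms s t by simp
  obtain u v where u: "u \<in> W" "v \<in> Arr T" "Dom T v = Dom T u" "Cod T u = Dom T s" "Cod T v = Dom T t"
    "t \<cdot> v = s \<cdot> u"
    by (rule ore[of t s]) (use R c in auto)
  have su: "s \<cdot> u \<in> W" using R u by (simp add: W_Comp)
  show ?thesis
    using that[of "s \<cdot> u" "f \<cdot> u" "g \<cdot> v"] cls_refine[OF s(1), of u] cls_refine[OF t(1), of v] u R su s t
    by simp
qed

text \<open>The comparisons for \<open>f\<close> and for \<open>g\<close> may use different
  refinements of the same two denominators; \<open>x\<close>, \<open>y\<close> and \<open>r\<close>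
  merge them into one.\<close>

lemma roof_add_eq:
  assumes "roof_eq s f s' f'" "roof_eq s g s' g'" "Cod T g = Cod T f"
  shows "roof_eq s (Add T f g) s' (Add T f' g')"
proof -
  have r: "roof s f" "roof s' f'" "roof s g" "roof s' g'" "Cod T s' = Cod T s" "Cod T f' = Cod T f"
    "Cod T g' = Cod T g"
    using assms by (auto simp: roof_eq_def)
  note R = roofD[OF r(1)] roofD[OF r(2)] roofD[OF r(3)] roofD[OF r(4)] r(5-7) assms(3)
  obtain a b where a: "a \<in> Arr T" "b \<in> Arr T" "Dom T b = Dom T a" "Cod T a = Dom T s" "Cod T b = Dom T s'"
    and a': "s \<cdot> a = s' \<cdot> b" "s \<cdot> a \<in> W" "f \<cdot> a = f' \<cdot> b" using roof_eqE[OF assms(1)] .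
  obtain c d where c: "c \<in> Arr T" "d \<in> Arr T" "Dom T d = Dom T c" "Cod T c = Dom T s" "Cod T d = Dom T s'"
    and c': "s \<cdot> c = s' \<cdot> d" "s \<cdot> c \<in> W" "g \<cdot> c = g' \<cdot> d" using roof_eqE[OF assms(2)] .
  obtain x y where x: "x \<in> Arr T" "y \<in> W" "Dom T x = Dom T y" "Cod T x = Dom T c" "Cod T y = Dom T a"
    and x': "c \<cdot> x = a \<cdot> y"
    using join[of s c a] R a c c' by auto
  note A = R a c x
  have "s' \<cdot> (b \<cdot> y) = (s \<cdot> a) \<cdot> y" unfolding a' using A by simp
  also have "\<dots> = s \<cdot> (c \<cdot> x)" unfolding x' using A by simp
  also have "\<dots> = (s \<cdot> c) \<cdot> x" using A by simp
  also have "\<dots> = s' \<cdot> (d \<cdot> x)" unfolding c' using A by simp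
  finally have "s' \<cdot> (b \<cdot> y) = s' \<cdot> (d \<cdot> x)" .
  then obtain r where z: "r \<in> W" "Cod T r = Dom T y" and z': "(b \<cdot> y) \<cdot> r = (d \<cdot> x) \<cdot> r"
    using cancel[of s' "b \<cdot> y" "d \<cdot> x"] A by auto
  note A = A z
  show ?thesis
  proof (rule roof_eqI[of _ _ _ _ "a \<cdot> (y \<cdot> r)" "b \<cdot> (y \<cdot> r)"])
    show "roof s (Add T f g)" "roof s' (Add T f' g')" using A by (auto simp: roof_def)
    have 1: "s \<cdot> (a \<cdot> (y \<cdot> r)) = (s \<cdot> a) \<cdot> (y \<cdot> r)" using A by simp
    show "s \<cdot> (a \<cdot> (y \<cdot> r)) = s' \<cdot> (b \<cdot> (y \<cdot> r))" unfolding 1 a' using A by simp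
    have "y \<cdot> r \<in> W" using A by (simp add: W_Comp)
    then show "s \<cdot> (a \<cdot> (y \<cdot> r)) \<in> W" unfolding 1 by (rule W_Comp) (use A a'(2) in auto)
    have 2: "f \<cdot> (a \<cdot> (y \<cdot> r)) = f' \<cdot> (b \<cdot> (y \<cdot> r))"
      using Comp_lift[OF a'(3), of "y \<cdot> r"] A by simp
    have "g \<cdot> (a \<cdot> (y \<cdot> r)) = g \<cdot> ((a \<cdot> y) \<cdot> r)" using A by simp
    also have "\<dots> = (g \<cdot> c) \<cdot> (x \<cdot> r)" unfolding x'[symmetric] using A by simp
    also have "\<dots> = g' \<cdot> ((d \<cdot> x) \<cdot> r)" unfolding c' using A by simp
    also have "\<dots> = g' \<cdot> (b \<cdot> (y \<cdot> r))" unfolding z'[symmetric] using A by simp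
    finally show "Add T f g \<cdot> (a \<cdot> (y \<cdot> r)) = Add T f' g' \<cdot> (b \<cdot> (y \<cdot> r))" using 2 A by simp
  qed (use A in auto)
qed

lemma Add_cls:
  assumes "roof s f" "roof s g" "Cod T g = Cod T f"
  shows "Add Q (cls s f) (cls s g) = cls s (Add T f g)"
proof -
  let ?A = "{roof_class T N s' (Add T f' g') | s' f' g'. (s', f') \<in> cls s f \<and> (s', g') \<in> cls s g}"
  have "\<Union> ?A = cls s (Add T f g)"
  proof (rule Union_single)
    fix x assume "x \<in> ?A"
    then obtain s' f' g' where x: "x = cls s' (Add T f' g')" "(s', f') \<in> cls s f" "(s', g') \<in> cls s g" by auto
    have "roof_eq s (Add T f g) s' (Add T f' g')"
      by (rule roof_add_eq[OF _ _ assms(3)])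
         (use cls_memD[OF assms(1) x(2)] cls_memD[OF assms(2) x(3)] in simp_all)
    then show "x = cls s (Add T f g)" unfolding x(1) by (rule cls_eq[symmetric])
  qed (use cls_self[OF assms(1)] cls_self[OF assms(2)] in auto)
  then show ?thesis unfolding Add_Q .
qed

lemma Smul_cls:
  assumes "roof s f" "a \<in> carrier k"
  shows "Smul Q a (cls s f) = cls s (Smul T a f)"
proof -
  let ?A = "{roof_class T N s' (Smul T a f') | s' f'. (s', f') \<in> cls s f}"
  have "\<Union> ?A = cls s (Smul T a f)"
  proof (rule Union_single)
    fix x assume "x \<in> ?A"
    then obtain s' f' where x: "x = cls s' (Smul T a f')" "(s', f') \<in> cls s f" by auto
    have e: "roof_eq s f s' f'" and r': "roof s' f'" using cls_memD[OF assms(1) x(2)] by auto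
    from e obtain u v where u: "u \<in> Arr T" "v \<in> Arr T" "Dom T v = Dom T u" "Cod T u = Dom T s"
      "Cod T v = Dom T s'" "s \<cdot> u = s' \<cdot> v" "s \<cdot> u \<in> W" "f \<cdot> u = f' \<cdot> v" by (rule roof_eqE)
    then show "x = cls s (Smul T a f)" unfolding x(1)
      using roofD[OF assms(1)] roofD[OF r'] cls_memD[OF assms(1) x(2)] assms(2)
      by (intro cls_eqI[symmetric, of _ _ _ _ u v]) (auto simp: roof_def)
  qed (use cls_self[OF assms(1)] in auto)
  then show ?thesis unfolding Smul_Q .
qed

lemma common_denom:
  assumes "roof t h" "s \<in> W" "Cod T t = Cod T s"
  obtains u h' where "u \<in> W" "Cod T u = Dom T s" "roof (s \<cdot> u) h'" "cls t h = cls (s \<cdot> u) h'"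
    "Cod T h' = Cod T h"
proof -
  note R = roofD[OF assms(1)]
  obtain u v where u: "u \<in> W" "v \<in> Arr T" "Dom T v = Dom T u" "Cod T u = Dom T s" "Cod T v = Dom T t"
    "t \<cdot> v = s \<cdot> u"
    by (rule ore[of t s]) (use R assms in auto)
  have tv: "t \<cdot> v \<in> W" unfolding u(6) using u assms by (simp add: W_Comp)
  show ?thesis
    using that[of u "h \<cdot> v"] cls_refine[OF assms(1) u(2,5) tv] u R assms by simp
qed

lemma common_fraction3:
  assumes "\<phi> \<in> Arr Q" "\<psi> \<in> Arr Q" "\<chi> \<in> Arr Q" "Dom Q \<psi> = Dom Q \<phi>" "Dom Q \<chi> = Dom Q \<phi>"
  obtains s f g h where "roof s f" "roof s g" "roof s h" "\<phi> = cls s f" "\<psi> = cls s g" "\<chi> = cls s h"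
proof -
  obtain s f g where s: "roof s f" "roof s g" "\<phi> = cls s f" "\<psi> = cls s g"
    using common_fraction[OF assms(1,2,4)] .
  obtain t h where t: "roof t h" "\<chi> = cls t h" using Arr_Q_E[OF assms(3)] .
  have c: "Cod T t = Cod T s" using assms s t by simp
  obtain u h' where u: "u \<in> W" "Cod T u = Dom T s" "roof (s \<cdot> u) h'" "cls t h = cls (s \<cdot> u) h'"
    using common_denom[OF t(1) _ c] roofD[OF s(1)] by metis
  have su: "s \<cdot> u \<in> W" using u s roofD[OF s(1)] by (simp add: W_Comp)
  show ?thesis using that[of "s \<cdot> u" "f \<cdot> u" "g \<cdot> u" h'] cls_refine[OF s(1) _ u(2) su]
      cls_refine[OF s(2) _ u(2) su] u s t by simp
qed

lemma cls_Zer: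
  assumes "s \<in> W" "Y \<in> Ob T"
  shows "roof s (Zer T (Dom T s) Y)" "cls s (Zer T (Dom T s) Y) = Zer Q (Cod T s) Y"
proof -
  show "roof s (Zer T (Dom T s) Y)" using assms by (simp add: roof_def)
  have r: "roof (Id T (Cod T s)) (Zer T (Cod T s) Y)" using assms by (simp add: roof_def)
  have "cls (Id T (Cod T s) \<cdot> s) (Zer T (Cod T s) Y \<cdot> s) = cls (Id T (Cod T s)) (Zer T (Cod T s) Y)"
    by (rule cls_refine(2)[OF r]) (use assms in auto)
  then show "cls s (Zer T (Dom T s) Y) = Zer Q (Cod T s) Y" using assms by (simp add: Zer_Q q_def del: q_Zer)
qed

lemma roof_Add: "\<lbrakk>roof s f; roof s g; Cod T g = Cod T f\<rbrakk> \<Longrightarrow> roof s (Add T f g)"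
  and roof_neg: "roof s f \<Longrightarrow> roof s (neg T f)"
  and roof_Smul: "\<lbrakk>roof s f; a \<in> carrier k\<rbrakk> \<Longrightarrow> roof s (Smul T a f)"
  by (auto simp: roof_def)

lemma q_Add: "\<lbrakk>f \<in> Arr T; g \<in> Arr T; Dom T g = Dom T f; Cod T g = Cod T f\<rbrakk>
    \<Longrightarrow> q (Add T f g) = Add Q (q f) (q g)"
  using Add_cls[of "Id T (Dom T f)" f g] roof_Id[of f] roof_Id[of g] by (simp add: q_def)

lemma q_Smul: "\<lbrakk>f \<in> Arr T; a \<in> carrier k\<rbrakk> \<Longrightarrow> q (Smul T a f) = Smul Q a (q f)"
  using Smul_cls[of "Id T (Dom T f)" f a] roof_Id[of f] by (simp add: q_def)

lemma Hom_Q_iff: "\<phi> \<in> Hom Q X Y \<longleftrightarrow> (\<exists>s f. roof s f \<and> \<phi> = cls s f \<and> Cod T s = X \<and> Cod T f = Y)"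
proof
  assume h: "\<phi> \<in> Hom Q X Y"
  then obtain s f where "roof s f" "\<phi> = cls s f" using Arr_Q_E[of \<phi>] unfolding Q.in_Hom by blast
  with h show "\<exists>s f. roof s f \<and> \<phi> = cls s f \<and> Cod T s = X \<and> Cod T f = Y" by (auto simp: Q.in_Hom)
qed (auto simp: Q.in_Hom)

lemma Hom_Q_E2:
  assumes "\<phi> \<in> Hom Q X Y" "\<psi> \<in> Hom Q X Y"
  obtains s f g where "roof s f" "roof s g" "\<phi> = cls s f" "\<psi> = cls s g" "Cod T s = X" "Cod T f = Y" "Cod T g = Y"
proof -
  obtain s f g where s: "roof s f" "roof s g" "\<phi> = cls s f" "\<psi> = cls s g"
    by (rule common_fraction[of \<phi> \<psi>]) (use assms in \<open>auto simp: Q.in_Hom\<close>)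
  then show ?thesis using that assms by (simp add: Q.in_Hom)
qed

lemma Hom_Q_E3:
  assumes "\<phi> \<in> Hom Q X Y" "\<psi> \<in> Hom Q X Y" "\<chi> \<in> Hom Q X Y"
  obtains s f g h where "roof s f" "roof s g" "roof s h" "\<phi> = cls s f" "\<psi> = cls s g" "\<chi> = cls s h"
    "Cod T s = X" "Cod T f = Y" "Cod T g = Y" "Cod T h = Y"
proof -
  obtain s f g h where s: "roof s f" "roof s g" "roof s h" "\<phi> = cls s f" "\<psi> = cls s g" "\<chi> = cls s h"
    by (rule common_fraction3[of \<phi> \<psi> \<chi>]) (use assms in \<open>auto simp: Q.in_Hom\<close>)
  then show ?thesis using that assms by (simp add: Q.in_Hom)
qed

lemma Add_Q_Hom:
  assumes "\<phi> \<in> Hom Q X Y" "\<psi> \<in> Hom Q X Y" shows "Add Q \<phi> \<psi> \<in> Hom Q X Y"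
proof -
  obtain s f g where s: "roof s f" "roof s g" "\<phi> = cls s f" "\<psi> = cls s g" "Cod T s = X" "Cod T f = Y" "Cod T g = Y"
    using Hom_Q_E2[OF assms] .
  then show ?thesis using Add_cls[OF s(1,2)] roof_Add[OF s(1,2)] roofD[OF s(1)] roofD[OF s(2)]
    by (simp add: Q.in_Hom)
qed

text \<open>The apex of a roof ranges over all objects, but it can be replaced by an isomorphic one
  from a small skeleton, which leaves only a small set of roofs.\<close>

lemma Hom_small_Q:
  assumes "X \<in> Ob T" "Y \<in> Ob T" shows "small \<kappa> (Hom Q X Y)"
proof -
  obtain R where R: "R \<subseteq> Ob T" "small \<kappa> R" "\<forall>Z\<in>Ob T. \<exists>Z'\<in>R. isomorphic T Z Z'"
    using skel by (auto simp: skeletally_small_def)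
  let ?B = "\<Union>Z\<in>R. \<Union>s\<in>Hom T Z X. (\<lambda>f. cls s f) ` Hom T Z Y"
  have "small \<kappa> ?B"
    using R(1) assms by (intro small_UN[OF univ] small_image R(2) Hom_small) auto
  moreover have "Hom Q X Y \<subseteq> ?B"
  proof
    fix \<phi> assume "\<phi> \<in> Hom Q X Y"
    then obtain s f where s: "roof s f" "\<phi> = cls s f" "Cod T s = X" "Cod T f = Y" by (auto simp: Hom_Q_iff)
    note S = roofD[OF s(1)]
    obtain Z where Z: "Z \<in> R" "isomorphic T (Dom T s) Z" using R(3) S by force
    obtain w where w: "is_iso T w" "w \<in> Arr T" "Dom T w = Z" "Cod T w = Dom T s"
      using isomorphic_sym[OF Z(2)] by (rule isomorphicE)
    have sw: "s \<cdot> w \<in> W" using W_Comp[OF W_iso[OF w(1)]] S w by simp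
    have "\<phi> = cls (s \<cdot> w) (f \<cdot> w)" using cls_refine[OF s(1) w(2,4) sw] s by simp
    moreover have "s \<cdot> w \<in> Hom T Z X" "f \<cdot> w \<in> Hom T Z Y" using S w s by (auto simp: in_Hom)
    ultimately show "\<phi> \<in> ?B" using Z(1) by blast
  qed
  ultimately show ?thesis by (rule small_mono)
qed

text \<open>Finitely many classes have a common denominator, and over a fixed denominator the
  operations are those of the Hom-modules of \<open>T\<close>; each axiom is inherited from
  there.\<close>

lemma Hom_module_Q:
  assumes o: "X \<in> Ob T" "Y \<in> Ob T" shows "module k (Hom_module Q X Y)"
proof (rule moduleI[OF ground_ring])
  have zer: "Zer Q X Y = cls s (Zer T (Dom T s) Y)" "roof s (Zer T (Dom T s) Y)" if "roof s f" "Cod T s = X" for s f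
    using cls_Zer[of s Y] roofD[OF that(1)] that(2) o by auto
  show "abelian_group (Hom_module Q X Y)"
  proof (rule abelian_groupI, unfold Hom_module_def partial_object.simps ring.simps)
    show "\<phi> \<in> Hom Q X Y \<Longrightarrow> \<psi> \<in> Hom Q X Y \<Longrightarrow> Add Q \<phi> \<psi> \<in> Hom Q X Y" for \<phi> \<psi> by (rule Add_Q_Hom)
    show "Zer Q X Y \<in> Hom Q X Y" using o by (simp add: Zer_Q Q.in_Hom del: q_Zer)
    fix \<phi> assume f: "\<phi> \<in> Hom Q X Y"
    obtain s f where s: "roof s f" "\<phi> = cls s f" "Cod T s = X" "Cod T f = Y" using f by (auto simp: Hom_Q_iff)
    note S = roofD[OF s(1)] and z = zer[OF s(1,3)]
    show "Add Q (Zer Q X Y) \<phi> = \<phi>" unfolding z(1) s(2) using Add_cls[OF z(2) s(1)] S s o by simp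
    show "\<exists>\<psi>\<in>Hom Q X Y. Add Q \<psi> \<phi> = Zer Q X Y"
      using Add_cls[OF roof_neg[OF s(1)] s(1)] roof_neg[OF s(1)] S s z(1)
      by (intro bexI[of _ "cls s (neg T f)"]) (simp_all add: Q.in_Hom)
    fix \<psi> assume g: "\<psi> \<in> Hom Q X Y"
    show "Add Q \<phi> \<psi> = Add Q \<psi> \<phi>"
    proof (rule Hom_Q_E2[OF f g])
      fix s f g assume s: "roof s f" "roof s g" "\<phi> = cls s f" "\<psi> = cls s g" "Cod T f = Y" "Cod T g = Y"
      then show ?thesis using Add_cls[OF s(1,2)] Add_cls[OF s(2,1)] Add_commute[of f g] roofD[OF s(1)] roofD[OF s(2)]
        by simp
    qed
    fix \<chi> assume h: "\<chi> \<in> Hom Q X Y"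
    show "Add Q (Add Q \<phi> \<psi>) \<chi> = Add Q \<phi> (Add Q \<psi> \<chi>)"
    proof (rule Hom_Q_E3[OF f g h])
      fix s f g h assume s: "roof s f" "roof s g" "roof s h" "\<phi> = cls s f" "\<psi> = cls s g" "\<chi> = cls s h"
        "Cod T f = Y" "Cod T g = Y" "Cod T h = Y"
      then show ?thesis using Add_cls[OF s(1,2)] Add_cls[OF s(2,3)] Add_cls[OF roof_Add[OF s(1,2)] s(3)]
          Add_cls[OF s(1) roof_Add[OF s(2,3)]] Add_assoc[of f g h] roofD[OF s(1)] roofD[OF s(2)] roofD[OF s(3)]
        by simp
    qed
  qed
  show "smult (Hom_module Q X Y) a \<phi> \<in> carrier (Hom_module Q X Y)"
    if "a \<in> carrier k" "\<phi> \<in> carrier (Hom_module Q X Y)" for a \<phi>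
    using that Smul_cls roof_Smul by (auto simp: Hom_module_def Hom_Q_iff) (metis Smul_Arr(3) roofD(2))
  interpret k: cring k by (rule ground_ring)
  have mod: "module k (Hom_module T A B)" if "A \<in> Ob T" "B \<in> Ob T" for A B using Hom_is_module[OF that] .
  have Sm: "Smul T (a \<oplus>\<^bsub>k\<^esub> b) f = Add T (Smul T a f) (Smul T b f)"
      "Smul T (a \<otimes>\<^bsub>k\<^esub> b) f = Smul T a (Smul T b f)" "Smul T \<one>\<^bsub>k\<^esub> f = f"
    if "f \<in> Arr T" "a \<in> carrier k" "b \<in> carrier k" for f a b
    using module.smult_l_distr[OF mod, of "Dom T f" "Cod T f" a b f]
      module.smult_assoc1[OF mod, of "Dom T f" "Cod T f" a b f]
      module.smult_one[OF mod, of "Dom T f" "Cod T f" f] that by (auto simp: in_Hom)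
  have Sr: "Smul T a (Add T f g) = Add T (Smul T a f) (Smul T a g)"
    if "f \<in> Arr T" "g \<in> Arr T" "Dom T g = Dom T f" "Cod T g = Cod T f" "a \<in> carrier k" for f g a
    using module.smult_r_distr[OF mod, of "Dom T f" "Cod T f" a f g] that by (auto simp: in_Hom)
  have E: "\<exists>s f. roof s f \<and> \<phi> = cls s f \<and> s \<in> W \<and> f \<in> Arr T \<and> Dom T f = Dom T s"
    if h: "\<phi> \<in> carrier (Hom_module Q X Y)" for \<phi>
  proof -
    obtain s f where "roof s f" "\<phi> = cls s f" using h by (auto simp: Hom_module_def Hom_Q_iff)
    then show ?thesis using roofD by blast
  qed
  note [simp] = Hom_module_def
  show "smult (Hom_module Q X Y) (a \<oplus>\<^bsub>k\<^esub> b) \<phi> = smult (Hom_module Q X Y) a \<phi> \<oplus>\<^bsub>Hom_module Q X Y\<^esub> smult (Hom_module Q X Y) b \<phi>"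
    if a: "a \<in> carrier k" "b \<in> carrier k" "\<phi> \<in> carrier (Hom_module Q X Y)" for a b \<phi>
  proof -
    obtain s f where s: "roof s f" "\<phi> = cls s f" "s \<in> W" "f \<in> Arr T" "Dom T f = Dom T s" using E[OF a(3)] by blast
    then show ?thesis
      using Add_cls[OF roof_Smul[OF s(1) a(1)] roof_Smul[OF s(1) a(2)]] a
      by (simp add: Smul_cls[OF s(1)] Sm)
  qed
  show "smult (Hom_module Q X Y) (a \<otimes>\<^bsub>k\<^esub> b) \<phi> = smult (Hom_module Q X Y) a (smult (Hom_module Q X Y) b \<phi>)"
    if a: "a \<in> carrier k" "b \<in> carrier k" "\<phi> \<in> carrier (Hom_module Q X Y)" for a b \<phi>
  proof -
    obtain s f where s: "roof s f" "\<phi> = cls s f" "s \<in> W" "f \<in> Arr T" "Dom T f = Dom T s" using E[OF a(3)] by blast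
    then show ?thesis
      using Smul_cls[OF roof_Smul[OF s(1) a(2)]] a by (simp add: Smul_cls[OF s(1)] Sm)
  qed
  show "smult (Hom_module Q X Y) \<one>\<^bsub>k\<^esub> \<phi> = \<phi>" if a: "\<phi> \<in> carrier (Hom_module Q X Y)" for \<phi>
  proof -
    obtain s f where s: "roof s f" "\<phi> = cls s f" "s \<in> W" "f \<in> Arr T" "Dom T f = Dom T s" using E[OF a] by blast
    then show ?thesis using Sm(3)[of f "\<one>\<^bsub>k\<^esub>" "\<one>\<^bsub>k\<^esub>"] by (simp add: Smul_cls[OF s(1)])
  qed
  show "smult (Hom_module Q X Y) a (\<phi> \<oplus>\<^bsub>Hom_module Q X Y\<^esub> \<psi>) = smult (Hom_module Q X Y) a \<phi> \<oplus>\<^bsub>Hom_module Q X Y\<^esub> smult (Hom_module Q X Y) a \<psi>"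
    if a: "a \<in> carrier k" and h: "\<phi> \<in> carrier (Hom_module Q X Y)" "\<psi> \<in> carrier (Hom_module Q X Y)" for a \<phi> \<psi>
  proof -
    obtain s f g where s: "roof s f" "roof s g" "\<phi> = cls s f" "\<psi> = cls s g" "Cod T s = X" "Cod T f = Y" "Cod T g = Y"
      by (rule Hom_Q_E2[of \<phi> X Y \<psi>]) (use h in simp_all)
    then show ?thesis using Add_cls[OF s(1,2)] Smul_cls[OF roof_Add[OF s(1,2)] a] Smul_cls[OF s(1) a]
        Smul_cls[OF s(2) a] Add_cls[OF roof_Smul[OF s(1) a] roof_Smul[OF s(2) a]] Sr[of f g a]
        roofD[OF s(1)] roofD[OF s(2)] a by simp
  qed
qed

lemma lin_category_Q: "lin_category \<kappa> k Q"
proof (intro lin_category.intro lin_category_axioms.intro category_Q)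
  show "cring k" by (rule ground_ring)
  show "small \<kappa> (Hom Q X Y)" if "X \<in> Ob Q" "Y \<in> Ob Q" for X Y using Hom_small_Q that by simp
  show "module k (Hom_module Q X Y)" if "X \<in> Ob Q" "Y \<in> Ob Q" for X Y using Hom_module_Q that by simp
next
  fix \<phi> X Y \<phi>' \<psi> Z assume h: "\<phi> \<in> Hom Q X Y" "\<phi>' \<in> Hom Q X Y" "\<psi> \<in> Hom Q Y Z"
  obtain s f f' where s: "roof s f" "roof s f'" "\<phi> = cls s f" "\<phi>' = cls s f'" "Cod T s = X" "Cod T f = Y" "Cod T f' = Y"
    using Hom_Q_E2[OF h(1,2)] .
  obtain t g where t: "roof t g" "\<psi> = cls t g" "Cod T t = Y" "Cod T g = Z" using h(3) by (auto simp: Hom_Q_iff)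
  note R = roofD[OF s(1)] roofD[OF s(2)] roofD[OF t(1)] s(5-7) t(3,4)
  obtain u v where u: "u \<in> W" "v \<in> Arr T" "Dom T v = Dom T u" "Cod T u = Dom T s" "Cod T v = Dom T t"
    "t \<cdot> v = f \<cdot> u" by (rule ore[of t f]) (use R in auto)
  \<comment> \<open>One denominator must serve both numerators, so the Ore condition is applied to
    \<open>f\<close> and then to \<open>f' \<cdot> u\<close>.\<close>
  obtain u' v' where u': "u' \<in> W" "v' \<in> Arr T" "Dom T v' = Dom T u'" "Cod T u' = Dom T u" "Cod T v' = Dom T t"
    "t \<cdot> v' = (f' \<cdot> u) \<cdot> u'" by (rule ore[of t "f' \<cdot> u"]) (use R u in auto)
  define w x where "w = u \<cdot> u'" and "x = v \<cdot> u'"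
  have w: "w \<in> W" "Dom T w = Dom T u'" "Cod T w = Dom T s" "x \<in> Arr T" "Dom T x = Dom T u'" "Cod T x = Dom T t"
    using u u' by (auto simp: w_def x_def W_Comp)
  have e: "f \<cdot> w = t \<cdot> x" "f' \<cdot> w = t \<cdot> v'"
    using u'(6) Comp_lift[OF u(6), of u'] R u(1-5) u'(1-5) by (simp_all add: w_def x_def)
  have r: "roof (s \<cdot> w) (g \<cdot> x)" "roof (s \<cdot> w) (g \<cdot> v')" "roof s (Add T f f')"
    using R w u'(1-5) by (auto simp: roof_def W_Comp)
  have 1: "\<psi> \<cdot>\<^bsub>Q\<^esub> \<phi> = cls (s \<cdot> w) (g \<cdot> x)" unfolding s t
    by (rule Comp_cls[OF s(1) t(1)]) (use R w u' e in auto)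
  have 2: "\<psi> \<cdot>\<^bsub>Q\<^esub> \<phi>' = cls (s \<cdot> w) (g \<cdot> v')" unfolding s t
    by (rule Comp_cls[OF s(2) t(1)]) (use R w u' e in auto)
  have 3: "\<psi> \<cdot>\<^bsub>Q\<^esub> cls s (Add T f f') = cls (s \<cdot> w) (g \<cdot> Add T x v')" unfolding t
    by (rule Comp_cls[OF r(3) t(1)]) (use R w u' e in auto)
  show "\<psi> \<cdot>\<^bsub>Q\<^esub> Add Q \<phi> \<phi>' = Add Q (\<psi> \<cdot>\<^bsub>Q\<^esub> \<phi>) (\<psi> \<cdot>\<^bsub>Q\<^esub> \<phi>')"
    unfolding 1 2 unfolding s(3,4) using Add_cls[OF s(1,2)] Add_cls[OF r(1,2)] 3 R w u'(1-5) by simp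
next
  fix \<phi> X Y \<psi> Z \<psi>' assume h: "\<phi> \<in> Hom Q X Y" "\<psi> \<in> Hom Q Y Z" "\<psi>' \<in> Hom Q Y Z"
  obtain t g g' where t: "roof t g" "roof t g'" "\<psi> = cls t g" "\<psi>' = cls t g'" "Cod T t = Y" "Cod T g = Z" "Cod T g' = Z"
    using Hom_Q_E2[OF h(2,3)] .
  obtain s f where s: "roof s f" "\<phi> = cls s f" "Cod T s = X" "Cod T f = Y" using h(1) by (auto simp: Hom_Q_iff)
  note R = roofD[OF s(1)] roofD[OF t(1)] roofD[OF t(2)] t(5-7) s(3,4)
  obtain u v where u: "u \<in> W" "v \<in> Arr T" "Dom T v = Dom T u" "Cod T u = Dom T s" "Cod T v = Dom T t"
    "t \<cdot> v = f \<cdot> u" by (rule ore[of t f]) (use R in auto)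
  have r: "roof (s \<cdot> u) (g \<cdot> v)" "roof (s \<cdot> u) (g' \<cdot> v)" "roof t (Add T g g')"
    using R u(1-5) by (auto simp: roof_def W_Comp)
  have 1: "\<psi> \<cdot>\<^bsub>Q\<^esub> \<phi> = cls (s \<cdot> u) (g \<cdot> v)" unfolding s t
    by (rule Comp_cls[OF s(1) t(1)]) (use R u in auto)
  have 2: "\<psi>' \<cdot>\<^bsub>Q\<^esub> \<phi> = cls (s \<cdot> u) (g' \<cdot> v)" unfolding s t
    by (rule Comp_cls[OF s(1) t(2)]) (use R u in auto)
  have 3: "cls t (Add T g g') \<cdot>\<^bsub>Q\<^esub> \<phi> = cls (s \<cdot> u) (Add T g g' \<cdot> v)" unfolding s
    by (rule Comp_cls[OF s(1) r(3)]) (use R u in auto)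
  show "Add Q \<psi> \<psi>' \<cdot>\<^bsub>Q\<^esub> \<phi> = Add Q (\<psi> \<cdot>\<^bsub>Q\<^esub> \<phi>) (\<psi>' \<cdot>\<^bsub>Q\<^esub> \<phi>)"
    unfolding 1 2 unfolding t(3,4) using Add_cls[OF t(1,2)] Add_cls[OF r(1,2)] 3 R u(1-5) by simp
next
  fix a \<phi> X Y \<psi> Z assume h: "a \<in> carrier k" "\<phi> \<in> Hom Q X Y" "\<psi> \<in> Hom Q Y Z"
  obtain t g where t: "roof t g" "\<psi> = cls t g" "Cod T t = Y" "Cod T g = Z" using h(3) by (auto simp: Hom_Q_iff)
  obtain s f where s: "roof s f" "\<phi> = cls s f" "Cod T s = X" "Cod T f = Y" using h(2) by (auto simp: Hom_Q_iff)
  note R = roofD[OF s(1)] roofD[OF t(1)] t(3,4) s(3,4) h(1)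
  obtain u v where u: "u \<in> W" "v \<in> Arr T" "Dom T v = Dom T u" "Cod T u = Dom T s" "Cod T v = Dom T t"
    "t \<cdot> v = f \<cdot> u" by (rule ore[of t f]) (use R in auto)
  have r: "roof (s \<cdot> u) (g \<cdot> v)" "roof s (Smul T a f)" "roof t (Smul T a g)"
    using R u(1-5) by (auto simp: roof_def W_Comp)
  have 1: "\<psi> \<cdot>\<^bsub>Q\<^esub> \<phi> = cls (s \<cdot> u) (g \<cdot> v)" unfolding s t
    by (rule Comp_cls[OF s(1) t(1)]) (use R u in auto)
  have 2: "\<psi> \<cdot>\<^bsub>Q\<^esub> cls s (Smul T a f) = cls (s \<cdot> u) (g \<cdot> Smul T a v)" unfolding t
    by (rule Comp_cls[OF r(2) t(1)]) (use R u in auto)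
  have 3: "cls t (Smul T a g) \<cdot>\<^bsub>Q\<^esub> \<phi> = cls (s \<cdot> u) (Smul T a g \<cdot> v)" unfolding s
    by (rule Comp_cls[OF s(1) r(3)]) (use R u in auto)
  show "\<psi> \<cdot>\<^bsub>Q\<^esub> Smul Q a \<phi> = Smul Q a (\<psi> \<cdot>\<^bsub>Q\<^esub> \<phi>)"
    unfolding 1 unfolding s(2) using Smul_cls[OF s(1) h(1)] Smul_cls[OF r(1) h(1)] 2 R u(1-5) by simp
  show "Smul Q a \<psi> \<cdot>\<^bsub>Q\<^esub> \<phi> = Smul Q a (\<psi> \<cdot>\<^bsub>Q\<^esub> \<phi>)"
    unfolding 1 unfolding t(2) using Smul_cls[OF t(1) h(1)] Smul_cls[OF r(1) h(1)] 3 R u(1-5) by simp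
qed

sublocale Q: lin_category \<kappa> k Q by (rule lin_category_Q)

lemma lin_functor_q: "lin_functor k T Q (quotient_functor T N)"
  unfolding lin_functor_def by (simp add: quotient_functor_def in_Hom Q.in_Hom q_Add q_Smul)

sublocale q: lin_functor_pair \<kappa> k T Q "quotient_functor T N"
  rewrites "Obf (quotient_functor T N) = (\<lambda>X. X)" and "Arf (quotient_functor T N) = q"
  by (unfold_locales, rule lin_functor_q) (simp_all add: quotient_functor_def)

lemma q_zero_object: "zero_object T Z \<Longrightarrow> zero_object Q Z"
  using q.F_zero_object .

lemma additive_category_Q: "additive_category \<kappa> k Q"
proof (intro additive_category.intro additive_category_axioms.intro lin_category_Q)
  show "\<exists>Z. zero_object Q Z" using ex_zero_object q_zero_object by blast
  show "\<exists>B\<in>Ob Q. biproduct Q X Y B" if "X \<in> Ob Q" "Y \<in> Ob Q" for X Y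
    using ex_biproduct[of X Y] that q.F_biproduct by auto
qed

sublocale Q: additive_category \<kappa> k Q by (rule additive_category_Q)

section \<open>The shift on the quotient\<close>

lemma ShA_W: "s \<in> W \<Longrightarrow> ShA T s \<in> W"
  unfolding cone_in_def using tri_shift tri_Arr N_shift N_Ob
  by clarsimp (metis ShA_Arr(3))

lemma W_ShA:
  assumes "s \<in> Arr T" "ShA T s \<in> W" shows "s \<in> W"
proof -
  obtain g h where t: "(s, g, h) \<in> Tri T" using TR1_cone assms by blast
  have "Cod T (ShA T g) \<in> N" using W_cone[OF assms(2) tri_shift[OF t]] .
  then show ?thesis using W_I[OF t] tri_Arr[OF t] N_shift by simp
qed

lemma roof_ShA: "roof s f \<Longrightarrow> roof (ShA T s) (ShA T f)"
  by (simp add: roof_def ShA_W)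

lemma ShA_cls:
  assumes "roof s f"
  shows "ShA Q (cls s f) = cls (ShA T s) (ShA T f)"
proof -
  let ?A = "{roof_class T N (ShA T s') (ShA T f') | s' f'. (s', f') \<in> cls s f}"
  have "\<Union> ?A = cls (ShA T s) (ShA T f)"
  proof (rule Union_single)
    fix x assume "x \<in> ?A"
    then obtain s' f' where x: "x = cls (ShA T s') (ShA T f')" "(s', f') \<in> cls s f" by auto
    have e: "roof_eq s f s' f'" and r': "roof s' f'" using cls_memD[OF assms x(2)] by auto
    note R = roofD[OF assms] roofD[OF r']
    from e obtain u v where u: "u \<in> Arr T" "v \<in> Arr T" "Dom T v = Dom T u" "Cod T u = Dom T s"
      "Cod T v = Dom T s'" "s \<cdot> u = s' \<cdot> v" "s \<cdot> u \<in> W" "f \<cdot> u = f' \<cdot> v" by (rule roof_eqE)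
    have "ShA T (s \<cdot> u) = ShA T (s' \<cdot> v)" "ShA T (f \<cdot> u) = ShA T (f' \<cdot> v)" using u by simp_all
    then have "cls (ShA T s) (ShA T f) = cls (ShA T s') (ShA T f')"
      using R e ShA_W[OF u(7)] u(1-5)
      by (intro cls_eqI[OF roof_ShA[OF assms] roof_ShA[OF r'], of "ShA T u" "ShA T v"])
         (auto simp: roof_eq_def)
    then show "x = cls (ShA T s) (ShA T f)" using x(1) by simp
  qed (use cls_self[OF assms] in auto)
  then show ?thesis unfolding ShA_Q .
qed

lemma ShA_q: "f \<in> Arr T \<Longrightarrow> ShA Q (q f) = q (ShA T f)"
  using ShA_cls[OF roof_Id[of f]] by (simp add: q_def)

lemma shift_functor_Q: "lin_functor k Q Q (shift Q)"
  unfolding lin_functor_def shift_sel Ob_Q ShO_Q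
proof (intro conjI ballI impI)
  show "ShO T X \<in> Ob T" if "X \<in> Ob T" for X using that by simp
  show "ShA Q \<phi> \<in> Hom Q (ShO T X) (ShO T Y)" if "X \<in> Ob T" "Y \<in> Ob T" "\<phi> \<in> Hom Q X Y" for X Y \<phi>
  proof -
    obtain s f where s: "roof s f" "\<phi> = cls s f" "Cod T s = X" "Cod T f = Y" using \<open>\<phi> \<in> Hom Q X Y\<close> by (auto simp: Hom_Q_iff)
    then show ?thesis using ShA_cls[OF s(1)] roof_ShA[OF s(1)] roofD[OF s(1)] by (simp add: Q.in_Hom)
  qed
  show "ShA Q (Id Q X) = Id Q (ShO T X)" if "X \<in> Ob T" for X
    using ShA_q[of "Id T X"] that by simp
next
  fix \<phi> \<psi> assume h: "\<phi> \<in> Arr Q" "\<psi> \<in> Arr Q" "Dom Q \<psi> = Cod Q \<phi>"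
  obtain s f where s: "roof s f" "\<phi> = cls s f" using Arr_Q_E h(1) by blast
  obtain t g where t: "roof t g" "\<psi> = cls t g" using Arr_Q_E h(2) by blast
  note R = roofD[OF s(1)] roofD[OF t(1)]
  have c: "Cod T f = Cod T t" using h s t by simp
  obtain u v where u: "u \<in> W" "v \<in> Arr T" "Dom T v = Dom T u" "Cod T u = Dom T s" "Cod T v = Dom T t"
    "t \<cdot> v = f \<cdot> u" by (rule ore[of t f]) (use R c in auto)
  have r: "roof (s \<cdot> u) (g \<cdot> v)" using R u(1-5) by (auto simp: roof_def W_Comp)
  have e: "ShA T t \<cdot> ShA T v = ShA T f \<cdot> ShA T u"
    using arg_cong[OF u(6), of "ShA T"] R u(1-5) c by simp
  have 1: "\<psi> \<cdot>\<^bsub>Q\<^esub> \<phi> = cls (s \<cdot> u) (g \<cdot> v)" unfolding s t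
    by (rule Comp_cls[OF s(1) t(1)]) (use R u c in auto)
  have 2: "cls (ShA T t) (ShA T g) \<cdot>\<^bsub>Q\<^esub> cls (ShA T s) (ShA T f) = cls (ShA T s \<cdot> ShA T u) (ShA T g \<cdot> ShA T v)"
    by (rule Comp_cls[OF roof_ShA[OF s(1)] roof_ShA[OF t(1)]]) (use R u(1-5) c e ShA_W in auto)
  show "ShA Q (\<psi> \<cdot>\<^bsub>Q\<^esub> \<phi>) = ShA Q \<psi> \<cdot>\<^bsub>Q\<^esub> ShA Q \<phi>"
    unfolding 1 unfolding s t ShA_cls[OF s(1)] ShA_cls[OF t(1)] ShA_cls[OF r] 2 using R u(1-5) by simp
next
  fix \<phi> \<psi> assume h: "\<phi> \<in> Arr Q" "\<psi> \<in> Arr Q" "Dom Q \<phi> = Dom Q \<psi> \<and> Cod Q \<phi> = Cod Q \<psi>"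
  obtain s f g where s: "roof s f" "roof s g" "\<phi> = cls s f" "\<psi> = cls s g"
    by (rule common_fraction[of \<phi> \<psi>]) (use h in auto)
  have c: "Cod T g = Cod T f" using h s by simp
  note R = roofD[OF s(1)] roofD[OF s(2)]
  show "ShA Q (Add Q \<phi> \<psi>) = Add Q (ShA Q \<phi>) (ShA Q \<psi>)"
    unfolding s Add_cls[OF s(1,2) c] ShA_cls[OF s(1)] ShA_cls[OF s(2)] ShA_cls[OF roof_Add[OF s(1,2) c]]
    using Add_cls[OF roof_ShA[OF s(1)] roof_ShA[OF s(2)]] R c by simp
next
  fix a \<phi> assume h: "a \<in> carrier k" "\<phi> \<in> Arr Q"
  obtain s f where s: "roof s f" "\<phi> = cls s f" using Arr_Q_E h(2) by blast
  show "ShA Q (Smul Q a \<phi>) = Smul Q a (ShA Q \<phi>)"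
    unfolding s Smul_cls[OF s(1) h(1)] ShA_cls[OF s(1)] ShA_cls[OF roof_Smul[OF s(1) h(1)]]
    using Smul_cls[OF roof_ShA[OF s(1)] h(1)] roofD[OF s(1)] h by simp
qed

lemma shift_fully_faithful_Q: "fully_faithful Q Q (shift Q)"
  unfolding fully_faithful_def shift_sel Ob_Q ShO_Q
proof (intro ballI bij_betwI')
  fix X Y \<phi> \<psi> assume o: "X \<in> Ob T" "Y \<in> Ob T" and h: "\<phi> \<in> Hom Q X Y" "\<psi> \<in> Hom Q X Y"
  obtain s f g where s: "roof s f" "roof s g" "\<phi> = cls s f" "\<psi> = cls s g" "Cod T s = X" "Cod T f = Y" "Cod T g = Y"
    using Hom_Q_E2[OF h] .
  note R = roofD[OF s(1)] roofD[OF s(2)] s(5-7)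
  show "ShA Q \<phi> = ShA Q \<psi> \<longleftrightarrow> \<phi> = \<psi>"
  proof
    assume "ShA Q \<phi> = ShA Q \<psi>"
    then have "cls (ShA T s) (ShA T f) = cls (ShA T s) (ShA T g)"
      using s(3,4) ShA_cls[OF s(1)] ShA_cls[OF s(2)] by simp
    then have "q (ShA T f) = q (ShA T g)"
      using cls_q_mult[OF roof_ShA[OF s(1)]] cls_q_mult[OF roof_ShA[OF s(2)]] by simp
    then obtain r where r: "r \<in> W" "Cod T r = ShO T (Dom T s)" "ShA T f \<cdot> r = ShA T g \<cdot> r"
      using q_eq_iff[of "ShA T f" "ShA T g"] R by auto
    \<comment> \<open>The source of \<open>r\<close> need not be a shift. Precomposing with the
      isomorphism \<open>w\<close> makes it one, so that \<open>r\<close> desuspends to a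
      denominator \<open>p\<close>.\<close>
    obtain V w where w: "V \<in> Ob T" "is_iso T w" "w \<in> Arr T" "Dom T w = ShO T V" "Cod T w = Dom T r"
      by (rule ShO_ess[of "Dom T r"]) (use r in auto)
    obtain p where p: "p \<in> Arr T" "Dom T p = V" "Cod T p = Dom T s" "ShA T p = r \<cdot> w"
      by (rule ShA_full[of "r \<cdot> w" V "Dom T s"]) (use r w R in auto)
    have "ShA T p \<in> W" unfolding p(4) using W_Comp[OF W_iso[OF w(2)] r(1)] w by simp
    then have pW: "p \<in> W" using W_ShA p(1) by blast
    have "ShA T f \<cdot> ShA T p = ShA T g \<cdot> ShA T p"
      unfolding p(4) using Comp_lift[OF r(3), of w] R r(1,2) w by simp
    then have "ShA T (f \<cdot> p) = ShA T (g \<cdot> p)" using R p(1-3) by simp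
    then have "f \<cdot> p = g \<cdot> p" using R p(1-3) by (intro ShA_inj[of "f \<cdot> p" "g \<cdot> p"]) auto
    then have "q f = q g" using q_eq_iff[of f g] R pW p(3) by auto
    then show "\<phi> = \<psi>" unfolding s(3,4) using cls_fraction[OF s(1)] cls_fraction[OF s(2)] by simp
  qed simp
next
  fix X Y \<phi> assume o: "X \<in> Ob T" "Y \<in> Ob T" and h: "\<phi> \<in> Hom Q X Y"
  then show "ShA Q \<phi> \<in> Hom Q (ShO T X) (ShO T Y)"
    using shift_functor_Q by (simp add: lin_functor_def)
next
  fix X Y \<psi> assume o: "X \<in> Ob T" "Y \<in> Ob T" and h: "\<psi> \<in> Hom Q (ShO T X) (ShO T Y)"
  then obtain s f where s: "roof s f" "\<psi> = cls s f" "Cod T s = ShO T X" "Cod T f = ShO T Y"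
    by (auto simp: Hom_Q_iff)
  note R = roofD[OF s(1)] s(3,4)
  obtain V w where w: "V \<in> Ob T" "is_iso T w" "w \<in> Arr T" "Dom T w = ShO T V" "Cod T w = Dom T s"
    by (rule ShO_ess[of "Dom T s"]) (use R in auto)
  obtain s' where s': "s' \<in> Arr T" "Dom T s' = V" "Cod T s' = X" "ShA T s' = s \<cdot> w"
    by (rule ShA_full[of "s \<cdot> w" V X]) (use R w o in auto)
  obtain f' where f': "f' \<in> Arr T" "Dom T f' = V" "Cod T f' = Y" "ShA T f' = f \<cdot> w"
    by (rule ShA_full[of "f \<cdot> w" V Y]) (use R w o in auto)
  have sw: "s \<cdot> w \<in> W" using W_Comp[OF W_iso[OF w(2)] R(1)] w by simp
  then have "s' \<in> W" using W_ShA[OF s'(1)] s'(4) by simp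
  then have r: "roof s' f'" using s' f' by (simp add: roof_def)
  have "\<psi> = ShA Q (cls s' f')"
    unfolding ShA_cls[OF r] s'(4) f'(4) s(2) using cls_refine[OF s(1) w(3,5) sw] by simp
  moreover have "cls s' f' \<in> Hom Q X Y" using r s' f' by (simp add: Q.in_Hom)
  ultimately show "\<exists>\<phi>\<in>Hom Q X Y. \<psi> = ShA Q \<phi>" by blast
qed

lemma shift_category_Q: "shift_category \<kappa> k Q"
proof (intro shift_category.intro shift_category_axioms.intro additive_category_Q)
  show "lin_functor k Q Q (shift Q)" by (rule shift_functor_Q)
  show "fully_faithful Q Q (shift Q)" by (rule shift_fully_faithful_Q)
  show "essentially_surjective Q Q (shift Q)"
    unfolding essentially_surjective_def shift_sel Ob_Q ShO_Q
    by (metis ShO_ess q.F_isomorphic isomorphicI)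
qed

sublocale Q: shift_category \<kappa> k Q by (rule shift_category_Q)

section \<open>The Verdier quotient is triangulated\<close>

lemma Dom_Cod_Q_Ob [simp]: "\<phi> \<in> Arr Q \<Longrightarrow> Dom Q \<phi> \<in> Ob T" "\<phi> \<in> Arr Q \<Longrightarrow> Cod Q \<phi> \<in> Ob T"
  using Q.Dom_in[of \<phi>] Q.Cod_in[of \<phi>] by simp_all

lemma Tri_Q: "Tri Q = {t. \<exists>(f, g, h) \<in> Tri T. triangle_iso (verdier_precat T N) (q f, q g, q h) t}"
  by (simp add: verdier_quotient_def)

lemma precat_sel: "Ob (verdier_precat T N) = Ob Q" "Arr (verdier_precat T N) = Arr Q"
  "Dom (verdier_precat T N) = Dom Q" "Cod (verdier_precat T N) = Cod Q" "Id (verdier_precat T N) = Id Q"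
  "Comp (verdier_precat T N) = Comp Q" "ShO (verdier_precat T N) = ShO Q" "ShA (verdier_precat T N) = ShA Q"
  by (simp_all add: verdier_quotient_def)

text \<open>Triangles of the quotient are defined through isomorphism in the preliminary structure,
  which has the same arrows but no triangles yet; the notion of isomorphism does not see the
  difference.\<close>

lemma precat_triangle_iso: "triangle_iso (verdier_precat T N) = triangle_iso Q"
  unfolding triangle_iso_def candidate_triangle_def is_iso_def inverse_arrows_def Hom_def precat_sel ..

lemma Tri_QI:
  assumes "(f, g, h) \<in> Tri T" "\<phi> \<in> Arr Q" "\<psi> \<in> Arr Q" "\<chi> \<in> Arr Q"
    "Dom Q \<psi> = Cod Q \<phi>" "Dom Q \<chi> = Cod Q \<psi>" "Cod Q \<chi> = ShO T (Dom Q \<phi>)"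
    and "is_iso Q a" "is_iso Q b" "is_iso Q c"
    and "Dom Q a = Dom T f" "Cod Q a = Dom Q \<phi>" "Dom Q b = Cod T f" "Cod Q b = Cod Q \<phi>"
      "Dom Q c = Cod T g" "Cod Q c = Cod Q \<psi>"
    and "\<phi> \<cdot>\<^bsub>Q\<^esub> a = b \<cdot>\<^bsub>Q\<^esub> q f" "\<psi> \<cdot>\<^bsub>Q\<^esub> b = c \<cdot>\<^bsub>Q\<^esub> q g" "\<chi> \<cdot>\<^bsub>Q\<^esub> c = ShA Q a \<cdot>\<^bsub>Q\<^esub> q h"
  shows "(\<phi>, \<psi>, \<chi>) \<in> Tri Q"
proof -
  have "triangle_iso Q (q f, q g, q h) (\<phi>, \<psi>, \<chi>)"
    unfolding triangle_iso_def prod.case candidate_triangle_def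
    using assms tri_Arr[OF assms(1)] Q.iso_Arr[of a] Q.iso_Arr[of b] Q.iso_Arr[of c]
    by (intro conjI bexI[of _ a] bexI[of _ b] bexI[of _ c]) (simp_all add: Q.in_Hom)
  then show ?thesis unfolding Tri_Q precat_triangle_iso using assms(1) by blast
qed

lemma Tri_QE:
  assumes "(\<phi>, \<psi>, \<chi>) \<in> Tri Q"
  obtains f g h a b c where "(f, g, h) \<in> Tri T" "\<phi> \<in> Arr Q" "\<psi> \<in> Arr Q" "\<chi> \<in> Arr Q"
    "Dom Q \<psi> = Cod Q \<phi>" "Dom Q \<chi> = Cod Q \<psi>" "Cod Q \<chi> = ShO T (Dom Q \<phi>)"
    "is_iso Q a" "is_iso Q b" "is_iso Q c" "a \<in> Arr Q" "b \<in> Arr Q" "c \<in> Arr Q"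
    "Dom Q a = Dom T f" "Cod Q a = Dom Q \<phi>" "Dom Q b = Cod T f" "Cod Q b = Cod Q \<phi>"
    "Dom Q c = Cod T g" "Cod Q c = Cod Q \<psi>"
    "\<phi> \<cdot>\<^bsub>Q\<^esub> a = b \<cdot>\<^bsub>Q\<^esub> q f" "\<psi> \<cdot>\<^bsub>Q\<^esub> b = c \<cdot>\<^bsub>Q\<^esub> q g" "\<chi> \<cdot>\<^bsub>Q\<^esub> c = ShA Q a \<cdot>\<^bsub>Q\<^esub> q h"
proof -
  obtain f g h where t: "(f, g, h) \<in> Tri T" and i: "triangle_iso Q (q f, q g, q h) (\<phi>, \<psi>, \<chi>)"
    using assms unfolding Tri_Q precat_triangle_iso by blast
  note T = tri_Arr[OF t]
  have c: "candidate_triangle Q (\<phi>, \<psi>, \<chi>)" using i unfolding triangle_iso_def prod.case by blast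
  obtain a b c where h: "a \<in> Hom Q (Dom Q (q f)) (Dom Q \<phi>)" "b \<in> Hom Q (Dom Q (q g)) (Dom Q \<psi>)"
      "c \<in> Hom Q (Dom Q (q h)) (Dom Q \<chi>)" "is_iso Q a" "is_iso Q b" "is_iso Q c"
      "\<phi> \<cdot>\<^bsub>Q\<^esub> a = b \<cdot>\<^bsub>Q\<^esub> q f" "\<psi> \<cdot>\<^bsub>Q\<^esub> b = c \<cdot>\<^bsub>Q\<^esub> q g" "\<chi> \<cdot>\<^bsub>Q\<^esub> c = ShA Q a \<cdot>\<^bsub>Q\<^esub> q h"
    using i unfolding triangle_iso_def prod.case by blast
  show ?thesis using h c T
    by (intro that[OF t, of a b c]) (simp_all add: candidate_triangle_def Q.in_Hom)
qed

lemma q_Tri: "(f, g, h) \<in> Tri T \<Longrightarrow> (q f, q g, q h) \<in> Tri Q"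
  using tri_Arr[of f g h]
  by (intro Tri_QI[of f g h _ _ _ "Id Q (Dom T f)" "Id Q (Cod T f)" "Id Q (Cod T g)"]) simp_all

lemma Tri_Q_Arr:
  assumes "(\<phi>, \<psi>, \<chi>) \<in> Tri Q"
  shows "\<phi> \<in> Arr Q" "\<psi> \<in> Arr Q" "\<chi> \<in> Arr Q" "Dom Q \<psi> = Cod Q \<phi>" "Dom Q \<chi> = Cod Q \<psi>" "Cod Q \<chi> = ShO T (Dom Q \<phi>)"
  by (rule Tri_QE[OF assms], assumption)+

text \<open>An arbitrary fill-in from TR3 is not known to be a denominator. The diagonal of the
  square factors in two ways, and the two octahedra yield \<open>u\<close>, with the cone of
  \<open>r\<close> as its cone, and \<open>v'\<close>, with the cone of \<open>s\<close> as its
  fibre; their composite is the required \<open>c\<close>.\<close>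

lemma W_tri_mor:
  assumes t: "(f, g, h) \<in> Tri T" and t': "(f', g', h') \<in> Tri T" and s: "s \<in> W" "r \<in> W"
    "Dom T s = Dom T f'" "Cod T s = Dom T f" "Dom T r = Cod T f'" "Cod T r = Cod T f" "f \<cdot> s = r \<cdot> f'"
  obtains c where "c \<in> W" "Dom T c = Cod T g'" "Cod T c = Cod T g" "g \<cdot> r = c \<cdot> g'" "h \<cdot> c = ShA T s \<cdot> h'"
proof -
  note A = tri_Arr[OF t] tri_Arr[OF t'] s(1-6) W_Arr[OF s(1)] W_Arr[OF s(2)]
  obtain c0 d0 where r: "(r, c0, d0) \<in> Tri T" using TR1_cone W_Arr s by blast
  obtain a1 b1 where s': "(s, a1, b1) \<in> Tri T" using TR1_cone W_Arr s by blast
  obtain e l where e: "(r \<cdot> f', e, l) \<in> Tri T" using TR1_cone[of "r \<cdot> f'"] A by auto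
  have e': "(f \<cdot> s, e, l) \<in> Tri T" using e s(7) by simp
  note A = A tri_Arr[OF r] tri_Arr[OF s'] tri_Arr[OF e]
  have m: "f' \<in> Hom T (Dom T f') (Cod T f')" "r \<in> Hom T (Cod T f') (Cod T r)"
    "s \<in> Hom T (Dom T s) (Cod T s)" "f \<in> Hom T (Cod T s) (Cod T f)" using A by (simp_all add: in_Hom)
  obtain u v where u: "u \<in> Hom T (Cod T g') (Cod T e)" "v \<in> Hom T (Cod T e) (Cod T c0)"
    "(u, v, ShA T g' \<cdot> d0) \<in> Tri T" "u \<cdot> g' = e \<cdot> r" "l \<cdot> u = h'"
    using TR4[OF m(1,2) t' r e] by blast
  obtain u' v' where u': "u' \<in> Hom T (Cod T a1) (Cod T e)" "v' \<in> Hom T (Cod T e) (Cod T g)"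
    "(u', v', ShA T a1 \<cdot> h) \<in> Tri T" "v' \<cdot> e = g" "h \<cdot> v' = ShA T s \<cdot> l"
    using TR4[OF m(3,4) s' t e'] by blast
  have U: "u \<in> Arr T" "Dom T u = Cod T g'" "Cod T u = Cod T e" "v' \<in> Arr T" "Dom T v' = Cod T e" "Cod T v' = Cod T g"
    using u u' by (auto simp: in_Hom)
  have "u \<in> W" using W_I[OF u(3)] W_cone[OF s(2) r] u(2) by (simp add: in_Hom)
  moreover have "v' \<in> W" using W_I'[OF u'(3)] W_cone[OF s(1) s'] u'(1) by (simp add: in_Hom)
  ultimately have W: "v' \<cdot> u \<in> W" using U by (simp add: W_Comp)
  have "(v' \<cdot> u) \<cdot> g' = v' \<cdot> (u \<cdot> g')" using A U by simp
  also have "\<dots> = (v' \<cdot> e) \<cdot> r" unfolding u(4) using A U by simp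
  finally have 1: "g \<cdot> r = (v' \<cdot> u) \<cdot> g'" unfolding u'(4) by simp
  have "h \<cdot> (v' \<cdot> u) = (h \<cdot> v') \<cdot> u" using A U by simp
  also have "\<dots> = ShA T s \<cdot> (l \<cdot> u)" unfolding u'(5) using A U by simp
  finally have 2: "h \<cdot> (v' \<cdot> u) = ShA T s \<cdot> h'" unfolding u(5) .
  show ?thesis using that[OF W _ _ 1 2] U by simp
qed

text \<open>The fill-in is a roof of triangles: after clearing denominators, one triangle on
  \<open>f2\<close> maps to \<open>(f, g, h)\<close> by denominators, thanks to
  \<open>W_tri_mor\<close>, and to \<open>(f', g', h')\<close> by TR3.\<close>

lemma TR3_q:
  assumes t: "(f, g, h) \<in> Tri T" and t': "(f', g', h') \<in> Tri T"
    and a: "\<alpha> \<in> Arr Q" "\<beta> \<in> Arr Q" "Dom Q \<alpha> = Dom T f" "Cod Q \<alpha> = Dom T f'" "Dom Q \<beta> = Cod T f" "Cod Q \<beta> = Cod T f'"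
    and e: "q f' \<cdot>\<^bsub>Q\<^esub> \<alpha> = \<beta> \<cdot>\<^bsub>Q\<^esub> q f"
  obtains \<gamma> where "\<gamma> \<in> Arr Q" "Dom Q \<gamma> = Cod T g" "Cod Q \<gamma> = Cod T g'"
    "q g' \<cdot>\<^bsub>Q\<^esub> \<beta> = \<gamma> \<cdot>\<^bsub>Q\<^esub> q g" "q h' \<cdot>\<^bsub>Q\<^esub> \<gamma> = ShA Q \<alpha> \<cdot>\<^bsub>Q\<^esub> q h"
proof -
  note A = tri_Arr[OF t] tri_Arr[OF t'] a
  obtain s a1 where s: "s \<in> W" "a1 \<in> Arr T" "Dom T a1 = Dom T s" "Cod T s = Dom T f" "Cod T a1 = Dom T f'"
    and s1: "\<alpha> \<cdot>\<^bsub>Q\<^esub> q s = q a1" by (rule fraction[OF a(1)]) (use A in auto)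
  obtain r b1 where r: "r \<in> W" "b1 \<in> Arr T" "Dom T b1 = Dom T r" "Cod T r = Cod T f" "Cod T b1 = Cod T f'"
    and r1: "\<beta> \<cdot>\<^bsub>Q\<^esub> q r = q b1" by (rule fraction[OF a(2)]) (use A in auto)
  obtain s' f1 where s': "s' \<in> W" "f1 \<in> Arr T" "Dom T f1 = Dom T s'" "Cod T s' = Dom T s" "Cod T f1 = Dom T r"
    "r \<cdot> f1 = (f \<cdot> s) \<cdot> s'" by (rule ore[of r "f \<cdot> s"]) (use A s r in auto)
  note A = A s r s'(1-5)
  have "q (f' \<cdot> (a1 \<cdot> s')) = q f' \<cdot>\<^bsub>Q\<^esub> (q a1 \<cdot>\<^bsub>Q\<^esub> q s')" using A by simp
  also have "\<dots> = (q f' \<cdot>\<^bsub>Q\<^esub> \<alpha>) \<cdot>\<^bsub>Q\<^esub> (q s \<cdot>\<^bsub>Q\<^esub> q s')" unfolding s1[symmetric] using A by simp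
  also have "\<dots> = \<beta> \<cdot>\<^bsub>Q\<^esub> q ((f \<cdot> s) \<cdot> s')" unfolding e using A by simp
  also have "\<dots> = (\<beta> \<cdot>\<^bsub>Q\<^esub> q r) \<cdot>\<^bsub>Q\<^esub> q f1" unfolding s'(6)[symmetric] using A by simp
  also have "\<dots> = q (b1 \<cdot> f1)" unfolding r1 using A by simp
  finally obtain p where p: "p \<in> W" "Cod T p = Dom T s'" "(f' \<cdot> (a1 \<cdot> s')) \<cdot> p = (b1 \<cdot> f1) \<cdot> p"
    using q_eq_iff[of "f' \<cdot> (a1 \<cdot> s')" "b1 \<cdot> f1"] A by auto
  \<comment> \<open>Everything is refined along \<open>p\<close>: over this apex the two squares
    commute in \<open>T\<close> itself and not merely in the quotient.\<close>
  define \<sigma> where "\<sigma> = s \<cdot> (s' \<cdot> p)"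
  define f2 where "f2 = f1 \<cdot> p"
  define a2 where "a2 = a1 \<cdot> (s' \<cdot> p)"
  have B: "\<sigma> \<in> W" "f2 \<in> Arr T" "a2 \<in> Arr T" "Dom T \<sigma> = Dom T p" "Dom T f2 = Dom T p" "Dom T a2 = Dom T p"
    "Cod T \<sigma> = Dom T f" "Cod T f2 = Dom T r" "Cod T a2 = Dom T f'"
    unfolding \<sigma>_def f2_def a2_def using A p(1,2) by (auto intro!: W_Comp)
  have e1: "f \<cdot> \<sigma> = r \<cdot> f2" using Comp_lift[OF s'(6), of p] A p(1,2) by (simp add: \<sigma>_def f2_def)
  have e2: "f' \<cdot> a2 = b1 \<cdot> f2" using p A by (simp add: a2_def f2_def)
  have e3: "\<alpha> \<cdot>\<^bsub>Q\<^esub> q \<sigma> = q a2" using Q.Comp_lift[OF s1, of "q (s' \<cdot> p)"] A p(1,2) by (simp add: \<sigma>_def a2_def)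
  obtain g2 h2 where t2: "(f2, g2, h2) \<in> Tri T" using TR1_cone B(2) by blast
  note A = A p(1,2) B tri_Arr[OF t2]
  obtain c where c: "c \<in> W" "Dom T c = Cod T g2" "Cod T c = Cod T g" "g \<cdot> r = c \<cdot> g2" "h \<cdot> c = ShA T \<sigma> \<cdot> h2"
    by (rule W_tri_mor[OF t t2 B(1) r(1)]) (use A e1 in auto)
  obtain c1 where c1: "c1 \<in> Arr T" "Dom T c1 = Cod T g2" "Cod T c1 = Cod T g'" "g' \<cdot> b1 = c1 \<cdot> g2" "h' \<cdot> c1 = ShA T a2 \<cdot> h2"
    by (rule tri_mor[OF t2 t' B(3) r(2)]) (use A e2 in auto)
  note A = A c(1-3) c1(1-3)
  \<comment> \<open>The roof formed by the third components of the two morphisms of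
    triangles.\<close>
  define \<gamma> where "\<gamma> = q c1 \<cdot>\<^bsub>Q\<^esub> inv_arrow Q (q c)"
  have G: "\<gamma> \<in> Arr Q" "Dom Q \<gamma> = Cod T g" "Cod Q \<gamma> = Cod T g'" using A by (simp_all add: \<gamma>_def)
  have gc: "\<gamma> \<cdot>\<^bsub>Q\<^esub> q c = q c1" using A by (simp add: \<gamma>_def)
  note A = A G
  have "q g' \<cdot>\<^bsub>Q\<^esub> \<beta> = \<gamma> \<cdot>\<^bsub>Q\<^esub> q g"
  proof (rule Q.iso_cancel_right[OF q_iso[OF r(1)]])
    have "(q g' \<cdot>\<^bsub>Q\<^esub> \<beta>) \<cdot>\<^bsub>Q\<^esub> q r = q g' \<cdot>\<^bsub>Q\<^esub> (\<beta> \<cdot>\<^bsub>Q\<^esub> q r)" using A by simp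
    also have "\<dots> = q (c1 \<cdot> g2)" unfolding r1 c1(4)[symmetric] using A by simp
    also have "\<dots> = (\<gamma> \<cdot>\<^bsub>Q\<^esub> q c) \<cdot>\<^bsub>Q\<^esub> q g2" unfolding gc using A by simp
    also have "\<dots> = \<gamma> \<cdot>\<^bsub>Q\<^esub> q (c \<cdot> g2)" using A by simp
    also have "\<dots> = (\<gamma> \<cdot>\<^bsub>Q\<^esub> q g) \<cdot>\<^bsub>Q\<^esub> q r" unfolding c(4)[symmetric] using A by simp
    finally show "(q g' \<cdot>\<^bsub>Q\<^esub> \<beta>) \<cdot>\<^bsub>Q\<^esub> q r = (\<gamma> \<cdot>\<^bsub>Q\<^esub> q g) \<cdot>\<^bsub>Q\<^esub> q r" .
  qed (use A in simp_all)
  moreover have "q h' \<cdot>\<^bsub>Q\<^esub> \<gamma> = ShA Q \<alpha> \<cdot>\<^bsub>Q\<^esub> q h"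
  proof (rule Q.iso_cancel_right[OF q_iso[OF c(1)]])
    have "(q h' \<cdot>\<^bsub>Q\<^esub> \<gamma>) \<cdot>\<^bsub>Q\<^esub> q c = q h' \<cdot>\<^bsub>Q\<^esub> (\<gamma> \<cdot>\<^bsub>Q\<^esub> q c)" using A by simp
    also have "\<dots> = q (ShA T a2 \<cdot> h2)" unfolding gc c1(5)[symmetric] using A by simp
    also have "\<dots> = ShA Q (q a2) \<cdot>\<^bsub>Q\<^esub> q h2" using A by (simp add: ShA_q)
    also have "\<dots> = ShA Q \<alpha> \<cdot>\<^bsub>Q\<^esub> (q (ShA T \<sigma>) \<cdot>\<^bsub>Q\<^esub> q h2)" unfolding e3[symmetric] using A by (simp add: ShA_q)
    also have "\<dots> = ShA Q \<alpha> \<cdot>\<^bsub>Q\<^esub> q (h \<cdot> c)" unfolding c(5) using A by simp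
    also have "\<dots> = (ShA Q \<alpha> \<cdot>\<^bsub>Q\<^esub> q h) \<cdot>\<^bsub>Q\<^esub> q c" using A by simp
    finally show "(q h' \<cdot>\<^bsub>Q\<^esub> \<gamma>) \<cdot>\<^bsub>Q\<^esub> q c = (ShA Q \<alpha> \<cdot>\<^bsub>Q\<^esub> q h) \<cdot>\<^bsub>Q\<^esub> q c" .
  qed (use A in simp_all)
  ultimately show ?thesis using that G by blast
qed

lemma TR3_Q:
  assumes t: "(\<phi>, \<psi>, \<chi>) \<in> Tri Q" and t': "(\<phi>', \<psi>', \<chi>') \<in> Tri Q"
    and "\<alpha> \<in> Hom Q (Dom Q \<phi>) (Dom Q \<phi>')" "\<beta> \<in> Hom Q (Dom Q \<psi>) (Dom Q \<psi>')" and e: "\<phi>' \<cdot>\<^bsub>Q\<^esub> \<alpha> = \<beta> \<cdot>\<^bsub>Q\<^esub> \<phi>"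
  shows "\<exists>\<gamma> \<in> Hom Q (Dom Q \<chi>) (Dom Q \<chi>'). \<psi>' \<cdot>\<^bsub>Q\<^esub> \<beta> = \<gamma> \<cdot>\<^bsub>Q\<^esub> \<psi> \<and> \<chi>' \<cdot>\<^bsub>Q\<^esub> \<gamma> = ShA Q \<alpha> \<cdot>\<^bsub>Q\<^esub> \<chi>"
proof -
  obtain f g h a b c where i: "(f, g, h) \<in> Tri T" "\<phi> \<in> Arr Q" "\<psi> \<in> Arr Q" "\<chi> \<in> Arr Q"
    "Dom Q \<psi> = Cod Q \<phi>" "Dom Q \<chi> = Cod Q \<psi>" "Cod Q \<chi> = ShO T (Dom Q \<phi>)"
    "is_iso Q a" "is_iso Q b" "is_iso Q c" "a \<in> Arr Q" "b \<in> Arr Q" "c \<in> Arr Q"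
    "Dom Q a = Dom T f" "Cod Q a = Dom Q \<phi>" "Dom Q b = Cod T f" "Cod Q b = Cod Q \<phi>"
    "Dom Q c = Cod T g" "Cod Q c = Cod Q \<psi>"
    and j: "\<phi> \<cdot>\<^bsub>Q\<^esub> a = b \<cdot>\<^bsub>Q\<^esub> q f" "\<psi> \<cdot>\<^bsub>Q\<^esub> b = c \<cdot>\<^bsub>Q\<^esub> q g" "\<chi> \<cdot>\<^bsub>Q\<^esub> c = ShA Q a \<cdot>\<^bsub>Q\<^esub> q h" by (rule Tri_QE[OF t])
  obtain f' g' h' a' b' c' where i': "(f', g', h') \<in> Tri T" "\<phi>' \<in> Arr Q" "\<psi>' \<in> Arr Q" "\<chi>' \<in> Arr Q"
    "Dom Q \<psi>' = Cod Q \<phi>'" "Dom Q \<chi>' = Cod Q \<psi>'" "Cod Q \<chi>' = ShO T (Dom Q \<phi>')"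
    "is_iso Q a'" "is_iso Q b'" "is_iso Q c'" "a' \<in> Arr Q" "b' \<in> Arr Q" "c' \<in> Arr Q"
    "Dom Q a' = Dom T f'" "Cod Q a' = Dom Q \<phi>'" "Dom Q b' = Cod T f'" "Cod Q b' = Cod Q \<phi>'"
    "Dom Q c' = Cod T g'" "Cod Q c' = Cod Q \<psi>'"
    and j': "\<phi>' \<cdot>\<^bsub>Q\<^esub> a' = b' \<cdot>\<^bsub>Q\<^esub> q f'" "\<psi>' \<cdot>\<^bsub>Q\<^esub> b' = c' \<cdot>\<^bsub>Q\<^esub> q g'" "\<chi>' \<cdot>\<^bsub>Q\<^esub> c' = ShA Q a' \<cdot>\<^bsub>Q\<^esub> q h'"
    by (rule Tri_QE[OF t'])
  have ab: "\<alpha> \<in> Arr Q" "Dom Q \<alpha> = Dom Q \<phi>" "Cod Q \<alpha> = Dom Q \<phi>'" "\<beta> \<in> Arr Q" "Dom Q \<beta> = Cod Q \<phi>" "Cod Q \<beta> = Cod Q \<phi>'"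
    using assms(3,4) i(5) i'(5) by (auto simp: Q.in_Hom)
  note A = i(2-) i'(2-) ab tri_Arr[OF i(1)] tri_Arr[OF i'(1)]
  define \<alpha>0 where "\<alpha>0 = inv_arrow Q a' \<cdot>\<^bsub>Q\<^esub> (\<alpha> \<cdot>\<^bsub>Q\<^esub> a)"
  define \<beta>0 where "\<beta>0 = inv_arrow Q b' \<cdot>\<^bsub>Q\<^esub> (\<beta> \<cdot>\<^bsub>Q\<^esub> b)"
  have B: "\<alpha>0 \<in> Arr Q" "Dom Q \<alpha>0 = Dom T f" "Cod Q \<alpha>0 = Dom T f'" "\<beta>0 \<in> Arr Q" "Dom Q \<beta>0 = Cod T f" "Cod Q \<beta>0 = Cod T f'"
    using A by (simp_all add: \<alpha>0_def \<beta>0_def)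
  have k: "a' \<cdot>\<^bsub>Q\<^esub> \<alpha>0 = \<alpha> \<cdot>\<^bsub>Q\<^esub> a" "b' \<cdot>\<^bsub>Q\<^esub> \<beta>0 = \<beta> \<cdot>\<^bsub>Q\<^esub> b" using A by (simp_all add: \<alpha>0_def \<beta>0_def)
  note A = A B
  have "q f' \<cdot>\<^bsub>Q\<^esub> \<alpha>0 = \<beta>0 \<cdot>\<^bsub>Q\<^esub> q f"
  proof (rule Q.iso_cancel_left[OF i'(9)])
    have "b' \<cdot>\<^bsub>Q\<^esub> (q f' \<cdot>\<^bsub>Q\<^esub> \<alpha>0) = (b' \<cdot>\<^bsub>Q\<^esub> q f') \<cdot>\<^bsub>Q\<^esub> \<alpha>0" using A by simp
    also have "\<dots> = \<phi>' \<cdot>\<^bsub>Q\<^esub> (a' \<cdot>\<^bsub>Q\<^esub> \<alpha>0)" unfolding j'(1)[symmetric] using A by simp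
    also have "\<dots> = (\<phi>' \<cdot>\<^bsub>Q\<^esub> \<alpha>) \<cdot>\<^bsub>Q\<^esub> a" unfolding k using A by simp
    also have "\<dots> = \<beta> \<cdot>\<^bsub>Q\<^esub> (\<phi> \<cdot>\<^bsub>Q\<^esub> a)" unfolding e using A by simp
    also have "\<dots> = (\<beta> \<cdot>\<^bsub>Q\<^esub> b) \<cdot>\<^bsub>Q\<^esub> q f" unfolding j using A by simp
    also have "\<dots> = b' \<cdot>\<^bsub>Q\<^esub> (\<beta>0 \<cdot>\<^bsub>Q\<^esub> q f)" unfolding k(2)[symmetric] using A by simp
    finally show "b' \<cdot>\<^bsub>Q\<^esub> (q f' \<cdot>\<^bsub>Q\<^esub> \<alpha>0) = b' \<cdot>\<^bsub>Q\<^esub> (\<beta>0 \<cdot>\<^bsub>Q\<^esub> q f)" .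
  qed (use A in simp_all)
  then obtain \<gamma>0 where g0: "\<gamma>0 \<in> Arr Q" "Dom Q \<gamma>0 = Cod T g" "Cod Q \<gamma>0 = Cod T g'"
    and g1: "q g' \<cdot>\<^bsub>Q\<^esub> \<beta>0 = \<gamma>0 \<cdot>\<^bsub>Q\<^esub> q g" "q h' \<cdot>\<^bsub>Q\<^esub> \<gamma>0 = ShA Q \<alpha>0 \<cdot>\<^bsub>Q\<^esub> q h"
    by (rule TR3_q[OF i(1) i'(1) B(1,4,2,3,5,6)])
  define \<gamma> where "\<gamma> = c' \<cdot>\<^bsub>Q\<^esub> (\<gamma>0 \<cdot>\<^bsub>Q\<^esub> inv_arrow Q c)"
  have G: "\<gamma> \<in> Arr Q" "Dom Q \<gamma> = Cod Q \<psi>" "Cod Q \<gamma> = Cod Q \<psi>'" using A g0 by (simp_all add: \<gamma>_def)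
  have gc: "\<gamma> \<cdot>\<^bsub>Q\<^esub> c = c' \<cdot>\<^bsub>Q\<^esub> \<gamma>0" using A g0 by (simp add: \<gamma>_def)
  note A = A G g0
  have "\<psi>' \<cdot>\<^bsub>Q\<^esub> \<beta> = \<gamma> \<cdot>\<^bsub>Q\<^esub> \<psi>"
  proof (rule Q.iso_cancel_right[OF i(9)])
    have "(\<psi>' \<cdot>\<^bsub>Q\<^esub> \<beta>) \<cdot>\<^bsub>Q\<^esub> b = \<psi>' \<cdot>\<^bsub>Q\<^esub> (b' \<cdot>\<^bsub>Q\<^esub> \<beta>0)" unfolding k using A by simp
    also have "\<dots> = (\<psi>' \<cdot>\<^bsub>Q\<^esub> b') \<cdot>\<^bsub>Q\<^esub> \<beta>0" using A by simp
    also have "\<dots> = c' \<cdot>\<^bsub>Q\<^esub> (\<gamma>0 \<cdot>\<^bsub>Q\<^esub> q g)" unfolding j' g1(1)[symmetric] using A by simp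
    also have "\<dots> = (\<gamma> \<cdot>\<^bsub>Q\<^esub> c) \<cdot>\<^bsub>Q\<^esub> q g" unfolding gc using A by simp
    also have "\<dots> = \<gamma> \<cdot>\<^bsub>Q\<^esub> (\<psi> \<cdot>\<^bsub>Q\<^esub> b)" unfolding j using A by simp
    also have "\<dots> = (\<gamma> \<cdot>\<^bsub>Q\<^esub> \<psi>) \<cdot>\<^bsub>Q\<^esub> b" using A by simp
    finally show "(\<psi>' \<cdot>\<^bsub>Q\<^esub> \<beta>) \<cdot>\<^bsub>Q\<^esub> b = (\<gamma> \<cdot>\<^bsub>Q\<^esub> \<psi>) \<cdot>\<^bsub>Q\<^esub> b" .
  qed (use A in simp_all)
  moreover have "\<chi>' \<cdot>\<^bsub>Q\<^esub> \<gamma> = ShA Q \<alpha> \<cdot>\<^bsub>Q\<^esub> \<chi>"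
  proof (rule Q.iso_cancel_right[OF i(10)])
    have "(\<chi>' \<cdot>\<^bsub>Q\<^esub> \<gamma>) \<cdot>\<^bsub>Q\<^esub> c = \<chi>' \<cdot>\<^bsub>Q\<^esub> (\<gamma> \<cdot>\<^bsub>Q\<^esub> c)" using A by simp
    also have "\<dots> = (\<chi>' \<cdot>\<^bsub>Q\<^esub> c') \<cdot>\<^bsub>Q\<^esub> \<gamma>0" unfolding gc using A by simp
    also have "\<dots> = ShA Q a' \<cdot>\<^bsub>Q\<^esub> (q h' \<cdot>\<^bsub>Q\<^esub> \<gamma>0)" unfolding j' using A by simp
    also have "\<dots> = ShA Q (a' \<cdot>\<^bsub>Q\<^esub> \<alpha>0) \<cdot>\<^bsub>Q\<^esub> q h" unfolding g1 using A by simp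
    also have "\<dots> = ShA Q \<alpha> \<cdot>\<^bsub>Q\<^esub> (ShA Q a \<cdot>\<^bsub>Q\<^esub> q h)" unfolding k using A by simp
    also have "\<dots> = (ShA Q \<alpha> \<cdot>\<^bsub>Q\<^esub> \<chi>) \<cdot>\<^bsub>Q\<^esub> c" unfolding j(3)[symmetric] using A by simp
    finally show "(\<chi>' \<cdot>\<^bsub>Q\<^esub> \<gamma>) \<cdot>\<^bsub>Q\<^esub> c = (ShA Q \<alpha> \<cdot>\<^bsub>Q\<^esub> \<chi>) \<cdot>\<^bsub>Q\<^esub> c" .
  qed (use A in simp_all)
  ultimately show ?thesis using A by (intro bexI[of _ \<gamma>]) (auto simp: Q.in_Hom)
qed

lemma Tri_Q_iso_closed:
  assumes "t \<in> Tri Q" "triangle_iso Q t t'" shows "t' \<in> Tri Q"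
proof -
  obtain \<phi> \<psi> \<chi> \<phi>' \<psi>' \<chi>' where tt: "t = (\<phi>, \<psi>, \<chi>)" "t' = (\<phi>', \<psi>', \<chi>')" by (metis prod_cases3)
  obtain f g h a b c where i: "(f, g, h) \<in> Tri T" "\<phi> \<in> Arr Q" "\<psi> \<in> Arr Q" "\<chi> \<in> Arr Q"
    "Dom Q \<psi> = Cod Q \<phi>" "Dom Q \<chi> = Cod Q \<psi>" "Cod Q \<chi> = ShO T (Dom Q \<phi>)"
    "is_iso Q a" "is_iso Q b" "is_iso Q c" "a \<in> Arr Q" "b \<in> Arr Q" "c \<in> Arr Q"
    "Dom Q a = Dom T f" "Cod Q a = Dom Q \<phi>" "Dom Q b = Cod T f" "Cod Q b = Cod Q \<phi>"
    "Dom Q c = Cod T g" "Cod Q c = Cod Q \<psi>"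
    and j: "\<phi> \<cdot>\<^bsub>Q\<^esub> a = b \<cdot>\<^bsub>Q\<^esub> q f" "\<psi> \<cdot>\<^bsub>Q\<^esub> b = c \<cdot>\<^bsub>Q\<^esub> q g" "\<chi> \<cdot>\<^bsub>Q\<^esub> c = ShA Q a \<cdot>\<^bsub>Q\<^esub> q h"
    by (rule Tri_QE[OF assms(1)[unfolded tt]])
  have cand: "candidate_triangle Q (\<phi>', \<psi>', \<chi>')"
    using assms(2) unfolding tt triangle_iso_def prod.case by blast
  obtain a' b' c' where "a' \<in> Hom Q (Dom Q \<phi>) (Dom Q \<phi>')" "b' \<in> Hom Q (Dom Q \<psi>) (Dom Q \<psi>')"
      "c' \<in> Hom Q (Dom Q \<chi>) (Dom Q \<chi>')" "is_iso Q a'" "is_iso Q b'" "is_iso Q c'"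
      and j': "\<phi>' \<cdot>\<^bsub>Q\<^esub> a' = b' \<cdot>\<^bsub>Q\<^esub> \<phi>" "\<psi>' \<cdot>\<^bsub>Q\<^esub> b' = c' \<cdot>\<^bsub>Q\<^esub> \<psi>" "\<chi>' \<cdot>\<^bsub>Q\<^esub> c' = ShA Q a' \<cdot>\<^bsub>Q\<^esub> \<chi>"
    using assms(2) unfolding tt triangle_iso_def prod.case by blast
  then have A: "a' \<in> Arr Q" "b' \<in> Arr Q" "c' \<in> Arr Q" "Dom Q a' = Dom Q \<phi>" "Cod Q a' = Dom Q \<phi>'"
    "Dom Q b' = Cod Q \<phi>" "Cod Q b' = Cod Q \<phi>'" "Dom Q c' = Cod Q \<psi>" "Cod Q c' = Cod Q \<psi>'"
    "is_iso Q a'" "is_iso Q b'" "is_iso Q c'" "\<phi>' \<in> Arr Q" "\<psi>' \<in> Arr Q" "\<chi>' \<in> Arr Q"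
    "Dom Q \<psi>' = Cod Q \<phi>'" "Dom Q \<chi>' = Cod Q \<psi>'" "Cod Q \<chi>' = ShO T (Dom Q \<phi>')"
    using cand i by (auto simp: Q.in_Hom candidate_triangle_def)
  note A = A i(2-) tri_Arr[OF i(1)]
  show ?thesis unfolding tt
  proof (rule Tri_QI[OF i(1), of _ _ _ "a' \<cdot>\<^bsub>Q\<^esub> a" "b' \<cdot>\<^bsub>Q\<^esub> b" "c' \<cdot>\<^bsub>Q\<^esub> c"])
    have "\<phi>' \<cdot>\<^bsub>Q\<^esub> (a' \<cdot>\<^bsub>Q\<^esub> a) = b' \<cdot>\<^bsub>Q\<^esub> (\<phi> \<cdot>\<^bsub>Q\<^esub> a)" using Q.Comp_lift[OF j'(1), of a] A by simp
    then show "\<phi>' \<cdot>\<^bsub>Q\<^esub> (a' \<cdot>\<^bsub>Q\<^esub> a) = (b' \<cdot>\<^bsub>Q\<^esub> b) \<cdot>\<^bsub>Q\<^esub> q f" unfolding j using A by simp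
    have "\<psi>' \<cdot>\<^bsub>Q\<^esub> (b' \<cdot>\<^bsub>Q\<^esub> b) = c' \<cdot>\<^bsub>Q\<^esub> (\<psi> \<cdot>\<^bsub>Q\<^esub> b)" using Q.Comp_lift[OF j'(2), of b] A by simp
    then show "\<psi>' \<cdot>\<^bsub>Q\<^esub> (b' \<cdot>\<^bsub>Q\<^esub> b) = (c' \<cdot>\<^bsub>Q\<^esub> c) \<cdot>\<^bsub>Q\<^esub> q g" unfolding j using A by simp
    have "\<chi>' \<cdot>\<^bsub>Q\<^esub> (c' \<cdot>\<^bsub>Q\<^esub> c) = ShA Q a' \<cdot>\<^bsub>Q\<^esub> (\<chi> \<cdot>\<^bsub>Q\<^esub> c)" using Q.Comp_lift[OF j'(3), of c] A by simp
    then show "\<chi>' \<cdot>\<^bsub>Q\<^esub> (c' \<cdot>\<^bsub>Q\<^esub> c) = ShA Q (a' \<cdot>\<^bsub>Q\<^esub> a) \<cdot>\<^bsub>Q\<^esub> q h" unfolding j using A by simp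
  qed (use A in simp_all)
qed

text \<open>Up to the isomorphism \<open>q s\<close>, the arrow \<open>\<phi>\<close> is the image
  of its numerator, whose cone is taken in \<open>T\<close>.\<close>

lemma TR1_cone_Q:
  assumes "\<phi> \<in> Arr Q" shows "\<exists>\<psi> \<chi>. (\<phi>, \<psi>, \<chi>) \<in> Tri Q"
proof -
  obtain s f where s: "s \<in> W" "f \<in> Arr T" "Dom T f = Dom T s" "Cod T s = Dom Q \<phi>" "Cod T f = Cod Q \<phi>"
    "\<phi> \<cdot>\<^bsub>Q\<^esub> q s = q f" using fraction[OF assms] by metis
  obtain g h where t: "(f, g, h) \<in> Tri T" using TR1_cone s(2) by blast
  have "(\<phi>, q g, ShA Q (q s) \<cdot>\<^bsub>Q\<^esub> q h) \<in> Tri Q"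
    by (rule Tri_QI[OF t, of _ _ _ "q s" "Id Q (Cod T f)" "Id Q (Cod T g)"])
       (use s assms tri_Arr[OF t] in simp_all)
  then show ?thesis by blast
qed

text \<open>A zero object of \<open>Q\<close> need not be zero in \<open>T\<close>, so the trivial
  triangle is taken over a zero object of \<open>T\<close> and compared with it inside
  \<open>Q\<close>.\<close>

lemma TR1_Id_Q:
  assumes "X \<in> Ob T" "zero_object Q Z"
  shows "(Id Q X, Zer Q X Z, Zer Q Z (ShO T X)) \<in> Tri Q"
proof -
  obtain Z0 where Z0: "zero_object T Z0" using ex_zero_object by blast
  have o: "Z0 \<in> Ob T" "Z \<in> Ob T" using Z0 assms by (simp_all add: zero_object_def)
  have o': "Z0 \<in> Ob Q" "Z \<in> Ob Q" "X \<in> Ob Q" "ShO T X \<in> Ob Q" using o assms by simp_all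
  note iso = Q.zero_objects_iso[OF q_zero_object[OF Z0] assms(2)]
  show ?thesis
    by (rule Tri_QI[OF TR1_Id[OF assms(1) Z0], of _ _ _ "Id Q X" "Id Q X" "Zer Q Z0 Z"])
       (use o o' assms(1) iso Q.Zer_Arr[OF o'(1,2)] Q.Zer_Arr[OF o'(3,2)] Q.Zer_Arr[OF o'(2,4)] in simp_all)
qed

lemma TR2_Q_rotate:
  assumes "(\<phi>, \<psi>, \<chi>) \<in> Tri Q" shows "(\<psi>, \<chi>, neg Q (ShA Q \<phi>)) \<in> Tri Q"
proof -
  obtain f g h a b c where i: "(f, g, h) \<in> Tri T" "\<phi> \<in> Arr Q" "\<psi> \<in> Arr Q" "\<chi> \<in> Arr Q"
    "Dom Q \<psi> = Cod Q \<phi>" "Dom Q \<chi> = Cod Q \<psi>" "Cod Q \<chi> = ShO T (Dom Q \<phi>)"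
    "is_iso Q a" "is_iso Q b" "is_iso Q c" "a \<in> Arr Q" "b \<in> Arr Q" "c \<in> Arr Q"
    "Dom Q a = Dom T f" "Cod Q a = Dom Q \<phi>" "Dom Q b = Cod T f" "Cod Q b = Cod Q \<phi>"
    "Dom Q c = Cod T g" "Cod Q c = Cod Q \<psi>"
    and j: "\<phi> \<cdot>\<^bsub>Q\<^esub> a = b \<cdot>\<^bsub>Q\<^esub> q f" "\<psi> \<cdot>\<^bsub>Q\<^esub> b = c \<cdot>\<^bsub>Q\<^esub> q g" "\<chi> \<cdot>\<^bsub>Q\<^esub> c = ShA Q a \<cdot>\<^bsub>Q\<^esub> q h"
    by (rule Tri_QE[OF assms])
  note A = i(2-) tri_Arr[OF i(1)]
  have "ShA Q \<phi> \<cdot>\<^bsub>Q\<^esub> ShA Q a = ShA Q (\<phi> \<cdot>\<^bsub>Q\<^esub> a)" using A by simp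
  also have "\<dots> = ShA Q b \<cdot>\<^bsub>Q\<^esub> q (ShA T f)" unfolding j using A by (simp add: ShA_q)
  finally have e: "ShA Q \<phi> \<cdot>\<^bsub>Q\<^esub> ShA Q a = ShA Q b \<cdot>\<^bsub>Q\<^esub> q (ShA T f)" .
  show ?thesis
    by (rule Tri_QI[OF tri_rotate[OF i(1)], of _ _ _ b c "ShA Q a"]) (use A j e in \<open>simp_all add: q.F_neg\<close>)
qed

text \<open>For the backward direction the underlying triangle of \<open>T\<close> is rotated back
  by \<open>unrotate\<close>, and the isomorphism on the new first object is found by desuspending
  the one on the last object.\<close>

lemma TR2_Q:
  assumes "candidate_triangle Q (\<phi>, \<psi>, \<chi>)"
  shows "(\<phi>, \<psi>, \<chi>) \<in> Tri Q \<longleftrightarrow> (\<psi>, \<chi>, neg Q (ShA Q \<phi>)) \<in> Tri Q"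
proof
  show "(\<phi>, \<psi>, \<chi>) \<in> Tri Q \<Longrightarrow> (\<psi>, \<chi>, neg Q (ShA Q \<phi>)) \<in> Tri Q" by (rule TR2_Q_rotate)
next
  assume t: "(\<psi>, \<chi>, neg Q (ShA Q \<phi>)) \<in> Tri Q"
  have C: "\<phi> \<in> Arr Q" "\<psi> \<in> Arr Q" "\<chi> \<in> Arr Q" "Dom Q \<psi> = Cod Q \<phi>" "Dom Q \<chi> = Cod Q \<psi>" "Cod Q \<chi> = ShO T (Dom Q \<phi>)"
    using assms by (simp_all add: candidate_triangle_def)
  obtain g h l b c d where i: "(g, h, l) \<in> Tri T"
    "is_iso Q b" "is_iso Q c" "is_iso Q d" "b \<in> Arr Q" "c \<in> Arr Q" "d \<in> Arr Q"
    "Dom Q b = Dom T g" "Cod Q b = Dom Q \<psi>" "Dom Q c = Cod T g" "Cod Q c = Cod Q \<psi>"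
    "Dom Q d = Cod T h" "Cod Q d = Cod Q \<chi>"
    and j: "\<psi> \<cdot>\<^bsub>Q\<^esub> b = c \<cdot>\<^bsub>Q\<^esub> q g" "\<chi> \<cdot>\<^bsub>Q\<^esub> c = d \<cdot>\<^bsub>Q\<^esub> q h" "neg Q (ShA Q \<phi>) \<cdot>\<^bsub>Q\<^esub> d = ShA Q b \<cdot>\<^bsub>Q\<^esub> q l"
    by (rule Tri_QE[OF t])
  obtain f w where f: "f \<in> Arr T" "Cod T f = Dom T g" "is_iso T w" "w \<in> Arr T" "Dom T w = ShO T (Dom T f)"
    "Cod T w = Cod T h" and t': "(f, g, inv_arrow T w \<cdot> h) \<in> Tri T" and n: "neg T (ShA T f) = l \<cdot> w"
    by (rule unrotate[OF i(1)])
  note A = C i(2-) f tri_Arr[OF i(1)]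
  have iw: "is_iso Q (q w)" using W_iso[OF f(3)] by simp
  have "Dom T f \<in> Ob Q" "Dom Q \<phi> \<in> Ob Q" using f C by simp_all
  \<comment> \<open>The shift of \<open>a\<close> is an isomorphism by construction, and the shift
    reflects isomorphisms.\<close>
  then obtain a where a: "a \<in> Arr Q" "Dom Q a = Dom T f" "Cod Q a = Dom Q \<phi>" "ShA Q a = d \<cdot>\<^bsub>Q\<^esub> q w"
    by (rule_tac Q.ShA_full[of "d \<cdot>\<^bsub>Q\<^esub> q w" "Dom T f" "Dom Q \<phi>"]) (use A in auto)
  have "is_iso Q (ShA Q a)" unfolding a(4) using iw A by simp
  then have ia: "is_iso Q a" using Q.ShA_reflect_iso a(1) by blast
  have "ShA Q (\<phi> \<cdot>\<^bsub>Q\<^esub> a) = ShA Q \<phi> \<cdot>\<^bsub>Q\<^esub> (d \<cdot>\<^bsub>Q\<^esub> q w)" using A a(1-3) by (simp flip: a(4))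
  also have "\<dots> = neg Q (neg Q (ShA Q \<phi>) \<cdot>\<^bsub>Q\<^esub> d) \<cdot>\<^bsub>Q\<^esub> q w" using A by simp
  also have "\<dots> = neg Q (ShA Q b \<cdot>\<^bsub>Q\<^esub> q (l \<cdot> w))" unfolding j using A by simp
  also have "\<dots> = ShA Q b \<cdot>\<^bsub>Q\<^esub> q (ShA T f)" unfolding n[symmetric] using A by (simp add: q.F_neg)
  also have "\<dots> = ShA Q (b \<cdot>\<^bsub>Q\<^esub> q f)" using A by (simp add: ShA_q)
  finally have e1: "\<phi> \<cdot>\<^bsub>Q\<^esub> a = b \<cdot>\<^bsub>Q\<^esub> q f"
    using A a(1-3) by (intro Q.ShA_inj[of "\<phi> \<cdot>\<^bsub>Q\<^esub> a" "b \<cdot>\<^bsub>Q\<^esub> q f"]) auto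
  have "ShA Q a \<cdot>\<^bsub>Q\<^esub> q (inv_arrow T w \<cdot> h) = d \<cdot>\<^bsub>Q\<^esub> q (w \<cdot> (inv_arrow T w \<cdot> h))"
    unfolding a(4) q_Comp[OF inv_Arr[OF f(3)] f(4)] using A
    by (simp del: inv_right' add: q_Comp)
  also have "\<dots> = d \<cdot>\<^bsub>Q\<^esub> q h" using A by simp
  finally have e2: "\<chi> \<cdot>\<^bsub>Q\<^esub> c = ShA Q a \<cdot>\<^bsub>Q\<^esub> q (inv_arrow T w \<cdot> h)" unfolding j by simp
  show "(\<phi>, \<psi>, \<chi>) \<in> Tri Q"
    by (rule Tri_QI[OF t', of _ _ _ a b c]) (use A a(1-3) ia e1 e2 j in simp_all)
qed

lemma pretri_category_Q: "pretri_category \<kappa> k Q"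
proof (intro pretri_category.intro pretri_category_axioms.intro shift_category_Q)
  show "candidate_triangle Q t" if "t \<in> Tri Q" for t
    using Tri_Q_Arr[of "fst t" "fst (snd t)" "snd (snd t)"] that by (simp add: candidate_triangle_def split_beta)
qed (use Tri_Q_iso_closed TR1_Id_Q TR1_cone_Q TR2_Q TR3_Q in simp_all)

sublocale Q: pretri_category \<kappa> k Q by (rule pretri_category_Q)

text \<open>Clearing denominators makes the composable pair isomorphic in \<open>Q\<close> to the
  images of composable arrows \<open>f2\<close> and \<open>g1\<close> of \<open>T\<close>. Their
  octahedron is pushed to \<open>Q\<close>, and \<open>octahedron_transport\<close> adapts it to the
  cones prescribed.\<close>

lemma TR4_Q:
  assumes "\<phi> \<in> Hom Q X Y" "\<psi> \<in> Hom Q Y Z"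
    "(\<phi>, a, b) \<in> Tri Q" "(\<psi>, c, d) \<in> Tri Q" "(\<psi> \<cdot>\<^bsub>Q\<^esub> \<phi>, e, l) \<in> Tri Q"
  shows "\<exists>u \<in> Hom Q (Cod Q a) (Cod Q e). \<exists>v \<in> Hom Q (Cod Q e) (Cod Q c).
            (u, v, ShA Q a \<cdot>\<^bsub>Q\<^esub> d) \<in> Tri Q \<and> u \<cdot>\<^bsub>Q\<^esub> a = e \<cdot>\<^bsub>Q\<^esub> \<psi> \<and> l \<cdot>\<^bsub>Q\<^esub> u = b \<and>
            v \<cdot>\<^bsub>Q\<^esub> e = c \<and> d \<cdot>\<^bsub>Q\<^esub> v = ShA Q \<phi> \<cdot>\<^bsub>Q\<^esub> l"
proof -
  have P: "\<phi> \<in> Arr Q" "Dom Q \<phi> = X" "Cod Q \<phi> = Y" "\<psi> \<in> Arr Q" "Dom Q \<psi> = Y" "Cod Q \<psi> = Z"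
    using assms by (auto simp: Q.in_Hom)
  obtain s f1 where s: "s \<in> W" "f1 \<in> Arr T" "Dom T f1 = Dom T s" "Cod T s = X" "Cod T f1 = Y"
    and s1: "\<phi> \<cdot>\<^bsub>Q\<^esub> q s = q f1" by (rule fraction[OF P(1)]) (use P in auto)
  obtain r g1 where r: "r \<in> W" "g1 \<in> Arr T" "Dom T g1 = Dom T r" "Cod T r = Y" "Cod T g1 = Z"
    and r1: "\<psi> \<cdot>\<^bsub>Q\<^esub> q r = q g1" by (rule fraction[OF P(4)]) (use P in auto)
  obtain s' f2 where s': "s' \<in> W" "f2 \<in> Arr T" "Dom T f2 = Dom T s'" "Cod T s' = Dom T s" "Cod T f2 = Dom T r"
    "r \<cdot> f2 = f1 \<cdot> s'" by (rule ore[of r f1]) (use s r in auto)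
  obtain A B where FA: "(f2, A, B) \<in> Tri T" using TR1_cone s'(2) by blast
  obtain C D where GC: "(g1, C, D) \<in> Tri T" using TR1_cone r(2) by blast
  obtain E L where GF: "(g1 \<cdot> f2, E, L) \<in> Tri T" using TR1_cone[of "g1 \<cdot> f2"] s' r by auto
  note AA = s(1-5) r(1-5) s'(1-5) P tri_Arr[OF FA] tri_Arr[OF GC] tri_Arr[OF GF]
  have m: "f2 \<in> Hom T (Dom T f2) (Cod T f2)" "g1 \<in> Hom T (Cod T f2) (Cod T g1)"
    using AA by (simp_all add: in_Hom)
  have GF': "(q g1 \<cdot>\<^bsub>Q\<^esub> q f2, q E, q L) \<in> Tri Q" using q_Tri[OF GF] AA by simp
  obtain U V where U: "U \<in> Hom T (Cod T A) (Cod T E)" "V \<in> Hom T (Cod T E) (Cod T C)"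
      "(U, V, ShA T A \<cdot> D) \<in> Tri T" "U \<cdot> A = E \<cdot> g1" "L \<cdot> U = B" "V \<cdot> E = C" "D \<cdot> V = ShA T f2 \<cdot> L"
    using TR4[OF m FA GC GF] by blast
  have UA: "U \<in> Arr T" "V \<in> Arr T" "Dom T U = Cod T A" "Cod T U = Cod T E" "Dom T V = Cod T E" "Cod T V = Cod T C"
    using U by (auto simp: in_Hom)
  have e1: "\<phi> \<cdot>\<^bsub>Q\<^esub> q (s \<cdot> s') = q r \<cdot>\<^bsub>Q\<^esub> q f2"
    using Q.Comp_lift[OF s1, of "q s'"] arg_cong[OF s'(6), of q] AA by simp
  have e2: "\<psi> \<cdot>\<^bsub>Q\<^esub> q r = Id Q Z \<cdot>\<^bsub>Q\<^esub> q g1" using r1 AA by simp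
  have qU: "q U \<cdot>\<^bsub>Q\<^esub> q A = q E \<cdot>\<^bsub>Q\<^esub> q g1" "q L \<cdot>\<^bsub>Q\<^esub> q U = q B" "q V \<cdot>\<^bsub>Q\<^esub> q E = q C"
    "q D \<cdot>\<^bsub>Q\<^esub> q V = ShA Q (q f2) \<cdot>\<^bsub>Q\<^esub> q L"
    using arg_cong[OF U(4), of q] arg_cong[OF U(5), of q] arg_cong[OF U(6), of q] arg_cong[OF U(7), of q] AA UA
    by (simp_all add: ShA_q)
  have qT: "(q U, q V, ShA Q (q A) \<cdot>\<^bsub>Q\<^esub> q D) \<in> Tri Q" using q_Tri[OF U(3)] AA UA by (simp add: ShA_q)
  have "is_iso Q (q (s \<cdot> s'))" using q_iso[OF W_Comp[of s' s]] AA by simp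
  show ?thesis
    by (rule Q.octahedron_transport[OF q_Tri[OF FA] q_Tri[OF GC] GF' _ _ _ _ _ _ _ _ qT qU assms(3-5),
        of "q (s \<cdot> s')" "q r" "Id Q Z"])
       (use AA UA e1 e2 \<open>is_iso Q (q (s \<cdot> s'))\<close> Q.Cod_in[of \<psi>] in simp_all)
qed

theorem tri_category_Q: "tri_category \<kappa> k Q"
proof (intro tri_category.intro tri_category_axioms.intro additive_category_Q)
  show "lin_functor k Q Q (shift Q)" "fully_faithful Q Q (shift Q)" "essentially_surjective Q Q (shift Q)"
    by (fact Q.sh_functor Q.sh_fully_faithful Q.sh_essentially_surjective)+
qed (fact Q.pre_candidate Q.pre_iso_closed Q.pre_TR1_Id Q.pre_TR1_cone Q.pre_TR2 Q.pre_TR3 TR4_Q)+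

sublocale Q: tri_category \<kappa> k Q by (rule tri_category_Q)

end

section \<open>Triangle functors\<close>

locale tri_functor_pair = T: tri_category \<kappa> k T + U: tri_category \<kappa> k U
  for \<kappa> :: "'u rel" and k :: "'r ring" and T :: "('r, 'o, 'm, 'y) tcat_scheme" (structure)
    and U :: "('r, 'p, 'q, 'z) tcat_scheme" +
  fixes F :: "('o, 'm, 'p, 'q, 'w) tftr_scheme"
  assumes tri: "tri_functor k T U F"
begin

sublocale lin_functor_pair \<kappa> k T U F
  by unfold_locales (use tri in \<open>simp add: tri_functor_def\<close>)

lemma Shf_Arr [simp]:
  assumes "X \<in> Ob T"
  shows "Shf F X \<in> Arr U" "Dom U (Shf F X) = Obf F (ShO T X)" "Cod U (Shf F X) = ShO U (Obf F X)"
    "is_iso U (Shf F X)"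
  using tri assms by (auto simp: tri_functor_def U.in_Hom)

lemma Shf_nat: "f \<in> Arr T \<Longrightarrow> Shf F (Cod T f) \<cdot>\<^bsub>U\<^esub> Arf F (ShA T f) = ShA U (Arf F f) \<cdot>\<^bsub>U\<^esub> Shf F (Dom T f)"
  using tri by (simp add: tri_functor_def)

lemma F_Tri: "(f, g, h) \<in> Tri T \<Longrightarrow> (Arf F f, Arf F g, Shf F (Dom T f) \<cdot>\<^bsub>U\<^esub> Arf F h) \<in> Tri U"
  using tri by (simp add: tri_functor_def)

lemma F_ShO_isomorphic: "X \<in> Ob T \<Longrightarrow> isomorphic U (Obf F (ShO T X)) (ShO U (Obf F X))"
  by (rule U.isomorphicI[of "Shf F X"]) simp_all

lemma ff_full:
  assumes "fully_faithful T U F" "X \<in> Ob T" "Y \<in> Ob T" "\<phi> \<in> Arr U" "Dom U \<phi> = Obf F X" "Cod U \<phi> = Obf F Y"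
  obtains f where "f \<in> Arr T" "Dom T f = X" "Cod T f = Y" "Arf F f = \<phi>"
proof -
  have "Arf F ` Hom T X Y = Hom U (Obf F X) (Obf F Y)"
    using assms(1-3) by (simp add: fully_faithful_def bij_betw_def)
  moreover have "\<phi> \<in> Hom U (Obf F X) (Obf F Y)" using assms by (simp add: U.in_Hom)
  ultimately have "\<phi> \<in> Arf F ` Hom T X Y" by simp
  then show ?thesis using that by (auto simp: T.in_Hom)
qed

lemma ff_inj:
  assumes "fully_faithful T U F" "f \<in> Arr T" "g \<in> Arr T" "Dom T g = Dom T f" "Cod T g = Cod T f"
    "Arf F f = Arf F g"
  shows "f = g"
proof -
  have "inj_on (Arf F) (Hom T (Dom T f) (Cod T f))"
    using assms(1,2) by (simp add: fully_faithful_def bij_betw_def)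
  then show ?thesis by (rule inj_onD) (use assms in \<open>simp_all add: T.in_Hom\<close>)
qed

end

lemma tri_functor_comp:
  assumes F: "tri_functor_pair \<kappa> k T U F" and G: "tri_functor_pair \<kappa> k U V G"
  shows "tri_functor k T V (tri_comp V G F)"
proof -
  interpret F: tri_functor_pair \<kappa> k T U F by (rule F)
  interpret G: tri_functor_pair \<kappa> k U V G by (rule G)
  show ?thesis unfolding tri_functor_def
  proof (intro conjI allI ballI impI)
    show "lin_functor k T V (tri_comp V G F)"
      unfolding lin_functor_def tri_comp_def
      by (auto simp: F.T.in_Hom G.U.in_Hom)
  next
    fix X assume X: "X \<in> Ob T"
    show "Shf (tri_comp V G F) X \<in> Hom V (Obf (tri_comp V G F) (ShO T X)) (ShO V (Obf (tri_comp V G F) X))"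
      "is_iso V (Shf (tri_comp V G F) X)"
      using X by (simp_all add: tri_comp_def G.U.in_Hom)
  next
    fix f assume f: "f \<in> Arr T"
    let ?Y = "Obf F (Cod T f)" and ?X = "Obf F (Dom T f)"
    have "(Shf G ?Y \<cdot>\<^bsub>V\<^esub> Arf G (Shf F (Cod T f))) \<cdot>\<^bsub>V\<^esub> Arf G (Arf F (ShA T f))
      = Shf G ?Y \<cdot>\<^bsub>V\<^esub> Arf G (Shf F (Cod T f) \<cdot>\<^bsub>U\<^esub> Arf F (ShA T f))" using f by simp
    also have "\<dots> = (Shf G (Cod U (Arf F f)) \<cdot>\<^bsub>V\<^esub> Arf G (ShA U (Arf F f))) \<cdot>\<^bsub>V\<^esub> Arf G (Shf F (Dom T f))"
      unfolding F.Shf_nat[OF f] using f by simp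
    also have "\<dots> = ShA V (Arf G (Arf F f)) \<cdot>\<^bsub>V\<^esub> (Shf G ?X \<cdot>\<^bsub>V\<^esub> Arf G (Shf F (Dom T f)))"
      using f by (subst G.Shf_nat) simp_all
    finally show "Shf (tri_comp V G F) (Cod T f) \<cdot>\<^bsub>V\<^esub> Arf (tri_comp V G F) (ShA T f) =
        ShA V (Arf (tri_comp V G F) f) \<cdot>\<^bsub>V\<^esub> Shf (tri_comp V G F) (Dom T f)"
      by (simp add: tri_comp_def)
  next
    fix f g h assume t: "(f, g, h) \<in> Tri T"
    note A = F.T.tri_Arr[OF t]
    show "(Arf (tri_comp V G F) f, Arf (tri_comp V G F) g,
        Shf (tri_comp V G F) (Dom T f) \<cdot>\<^bsub>V\<^esub> Arf (tri_comp V G F) h) \<in> Tri V"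
      using G.F_Tri[OF F.F_Tri[OF t]] A by (simp add: tri_comp_def)
  qed
qed

section \<open>Closure under isomorphism and essential images of functors\<close>

definition iso_closure :: "('o, 'm, 'z) cat_scheme \<Rightarrow> 'o set \<Rightarrow> 'o set" where
  "iso_closure C N = {Y. \<exists>X \<in> N. isomorphic C X Y}"

text \<open>A cone isomorphic to an object of \<open>N\<close> can be exchanged for that object. So
  a quotient by the bare image of a functor may be treated as one by its isomorphism closure, to
  which \<open>verdier\<close> applies.\<close>

lemma (in tri_category) cone_in_iso_closure:
  assumes "N \<subseteq> Ob T" shows "cone_in T (iso_closure T N) = cone_in T N"
proof
  show "cone_in T N \<subseteq> cone_in T (iso_closure T N)"
    using assms isomorphic_refl unfolding cone_in_def iso_closure_def by blast
  show "cone_in T (iso_closure T N) \<subseteq> cone_in T N"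
  proof
    fix s assume "s \<in> cone_in T (iso_closure T N)"
    then obtain g h X where t: "(s, g, h) \<in> Tri T" "X \<in> N" "isomorphic T X (Cod T g)"
      by (auto simp: cone_in_def iso_closure_def)
    obtain w where w: "is_iso T w" "w \<in> Arr T" "Dom T w = X" "Cod T w = Cod T g" using t(3) by (rule isomorphicE)
    note A = tri_Arr[OF t(1)]
    have "(s, inv_arrow T w \<cdot> g, h \<cdot> w) \<in> Tri T"
      by (rule tri_isoI[OF t(1), of _ _ _ "Id T (Dom T s)" "Id T (Cod T s)" "inv_arrow T w"]) (use A w in simp_all)
    moreover have "Cod T (inv_arrow T w \<cdot> g) = X" using A w by simp
    ultimately show "s \<in> cone_in T N" using t(2) unfolding cone_in_def by blast
  qed
qed

text \<open>The subcategory enters the construction of the quotient only through its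
  denominators.\<close>

lemma verdier_quotient_cong:
  assumes "cone_in T N = cone_in T M" shows "verdier_quotient T N = verdier_quotient T M"
proof -
  have r: "roofs T N = roofs T M" by (simp add: roofs_def assms)
  have c: "roof_class T N = roof_class T M" by (intro ext) (simp add: roof_class_def assms r)
  have a: "quotient_arrow T N = quotient_arrow T M" by (intro ext) (simp add: quotient_arrow_def c)
  have "verdier_precat T N = verdier_precat T M" by (simp add: verdier_precat_def assms r c a)
  then show ?thesis by (simp add: verdier_quotient_def a)
qed

text \<open>Fullness turns an arrow between objects of the essential image into the image of an
  arrow \<open>f0\<close>, up to isomorphism; the image of a cone of \<open>f0\<close> is then a
  cone.\<close>

lemma (in tri_functor_pair) image_cone:
  assumes ff: "fully_faithful T U F" and t: "(f, g, h) \<in> Tri U"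
    and "X \<in> Ob T" "isomorphic U (Obf F X) (Dom U f)" "Y \<in> Ob T" "isomorphic U (Obf F Y) (Cod U f)"
  shows "\<exists>Z \<in> Ob T. isomorphic U (Obf F Z) (Cod U g)"
proof -
  note A = U.tri_Arr[OF t]
  obtain a where a: "is_iso U a" "a \<in> Arr U" "Dom U a = Obf F X" "Cod U a = Dom U f" using assms(4) by (rule U.isomorphicE)
  obtain b where b: "is_iso U b" "b \<in> Arr U" "Dom U b = Obf F Y" "Cod U b = Cod U f" using assms(6) by (rule U.isomorphicE)
  obtain f0 where f0: "f0 \<in> Arr T" "Dom T f0 = X" "Cod T f0 = Y" "Arf F f0 = inv_arrow U b \<cdot>\<^bsub>U\<^esub> (f \<cdot>\<^bsub>U\<^esub> a)"
    by (rule ff_full[OF ff assms(3,5), of "inv_arrow U b \<cdot>\<^bsub>U\<^esub> (f \<cdot>\<^bsub>U\<^esub> a)"]) (use A a b in auto)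
  obtain g0 h0 where t0: "(f0, g0, h0) \<in> Tri T" using T.TR1_cone f0(1) by blast
  note A0 = T.tri_Arr[OF t0]
  have e: "f \<cdot>\<^bsub>U\<^esub> a = b \<cdot>\<^bsub>U\<^esub> Arf F f0" unfolding f0(4) using A a b by simp
  obtain c where "is_iso U c" "Dom U c = Cod U (Arf F g0)" "Cod U c = Cod U g"
    by (rule U.cone_mor_iso[OF F_Tri[OF t0] t a(1) b(1)]) (use A A0 a b f0(1-3) e in simp_all)
  then have "isomorphic U (Obf F (Cod T g0)) (Cod U g)" using A0 by (intro U.isomorphicI[of c]) simp_all
  then show ?thesis using A0 by auto
qed

lemma verdier_image:
  fixes U :: "('r, 'p, 'q) tcat"
  assumes F: "tri_functor_pair \<kappa> k T U F" and ff: "fully_faithful T U F"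
    and "universe_card \<kappa>" "skeletally_small \<kappa> U"
  shows "verdier \<kappa> k U (iso_closure U (Obf F ` Ob T))"
proof -
  interpret tri_functor_pair \<kappa> k T U F by (rule F)
  let ?M = "iso_closure U (Obf F ` Ob T)"
  have MI: "Y \<in> ?M" if "X \<in> Ob T" "isomorphic U (Obf F X) Y" for X Y
    using that unfolding iso_closure_def by blast
  have ME: "\<exists>X \<in> Ob T. isomorphic U (Obf F X) Y" if "Y \<in> ?M" for Y
    using that unfolding iso_closure_def by blast
  have "verdier_axioms \<kappa> U ?M"
  proof (rule verdier_axioms.intro)
    show "universe_card \<kappa>" "skeletally_small \<kappa> U" by (fact assms(3,4))+
    show "X \<in> Ob U" if "X \<in> ?M" for X using ME[OF that] U.isomorphic_Ob by blast
    show "Y \<in> ?M" if "X \<in> ?M" "isomorphic U X Y" for X Y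
      using ME[OF that(1)] that(2) MI U.isomorphic_trans by blast
    show "Z \<in> ?M" if "zero_object U Z" for Z
    proof -
      obtain Z0 where Z0: "zero_object T Z0" using T.ex_zero_object by blast
      have o: "Z0 \<in> Ob T" "Z \<in> Ob U" using Z0 that by (simp_all add: zero_object_def)
      show ?thesis using o U.zero_objects_iso[OF F_zero_object[OF Z0] that]
        by (intro MI[of Z0]) (auto intro!: U.isomorphicI[of "Zer U (Obf F Z0) Z"])
    qed
    show "ShO U X \<in> ?M \<longleftrightarrow> X \<in> ?M" if X: "X \<in> Ob U" for X
    proof
      assume "X \<in> ?M"
      then obtain X0 where X0: "X0 \<in> Ob T" "isomorphic U (Obf F X0) X" using ME by blast
      then show "ShO U X \<in> ?M"
        using U.isomorphic_trans[OF F_ShO_isomorphic[OF X0(1)] U.ShO_isomorphic[OF X0(2)]] by (intro MI[of "ShO T X0"]) simp_all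
    next
      assume "ShO U X \<in> ?M"
      then obtain Y where Y: "Y \<in> Ob T" "isomorphic U (Obf F Y) (ShO U X)" using ME by blast
      \<comment> \<open>Desuspending already in \<open>T\<close> stays in the image; the shift of
        \<open>U\<close> then reflects the isomorphism.\<close>
      obtain Y1 w where w: "Y1 \<in> Ob T" "is_iso T w" "w \<in> Arr T" "Dom T w = ShO T Y1" "Cod T w = Y"
        by (rule T.ShO_ess[OF Y(1)])
      have "isomorphic U (Obf F (ShO T Y1)) (Obf F Y)" using w by (intro F_isomorphic T.isomorphicI[of w]) simp_all
      then have "isomorphic U (ShO U (Obf F Y1)) (ShO U X)"
        using U.isomorphic_trans U.isomorphic_sym F_ShO_isomorphic[OF w(1)] Y(2) by metis
      then show "X \<in> ?M" using MI[OF w(1)] U.ShO_reflect_isomorphic w(1) X F_Ob by blast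
    qed
    show "Cod U g \<in> ?M" if t: "(f, g, h) \<in> Tri U" "Dom U f \<in> ?M" "Cod U f \<in> ?M" for f g h
      using image_cone[OF ff t(1)] ME[OF t(2)] ME[OF t(3)] MI by blast
  qed
  then show ?thesis using U.tri_category_axioms by (intro verdier.intro)
qed

context verdier begin

lemma tri_functor_q: "tri_functor k T Q (quotient_functor T N)"
  unfolding tri_functor_def
proof (intro conjI allI ballI impI)
  show "lin_functor k T Q (quotient_functor T N)" by (rule lin_functor_q)
  fix X assume "X \<in> Ob T"
  then show "Shf (quotient_functor T N) X
      \<in> Hom Q (Obf (quotient_functor T N) (ShO T X)) (ShO Q (Obf (quotient_functor T N) X))"
    "is_iso Q (Shf (quotient_functor T N) X)"
    by (simp_all add: quotient_functor_def Q.in_Hom)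
next
  fix f assume "f \<in> Arr T"
  then show "Shf (quotient_functor T N) (Cod T f) \<cdot>\<^bsub>Q\<^esub> Arf (quotient_functor T N) (ShA T f) =
      ShA Q (Arf (quotient_functor T N) f) \<cdot>\<^bsub>Q\<^esub> Shf (quotient_functor T N) (Dom T f)"
    by (simp add: quotient_functor_def ShA_q)
next
  fix f g h assume t: "(f, g, h) \<in> Tri T"
  show "(Arf (quotient_functor T N) f, Arf (quotient_functor T N) g,
      Shf (quotient_functor T N) (Dom T f) \<cdot>\<^bsub>Q\<^esub> Arf (quotient_functor T N) h) \<in> Tri Q"
    using q_Tri[OF t] tri_Arr[OF t] by (simp add: quotient_functor_def)
qed

lemma tri_functor_pair_q: "tri_functor_pair \<kappa> k T Q (quotient_functor T N)"
  by (intro tri_functor_pair.intro tri_functor_pair_axioms.intro tri_functor_q tri_category_axioms tri_category_Q)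

lemma zero_object_Q: assumes "X \<in> N" shows "zero_object Q X"
proof -
  obtain Z where Z: "zero_object T Z" using ex_zero_object by blast
  have o: "X \<in> Ob T" "Z \<in> Ob T" using Z assms N_Ob by (simp_all add: zero_object_def)
  obtain g h where t: "(Zer T X Z, g, h) \<in> Tri T" using TR1_cone[of "Zer T X Z"] o by auto
  have "Zer T X Z \<in> W" using W_I[OF t] N_cone[OF t] N_zero[OF Z] assms o by simp
  then have "is_iso Q (q (Zer T X Z))" by (rule q_iso)
  then have "isomorphic Q X Z"
    by (rule Q.isomorphicI) (use o Q.Zer_Arr[of X Z] in simp_all)
  then show ?thesis using Q.zero_object_iso q_zero_object[OF Z] by blast
qed

lemma skeletally_small_Q: "skeletally_small \<kappa> Q"
  using skel q.F_isomorphic unfolding skeletally_small_def by (metis Ob_Q)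

end

section \<open>The universal property of a Verdier quotient and a criterion for full
  faithfulness\<close>

locale verdier_functor = verdier \<kappa> k T N + U: tri_category \<kappa> k U
  for \<kappa> :: "'u rel" and k :: "'r ring" and T :: "('r, 'o, 'm) tcat" (structure) and N :: "'o set"
    and U :: "('r, 'p, 'q, 'z) tcat_scheme" +
  fixes F :: "('o, 'm, 'p, 'q) tftr"
  assumes F_tri: "tri_functor k T U F" and F_kills: "X \<in> N \<Longrightarrow> zero_object U (Obf F X)"
begin

sublocale F: tri_functor_pair \<kappa> k T U F
  by unfold_locales (rule F_tri)

abbreviation "F' \<equiv> factor_quotient U F"

lemma Obf_F' [simp]: "Obf F' = Obf F" and Shf_F' [simp]: "Shf F' = Shf F"
  by (simp_all add: factor_quotient_def)

lemma F_W [simp]: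
  assumes "s \<in> W" shows "is_iso U (Arf F s)"
proof -
  obtain g h where t: "(s, g, h) \<in> Tri T" "Cod T g \<in> N" using assms by (auto simp: cone_in_def)
  then show ?thesis using U.zero_cone_iso[OF F.F_Tri[OF t(1)]] F_kills tri_Arr[OF t(1)] by simp
qed

lemma F'_eq:
  assumes "roof_eq s f s' f'"
  shows "Arf F f' \<cdot>\<^bsub>U\<^esub> inv_arrow U (Arf F s') = Arf F f \<cdot>\<^bsub>U\<^esub> inv_arrow U (Arf F s)"
proof -
  have r: "roof s f" "roof s' f'" "Cod T s' = Cod T s" "Cod T f' = Cod T f" using assms by (auto simp: roof_eq_def)
  note R = roofD[OF r(1)] roofD[OF r(2)] r(3,4)
  obtain u v where u: "u \<in> Arr T" "v \<in> Arr T" "Dom T v = Dom T u" "Cod T u = Dom T s" "Cod T v = Dom T s'"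
    "s \<cdot> u = s' \<cdot> v" "s \<cdot> u \<in> W" "f \<cdot> u = f' \<cdot> v" using roof_eqE[OF assms] .
  note A = R u(1-5) F_W[OF R(1)] F_W[OF R(4)]
  show ?thesis
  proof (rule U.iso_cancel_right[OF F_W[OF u(7)]])
    have "(Arf F f' \<cdot>\<^bsub>U\<^esub> inv_arrow U (Arf F s')) \<cdot>\<^bsub>U\<^esub> Arf F (s \<cdot> u) = Arf F (f' \<cdot> v)"
      unfolding u(6) using A by simp
    also have "\<dots> = (Arf F f \<cdot>\<^bsub>U\<^esub> inv_arrow U (Arf F s)) \<cdot>\<^bsub>U\<^esub> Arf F (s \<cdot> u)"
      unfolding u(8)[symmetric] using A by simp
    finally show "(Arf F f' \<cdot>\<^bsub>U\<^esub> inv_arrow U (Arf F s')) \<cdot>\<^bsub>U\<^esub> Arf F (s \<cdot> u) =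
      (Arf F f \<cdot>\<^bsub>U\<^esub> inv_arrow U (Arf F s)) \<cdot>\<^bsub>U\<^esub> Arf F (s \<cdot> u)" .
  qed (use A in simp_all)
qed

lemma F'_cls:
  assumes "roof s f" shows "Arf F' (cls s f) = Arf F f \<cdot>\<^bsub>U\<^esub> inv_arrow U (Arf F s)"
proof -
  have "the_elem ((\<lambda>(s, f). Arf F f \<cdot>\<^bsub>U\<^esub> inv_arrow U (Arf F s)) ` cls s f)
      = (\<lambda>(s, f). Arf F f \<cdot>\<^bsub>U\<^esub> inv_arrow U (Arf F s)) (s, f)"
    by (rule the_elem_cls[OF assms], drule cls_memD[OF assms], unfold prod.case) (metis F'_eq)
  then show ?thesis by (simp add: factor_quotient_def)
qed

lemma F'_q [simp]: "f \<in> Arr T \<Longrightarrow> Arf F' (q f) = Arf F f"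
  using F'_cls[OF roof_Id[of f]] by (simp add: q_def)

lemma lin_functor_F': "lin_functor k Q U F'"
  unfolding lin_functor_def Ob_Q Obf_F'
proof (intro conjI ballI impI)
  show "Obf F X \<in> Ob U" if "X \<in> Ob T" for X using that by simp
  show "Arf F' \<phi> \<in> Hom U (Obf F X) (Obf F Y)" if "\<phi> \<in> Hom Q X Y" for X Y \<phi>
  proof -
    obtain s f where s: "roof s f" "\<phi> = cls s f" "Cod T s = X" "Cod T f = Y" using \<open>\<phi> \<in> Hom Q X Y\<close> by (auto simp: Hom_Q_iff)
    then show ?thesis using F'_cls[OF s(1)] roofD[OF s(1)] F_W[of s] by (simp add: U.in_Hom)
  qed
  show "Arf F' (Id Q X) = Id U (Obf F X)" if "X \<in> Ob T" for X
    using F'_q[of "Id T X"] that by simp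
next
  fix \<phi> \<psi> assume h: "\<phi> \<in> Arr Q" "\<psi> \<in> Arr Q" "Dom Q \<psi> = Cod Q \<phi>"
  obtain s f where s: "roof s f" "\<phi> = cls s f" using Arr_Q_E h(1) by blast
  obtain t g where t: "roof t g" "\<psi> = cls t g" using Arr_Q_E h(2) by blast
  note R = roofD[OF s(1)] roofD[OF t(1)]
  have c: "Cod T f = Cod T t" using h s t by simp
  obtain u v where u: "u \<in> W" "v \<in> Arr T" "Dom T v = Dom T u" "Cod T u = Dom T s" "Cod T v = Dom T t"
    "t \<cdot> v = f \<cdot> u" by (rule ore[of t f]) (use R c in auto)
  have r: "roof (s \<cdot> u) (g \<cdot> v)" using R u(1-5) by (auto simp: roof_def W_Comp)
  have 1: "\<psi> \<cdot>\<^bsub>Q\<^esub> \<phi> = cls (s \<cdot> u) (g \<cdot> v)" unfolding s t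
    by (rule Comp_cls[OF s(1) t(1)]) (use R u c in auto)
  note A = R u(1-5) c F_W[OF R(1)] F_W[OF R(4)] F_W[OF u(1)]
  have "Arf F (g \<cdot> v) \<cdot>\<^bsub>U\<^esub> inv_arrow U (Arf F (s \<cdot> u)) =
      (Arf F g \<cdot>\<^bsub>U\<^esub> inv_arrow U (Arf F t)) \<cdot>\<^bsub>U\<^esub> (Arf F f \<cdot>\<^bsub>U\<^esub> inv_arrow U (Arf F s))"
  proof (rule U.iso_cancel_right[OF F_W[of "s \<cdot> u"]])
    show "s \<cdot> u \<in> W" using r by (rule roofD)
    have "(Arf F g \<cdot>\<^bsub>U\<^esub> inv_arrow U (Arf F t)) \<cdot>\<^bsub>U\<^esub> (Arf F f \<cdot>\<^bsub>U\<^esub> inv_arrow U (Arf F s)) \<cdot>\<^bsub>U\<^esub> Arf F (s \<cdot> u)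
      = (Arf F g \<cdot>\<^bsub>U\<^esub> inv_arrow U (Arf F t)) \<cdot>\<^bsub>U\<^esub> Arf F (f \<cdot> u)" using A by simp
    also have "\<dots> = Arf F (g \<cdot> v)" unfolding u(6)[symmetric] using A by simp
    finally show "(Arf F (g \<cdot> v) \<cdot>\<^bsub>U\<^esub> inv_arrow U (Arf F (s \<cdot> u))) \<cdot>\<^bsub>U\<^esub> Arf F (s \<cdot> u) =
      (Arf F g \<cdot>\<^bsub>U\<^esub> inv_arrow U (Arf F t)) \<cdot>\<^bsub>U\<^esub> (Arf F f \<cdot>\<^bsub>U\<^esub> inv_arrow U (Arf F s)) \<cdot>\<^bsub>U\<^esub> Arf F (s \<cdot> u)"
      using A F_W[OF roofD(1)[OF r]] by simp
  qed (use A F_W[OF roofD(1)[OF r]] in simp_all)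
  then show "Arf F' (\<psi> \<cdot>\<^bsub>Q\<^esub> \<phi>) = Arf F' \<psi> \<cdot>\<^bsub>U\<^esub> Arf F' \<phi>"
    unfolding 1 F'_cls[OF r] unfolding s t F'_cls[OF s(1)] F'_cls[OF t(1)] .
next
  fix \<phi> \<psi> assume h: "\<phi> \<in> Arr Q" "\<psi> \<in> Arr Q" "Dom Q \<phi> = Dom Q \<psi> \<and> Cod Q \<phi> = Cod Q \<psi>"
  obtain s f g where s: "roof s f" "roof s g" "\<phi> = cls s f" "\<psi> = cls s g"
    by (rule common_fraction[of \<phi> \<psi>]) (use h in auto)
  have c: "Cod T g = Cod T f" using h s by simp
  show "Arf F' (Add Q \<phi> \<psi>) = Add U (Arf F' \<phi>) (Arf F' \<psi>)"
    unfolding s Add_cls[OF s(1,2) c] F'_cls[OF s(1)] F'_cls[OF s(2)] F'_cls[OF roof_Add[OF s(1,2) c]]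
    using c roofD[OF s(1)] roofD[OF s(2)] F_W[of s] by simp
next
  fix a \<phi> assume h: "a \<in> carrier k" "\<phi> \<in> Arr Q"
  obtain s f where s: "roof s f" "\<phi> = cls s f" using Arr_Q_E h(2) by blast
  show "Arf F' (Smul Q a \<phi>) = Smul U a (Arf F' \<phi>)"
    unfolding s Smul_cls[OF s(1) h(1)] F'_cls[OF s(1)] F'_cls[OF roof_Smul[OF s(1) h(1)]]
    using roofD[OF s(1)] F_W[of s] h by simp
qed

sublocale F': lin_functor_pair \<kappa> k Q U F'
  by unfold_locales (rule lin_functor_F')

lemma F'_Shf_nat:
  assumes "\<phi> \<in> Arr Q"
  shows "Shf F (Cod Q \<phi>) \<cdot>\<^bsub>U\<^esub> Arf F' (ShA Q \<phi>) = ShA U (Arf F' \<phi>) \<cdot>\<^bsub>U\<^esub> Shf F (Dom Q \<phi>)"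
proof -
  obtain s f where s: "s \<in> W" "f \<in> Arr T" "Dom T f = Dom T s" "Cod T s = Dom Q \<phi>" "Cod T f = Cod Q \<phi>"
    "\<phi> \<cdot>\<^bsub>Q\<^esub> q s = q f" using fraction[OF assms] by metis
  have e: "Arf F' \<phi> \<cdot>\<^bsub>U\<^esub> Arf F s = Arf F f" using F'.F_Comp[of "q s" \<phi>] s assms by simp
  have e': "Arf F' (ShA Q \<phi>) \<cdot>\<^bsub>U\<^esub> Arf F (ShA T s) = Arf F (ShA T f)"
    using arg_cong[OF s(6), of "\<lambda>x. Arf F' (ShA Q x)"] s(1-5) assms by (simp add: ShA_q)
  have X: "Dom T s \<in> Ob T" "Dom Q \<phi> \<in> Ob T" "Cod Q \<phi> \<in> Ob T" using s assms by simp_all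
  show ?thesis
  proof (rule U.iso_cancel_right[OF F_W[OF ShA_W[OF s(1)]]])
    have "(Shf F (Cod Q \<phi>) \<cdot>\<^bsub>U\<^esub> Arf F' (ShA Q \<phi>)) \<cdot>\<^bsub>U\<^esub> Arf F (ShA T s) = Shf F (Cod T f) \<cdot>\<^bsub>U\<^esub> Arf F (ShA T f)"
      unfolding e'[symmetric] using s assms X by simp
    also have "\<dots> = ShA U (Arf F' \<phi>) \<cdot>\<^bsub>U\<^esub> (ShA U (Arf F s) \<cdot>\<^bsub>U\<^esub> Shf F (Dom T s))"
      unfolding F.Shf_nat[OF s(2)] e[symmetric] using s assms X by simp
    also have "\<dots> = (ShA U (Arf F' \<phi>) \<cdot>\<^bsub>U\<^esub> Shf F (Dom Q \<phi>)) \<cdot>\<^bsub>U\<^esub> Arf F (ShA T s)"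
      unfolding F.Shf_nat[OF W_Arr[OF s(1)], symmetric] using s assms X by simp
    finally show "(Shf F (Cod Q \<phi>) \<cdot>\<^bsub>U\<^esub> Arf F' (ShA Q \<phi>)) \<cdot>\<^bsub>U\<^esub> Arf F (ShA T s) =
      (ShA U (Arf F' \<phi>) \<cdot>\<^bsub>U\<^esub> Shf F (Dom Q \<phi>)) \<cdot>\<^bsub>U\<^esub> Arf F (ShA T s)" .
  qed (use s assms X in simp_all)
qed

lemma tri_functor_F': "tri_functor k Q U F'"
  unfolding tri_functor_def Shf_F' Obf_F' Ob_Q ShO_Q
proof (intro conjI allI ballI impI)
  show "lin_functor k Q U F'" by (rule lin_functor_F')
  show "Shf F X \<in> Hom U (Obf F (ShO T X)) (ShO U (Obf F X))" "is_iso U (Shf F X)" if "X \<in> Ob T" for X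
    using that by (simp_all add: U.in_Hom)
  show "Shf F (Cod Q \<phi>) \<cdot>\<^bsub>U\<^esub> Arf F' (ShA Q \<phi>) = ShA U (Arf F' \<phi>) \<cdot>\<^bsub>U\<^esub> Shf F (Dom Q \<phi>)" if "\<phi> \<in> Arr Q" for \<phi>
    by (rule F'_Shf_nat[OF that])
next
  fix \<phi> \<psi> \<chi> assume t: "(\<phi>, \<psi>, \<chi>) \<in> Tri Q"
  obtain f g h a b c where i: "(f, g, h) \<in> Tri T" "\<phi> \<in> Arr Q" "\<psi> \<in> Arr Q" "\<chi> \<in> Arr Q"
    "Dom Q \<psi> = Cod Q \<phi>" "Dom Q \<chi> = Cod Q \<psi>" "Cod Q \<chi> = ShO T (Dom Q \<phi>)"
    "is_iso Q a" "is_iso Q b" "is_iso Q c" "a \<in> Arr Q" "b \<in> Arr Q" "c \<in> Arr Q"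
    "Dom Q a = Dom T f" "Cod Q a = Dom Q \<phi>" "Dom Q b = Cod T f" "Cod Q b = Cod Q \<phi>"
    "Dom Q c = Cod T g" "Cod Q c = Cod Q \<psi>"
    and j: "\<phi> \<cdot>\<^bsub>Q\<^esub> a = b \<cdot>\<^bsub>Q\<^esub> q f" "\<psi> \<cdot>\<^bsub>Q\<^esub> b = c \<cdot>\<^bsub>Q\<^esub> q g" "\<chi> \<cdot>\<^bsub>Q\<^esub> c = ShA Q a \<cdot>\<^bsub>Q\<^esub> q h" by (rule Tri_QE[OF t])
  note A = i(2-) tri_Arr[OF i(1)]
  have e1: "Arf F' \<phi> \<cdot>\<^bsub>U\<^esub> Arf F' a = Arf F' b \<cdot>\<^bsub>U\<^esub> Arf F f" using arg_cong[OF j(1), of "Arf F'"] A by simp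
  have e2: "Arf F' \<psi> \<cdot>\<^bsub>U\<^esub> Arf F' b = Arf F' c \<cdot>\<^bsub>U\<^esub> Arf F g" using arg_cong[OF j(2), of "Arf F'"] A by simp
  have e3: "Arf F' \<chi> \<cdot>\<^bsub>U\<^esub> Arf F' c = Arf F' (ShA Q a) \<cdot>\<^bsub>U\<^esub> Arf F h" using arg_cong[OF j(3), of "Arf F'"] A by simp
  have n: "Shf F (Dom Q \<phi>) \<cdot>\<^bsub>U\<^esub> Arf F' (ShA Q a) = ShA U (Arf F' a) \<cdot>\<^bsub>U\<^esub> Shf F (Dom T f)"
    using F'_Shf_nat[of a] A by simp
  have X: "Dom Q \<phi> \<in> Ob T" using A by simp
  have "(Shf F (Dom Q \<phi>) \<cdot>\<^bsub>U\<^esub> Arf F' \<chi>) \<cdot>\<^bsub>U\<^esub> Arf F' c = (Shf F (Dom Q \<phi>) \<cdot>\<^bsub>U\<^esub> Arf F' (ShA Q a)) \<cdot>\<^bsub>U\<^esub> Arf F h"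
    using A X e3 by simp
  also have "\<dots> = ShA U (Arf F' a) \<cdot>\<^bsub>U\<^esub> (Shf F (Dom T f) \<cdot>\<^bsub>U\<^esub> Arf F h)" unfolding n using A X by simp
  finally have e4: "(Shf F (Dom Q \<phi>) \<cdot>\<^bsub>U\<^esub> Arf F' \<chi>) \<cdot>\<^bsub>U\<^esub> Arf F' c = ShA U (Arf F' a) \<cdot>\<^bsub>U\<^esub> (Shf F (Dom T f) \<cdot>\<^bsub>U\<^esub> Arf F h)" .
  show "(Arf F' \<phi>, Arf F' \<psi>, Shf F (Dom Q \<phi>) \<cdot>\<^bsub>U\<^esub> Arf F' \<chi>) \<in> Tri U"
    by (rule U.tri_isoI[OF F.F_Tri[OF i(1)], of _ _ _ "Arf F' a" "Arf F' b" "Arf F' c"])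
       (use A X e1 e2 e4 in simp_all)
qed

text \<open>Two parallel arrows of the quotient have a common denominator, whose image is
  invertible, and the functor is additive. So injectivity on Hom-sets reduces to the vanishing of
  single arrows of \<open>T\<close>.\<close>

lemma fully_faithful_F'I:
  assumes full: "\<And>X Y \<phi>. \<lbrakk>X \<in> Ob T; Y \<in> Ob T; \<phi> \<in> Arr U; Dom U \<phi> = Obf F X; Cod U \<phi> = Obf F Y\<rbrakk>
      \<Longrightarrow> \<exists>s f. s \<in> W \<and> f \<in> Arr T \<and> Dom T f = Dom T s \<and> Cod T s = X \<and> Cod T f = Y \<and> \<phi> \<cdot>\<^bsub>U\<^esub> Arf F s = Arf F f"
    and faithful: "\<And>f. \<lbrakk>f \<in> Arr T; Arf F f = Zer U (Obf F (Dom T f)) (Obf F (Cod T f))\<rbrakk>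
      \<Longrightarrow> \<exists>r. r \<in> W \<and> Cod T r = Dom T f \<and> f \<cdot> r = Zer T (Dom T r) (Cod T f)"
  shows "fully_faithful Q U F'"
  unfolding fully_faithful_def Ob_Q Obf_F'
proof (intro ballI bij_betwI')
  fix X Y \<phi> \<psi> assume h: "\<phi> \<in> Hom Q X Y" "\<psi> \<in> Hom Q X Y"
  obtain s f g where s: "roof s f" "roof s g" "\<phi> = cls s f" "\<psi> = cls s g" "Cod T s = X" "Cod T f = Y" "Cod T g = Y"
    using Hom_Q_E2[OF h] .
  note R = roofD[OF s(1)] roofD[OF s(2)] s(5-7)
  show "Arf F' \<phi> = Arf F' \<psi> \<longleftrightarrow> \<phi> = \<psi>"
  proof
    assume "Arf F' \<phi> = Arf F' \<psi>"
    then have "Arf F f \<cdot>\<^bsub>U\<^esub> inv_arrow U (Arf F s) = Arf F g \<cdot>\<^bsub>U\<^esub> inv_arrow U (Arf F s)"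
      unfolding s(3,4) F'_cls[OF s(1)] F'_cls[OF s(2)] .
    then have "Arf F f = Arf F g"
      by (rule U.iso_cancel_right[rotated -1]) (use R F_W[OF R(1)] in simp_all)
    then have "Arf F (Add T f (neg T g)) = Zer U (Obf F (Dom T (Add T f (neg T g)))) (Obf F (Cod T (Add T f (neg T g))))"
      using R by simp
    then obtain r where r: "r \<in> W" "Cod T r = Dom T s" "Add T f (neg T g) \<cdot> r = Zer T (Dom T r) Y"
      using faithful[of "Add T f (neg T g)"] R by auto
    have "f \<cdot> r = g \<cdot> r" by (rule Add_neg_eq_Zer[of _ _ "Dom T r" Y]) (use R r in auto)
    then have "q f = q g" using q_eq_iff[of f g] R r by auto
    then show "\<phi> = \<psi>" unfolding s(3,4) cls_fraction[OF s(1)] cls_fraction[OF s(2)] by simp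
  qed simp
next
  show "Arf F' \<phi> \<in> Hom U (Obf F X) (Obf F Y)" if "\<phi> \<in> Hom Q X Y" for X Y \<phi>
    using F'.F_Hom[OF that] by simp
next
  fix X Y \<phi> assume h: "X \<in> Ob T" "Y \<in> Ob T" "\<phi> \<in> Hom U (Obf F X) (Obf F Y)"
  then obtain s f where s: "s \<in> W" "f \<in> Arr T" "Dom T f = Dom T s" "Cod T s = X" "Cod T f = Y"
    "\<phi> \<cdot>\<^bsub>U\<^esub> Arf F s = Arf F f" using full[of X Y \<phi>] by (auto simp: U.in_Hom)
  have p: "\<phi> \<in> Arr U" "Dom U \<phi> = Obf F X" "Cod U \<phi> = Obf F Y" using h(3) by (auto simp: U.in_Hom)
  have r: "roof s f" using s by (simp add: roof_def)
  have "\<phi> = Arf F' (cls s f)" unfolding F'_cls[OF r] s(6)[symmetric] using s(1-5) p F_W[OF s(1)] by simp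
  then show "\<exists>\<psi> \<in> Hom Q X Y. \<phi> = Arf F' \<psi>" using r s(4,5) by (intro bexI[of _ "cls s f"]) (simp_all add: Q.in_Hom)
qed

text \<open>Together with \<open>F'_faithful\<close> this is the converse of the criterion. It
  unpacks the exactness hypothesis into lifts along denominators.\<close>

lemma F'_full:
  assumes "fully_faithful Q U F'" "X \<in> Ob T" "Y \<in> Ob T" "\<phi> \<in> Arr U" "Dom U \<phi> = Obf F X" "Cod U \<phi> = Obf F Y"
  obtains s f where "s \<in> W" "f \<in> Arr T" "Dom T f = Dom T s" "Cod T s = X" "Cod T f = Y" "\<phi> \<cdot>\<^bsub>U\<^esub> Arf F s = Arf F f"
proof -
  have "Arf F' ` Hom Q X Y = Hom U (Obf F X) (Obf F Y)"
    using assms(1-3) by (simp add: fully_faithful_def bij_betw_def)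
  moreover have "\<phi> \<in> Hom U (Obf F X) (Obf F Y)" using assms by (simp add: U.in_Hom)
  ultimately obtain \<psi> where p: "\<psi> \<in> Hom Q X Y" "Arf F' \<psi> = \<phi>" by force
  then obtain s f where s: "roof s f" "\<psi> = cls s f" "Cod T s = X" "Cod T f = Y" by (auto simp: Hom_Q_iff)
  note R = roofD[OF s(1)]
  have "\<phi> \<cdot>\<^bsub>U\<^esub> Arf F s = Arf F f" unfolding p(2)[symmetric] s(2) F'_cls[OF s(1)] using R F_W[OF R(1)] by simp
  then show ?thesis using that R s by blast
qed

lemma F'_faithful:
  assumes "fully_faithful Q U F'" "f \<in> Arr T" "Arf F f = Zer U (Obf F (Dom T f)) (Obf F (Cod T f))"
  obtains r where "r \<in> W" "Cod T r = Dom T f" "f \<cdot> r = Zer T (Dom T r) (Cod T f)"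
proof -
  have i: "inj_on (Arf F') (Hom Q (Dom T f) (Cod T f))"
    using assms(1,2) by (simp add: fully_faithful_def bij_betw_def)
  let ?z = "Zer T (Dom T f) (Cod T f)"
  have "Arf F' (q f) = Arf F' (q ?z)" using assms(2,3) F'_q[of ?z] by (simp del: q_Zer)
  then have "q f = q ?z" by (rule inj_onD[OF i]) (use assms(2) in \<open>simp_all add: Q.in_Hom del: q_Zer\<close>)
  then obtain r where "r \<in> W" "Cod T r = Dom T f" "f \<cdot> r = ?z \<cdot> r"
    using q_eq_iff[of f ?z] assms(2) by auto
  then show ?thesis using that assms(2) by simp
qed

end

section \<open>Short exact sequences of quotients\<close>

lemma verdier_quotient_iso_closure:
  assumes "tri_category \<kappa> k T" "N \<subseteq> Ob T"
  shows "verdier_quotient T (iso_closure T N) = verdier_quotient T N"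
  by (rule verdier_quotient_cong) (rule tri_category.cone_in_iso_closure[OF assms])

lemma tri_comp_sel [simp]: "Obf (tri_comp V G F) X = Obf G (Obf F X)" "Arf (tri_comp V G F) f = Arf G (Arf F f)"
  by (simp_all add: tri_comp_def)

lemma quotient_functor_sel [simp]: "Obf (quotient_functor T N) X = X" "Arf (quotient_functor T N) f = quotient_arrow T N f"
  by (simp_all add: quotient_functor_def)

lemma induced_verdier_functor:
  assumes "verdier \<kappa> k T N" "verdier \<kappa> k U M" "tri_functor k T U F" "Obf F ` N \<subseteq> M"
  shows "verdier_functor \<kappa> k T N (verdier_quotient U M)
    (tri_comp (verdier_quotient U M) (quotient_functor U M) F)"
proof -
  interpret T: verdier \<kappa> k T N by fact
  interpret U: verdier \<kappa> k U M by fact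
  have F: "tri_functor_pair \<kappa> k T U F"
    by (intro tri_functor_pair.intro tri_functor_pair_axioms.intro T.tri_category_axioms U.tri_category_axioms assms)
  show ?thesis
  proof (intro verdier_functor.intro verdier_functor_axioms.intro T.verdier_axioms U.tri_category_Q)
    show "tri_functor k T U.Q (tri_comp U.Q (quotient_functor U M) F)"
      by (rule tri_functor_comp[OF F U.tri_functor_pair_q])
    show "zero_object U.Q (Obf (tri_comp U.Q (quotient_functor U M) F) X)" if "X \<in> N" for X
      using U.zero_object_Q that assms(4) by auto
  qed
qed

text \<open>The formal half of the argument. Beyond the preservation of the
  \<open>N\<close>-classes, what is needed about compact objects is condensed into
  \<open>G_factor\<close> and \<open>F_retract\<close>, which the approximation theorem later
  provides.\<close>

locale quotient_sequence = V0: verdier \<kappa> k A0 N0 + V1: verdier \<kappa> k A1 N1 + V2: verdier \<kappa> k A2 N2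
  for \<kappa> :: "'u rel" and k :: "'r ring"
    and A0 :: "('r, 'o, 'm) tcat" (structure) and N0 :: "'o set"
    and A1 :: "('r, 'o1, 'm1) tcat" and N1 :: "'o1 set"
    and A2 :: "('r, 'o2, 'm2) tcat" and N2 :: "'o2 set" +
  fixes F :: "('o, 'm, 'o1, 'm1) tftr" and G :: "('o2, 'm2, 'o, 'm) tftr"
  assumes exact: "short_exact_up_to_summands \<kappa> k A1 F A0 G A2"
    and F_N: "Obf F ` N0 \<subseteq> N1" and G_N: "Obf G ` N2 \<subseteq> N0"
    and G_factor: "\<lbrakk>C \<in> N0; X \<in> Ob A2; f \<in> Arr A0; Dom A0 f = C; Cod A0 f = Obf G X\<rbrakk>
      \<Longrightarrow> \<exists>d g. d \<in> Arr A2 \<and> g \<in> Arr A0 \<and> Dom A2 d \<in> N2 \<and> Cod A2 d = X \<and> Dom A0 g = C \<and>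
            Cod A0 g = Obf G (Dom A2 d) \<and> Arf G d \<cdot> g = f"
    and F_retract: "B \<in> N1 \<Longrightarrow> \<exists>D i p. D \<in> N0 \<and> i \<in> Hom A1 B (Obf F D) \<and> p \<in> Hom A1 (Obf F D) B \<and>
            p \<cdot>\<^bsub>A1\<^esub> i = Id A1 B"
begin

abbreviation "iF \<equiv> induced_functor A1 N1 F"
abbreviation "iG \<equiv> induced_functor A0 N0 G"

lemma exactD: "tri_functor k A0 A1 F" "tri_functor k A2 A0 G" "fully_faithful A2 A0 G"
  "\<And>X. X \<in> Ob A2 \<Longrightarrow> zero_object A1 (Obf F (Obf G X))"
  "equivalence_up_to_summands (verdier_quotient A0 (Obf G ` Ob A2)) A1 (factor_quotient A1 F)"
  using exact by (auto simp: short_exact_up_to_summands_def)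

sublocale F: tri_functor_pair \<kappa> k A0 A1 F
  by (intro tri_functor_pair.intro tri_functor_pair_axioms.intro V0.tri_category_axioms V1.tri_category_axioms exactD)

sublocale G: tri_functor_pair \<kappa> k A2 A0 G
  by (intro tri_functor_pair.intro tri_functor_pair_axioms.intro V0.tri_category_axioms V2.tri_category_axioms exactD)

sublocale iF: verdier_functor \<kappa> k A0 N0 V1.Q "tri_comp V1.Q (quotient_functor A1 N1) F"
  by (rule induced_verdier_functor[OF V0.verdier_axioms V1.verdier_axioms exactD(1) F_N])

sublocale iG: verdier_functor \<kappa> k A2 N2 V0.Q "tri_comp V0.Q (quotient_functor A0 N0) G"
  by (rule induced_verdier_functor[OF V2.verdier_axioms V0.verdier_axioms exactD(2) G_N])

lemma induced_eq: "iF = iF.F'" "iG = iG.F'"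
  by (simp_all add: induced_functor_def)

lemma Obf_induced [simp]: "Obf iF X = Obf F X" "Obf iG Y = Obf G Y"
  by (simp_all add: induced_eq)

lemma iG_fully_faithful: "fully_faithful V2.Q V0.Q iG"
  unfolding induced_eq
proof (rule iG.fully_faithful_F'I)
  fix X Y \<phi> assume X: "X \<in> Ob A2" "Y \<in> Ob A2"
    and p: "\<phi> \<in> Arr V0.Q" "Dom V0.Q \<phi> = Obf (tri_comp V0.Q (quotient_functor A0 N0) G) X"
      "Cod V0.Q \<phi> = Obf (tri_comp V0.Q (quotient_functor A0 N0) G) Y"
  obtain s f where s: "s \<in> V0.W" "f \<in> Arr A0" "Dom A0 f = Dom A0 s" "Cod A0 s = Obf G X" "Cod A0 f = Obf G Y"
    and s1: "\<phi> \<cdot>\<^bsub>V0.Q\<^esub> V0.q s = V0.q f" by (rule V0.fraction[OF p(1)]) (use p in auto)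
  \<comment> \<open>The apex of the right fraction bears no relation to the image of
    \<open>G\<close>. Passing to a left fraction gives a denominator \<open>t\<close> that starts at
    \<open>Obf G Y\<close>, so that its fibre maps into the image of \<open>G\<close>.\<close>
  obtain t g where t: "t \<in> V0.W" "g \<in> Arr A0" "Cod A0 g = Cod A0 t" "Dom A0 t = Cod A0 f" "Dom A0 g = Cod A0 s"
    and t1: "g \<cdot> s = t \<cdot> f" by (rule V0.ore_left[OF s(1-3)])
  note A = X p s t V0.W_Arr[OF s(1)] V0.W_Arr[OF t(1)]
  have tp: "V0.q t \<cdot>\<^bsub>V0.Q\<^esub> \<phi> = V0.q g"
  proof (rule V0.Q.iso_cancel_right[OF V0.q_iso[OF s(1)]])
    have "(V0.q t \<cdot>\<^bsub>V0.Q\<^esub> \<phi>) \<cdot>\<^bsub>V0.Q\<^esub> V0.q s = V0.q (t \<cdot> f)" using A s1 by simp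
    also have "\<dots> = V0.q g \<cdot>\<^bsub>V0.Q\<^esub> V0.q s" unfolding t1[symmetric] using A by simp
    finally show "(V0.q t \<cdot>\<^bsub>V0.Q\<^esub> \<phi>) \<cdot>\<^bsub>V0.Q\<^esub> V0.q s = V0.q g \<cdot>\<^bsub>V0.Q\<^esub> V0.q s" .
  qed (use A in simp_all)
  obtain n h where n: "(n, t, h) \<in> Tri A0" "Dom A0 n \<in> N0" by (rule V0.W_weak_kernel[OF t(1)])
  note A = A V0.tri_Arr[OF n(1)]
  \<comment> \<open>The fibre \<open>n\<close> of \<open>t\<close> starts in \<open>N0\<close> and
    ends at \<open>Obf G Y\<close>, which is exactly the situation of
    \<open>G_factor\<close>.\<close>
  obtain d g' where d: "d \<in> Arr A2" "g' \<in> Arr A0" "Dom A2 d \<in> N2" "Cod A2 d = Y" "Dom A0 g' = Dom A0 n"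
      "Cod A0 g' = Obf G (Dom A2 d)" and d1: "Arf G d \<cdot> g' = n"
    using G_factor[OF n(2) X(2), of n] A by auto
  obtain s' h' where s': "(d, s', h') \<in> Tri A2" using V2.TR1_cone[OF d(1)] by blast
  note A = A d V2.tri_Arr[OF s']
  have sW: "s' \<in> V2.W" by (rule V2.W_I'[OF s' d(3)])
  have "Arf G s' \<cdot> n = Arf G (s' \<cdot>\<^bsub>A2\<^esub> d) \<cdot> g'" unfolding d1[symmetric] using A by simp
  also have "\<dots> = Zer A0 (Dom A0 n) (Obf G (Cod A2 s'))" unfolding V2.tri_comp_Zer[OF s'] using A by simp
  \<comment> \<open>As \<open>Arf G s'\<close> kills \<open>n\<close>, it factors through
    \<open>t\<close>. The denominator \<open>t\<close> is thereby replaced by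
    \<open>Arf G s'\<close>, and the new numerator \<open>m \<cdot> g\<close> runs between objects
    in the image of \<open>G\<close>.\<close>
  finally obtain m where m: "m \<in> Arr A0" "Dom A0 m = Cod A0 t" "Cod A0 m = Obf G (Cod A2 s')" "m \<cdot> t = Arf G s'"
    using V0.weak_cokernel[OF n(1), of "Arf G s'"] A by auto
  obtain f' where f': "f' \<in> Arr A2" "Dom A2 f' = X" "Cod A2 f' = Cod A2 s'" "Arf G f' = m \<cdot> g"
    by (rule G.ff_full[OF exactD(3), of X "Cod A2 s'" "m \<cdot> g"]) (use A m in auto)
  \<comment> \<open>Back to a right fraction, now inside \<open>A2\<close>.\<close>
  obtain s2 f2 where s2: "s2 \<in> V2.W" "f2 \<in> Arr A2" "Dom A2 f2 = Dom A2 s2" "Cod A2 s2 = X" "Cod A2 f2 = Y"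
      "s' \<cdot>\<^bsub>A2\<^esub> f2 = f' \<cdot>\<^bsub>A2\<^esub> s2"
    by (rule V2.ore[OF sW f'(1)]) (use f' A in auto)
  note A = A m(1-3) f'(1-3) s2(1-5) V2.W_Arr[OF s2(1)]
  have iso: "is_iso V0.Q (V0.q (Arf G s'))" using iG.F_W[OF sW] by simp
  have "\<phi> \<cdot>\<^bsub>V0.Q\<^esub> V0.q (Arf G s2) = V0.q (Arf G f2)"
  proof (rule V0.Q.iso_cancel_left[OF iso])
    have "V0.q (Arf G s') \<cdot>\<^bsub>V0.Q\<^esub> (\<phi> \<cdot>\<^bsub>V0.Q\<^esub> V0.q (Arf G s2)) = V0.q m \<cdot>\<^bsub>V0.Q\<^esub> ((V0.q t \<cdot>\<^bsub>V0.Q\<^esub> \<phi>) \<cdot>\<^bsub>V0.Q\<^esub> V0.q (Arf G s2))"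
      unfolding m(4)[symmetric] using A by simp
    also have "\<dots> = V0.q (m \<cdot> g) \<cdot>\<^bsub>V0.Q\<^esub> V0.q (Arf G s2)" unfolding tp using A by simp
    also have "\<dots> = V0.q (Arf G (f' \<cdot>\<^bsub>A2\<^esub> s2))" unfolding f'(4)[symmetric] using A by simp
    also have "\<dots> = V0.q (Arf G s') \<cdot>\<^bsub>V0.Q\<^esub> V0.q (Arf G f2)" unfolding s2(6)[symmetric] using A by simp
    finally show "V0.q (Arf G s') \<cdot>\<^bsub>V0.Q\<^esub> (\<phi> \<cdot>\<^bsub>V0.Q\<^esub> V0.q (Arf G s2)) = V0.q (Arf G s') \<cdot>\<^bsub>V0.Q\<^esub> V0.q (Arf G f2)" .
  qed (use A in simp_all)
  then show "\<exists>s f. s \<in> V2.W \<and> f \<in> Arr A2 \<and> Dom A2 f = Dom A2 s \<and> Cod A2 s = X \<and> Cod A2 f = Y \<and>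
      \<phi> \<cdot>\<^bsub>V0.Q\<^esub> Arf (tri_comp V0.Q (quotient_functor A0 N0) G) s = Arf (tri_comp V0.Q (quotient_functor A0 N0) G) f"
    using A by (intro exI[of _ s2] exI[of _ f2]) simp
next
  fix f assume f: "f \<in> Arr A2" and z: "Arf (tri_comp V0.Q (quotient_functor A0 N0) G) f =
      Zer V0.Q (Obf (tri_comp V0.Q (quotient_functor A0 N0) G) (Dom A2 f))
        (Obf (tri_comp V0.Q (quotient_functor A0 N0) G) (Cod A2 f))"
  have "V0.q (Arf G f) = V0.q (Zer A0 (Obf G (Dom A2 f)) (Obf G (Cod A2 f)))" using z by simp
  then obtain r where "r \<in> V0.W" "Cod A0 r = Obf G (Dom A2 f)" "Arf G f \<cdot> r = Zer A0 (Dom A0 r) (Obf G (Cod A2 f))"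
    using V0.q_eq_iff[of "Arf G f" "Zer A0 (Obf G (Dom A2 f)) (Obf G (Cod A2 f))"] f by auto
  \<comment> \<open>Vanishing in the quotient is a factorisation through an object of
    \<open>N0\<close>; \<open>G_factor\<close> then moves that object to an object of
    \<open>N2\<close>.\<close>
  then obtain x y where x: "x \<in> Arr A0" "y \<in> Arr A0" "Dom A0 x = Obf G (Dom A2 f)" "Cod A0 x = Dom A0 y"
      "Cod A0 y = Obf G (Cod A2 f)" "Cod A0 x \<in> N0" "y \<cdot> x = Arf G f"
    using V0.W_factor[of r "Arf G f"] f by auto
  obtain d g where d: "d \<in> Arr A2" "g \<in> Arr A0" "Dom A2 d \<in> N2" "Cod A2 d = Cod A2 f" "Dom A0 g = Cod A0 x"
      "Cod A0 g = Obf G (Dom A2 d)" "Arf G d \<cdot> g = y"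
    using G_factor[OF x(6), of "Cod A2 f" y] x f by auto
  obtain a where a: "a \<in> Arr A2" "Dom A2 a = Dom A2 f" "Cod A2 a = Dom A2 d" "Arf G a = g \<cdot> x"
    by (rule G.ff_full[OF exactD(3), of "Dom A2 f" "Dom A2 d" "g \<cdot> x"]) (use f d x in auto)
  have "Arf G (d \<cdot>\<^bsub>A2\<^esub> a) = (Arf G d \<cdot> g) \<cdot> x" using a d(1-6) x(1-5) by simp
  then have "Arf G (d \<cdot>\<^bsub>A2\<^esub> a) = Arf G f" unfolding d(7) x(7) .
  then have e: "d \<cdot>\<^bsub>A2\<^esub> a = f" by (intro G.ff_inj[OF exactD(3)]) (use a d f in simp_all)
  obtain r where "r \<in> V2.W" "Cod A2 r = Dom A2 a" "(d \<cdot>\<^bsub>A2\<^esub> a) \<cdot>\<^bsub>A2\<^esub> r = Zer A2 (Dom A2 r) (Cod A2 d)"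
    by (rule V2.kill[OF a(1) d(1)]) (use a d in auto)
  then show "\<exists>r. r \<in> V2.W \<and> Cod A2 r = Dom A2 f \<and> f \<cdot>\<^bsub>A2\<^esub> r = Zer A2 (Dom A2 r) (Cod A2 f)"
    unfolding e using a d by auto
qed

text \<open>The essential images of \<open>A2\<close> before and after passing to the quotients,
  closed under isomorphism as \<open>verdier\<close> requires.\<close>

abbreviation "M \<equiv> iso_closure A0 (Obf G ` Ob A2)"
abbreviation "M' \<equiv> iso_closure V0.Q (Obf iG ` Ob V2.Q)"

lemma verdier_functor_S: "verdier_functor \<kappa> k A0 M A1 F"
proof (intro verdier_functor.intro verdier_functor_axioms.intro V1.tri_category_axioms exactD(1))
  show "verdier \<kappa> k A0 M"
    by (rule verdier_image[OF G.tri_functor_pair_axioms exactD(3) V0.univ V0.skel])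
  show "zero_object A1 (Obf F X)" if X: "X \<in> M" for X
  proof -
    obtain Y where Y: "Y \<in> Ob A2" "isomorphic A0 (Obf G Y) X" using X unfolding iso_closure_def by blast
    have "isomorphic A1 (Obf F X) (Obf F (Obf G Y))"
      using F.F_isomorphic[OF Y(2)] V1.isomorphic_sym by blast
    then show ?thesis using V1.zero_object_iso[OF exactD(4)[OF Y(1)]] by blast
  qed
qed

sublocale S: verdier_functor \<kappa> k A0 M A1 F by (rule verdier_functor_S)

lemma S_ff: "fully_faithful S.Q A1 S.F'"
proof -
  have "S.Q = verdier_quotient A0 (Obf G ` Ob A2)"
    by (rule verdier_quotient_iso_closure[OF V0.tri_category_axioms]) auto
  then show ?thesis using exactD(5) by (simp add: equivalence_up_to_summands_def)
qed

lemma tri_functor_iG: "tri_functor k V2.Q V0.Q iG"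
  unfolding induced_eq by (rule iG.tri_functor_F')

lemma tri_functor_iF: "tri_functor k V0.Q V1.Q iF"
  unfolding induced_eq by (rule iF.tri_functor_F')

lemma zero_iF_iG: "X \<in> Ob A2 \<Longrightarrow> zero_object V1.Q (Obf iF (Obf iG X))"
  using V1.q_zero_object[OF exactD(4)] by simp

lemma verdier_functor_P: "verdier_functor \<kappa> k V0.Q M' V1.Q iF"
proof (intro verdier_functor.intro verdier_functor_axioms.intro V1.tri_category_Q tri_functor_iF)
  show "verdier \<kappa> k V0.Q M'"
    by (rule verdier_image[OF _ iG_fully_faithful V0.univ V0.skeletally_small_Q])
       (intro tri_functor_pair.intro tri_functor_pair_axioms.intro V2.tri_category_Q V0.tri_category_Q tri_functor_iG)
  show "zero_object V1.Q (Obf iF X)" if X: "X \<in> M'" for X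
  proof -
    obtain Y where Y: "Y \<in> Ob A2" "isomorphic V0.Q (Obf iG Y) X" using X unfolding iso_closure_def by auto
    have "isomorphic V1.Q (Obf iF X) (Obf iF (Obf iG Y))"
      using iF.F'.F_isomorphic[OF Y(2)] V1.Q.isomorphic_sym by (simp add: induced_eq)
    then show ?thesis using V1.Q.zero_object_iso[OF zero_iF_iG[OF Y(1)]] by blast
  qed
qed

sublocale P: verdier_functor \<kappa> k V0.Q M' V1.Q iF by (rule verdier_functor_P)

lemma M_M': "X \<in> M \<Longrightarrow> X \<in> M'"
  using V0.q.F_isomorphic unfolding iso_closure_def by auto

lemma S_W_P_W: assumes "s \<in> S.W" shows "V0.q s \<in> P.W"
proof -
  obtain g h where t: "(s, g, h) \<in> Tri A0" "Cod A0 g \<in> M" using assms by (auto simp: cone_in_def)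
  show ?thesis by (rule P.W_I[OF V0.q_Tri[OF t(1)]]) (use M_M'[OF t(2)] V0.tri_Arr[OF t(1)] in simp)
qed

lemma iF_q: "f \<in> Arr A0 \<Longrightarrow> Arf iF (V0.q f) = V1.q (Arf F f)"
  unfolding induced_eq by simp

lemma iF_fully_faithful: "fully_faithful P.Q V1.Q P.F'"
proof (rule P.fully_faithful_F'I)
  fix X Y \<phi> assume "X \<in> Ob V0.Q" "Y \<in> Ob V0.Q" and "\<phi> \<in> Arr V1.Q" "Dom V1.Q \<phi> = Obf iF X" "Cod V1.Q \<phi> = Obf iF Y"
  then have X: "X \<in> Ob A0" "Y \<in> Ob A0" and p: "\<phi> \<in> Arr V1.Q" "Dom V1.Q \<phi> = Obf F X" "Cod V1.Q \<phi> = Obf F Y"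
    by simp_all
  obtain t h where t: "t \<in> V1.W" "h \<in> Arr A1" "Dom A1 h = Dom A1 t" "Cod A1 t = Obf F X" "Cod A1 h = Obf F Y"
    and t1: "\<phi> \<cdot>\<^bsub>V1.Q\<^esub> V1.q t = V1.q h" by (rule V1.fraction[OF p(1)]) (use p in auto)
  obtain c c' where c: "(t, c, c') \<in> Tri A1" "Cod A1 c \<in> N1" using t(1) by (auto simp: cone_in_def)
  \<comment> \<open>The cone of \<open>t\<close> need not be in the image of \<open>F\<close>; it is
    replaced by some \<open>Obf F D\<close> of which it is a retract.\<close>
  obtain D i p' where D: "D \<in> N0" "i \<in> Arr A1" "Dom A1 i = Cod A1 c" "Cod A1 i = Obf F D"
      "p' \<in> Arr A1" "Dom A1 p' = Obf F D" "Cod A1 p' = Cod A1 c" and ip: "p' \<cdot>\<^bsub>A1\<^esub> i = Id A1 (Cod A1 c)"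
    using F_retract[OF c(2)] by (auto simp: V1.in_Hom)
  note A = X p t V1.W_Arr[OF t(1)] V1.tri_Arr[OF c(1)] D V0.N_Ob[OF D(1)]
  \<comment> \<open>By the exactness hypothesis the composite from \<open>Obf F X\<close> to
    \<open>Obf F D\<close> lifts to \<open>A0\<close>, up to a denominator with cone in
    \<open>M\<close>.\<close>
  obtain s1 g where s1: "s1 \<in> S.W" "g \<in> Arr A0" "Dom A0 g = Dom A0 s1" "Cod A0 s1 = X" "Cod A0 g = D"
      and s1g: "(i \<cdot>\<^bsub>A1\<^esub> c) \<cdot>\<^bsub>A1\<^esub> Arf F s1 = Arf F g"
    by (rule S.F'_full[OF S_ff X(1) V0.N_Ob[OF D(1)], of "i \<cdot>\<^bsub>A1\<^esub> c"]) (use A in auto)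
  \<comment> \<open>The cone of the fibre \<open>w\<close> is \<open>D\<close>, an object of
    \<open>N0\<close>, so \<open>w\<close> becomes invertible in the quotient; its image lifts along
    \<open>t\<close> up to \<open>s1\<close> because it annihilates the arrow to
    \<open>Obf F D\<close>.\<close>
  obtain w w' where w: "(w, g, w') \<in> Tri A0" by (rule V0.fibre[OF s1(2)])
  note A = A s1 S.W_Arr[OF s1(1)] V0.tri_Arr[OF w]
  have wW: "w \<in> V0.W" by (rule V0.W_I[OF w]) (use A in simp)
  have "i \<cdot>\<^bsub>A1\<^esub> (c \<cdot>\<^bsub>A1\<^esub> Arf F (s1 \<cdot> w)) = ((i \<cdot>\<^bsub>A1\<^esub> c) \<cdot>\<^bsub>A1\<^esub> Arf F s1) \<cdot>\<^bsub>A1\<^esub> Arf F w" using A by simp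
  also have "\<dots> = Arf F (g \<cdot> w)" unfolding s1g using A by simp
  also have "\<dots> = Zer A1 (Obf F (Dom A0 w)) (Obf F D)" unfolding V0.tri_comp_Zer[OF w] using A by simp
  finally have z: "i \<cdot>\<^bsub>A1\<^esub> (c \<cdot>\<^bsub>A1\<^esub> Arf F (s1 \<cdot> w)) = Zer A1 (Obf F (Dom A0 w)) (Obf F D)" .
  \<comment> \<open>The retraction \<open>p'\<close> removes the split monomorphism
    \<open>i\<close>, so already the composite with \<open>c\<close> vanishes.\<close>
  have "c \<cdot>\<^bsub>A1\<^esub> Arf F (s1 \<cdot> w) = (p' \<cdot>\<^bsub>A1\<^esub> i) \<cdot>\<^bsub>A1\<^esub> (c \<cdot>\<^bsub>A1\<^esub> Arf F (s1 \<cdot> w))" unfolding ip using A by simp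
  also have "\<dots> = p' \<cdot>\<^bsub>A1\<^esub> (i \<cdot>\<^bsub>A1\<^esub> (c \<cdot>\<^bsub>A1\<^esub> Arf F (s1 \<cdot> w)))" using A by simp
  also have "\<dots> = Zer A1 (Obf F (Dom A0 w)) (Cod A1 c)" unfolding z using A by simp
  finally have "c \<cdot>\<^bsub>A1\<^esub> Arf F (s1 \<cdot> w) = Zer A1 (Obf F (Dom A0 w)) (Cod A1 c)" .
  then obtain m where m: "m \<in> Arr A1" "Dom A1 m = Obf F (Dom A0 w)" "Cod A1 m = Dom A1 t" "t \<cdot>\<^bsub>A1\<^esub> m = Arf F (s1 \<cdot> w)"
    using V1.weak_kernel[OF c(1), of "Arf F (s1 \<cdot> w)"] A by auto
  \<comment> \<open>The numerator, now defined on the image of the source of \<open>w\<close>, is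
    lifted in the same way.\<close>
  obtain s2 g2 where s2: "s2 \<in> S.W" "g2 \<in> Arr A0" "Dom A0 g2 = Dom A0 s2" "Cod A0 s2 = Dom A0 w" "Cod A0 g2 = Y"
      and s2g: "(h \<cdot>\<^bsub>A1\<^esub> m) \<cdot>\<^bsub>A1\<^esub> Arf F s2 = Arf F g2"
    by (rule S.F'_full[OF S_ff _ X(2), of "Dom A0 w" "h \<cdot>\<^bsub>A1\<^esub> m"]) (use A m in auto)
  note A = A m(1-3) s2 S.W_Arr[OF s2(1)]
  \<comment> \<open>A denominator of mixed origin: \<open>w\<close> is invertible modulo
    \<open>N0\<close>, while \<open>s1\<close> and \<open>s2\<close> have cones in
    \<open>M\<close>.\<close>
  let ?\<sigma> = "V0.q s1 \<cdot>\<^bsub>V0.Q\<^esub> (V0.q w \<cdot>\<^bsub>V0.Q\<^esub> V0.q s2)"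
  have "V0.q w \<cdot>\<^bsub>V0.Q\<^esub> V0.q s2 \<in> P.W"
    by (rule P.W_Comp[OF S_W_P_W[OF s2(1)] P.W_iso[OF V0.q_iso[OF wW]]]) (use A in simp)
  then have sW: "?\<sigma> \<in> P.W" by (rule P.W_Comp[OF _ S_W_P_W[OF s1(1)]]) (use A in simp)
  have "\<phi> \<cdot>\<^bsub>V1.Q\<^esub> Arf iF ?\<sigma> = \<phi> \<cdot>\<^bsub>V1.Q\<^esub> Arf iF (V0.q (s1 \<cdot> w \<cdot> s2))" using A by simp
  also have "\<dots> = \<phi> \<cdot>\<^bsub>V1.Q\<^esub> V1.q (Arf F (s1 \<cdot> w) \<cdot>\<^bsub>A1\<^esub> Arf F s2)" using A by (subst iF_q) simp_all
  also have "\<dots> = (\<phi> \<cdot>\<^bsub>V1.Q\<^esub> V1.q t) \<cdot>\<^bsub>V1.Q\<^esub> V1.q (m \<cdot>\<^bsub>A1\<^esub> Arf F s2)" unfolding m(4)[symmetric] using A by simp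
  also have "\<dots> = V1.q ((h \<cdot>\<^bsub>A1\<^esub> m) \<cdot>\<^bsub>A1\<^esub> Arf F s2)" unfolding t1 using A by simp
  also have "\<dots> = Arf iF (V0.q g2)" unfolding s2g using A by (simp add: iF_q)
  finally have e: "\<phi> \<cdot>\<^bsub>V1.Q\<^esub> Arf iF ?\<sigma> = Arf iF (V0.q g2)" .
  show "\<exists>s f. s \<in> P.W \<and> f \<in> Arr V0.Q \<and> Dom V0.Q f = Dom V0.Q s \<and> Cod V0.Q s = X \<and> Cod V0.Q f = Y \<and>
      \<phi> \<cdot>\<^bsub>V1.Q\<^esub> Arf iF s = Arf iF f"
    by (rule exI[of _ ?\<sigma>], rule exI[of _ "V0.q g2"], intro conjI sW e) (use A in simp_all)
next
  fix f assume f: "f \<in> Arr V0.Q" and z: "Arf iF f = Zer V1.Q (Obf iF (Dom V0.Q f)) (Obf iF (Cod V0.Q f))"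
  obtain s g where s: "s \<in> V0.W" "g \<in> Arr A0" "Dom A0 g = Dom A0 s" "Cod A0 s = Dom V0.Q f" "Cod A0 g = Cod V0.Q f"
    and s1: "f \<cdot>\<^bsub>V0.Q\<^esub> V0.q s = V0.q g" by (rule V0.fraction[OF f])
  have fO: "Obf F (Dom V0.Q f) \<in> Ob A1" "Obf F (Cod V0.Q f) \<in> Ob A1" using f by simp_all
  have "V1.q (Arf F g) = Arf iF f \<cdot>\<^bsub>V1.Q\<^esub> Arf iF (V0.q s)"
    using arg_cong[OF s1, of "Arf iF"] s f by (simp add: iF_q)
  also have "\<dots> = V1.q (Zer A1 (Obf F (Dom A0 s)) (Obf F (Cod A0 g)))"
    unfolding z using s f fO by (simp add: iF_q)
  finally obtain r where "r \<in> V1.W" "Cod A1 r = Obf F (Dom A0 s)" "Arf F g \<cdot>\<^bsub>A1\<^esub> r = Zer A1 (Dom A1 r) (Obf F (Cod A0 g))"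
    using V1.q_eq_iff[of "Arf F g" "Zer A1 (Obf F (Dom A0 s)) (Obf F (Cod A0 g))"] s(1-3) by auto
  \<comment> \<open>The vanishing of the arrow is a factorisation of \<open>Arf F g\<close> through
    an object of \<open>N1\<close>. The aim is to lift this factorisation to
    \<open>A0\<close>.\<close>
  then obtain x y where x: "x \<in> Arr A1" "y \<in> Arr A1" "Dom A1 x = Obf F (Dom A0 s)" "Cod A1 x = Dom A1 y"
      "Cod A1 y = Obf F (Cod A0 g)" "Cod A1 x \<in> N1" "y \<cdot>\<^bsub>A1\<^esub> x = Arf F g"
    using V1.W_factor[of r "Arf F g"] s(1-3) by auto
  obtain D i p where D: "D \<in> N0" "i \<in> Arr A1" "Dom A1 i = Cod A1 x" "Cod A1 i = Obf F D"
      "p \<in> Arr A1" "Dom A1 p = Obf F D" "Cod A1 p = Cod A1 x" and ip: "p \<cdot>\<^bsub>A1\<^esub> i = Id A1 (Cod A1 x)"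
    using F_retract[OF x(6)] by (auto simp: V1.in_Hom)
  note A = f s V0.W_Arr[OF s(1)] x(1-6) D V0.N_Ob[OF D(1)]
  \<comment> \<open>Passing through \<open>Obf F D\<close> instead of the object of
    \<open>N1\<close> makes both halves arrows between objects in the image of \<open>F\<close>, so
    that each of them lifts.\<close>
  obtain s1 a1 where s1: "s1 \<in> S.W" "a1 \<in> Arr A0" "Dom A0 a1 = Dom A0 s1" "Cod A0 s1 = Dom A0 s" "Cod A0 a1 = D"
      and a1: "(i \<cdot>\<^bsub>A1\<^esub> x) \<cdot>\<^bsub>A1\<^esub> Arf F s1 = Arf F a1"
    by (rule S.F'_full[OF S_ff _ V0.N_Ob[OF D(1)], of "Dom A0 s" "i \<cdot>\<^bsub>A1\<^esub> x"]) (use A in auto)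
  obtain s2 b1 where s2: "s2 \<in> S.W" "b1 \<in> Arr A0" "Dom A0 b1 = Dom A0 s2" "Cod A0 s2 = D" "Cod A0 b1 = Cod A0 g"
      and b1: "(y \<cdot>\<^bsub>A1\<^esub> p) \<cdot>\<^bsub>A1\<^esub> Arf F s2 = Arf F b1"
    by (rule S.F'_full[OF S_ff V0.N_Ob[OF D(1)], of "Cod A0 g" "y \<cdot>\<^bsub>A1\<^esub> p"]) (use A in auto)
  \<comment> \<open>The second half lifts only after \<open>s2\<close>, so the Ore condition is
    needed before the two lifts can be composed.\<close>
  obtain s3 a3 where s3: "s3 \<in> S.W" "a3 \<in> Arr A0" "Dom A0 a3 = Dom A0 s3" "Cod A0 s3 = Dom A0 s1" "Cod A0 a3 = Dom A0 s2"
      and a3: "s2 \<cdot> a3 = a1 \<cdot> s3"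
    by (rule S.ore[OF s2(1) s1(2)]) (use s1 s2 in auto)
  note A = A s1 S.W_Arr[OF s1(1)] s2 S.W_Arr[OF s2(1)] s3 S.W_Arr[OF s3(1)]
  have "Arf F (b1 \<cdot> a3) = (y \<cdot>\<^bsub>A1\<^esub> p) \<cdot>\<^bsub>A1\<^esub> Arf F (s2 \<cdot> a3)" using A b1[symmetric] by simp
  also have "\<dots> = (y \<cdot>\<^bsub>A1\<^esub> p) \<cdot>\<^bsub>A1\<^esub> (((i \<cdot>\<^bsub>A1\<^esub> x) \<cdot>\<^bsub>A1\<^esub> Arf F s1) \<cdot>\<^bsub>A1\<^esub> Arf F s3)" unfolding a3 a1 using A by simp
  also have "\<dots> = y \<cdot>\<^bsub>A1\<^esub> ((p \<cdot>\<^bsub>A1\<^esub> i) \<cdot>\<^bsub>A1\<^esub> (x \<cdot>\<^bsub>A1\<^esub> Arf F (s1 \<cdot> s3)))" using A by simp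
  also have "\<dots> = (y \<cdot>\<^bsub>A1\<^esub> x) \<cdot>\<^bsub>A1\<^esub> Arf F (s1 \<cdot> s3)" unfolding ip using A by simp
  also have "\<dots> = Arf F (g \<cdot> (s1 \<cdot> s3))" unfolding x(7) using A by simp
  finally have e: "Arf F (b1 \<cdot> a3) = Arf F (g \<cdot> (s1 \<cdot> s3))" .
  let ?d = "Add A0 (b1 \<cdot> a3) (neg A0 (g \<cdot> (s1 \<cdot> s3)))"
  have d: "?d \<in> Arr A0" "Dom A0 ?d = Dom A0 s3" "Cod A0 ?d = Cod A0 g" using A by simp_all
  have "Arf F ?d = Add A1 (Arf F (b1 \<cdot> a3)) (neg A1 (Arf F (g \<cdot> (s1 \<cdot> s3))))"
    using A by (simp del: F.F_Comp)
  also have "\<dots> = Zer A1 (Obf F (Dom A0 ?d)) (Obf F (Cod A0 ?d))" unfolding e d(2,3) using A by (simp del: F.F_Comp)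
  \<comment> \<open>The lifted factorisation agrees with \<open>g\<close> only after applying
    \<open>F\<close>; faithfulness repairs this at the price of one more denominator.\<close>
  finally obtain s4 where s4: "s4 \<in> S.W" "Cod A0 s4 = Dom A0 s3" and s4d: "?d \<cdot> s4 = Zer A0 (Dom A0 s4) (Cod A0 g)"
    using S.F'_faithful[OF S_ff d(1)] d by metis
  note A = A s4 S.W_Arr[OF s4(1)]
  have e4: "(b1 \<cdot> a3) \<cdot> s4 = (g \<cdot> (s1 \<cdot> s3)) \<cdot> s4"
    by (rule V0.Add_neg_eq_Zer[of _ _ "Dom A0 s4" "Cod A0 g"]) (use A s4d in simp_all)
  \<comment> \<open>The lift passes through the source of \<open>s2\<close> rather than through
    \<open>D\<close>. Modulo \<open>N0\<close> the object \<open>D\<close> is zero and the cone of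
    \<open>s2\<close> lies in \<open>M\<close>, so this source lies in \<open>M'\<close>; arrows
    through it are killed by a denominator.\<close>
  obtain g2 h2 where t2: "(s2, g2, h2) \<in> Tri A0" "Cod A0 g2 \<in> M" using s2(1) by (auto simp: cone_in_def)
  have "Dom V0.Q (V0.q s2) \<in> M'"
    by (rule P.N_fibre[OF V0.q_Tri[OF t2(1)]])
       (use P.N_zero[OF V0.zero_object_Q[OF D(1)]] M_M'[OF t2(2)] V0.tri_Arr[OF t2(1)] A in simp_all)
  then have C2: "Dom A0 s2 \<in> M'" using A by simp
  obtain r where r: "r \<in> P.W" "Cod V0.Q r = Dom A0 s4"
      and r0: "(V0.q b1 \<cdot>\<^bsub>V0.Q\<^esub> V0.q (a3 \<cdot> s4)) \<cdot>\<^bsub>V0.Q\<^esub> r = Zer V0.Q (Dom V0.Q r) (Cod A0 g)"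
    by (rule P.kill[of "V0.q (a3 \<cdot> s4)" "V0.q b1"]) (use A C2 in auto)
  note A = A r P.W_Arr[OF r(1)]
  let ?r = "V0.q s \<cdot>\<^bsub>V0.Q\<^esub> (V0.q s1 \<cdot>\<^bsub>V0.Q\<^esub> (V0.q s3 \<cdot>\<^bsub>V0.Q\<^esub> (V0.q s4 \<cdot>\<^bsub>V0.Q\<^esub> r)))"
  have 4: "V0.q s4 \<cdot>\<^bsub>V0.Q\<^esub> r \<in> P.W" by (rule P.W_Comp[OF r(1) S_W_P_W[OF s4(1)]]) (use A in simp)
  have 3: "V0.q s3 \<cdot>\<^bsub>V0.Q\<^esub> (V0.q s4 \<cdot>\<^bsub>V0.Q\<^esub> r) \<in> P.W" by (rule P.W_Comp[OF 4 S_W_P_W[OF s3(1)]]) (use A in simp)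
  have 2: "V0.q s1 \<cdot>\<^bsub>V0.Q\<^esub> (V0.q s3 \<cdot>\<^bsub>V0.Q\<^esub> (V0.q s4 \<cdot>\<^bsub>V0.Q\<^esub> r)) \<in> P.W"
    by (rule P.W_Comp[OF 3 S_W_P_W[OF s1(1)]]) (use A in simp)
  have 1: "?r \<in> P.W" by (rule P.W_Comp[OF 2 P.W_iso[OF V0.q_iso[OF s(1)]]]) (use A in simp)
  have "f \<cdot>\<^bsub>V0.Q\<^esub> ?r = (f \<cdot>\<^bsub>V0.Q\<^esub> V0.q s) \<cdot>\<^bsub>V0.Q\<^esub> (V0.q s1 \<cdot>\<^bsub>V0.Q\<^esub> (V0.q s3 \<cdot>\<^bsub>V0.Q\<^esub> (V0.q s4 \<cdot>\<^bsub>V0.Q\<^esub> r)))"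
    using A by simp
  also have "\<dots> = V0.q ((g \<cdot> (s1 \<cdot> s3)) \<cdot> s4) \<cdot>\<^bsub>V0.Q\<^esub> r"
    unfolding \<open>f \<cdot>\<^bsub>V0.Q\<^esub> V0.q s = V0.q g\<close> using A by simp
  also have "\<dots> = (V0.q b1 \<cdot>\<^bsub>V0.Q\<^esub> V0.q (a3 \<cdot> s4)) \<cdot>\<^bsub>V0.Q\<^esub> r" unfolding e4[symmetric] using A by simp
  also have "\<dots> = Zer V0.Q (Dom V0.Q ?r) (Cod V0.Q f)" unfolding r0 using A by simp
  finally have "f \<cdot>\<^bsub>V0.Q\<^esub> ?r = Zer V0.Q (Dom V0.Q ?r) (Cod V0.Q f)" .
  moreover have "Cod V0.Q ?r = Dom V0.Q f" using A by simp
  ultimately show "\<exists>r. r \<in> P.W \<and> Cod V0.Q r = Dom V0.Q f \<and> f \<cdot>\<^bsub>V0.Q\<^esub> r = Zer V0.Q (Dom V0.Q r) (Cod V0.Q f)"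
    using 1 by blast
qed

theorem quotients_exact: "short_exact_up_to_summands \<kappa> k V1.Q iF V0.Q iG V2.Q"
  unfolding short_exact_up_to_summands_def
proof (intro conjI ballI V0.tri_category_Q V1.tri_category_Q V2.tri_category_Q tri_functor_iF tri_functor_iG
    iG_fully_faithful)
  show "zero_object V1.Q (Obf iF (Obf iG X))" if "X \<in> Ob V2.Q" for X
    using zero_iF_iG that by simp
  have eq: "verdier_quotient V0.Q (Obf iG ` Ob V2.Q) = P.Q"
    by (rule verdier_quotient_iso_closure[OF V0.tri_category_Q, symmetric]) auto
  show "equivalence_up_to_summands (verdier_quotient V0.Q (Obf iG ` Ob V2.Q)) V1.Q (factor_quotient V1.Q iF)"
    unfolding equivalence_up_to_summands_def eq
  proof (intro conjI ballI iF_fully_faithful)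
    fix Y assume "Y \<in> Ob V1.Q"
    then obtain X where X: "X \<in> Ob (verdier_quotient A0 (Obf G ` Ob A2))" "direct_summand A1 Y (Obf F X)"
      using exactD(5) by (auto simp: equivalence_up_to_summands_def)
    have "X \<in> Ob A0" using X(1) by (simp add: verdier_quotient_def verdier_precat_def)
    then have "X \<in> Ob P.Q" unfolding P.Ob_Q by simp
    \<comment> \<open>Biproducts are given by equations, so the quotient functor preserves them and
      density up to summands is inherited.\<close>
    moreover have "direct_summand V1.Q Y (Obf P.F' X)"
      unfolding P.Obf_F' Obf_induced using X(2) V1.q.F_biproduct unfolding direct_summand_def by auto
    ultimately show "\<exists>X\<in>Ob P.Q. direct_summand V1.Q Y (Obf P.F' X)" by blast
  qed
qed

end

section \<open>Coproducts and compact objects\<close>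

text \<open>
  Finite sums over the summands of a coproduct are avoided by working with the idempotents of \<open>B\<close> that project
  onto the summands indexed by \<open>J\<close>: a morphism factors through these summands iff the idempotent fixes it.
\<close>

definition is_cut :: "('r, 'o, 'm, 'z) lcat_scheme \<Rightarrow> 'i set \<Rightarrow> 'o \<Rightarrow> ('i \<Rightarrow> 'm) \<Rightarrow> 'i set \<Rightarrow> 'm \<Rightarrow> bool" where
  "is_cut C I B \<iota> J e \<longleftrightarrow> e \<in> Hom C B B \<and> (\<forall>i \<in> I. e \<cdot>\<^bsub>C\<^esub> \<iota> i = (if i \<in> J then \<iota> i else Zer C (Dom C (\<iota> i)) B))"

definition fin_supp :: "('r, 'o, 'm, 'z) lcat_scheme \<Rightarrow> 'i set \<Rightarrow> 'o \<Rightarrow> ('i \<Rightarrow> 'm) \<Rightarrow> 'm \<Rightarrow> bool" where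
  "fin_supp C I B \<iota> x \<longleftrightarrow> (\<exists>J e. finite J \<and> J \<subseteq> I \<and> is_cut C I B \<iota> J e \<and> e \<cdot>\<^bsub>C\<^esub> x = x)"

section \<open>Coproducts and their index sets\<close>

context category begin

lemma coproductD:
  assumes "coproduct C I Y B \<iota>"
  shows "B \<in> Ob C" "i \<in> I \<Longrightarrow> \<iota> i \<in> Arr C" "i \<in> I \<Longrightarrow> Dom C (\<iota> i) = Y i" "i \<in> I \<Longrightarrow> Cod C (\<iota> i) = B"
    "i \<in> I \<Longrightarrow> Y i \<in> Ob C"
proof -
  show "B \<in> Ob C" using assms by (simp add: coproduct_def)
  assume "i \<in> I"
  then show *: "\<iota> i \<in> Arr C" "Dom C (\<iota> i) = Y i" "Cod C (\<iota> i) = B" using assms by (auto simp: coproduct_def in_Hom)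
  show "Y i \<in> Ob C" using * Dom_in[of "\<iota> i"] by simp
qed

lemma coproduct_ex:
  assumes "coproduct C I Y B \<iota>" "Z \<in> Ob C" "\<And>i. i \<in> I \<Longrightarrow> g i \<in> Arr C" "\<And>i. i \<in> I \<Longrightarrow> Dom C (g i) = Y i"
    "\<And>i. i \<in> I \<Longrightarrow> Cod C (g i) = Z"
  obtains h where "h \<in> Arr C" "Dom C h = B" "Cod C h = Z" "\<And>i. i \<in> I \<Longrightarrow> h \<cdot> \<iota> i = g i"
proof -
  have "\<forall>i\<in>I. g i \<in> Hom C (Y i) Z" using assms by (auto simp: in_Hom)
  then obtain h where "h \<in> Hom C B Z" "\<forall>i\<in>I. h \<cdot> \<iota> i = g i"
    using assms(1,2) unfolding coproduct_def by blast
  then show ?thesis using that by (auto simp: in_Hom)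
qed

lemma coproduct_eq:
  assumes "coproduct C I Y B \<iota>" "h \<in> Arr C" "h' \<in> Arr C" "Dom C h = B" "Dom C h' = B" "Cod C h = Cod C h'"
    "\<And>i. i \<in> I \<Longrightarrow> h \<cdot> \<iota> i = h' \<cdot> \<iota> i"
  shows "h = h'"
proof -
  have "\<forall>i\<in>I. h' \<cdot> \<iota> i \<in> Hom C (Y i) (Cod C h')"
    using coproductD[OF assms(1)] assms by (auto simp: in_Hom)
  then have "\<exists>!k. k \<in> Hom C B (Cod C h') \<and> (\<forall>i\<in>I. k \<cdot> \<iota> i = h' \<cdot> \<iota> i)"
    using assms(1,3) unfolding coproduct_def by simp
  moreover have "h \<in> Hom C B (Cod C h') \<and> (\<forall>i\<in>I. h \<cdot> \<iota> i = h' \<cdot> \<iota> i)" using assms by (auto simp: in_Hom)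
  moreover have "h' \<in> Hom C B (Cod C h') \<and> (\<forall>i\<in>I. h' \<cdot> \<iota> i = h' \<cdot> \<iota> i)" using assms by (auto simp: in_Hom)
  ultimately show ?thesis by blast
qed

lemma coproductI:
  assumes "B \<in> Ob C" and \<iota>: "\<And>i. i \<in> I \<Longrightarrow> \<iota> i \<in> Arr C" "\<And>i. i \<in> I \<Longrightarrow> Dom C (\<iota> i) = Y i" "\<And>i. i \<in> I \<Longrightarrow> Cod C (\<iota> i) = B"
    and ex: "\<And>Z g. \<lbrakk>Z \<in> Ob C; \<And>i. i \<in> I \<Longrightarrow> g i \<in> Arr C; \<And>i. i \<in> I \<Longrightarrow> Dom C (g i) = Y i; \<And>i. i \<in> I \<Longrightarrow> Cod C (g i) = Z\<rbrakk>
      \<Longrightarrow> \<exists>h. h \<in> Arr C \<and> Dom C h = B \<and> Cod C h = Z \<and> (\<forall>i\<in>I. h \<cdot> \<iota> i = g i)"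
    and eq: "\<And>h h'. \<lbrakk>h \<in> Arr C; h' \<in> Arr C; Dom C h = B; Dom C h' = B; Cod C h = Cod C h';
      \<And>i. i \<in> I \<Longrightarrow> h \<cdot> \<iota> i = h' \<cdot> \<iota> i\<rbrakk> \<Longrightarrow> h = h'"
  shows "coproduct C I Y B \<iota>"
  unfolding coproduct_def
proof (intro conjI ballI allI impI)
  show "B \<in> Ob C" by fact
  show "\<iota> i \<in> Hom C (Y i) B" if "i \<in> I" for i using \<iota>[OF that] by (simp add: in_Hom)
  fix Z g assume Z: "Z \<in> Ob C" and "\<forall>i\<in>I. g i \<in> Hom C (Y i) Z"
  then have g: "\<And>i. i \<in> I \<Longrightarrow> g i \<in> Arr C" "\<And>i. i \<in> I \<Longrightarrow> Dom C (g i) = Y i" "\<And>i. i \<in> I \<Longrightarrow> Cod C (g i) = Z"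
    by (auto simp: in_Hom)
  obtain h where h: "h \<in> Arr C" "Dom C h = B" "Cod C h = Z" "\<forall>i\<in>I. h \<cdot> \<iota> i = g i" using ex[OF Z g] by blast
  show "\<exists>!h. h \<in> Hom C B Z \<and> (\<forall>i\<in>I. h \<cdot> \<iota> i = g i)"
  proof (rule ex1I[of _ h])
    show "h \<in> Hom C B Z \<and> (\<forall>i\<in>I. h \<cdot> \<iota> i = g i)" using h by (simp add: in_Hom)
    show "h' = h" if "h' \<in> Hom C B Z \<and> (\<forall>i\<in>I. h' \<cdot> \<iota> i = g i)" for h'
      by (rule eq) (use that h in \<open>auto simp: in_Hom\<close>)
  qed
qed

lemma coproduct_reindex:
  assumes "inj_on e I" "coproduct C (e ` I) Y B \<iota>"
  shows "coproduct C I (\<lambda>i. Y (e i)) B (\<lambda>i. \<iota> (e i))"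
proof (rule coproductI)
  note D = coproductD[OF assms(2)]
  show "B \<in> Ob C" by (rule D(1))
  show "\<And>i. i \<in> I \<Longrightarrow> \<iota> (e i) \<in> Arr C" "\<And>i. i \<in> I \<Longrightarrow> Dom C (\<iota> (e i)) = Y (e i)" "\<And>i. i \<in> I \<Longrightarrow> Cod C (\<iota> (e i)) = B"
    using D by auto
  fix Z g assume Z: "Z \<in> Ob C" "\<And>i. i \<in> I \<Longrightarrow> g i \<in> Arr C" "\<And>i. i \<in> I \<Longrightarrow> Dom C (g i) = Y (e i)" "\<And>i. i \<in> I \<Longrightarrow> Cod C (g i) = Z"
  obtain h where "h \<in> Arr C" "Dom C h = B" "Cod C h = Z" "\<And>j. j \<in> e ` I \<Longrightarrow> h \<cdot> \<iota> j = g (inv_into I e j)"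
    by (rule coproduct_ex[OF assms(2) Z(1), of "\<lambda>j. g (inv_into I e j)"]) (use Z assms(1) in auto)
  then show "\<exists>h. h \<in> Arr C \<and> Dom C h = B \<and> Cod C h = Z \<and> (\<forall>i\<in>I. h \<cdot> \<iota> (e i) = g i)"
    using assms(1) by (intro exI[of _ h]) auto
next
  fix h h' assume h: "h \<in> Arr C" "h' \<in> Arr C" "Dom C h = B" "Dom C h' = B" "Cod C h = Cod C h'"
    "\<And>i. i \<in> I \<Longrightarrow> h \<cdot> \<iota> (e i) = h' \<cdot> \<iota> (e i)"
  have "h \<cdot> \<iota> j = h' \<cdot> \<iota> j" if "j \<in> e ` I" for j using that h(6) by blast
  then show "h = h'" using coproduct_eq[OF assms(2) h(1-5)] by blast
qed

end

lemma small_inj: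
  fixes \<kappa> :: "'u rel"
  assumes "universe_card \<kappa>" "small \<kappa> I" obtains e :: "'i \<Rightarrow> 'u" where "inj_on e I"
proof -
  have "(card_of I, card_of (Field \<kappa>)) \<in> ordLeq"
    using assms by (metis small_def universe_card_def card_of_Field_ordIso ordIso_symmetric ordLess_imp_ordLeq
        ordLeq_ordIso_trans)
  then obtain e :: "'i \<Rightarrow> 'u" where "inj_on e I" using card_of_ordLeq[of I "Field \<kappa>"] by auto
  then show ?thesis by (rule that)
qed

text \<open>The definition only quantifies over subsets of \<open>'u\<close>, while coproducts
  indexed by sets of arrows and by natural numbers are needed; an injection into \<open>'u\<close>
  transfers them.\<close>

lemma (in category) has_direct_sums_any:
  fixes I :: "'i set" and \<kappa> :: "'u rel"
  assumes "universe_card \<kappa>" "has_direct_sums \<kappa> C" "small \<kappa> I" "\<And>i. i \<in> I \<Longrightarrow> Y i \<in> Ob C"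
  obtains B \<iota> where "coproduct C I Y B \<iota>"
proof -
  obtain e :: "'i \<Rightarrow> 'u" where e: "inj_on e I" using small_inj[OF assms(1,3)] .
  have "small \<kappa> (e ` I) \<and> (\<forall>j\<in>e ` I. Y (inv_into I e j) \<in> Ob C)" using assms(4) e small_image[OF assms(3)] by auto
  from assms(2)[unfolded has_direct_sums_def, THEN spec, THEN spec, THEN mp, OF this]
  obtain B \<iota> where B: "coproduct C (e ` I) (\<lambda>j. Y (inv_into I e j)) B \<iota>" by blast
  have "coproduct C I (\<lambda>i. Y (inv_into I e (e i))) B (\<lambda>i. \<iota> (e i))" by (rule coproduct_reindex[OF e B])
  moreover have "coproduct C I (\<lambda>i. Y (inv_into I e (e i))) B (\<lambda>i. \<iota> (e i)) = coproduct C I Y B (\<lambda>i. \<iota> (e i))"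
    unfolding coproduct_def using e by simp
  ultimately show ?thesis using that by blast
qed

section \<open>Projections onto partial coproducts, and compactness as finite support\<close>

context lin_category begin

lemma is_cutD:
  assumes "is_cut C I B \<iota> J e"
  shows "e \<in> Arr C" "Dom C e = B" "Cod C e = B" "\<lbrakk>i \<in> I; i \<in> J\<rbrakk> \<Longrightarrow> e \<cdot> \<iota> i = \<iota> i"
    "\<lbrakk>i \<in> I; i \<notin> J\<rbrakk> \<Longrightarrow> e \<cdot> \<iota> i = Zer C (Dom C (\<iota> i)) B"
  using assms by (auto simp: is_cut_def in_Hom)

lemma cut_ex:
  assumes "coproduct C I Y B \<iota>" obtains e where "is_cut C I B \<iota> J e"
proof -
  note D = coproductD[OF assms]
  obtain e where "e \<in> Arr C" "Dom C e = B" "Cod C e = B"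
      "\<And>i. i \<in> I \<Longrightarrow> e \<cdot> \<iota> i = (if i \<in> J then \<iota> i else Zer C (Dom C (\<iota> i)) B)"
    by (rule coproduct_ex[OF assms D(1), of "\<lambda>i. if i \<in> J then \<iota> i else Zer C (Dom C (\<iota> i)) B"])
       (use D in auto)
  then show ?thesis using that by (auto simp: is_cut_def in_Hom)
qed

lemma cut_unique:
  assumes "coproduct C I Y B \<iota>" "is_cut C I B \<iota> J e" "is_cut C I B \<iota> J e'" shows "e = e'"
  by (rule coproduct_eq[OF assms(1)]) (use assms(2,3) in \<open>auto simp: is_cut_def in_Hom\<close>)

text \<open>For \<open>J = K\<close> this says that the cut is idempotent; in general it allows
  supports to be enlarged and merged.\<close>

lemma cut_mono:
  assumes "coproduct C I Y B \<iota>" "is_cut C I B \<iota> J e" "is_cut C I B \<iota> K e'" "J \<subseteq> K"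
  shows "e' \<cdot> e = e"
proof (rule coproduct_eq[OF assms(1)])
  note D = coproductD[OF assms(1)] is_cutD[OF assms(2)] is_cutD[OF assms(3)]
  fix i assume i: "i \<in> I"
  show "(e' \<cdot> e) \<cdot> \<iota> i = e \<cdot> \<iota> i"
  proof (cases "i \<in> J")
    case True
    then have "i \<in> K" using assms(4) by blast
    then show ?thesis using D(4)[OF i] D(2)[OF i] D(9)[OF i True] D(14)[OF i] D(6-8) D(11-13) by simp
  next
    case False
    then show ?thesis using D(4)[OF i] D(2)[OF i] D(3)[OF i] D(5)[OF i] D(10)[OF i False] D(1) D(6-8) D(11-13) by simp
  qed
qed (use is_cutD[OF assms(2)] is_cutD[OF assms(3)] in auto)

lemma fin_supp_mono:
  assumes "coproduct C I Y B \<iota>" "is_cut C I B \<iota> J e" "is_cut C I B \<iota> K e'" "J \<subseteq> K"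
    "x \<in> Arr C" "Cod C x = B" "e \<cdot> x = x"
  shows "e' \<cdot> x = x"
proof -
  have "e' \<cdot> x = (e' \<cdot> e) \<cdot> x" using assms(5-7) is_cutD[OF assms(2)] is_cutD[OF assms(3)] by simp
  then show ?thesis unfolding cut_mono[OF assms(1-4)] assms(7) .
qed

lemma fin_supp2:
  assumes "coproduct C I Y B \<iota>" "fin_supp C I B \<iota> x" "fin_supp C I B \<iota> y"
    "x \<in> Arr C" "Cod C x = B" "y \<in> Arr C" "Cod C y = B"
  obtains J e where "finite J" "J \<subseteq> I" "is_cut C I B \<iota> J e" "e \<cdot> x = x" "e \<cdot> y = y"
proof -
  obtain J e K e' where J: "finite J" "J \<subseteq> I" "is_cut C I B \<iota> J e" "e \<cdot> x = x"
    "finite K" "K \<subseteq> I" "is_cut C I B \<iota> K e'" "e' \<cdot> y = y" using assms(2,3) unfolding fin_supp_def by blast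
  obtain c where c: "is_cut C I B \<iota> (J \<union> K) c" by (rule cut_ex[OF assms(1)])
  show ?thesis using that[of "J \<union> K" c] J c fin_supp_mono[OF assms(1) J(3) c _ assms(4,5) J(4)]
      fin_supp_mono[OF assms(1) J(7) c _ assms(6,7) J(8)] by blast
qed

lemma coproduct_proj:
  assumes "coproduct C I Y B \<iota>"
  obtains \<pi> where "\<forall>i\<in>I. \<pi> i \<in> Arr C \<and> Dom C (\<pi> i) = B \<and> Cod C (\<pi> i) = Y i \<and>
      (\<forall>j\<in>I. \<pi> i \<cdot> \<iota> j = (if j = i then Id C (Y i) else Zer C (Y j) (Y i)))"
proof -
  note D = coproductD[OF assms]
  have "\<exists>p. p \<in> Arr C \<and> Dom C p = B \<and> Cod C p = Y i \<and> (\<forall>j\<in>I. p \<cdot> \<iota> j = (if j = i then Id C (Y i) else Zer C (Y j) (Y i)))"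
    if i: "i \<in> I" for i
  proof -
    obtain p where "p \<in> Arr C" "Dom C p = B" "Cod C p = Y i"
      "\<And>j. j \<in> I \<Longrightarrow> p \<cdot> \<iota> j = (if j = i then Id C (Y i) else Zer C (Y j) (Y i))"
      by (rule coproduct_ex[OF assms D(5)[OF i], of "\<lambda>j. if j = i then Id C (Y i) else Zer C (Y j) (Y i)"])
         (use D(5) i in auto)
    then show ?thesis by blast
  qed
  then have "\<exists>\<pi>. \<forall>i\<in>I. \<pi> i \<in> Arr C \<and> Dom C (\<pi> i) = B \<and> Cod C (\<pi> i) = Y i \<and>
      (\<forall>j\<in>I. \<pi> i \<cdot> \<iota> j = (if j = i then Id C (Y i) else Zer C (Y j) (Y i)))"
    by (intro bchoice ballI)
  then show ?thesis using that by blast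
qed

lemma proj_cut:
  assumes c: "coproduct C I Y B \<iota>" and e: "is_cut C I B \<iota> J e" and i: "i \<in> I" "i \<notin> J"
    and p: "p \<in> Arr C" "Dom C p = B" "Cod C p = Y i" "\<And>j. \<lbrakk>j \<in> I; j \<noteq> i\<rbrakk> \<Longrightarrow> p \<cdot> \<iota> j = Zer C (Y j) (Y i)"
  shows "p \<cdot> e = Zer C B (Y i)"
proof (rule coproduct_eq[OF c])
  note D = coproductD[OF c] is_cutD[OF e]
  fix j assume j: "j \<in> I"
  show "(p \<cdot> e) \<cdot> \<iota> j = Zer C B (Y i) \<cdot> \<iota> j"
  proof (cases "j \<in> J")
    case True
    then have "j \<noteq> i" using i by blast
    then show ?thesis using D(1) D(2-5)[OF j] D(6-8) D(9)[OF j True] p(1-3) p(4)[OF j] D(5)[OF i(1)] by simp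
  next
    case False
    then show ?thesis using D(1) D(2-5)[OF j] D(6-8) D(10)[OF j False] p(1-3) D(5)[OF i(1)] by simp
  qed
qed (use coproductD[OF c] is_cutD[OF e] p i in auto)

lemma cut_insert:
  assumes c: "coproduct C I Y B \<iota>" and e: "is_cut C I B \<iota> J e" and i: "i \<in> I" "i \<notin> J"
    and p: "p \<in> Arr C" "Dom C p = B" "Cod C p = Y i" "p \<cdot> \<iota> i = Id C (Y i)" "\<And>j. \<lbrakk>j \<in> I; j \<noteq> i\<rbrakk> \<Longrightarrow> p \<cdot> \<iota> j = Zer C (Y j) (Y i)"
  shows "is_cut C I B \<iota> (insert i J) (Add C (\<iota> i \<cdot> p) e)"
  unfolding is_cut_def
proof (intro conjI ballI)
  note D = coproductD[OF c] is_cutD[OF e] and Di = coproductD(2-5)[OF c, of i]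
  show "Add C (\<iota> i \<cdot> p) e \<in> Hom C B B" using Di D(6-8) i p by (simp add: in_Hom)
  fix j assume j: "j \<in> I"
  show "Add C (\<iota> i \<cdot> p) e \<cdot> \<iota> j = (if j \<in> insert i J then \<iota> j else Zer C (Dom C (\<iota> j)) B)"
  proof (cases "j = i")
    case True
    then show ?thesis using Di i p(1-4) D(6-8) D(10)[OF i] by simp
  next
    case False
    have "p \<cdot> \<iota> j = Zer C (Y j) (Y i)" by (rule p(5)[OF j False])
    then show ?thesis using False Di i p(1-3) D(1) D(2-5)[OF j] D(6-8) D(9)[OF j] D(10)[OF j] by simp
  qed
qed

lemma cut_empty: "coproduct C I Y B \<iota> \<Longrightarrow> is_cut C I B \<iota> {} (Zer C B B)"
  using coproductD[of I Y B \<iota>] by (simp add: is_cut_def in_Hom)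

lemma hsum_insert:
  assumes "finite A" "a \<notin> A" "\<And>i. i \<in> insert a A \<Longrightarrow> f i \<in> Hom C X B" "X \<in> Ob C" "B \<in> Ob C"
  shows "finsum (Hom_module C X B) f (insert a A) = Add C (f a) (finsum (Hom_module C X B) f A)"
proof -
  interpret M: abelian_group "Hom_module C X B" by (rule Hom_group[OF assms(4,5)])
  show ?thesis using M.finsum_insert[OF assms(1,2), of f] assms(3) by auto
qed

lemma hsum_closed:
  assumes "\<And>i. i \<in> A \<Longrightarrow> f i \<in> Hom C X B" "X \<in> Ob C" "B \<in> Ob C"
  shows "finsum (Hom_module C X B) f A \<in> Hom C X B"
proof -
  interpret M: abelian_group "Hom_module C X B" by (rule Hom_group[OF assms(2,3)])
  show ?thesis using M.finsum_closed[of f A] assms(1) by auto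
qed

lemma hsum_cong:
  assumes "\<And>i. i \<in> A \<Longrightarrow> f i = g i" "\<And>i. i \<in> A \<Longrightarrow> g i \<in> Hom C X B" "X \<in> Ob C" "B \<in> Ob C"
  shows "finsum (Hom_module C X B) f A = finsum (Hom_module C X B) g A"
proof -
  interpret M: abelian_group "Hom_module C X B" by (rule Hom_group[OF assms(3,4)])
  show ?thesis by (rule M.finsum_cong') (use assms in auto)
qed

lemma hsum_empty: "\<lbrakk>X \<in> Ob C; B \<in> Ob C\<rbrakk> \<Longrightarrow> finsum (Hom_module C X B) f {} = Zer C X B"
  using abelian_monoid.finsum_empty[OF abelian_group.axioms(1)[OF Hom_group], of X B f] by simp

lemma hsum_neutral:
  assumes "finite A" "K \<subseteq> A" "\<And>i. i \<in> A - K \<Longrightarrow> f i = Zer C X B" "\<And>i. i \<in> A \<Longrightarrow> f i \<in> Hom C X B" "X \<in> Ob C" "B \<in> Ob C"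
  shows "finsum (Hom_module C X B) f K = finsum (Hom_module C X B) f A"
proof -
  interpret M: abelian_group "Hom_module C X B" by (rule Hom_group[OF assms(5,6)])
  show ?thesis by (rule M.add.finprod_mono_neutral_cong_left) (use assms in auto)
qed

lemma Comp_hsum:
  assumes "finite A" "\<And>i. i \<in> A \<Longrightarrow> f i \<in> Hom C X B" "e \<in> Hom C B Z" "X \<in> Ob C"
  shows "e \<cdot> finsum (Hom_module C X B) f A = finsum (Hom_module C X Z) (\<lambda>i. e \<cdot> f i) A"
  using assms(1,2)
proof (induction A)
  case empty
  then show ?case using assms(3,4) by (auto simp: hsum_empty in_Hom)
next
  case (insert a A)
  have o: "B \<in> Ob C" "Z \<in> Ob C" using assms(3) by (auto simp: in_Hom)
  have 1: "finsum (Hom_module C X B) f A \<in> Hom C X B" by (rule hsum_closed[OF insert.prems assms(4) o(1)]) simp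
  have 2: "e \<cdot> f i \<in> Hom C X Z" if "i \<in> insert a A" for i
    using insert.prems[OF that] assms(3) by (simp add: in_Hom)
  have "finsum (Hom_module C X B) f (insert a A) = Add C (f a) (finsum (Hom_module C X B) f A)"
    by (rule hsum_insert[OF insert.hyps insert.prems assms(4) o(1)])
  moreover have "finsum (Hom_module C X Z) (\<lambda>i. e \<cdot> f i) (insert a A) =
      Add C (e \<cdot> f a) (finsum (Hom_module C X Z) (\<lambda>i. e \<cdot> f i) A)"
    by (rule hsum_insert[OF insert.hyps 2 assms(4) o(2)])
  ultimately show ?case using insert.IH insert.prems insert.prems[of a] 1 assms(3) by (simp add: in_Hom)
qed

text \<open>The cut at a finite set is the sum of the composites
  \<open>\<iota> i \<cdot> \<pi> i\<close> over that set. This connects cuts with the finite sums in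
  the definition of compactness.\<close>

lemma cut_hsum:
  assumes c: "coproduct C I Y B \<iota>" and "finite J" "J \<subseteq> I" "is_cut C I B \<iota> J e" "x \<in> Hom C X B"
    and p: "\<And>i. i \<in> I \<Longrightarrow> \<pi> i \<in> Arr C" "\<And>i. i \<in> I \<Longrightarrow> Dom C (\<pi> i) = B" "\<And>i. i \<in> I \<Longrightarrow> Cod C (\<pi> i) = Y i"
    "\<And>i. i \<in> I \<Longrightarrow> \<pi> i \<cdot> \<iota> i = Id C (Y i)" "\<And>i j. \<lbrakk>i \<in> I; j \<in> I; j \<noteq> i\<rbrakk> \<Longrightarrow> \<pi> i \<cdot> \<iota> j = Zer C (Y j) (Y i)"
  shows "e \<cdot> x = finsum (Hom_module C X B) (\<lambda>i. \<iota> i \<cdot> (\<pi> i \<cdot> x)) J"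
  using assms(2-4)
proof (induction J arbitrary: e)
  case empty
  have x: "x \<in> Arr C" "Dom C x = X" "Cod C x = B" "X \<in> Ob C" "B \<in> Ob C" using assms(5) by (auto simp: in_Hom)
  have "e = Zer C B B" by (rule cut_unique[OF c empty(2) cut_empty[OF c]])
  then show ?case using x by (simp add: hsum_empty)
next
  case (insert i J)
  have x: "x \<in> Arr C" "Dom C x = X" "Cod C x = B" "X \<in> Ob C" "B \<in> Ob C" using assms(5) by (auto simp: in_Hom)
  have i: "i \<in> I" "J \<subseteq> I" using insert.prems by auto
  obtain e' where e': "is_cut C I B \<iota> J e'" by (rule cut_ex[OF c])
  note E = is_cutD(1-3)[OF e'] coproductD(2-5)[OF c i(1)] p(1-3)[OF i(1)]
  have "is_cut C I B \<iota> (insert i J) (Add C (\<iota> i \<cdot> \<pi> i) e')"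
    by (rule cut_insert[OF c e' i(1) insert.hyps(2) p(1-4)[OF i(1)] p(5)[OF i(1)]])
  then have "e = Add C (\<iota> i \<cdot> \<pi> i) e'" using cut_unique[OF c insert.prems(2)] by blast
  then have "e \<cdot> x = Add C (\<iota> i \<cdot> (\<pi> i \<cdot> x)) (e' \<cdot> x)" using E x by simp
  also have "e' \<cdot> x = finsum (Hom_module C X B) (\<lambda>i. \<iota> i \<cdot> (\<pi> i \<cdot> x)) J" by (rule insert.IH[OF i(2) e'])
  also have "Add C (\<iota> i \<cdot> (\<pi> i \<cdot> x)) \<dots> = finsum (Hom_module C X B) (\<lambda>i. \<iota> i \<cdot> (\<pi> i \<cdot> x)) (insert i J)"
  proof (rule hsum_insert[symmetric])
    fix j assume "j \<in> insert i J"
    then have "j \<in> I" using i by auto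
    then show "\<iota> j \<cdot> (\<pi> j \<cdot> x) \<in> Hom C X B" using coproductD(2-5)[OF c, of j] p(1-3)[of j] x by (simp add: in_Hom)
  qed (use insert.hyps x in auto)
  finally show ?case .
qed

text \<open>Projections recover the summands, which makes the comparison map of compactness
  injective for every object.\<close>

lemma proj_hsum:
  assumes c: "coproduct C I Y B \<iota>" and f: "\<And>i. i \<in> I \<Longrightarrow> f i \<in> Hom C X (Y i)" and J: "finite J" "J \<subseteq> I"
    "\<And>i. i \<in> I - J \<Longrightarrow> f i = Zer C X (Y i)" and X: "X \<in> Ob C"
    and i: "i \<in> I" and p: "p \<in> Arr C" "Dom C p = B" "Cod C p = Y i" "p \<cdot> \<iota> i = Id C (Y i)"
      "\<And>j. \<lbrakk>j \<in> I; j \<noteq> i\<rbrakk> \<Longrightarrow> p \<cdot> \<iota> j = Zer C (Y j) (Y i)"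
  shows "p \<cdot> finsum (Hom_module C X B) (\<lambda>i. \<iota> i \<cdot> f i) J = f i"
proof -
  note D = coproductD[OF c]
  have h: "\<iota> j \<cdot> f j \<in> Hom C X B" if "j \<in> I" for j using D(2-5)[OF that] f[OF that] by (simp add: in_Hom)
  have t: "p \<cdot> (\<iota> j \<cdot> f j) = (if j = i then f i else Zer C X (Y i))" if "j \<in> I" for j
  proof -
    have "p \<cdot> (\<iota> j \<cdot> f j) = (p \<cdot> \<iota> j) \<cdot> f j" using D(2-5)[OF that] f[OF that] p(1-3) by (simp add: in_Hom)
    then show ?thesis using p(4,5) that D(5)[OF that] f[OF that] D(5)[OF i] by (auto simp: in_Hom)
  qed
  have fi: "f i \<in> Hom C X (Y i)" "Y i \<in> Ob C" using f[OF i] D(5)[OF i] by auto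
  have "p \<cdot> finsum (Hom_module C X B) (\<lambda>i. \<iota> i \<cdot> f i) J = finsum (Hom_module C X (Y i)) (\<lambda>j. p \<cdot> (\<iota> j \<cdot> f j)) J"
    by (rule Comp_hsum[OF J(1)]) (use h J X p in \<open>auto simp: in_Hom\<close>)
  also have "\<dots> = finsum (Hom_module C X (Y i)) (\<lambda>j. if j = i then f i else Zer C X (Y i)) J"
    by (rule hsum_cong) (use t J fi X in \<open>auto simp: in_Hom\<close>)
  also have "\<dots> = f i"
  proof (cases "i \<in> J")
    case True
    have "finsum (Hom_module C X (Y i)) (\<lambda>j. if j = i then f i else Zer C X (Y i)) {i} =
        finsum (Hom_module C X (Y i)) (\<lambda>j. if j = i then f i else Zer C X (Y i)) J"
      by (rule hsum_neutral) (use True J fi X in \<open>auto simp: in_Hom\<close>)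
    moreover have "finsum (Hom_module C X (Y i)) (\<lambda>j. if j = i then f i else Zer C X (Y i)) {i} = f i"
      by (subst hsum_insert) (use fi X in \<open>auto simp: in_Hom hsum_empty\<close>)
    ultimately show ?thesis by simp
  next
    case False
    have "finsum (Hom_module C X (Y i)) (\<lambda>j. if j = i then f i else Zer C X (Y i)) {} =
        finsum (Hom_module C X (Y i)) (\<lambda>j. if j = i then f i else Zer C X (Y i)) J"
      by (rule hsum_neutral) (use False J fi X in \<open>auto simp: in_Hom\<close>)
    then show ?thesis using J(3)[of i] False i X fi by (simp add: hsum_empty)
  qed
  finally show ?thesis .
qed

text \<open>Injectivity of the comparison map holds in any case, so compactness amounts to its
  surjectivity, and this is finite support of each arrow into a coproduct.\<close>

lemma compactI:
  fixes \<kappa>' :: "'u rel"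
  assumes X: "X \<in> Ob C"
    and fs: "\<And>(I :: 'u set) Y B \<iota> x. \<lbrakk>small \<kappa>' I; coproduct C I Y B \<iota>; x \<in> Arr C; Dom C x = X; Cod C x = B\<rbrakk> \<Longrightarrow> fin_supp C I B \<iota> x"
  shows "compact_object \<kappa>' C X"
  unfolding compact_object_def
proof (intro conjI allI impI X, elim conjE)
  fix I :: "'u set" and Y B \<iota> assume I: "small \<kappa>' I" and c: "coproduct C I Y B \<iota>"
  note D = coproductD[OF c]
  obtain \<pi> where p0: "\<forall>i\<in>I. \<pi> i \<in> Arr C \<and> Dom C (\<pi> i) = B \<and> Cod C (\<pi> i) = Y i \<and>
      (\<forall>j\<in>I. \<pi> i \<cdot> \<iota> j = (if j = i then Id C (Y i) else Zer C (Y j) (Y i)))"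
    by (rule coproduct_proj[OF c])
  then have p: "\<And>i. i \<in> I \<Longrightarrow> \<pi> i \<in> Arr C" "\<And>i. i \<in> I \<Longrightarrow> Dom C (\<pi> i) = B" "\<And>i. i \<in> I \<Longrightarrow> Cod C (\<pi> i) = Y i"
    "\<And>i. i \<in> I \<Longrightarrow> \<pi> i \<cdot> \<iota> i = Id C (Y i)" "\<And>i j. \<lbrakk>i \<in> I; j \<in> I; j \<noteq> i\<rbrakk> \<Longrightarrow> \<pi> i \<cdot> \<iota> j = Zer C (Y j) (Y i)"
    by auto
  let ?s = "\<lambda>f. {i \<in> I. f i \<noteq> Zer C X (Y i)}"
  let ?m = "\<lambda>f. finsum (Hom_module C X B) (\<lambda>i. \<iota> i \<cdot> f i) (?s f)"
  let ?A = "{f \<in> (\<Pi>\<^sub>E i \<in> I. Hom C X (Y i)). finite (?s f)}"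
  have pm: "\<pi> i \<cdot> ?m f = f i" if "f \<in> ?A" "i \<in> I" for f i
    by (rule proj_hsum[OF c _ _ _ _ X that(2) p(1-4)[OF that(2)] p(5)[OF that(2)]]) (use that in \<open>auto simp: PiE_iff\<close>)
  show "bij_betw ?m ?A (Hom C X B)"
  proof (rule bij_betwI')
    show "?m f = ?m g \<longleftrightarrow> f = g" if "f \<in> ?A" "g \<in> ?A" for f g
    proof
      assume e: "?m f = ?m g"
      have "f i = g i" if "i \<in> I" for i using pm[OF \<open>f \<in> ?A\<close> that] pm[OF \<open>g \<in> ?A\<close> that] e by simp
      then show "f = g" using that by (auto intro: PiE_ext)
    qed simp
    show "?m f \<in> Hom C X B" if "f \<in> ?A" for f
      by (rule hsum_closed[OF _ X D(1)]) (use that D in \<open>auto simp: PiE_iff in_Hom\<close>)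
    fix x assume "x \<in> Hom C X B"
    then have x: "x \<in> Arr C" "Dom C x = X" "Cod C x = B" "x \<in> Hom C X B" by (auto simp: in_Hom)
    obtain J e where J: "finite J" "J \<subseteq> I" "is_cut C I B \<iota> J e" "e \<cdot> x = x"
      using fs[OF I c x(1-3)] unfolding fin_supp_def by blast
    \<comment> \<open>The family of components of \<open>x\<close>; outside the finite support they
      vanish by \<open>proj_cut\<close>.\<close>
    define f where "f = restrict (\<lambda>i. \<pi> i \<cdot> x) I"
    have z: "f i = Zer C X (Y i)" if "i \<in> I" "i \<notin> J" for i
    proof -
      have "\<pi> i \<cdot> x = (\<pi> i \<cdot> e) \<cdot> x" using J(4) is_cutD(1-3)[OF J(3)] p(1-3)[OF that(1)] x by simp
      also have "\<dots> = Zer C B (Y i) \<cdot> x"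
        using proj_cut[OF c J(3) that p(1-3)[OF that(1)] p(5)[OF that(1)]] by simp
      finally show ?thesis using that x D(5)[OF that(1)] by (simp add: f_def)
    qed
    have fA: "f \<in> ?A"
    proof -
      have "?s f \<subseteq> J" using z by blast
      then have "finite (?s f)" using J(1) finite_subset by blast
      then show ?thesis using p x by (auto simp: f_def PiE_iff in_Hom)
    qed
    have h: "\<iota> i \<cdot> f i \<in> Hom C X B" if "i \<in> I" for i
      using D(2-5)[OF that] p(1-3)[OF that] x that by (simp add: f_def in_Hom)
    have "x = finsum (Hom_module C X B) (\<lambda>i. \<iota> i \<cdot> (\<pi> i \<cdot> x)) J"
      using cut_hsum[OF c J(1-3) x(4) p] J(4) by simp
    also have "\<dots> = finsum (Hom_module C X B) (\<lambda>i. \<iota> i \<cdot> f i) J"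
      by (rule hsum_cong) (use J(2) h X D(1) in \<open>auto simp: f_def\<close>)
    also have "\<dots> = ?m f"
    proof (rule hsum_neutral[symmetric])
      show "?s f \<subseteq> J" using z by blast
      show "\<iota> i \<cdot> f i = Zer C X B" if "i \<in> J - ?s f" for i
      proof -
        have "i \<in> I" "f i = Zer C X (Y i)" using that J(2) by auto
        then show ?thesis using D(2-4)[of i] X by simp
      qed
    qed (use J h X D(1) in auto)
    finally show "\<exists>f \<in> ?A. x = ?m f" using fA by blast
  qed
qed

text \<open>Converse of \<open>compactI\<close>: an arrow that is a finite sum of arrows through the
  summands is fixed by the cut at their indices.\<close>

lemma compact_fin_supp_univ:
  fixes \<kappa>' :: "'u rel" and I :: "'u set"
  assumes "compact_object \<kappa>' C X" "small \<kappa>' I" "coproduct C I Y B \<iota>" "x \<in> Arr C" "Dom C x = X" "Cod C x = B"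
  shows "fin_supp C I B \<iota> x"
proof -
  note D = coproductD[OF assms(3)]
  have X: "X \<in> Ob C" using assms(4,5) Dom_in[of x] by simp
  let ?s = "\<lambda>f. {i \<in> I. f i \<noteq> Zer C X (Y i)}"
  let ?m = "\<lambda>f. finsum (Hom_module C X B) (\<lambda>i. \<iota> i \<cdot> f i) (?s f)"
  let ?A = "{f \<in> (\<Pi>\<^sub>E i \<in> I. Hom C X (Y i)). finite (?s f)}"
  have "small \<kappa>' I \<and> (\<forall>i\<in>I. Y i \<in> Ob C) \<and> coproduct C I Y B \<iota>" using assms(2,3) D(5) by simp
  from assms(1)[unfolded compact_object_def, THEN conjunct2, THEN spec, THEN spec, THEN spec, THEN spec, THEN mp, OF this]
  have "bij_betw ?m ?A (Hom C X B)" .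
  moreover have "x \<in> Hom C X B" using assms by (simp add: in_Hom)
  ultimately obtain f where f: "f \<in> ?A" "x = ?m f" unfolding bij_betw_def by blast
  obtain e where e: "is_cut C I B \<iota> (?s f) e" by (rule cut_ex[OF assms(3)])
  note E = is_cutD[OF e]
  have h: "\<iota> i \<cdot> f i \<in> Hom C X B" if "i \<in> I" for i using D(2-5)[OF that] f(1) that by (auto simp: PiE_iff in_Hom)
  have "e \<cdot> ?m f = finsum (Hom_module C X B) (\<lambda>i. e \<cdot> (\<iota> i \<cdot> f i)) (?s f)"
    by (rule Comp_hsum) (use f(1) h X E(1-3) in \<open>auto simp: in_Hom\<close>)
  also have "\<dots> = ?m f"
  proof (rule hsum_cong)
    fix i assume i: "i \<in> ?s f"
    then have "e \<cdot> \<iota> i = \<iota> i" using E(4)[of i] by blast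
    from Comp_lift[OF this, of "f i"] show "e \<cdot> (\<iota> i \<cdot> f i) = \<iota> i \<cdot> f i"
      using i D(2-5)[of i] E(1-3) f(1) by (auto simp: PiE_iff in_Hom)
  qed (use h X D(1) in auto)
  finally have "e \<cdot> x = x" using f(2) by simp
  then show ?thesis unfolding fin_supp_def using e f(1) by blast
qed

lemma compact_fin_supp:
  fixes \<kappa>' :: "'u rel" and I :: "'i set"
  assumes "compact_object \<kappa>' C X" "universe_card \<kappa>'" "small \<kappa>' I" "coproduct C I Y B \<iota>"
    "x \<in> Arr C" "Dom C x = X" "Cod C x = B"
  shows "fin_supp C I B \<iota> x"
proof -
  obtain e :: "'i \<Rightarrow> 'u" where e: "inj_on e I" using small_inj[OF assms(2,3)] .
  let ?i = "inv_into I e"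
  have inj: "inj_on ?i (e ` I)" and im: "?i ` e ` I = I" using e by (auto simp: inj_on_inv_into)
  have c: "coproduct C (e ` I) (\<lambda>j. Y (?i j)) B (\<lambda>j. \<iota> (?i j))"
    by (rule coproduct_reindex[OF inj]) (simp add: im assms(4))
  obtain J c where J: "finite J" "J \<subseteq> e ` I" "is_cut C (e ` I) B (\<lambda>j. \<iota> (?i j)) J c" "c \<cdot> x = x"
    using compact_fin_supp_univ[OF assms(1) small_image[OF assms(3)] c assms(5-7)] unfolding fin_supp_def by blast
  have "is_cut C I B \<iota> (?i ` J) c"
    unfolding is_cut_def
  proof (intro conjI ballI)
    show "c \<in> Hom C B B" using is_cutD[OF J(3)] by (simp add: in_Hom)
    fix i assume i: "i \<in> I"
    have "i \<in> ?i ` J \<longleftrightarrow> e i \<in> J"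
    proof
      assume "i \<in> ?i ` J"
      then obtain j where "j \<in> J" "i = ?i j" by blast
      then show "e i \<in> J" using J(2) f_inv_into_f[of j e I] by auto
    next
      assume "e i \<in> J"
      then have "?i (e i) \<in> ?i ` J" by (rule imageI)
      then show "i \<in> ?i ` J" using i e by simp
    qed
    then show "c \<cdot> \<iota> i = (if i \<in> ?i ` J then \<iota> i else Zer C (Dom C (\<iota> i)) B)"
      using is_cutD(4,5)[OF J(3), of "e i"] i e by auto
  qed
  then show ?thesis unfolding fin_supp_def using J im by (intro exI[of _ "?i ` J"] exI[of _ c]) auto
qed

section \<open>Closure properties of compact objects\<close>

lemma compact_retract:
  fixes \<kappa>' :: "'u rel"
  assumes Z: "compact_object \<kappa>' C Z" and i: "i \<in> Hom C X Z" "p \<in> Hom C Z X" "p \<cdot> i = Id C X"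
  shows "compact_object \<kappa>' C X"
proof (rule compactI)
  have a: "i \<in> Arr C" "Dom C i = X" "Cod C i = Z" "p \<in> Arr C" "Dom C p = Z" "Cod C p = X"
    using i by (auto simp: in_Hom)
  then show "X \<in> Ob C" using Dom_in[of i] by simp
  fix I :: "'u set" and Y B \<iota> x
  assume I: "small \<kappa>' I" and c: "coproduct C I Y B \<iota>" and x: "x \<in> Arr C" "Dom C x = X" "Cod C x = B"
  obtain J e where J: "finite J" "J \<subseteq> I" "is_cut C I B \<iota> J e" "e \<cdot> (x \<cdot> p) = x \<cdot> p"
    using compact_fin_supp_univ[OF Z I c, of "x \<cdot> p"] a x unfolding fin_supp_def by auto
  note E = is_cutD(1-3)[OF J(3)]
  have "e \<cdot> x = (e \<cdot> x) \<cdot> (p \<cdot> i)" unfolding i(3) using E a x by simp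
  also have "\<dots> = (e \<cdot> (x \<cdot> p)) \<cdot> i" using E a x by simp
  also have "\<dots> = x \<cdot> (p \<cdot> i)" unfolding J(4) using a x by simp
  also have "\<dots> = x" unfolding i(3) using x by simp
  finally show "fin_supp C I B \<iota> x" unfolding fin_supp_def using J by blast
qed

lemma compact_iso:
  fixes \<kappa>' :: "'u rel"
  assumes "compact_object \<kappa>' C Z" "isomorphic C Z X" shows "compact_object \<kappa>' C X"
proof -
  obtain f where "is_iso C f" "f \<in> Arr C" "Dom C f = Z" "Cod C f = X" using assms(2) by (rule isomorphicE)
  then show ?thesis by (intro compact_retract[OF assms(1), of "inv_arrow C f" X f]) (auto simp: in_Hom)
qed

lemma compact_zero:
  fixes \<kappa>' :: "'u rel"
  assumes "zero_object C Z" shows "compact_object \<kappa>' C Z"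
proof (rule compactI)
  show "Z \<in> Ob C" using assms by (simp add: zero_object_def)
  fix I :: "'u set" and Y B \<iota> x
  assume c: "coproduct C I Y B \<iota>" and x: "x \<in> Arr C" "Dom C x = Z" "Cod C x = B"
  have "x = Zer C Z B" using zero_object_Dom[OF assms x(1,2)] x(3) by simp
  then have "Zer C B B \<cdot> x = x" using x Dom_in[of x] Cod_in[of x] by simp
  then show "fin_supp C I B \<iota> x" unfolding fin_supp_def using cut_empty[OF c] by blast
qed

lemma compact_biproduct:
  fixes \<kappa>' :: "'u rel"
  assumes X: "compact_object \<kappa>' C X" and Y: "compact_object \<kappa>' C Y"
    and h: "i1 \<in> Hom C X Z" "i2 \<in> Hom C Y Z" "p1 \<in> Hom C Z X" "p2 \<in> Hom C Z Y"
      "Add C (i1 \<cdot> p1) (i2 \<cdot> p2) = Id C Z"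
  shows "compact_object \<kappa>' C Z"
proof (rule compactI)
  have a: "i1 \<in> Arr C" "Dom C i1 = X" "Cod C i1 = Z" "p1 \<in> Arr C" "Dom C p1 = Z" "Cod C p1 = X"
    "i2 \<in> Arr C" "Dom C i2 = Y" "Cod C i2 = Z" "p2 \<in> Arr C" "Dom C p2 = Z" "Cod C p2 = Y"
    using h by (auto simp: in_Hom)
  then show "Z \<in> Ob C" using Dom_in[of p1] by simp
  fix I :: "'u set" and Y' B \<iota> x
  assume I: "small \<kappa>' I" and c: "coproduct C I Y' B \<iota>" and x: "x \<in> Arr C" "Dom C x = Z" "Cod C x = B"
  have f1: "fin_supp C I B \<iota> (x \<cdot> i1)" by (rule compact_fin_supp_univ[OF X I c]) (use a x in auto)
  have f2: "fin_supp C I B \<iota> (x \<cdot> i2)" by (rule compact_fin_supp_univ[OF Y I c]) (use a x in auto)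
  obtain J e where J: "finite J" "J \<subseteq> I" "is_cut C I B \<iota> J e" "e \<cdot> (x \<cdot> i1) = x \<cdot> i1" "e \<cdot> (x \<cdot> i2) = x \<cdot> i2"
    by (rule fin_supp2[OF c f1 f2]) (use a x in auto)
  note E = is_cutD(1-3)[OF J(3)]
  have "e \<cdot> x = e \<cdot> (x \<cdot> Add C (i1 \<cdot> p1) (i2 \<cdot> p2))" unfolding h(5) using E x by simp
  also have "\<dots> = Add C ((e \<cdot> (x \<cdot> i1)) \<cdot> p1) ((e \<cdot> (x \<cdot> i2)) \<cdot> p2)" using E a x by simp
  also have "\<dots> = x \<cdot> Add C (i1 \<cdot> p1) (i2 \<cdot> p2)" unfolding J(4,5) using a x by simp
  also have "\<dots> = x" unfolding h(5) using x by simp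
  finally show "fin_supp C I B \<iota> x" unfolding fin_supp_def using J by blast
qed

text \<open>The union of the supports of the finitely many components supports the whole
  arrow.\<close>

lemma compact_finite_coproduct:
  fixes \<kappa>' :: "'u rel" and K :: "'i set"
  assumes K: "finite K" and P: "coproduct C K V P \<nu>" and V: "\<And>j. j \<in> K \<Longrightarrow> compact_object \<kappa>' C (V j)"
  shows "compact_object \<kappa>' C P"
proof (rule compactI)
  note D = coproductD[OF P]
  show "P \<in> Ob C" by (rule D(1))
  fix I :: "'u set" and Y B \<iota> x
  assume I: "small \<kappa>' I" and c: "coproduct C I Y B \<iota>" and x: "x \<in> Arr C" "Dom C x = P" "Cod C x = B"
  have "fin_supp C I B \<iota> (x \<cdot> \<nu> j)" if "j \<in> K" for j
    by (rule compact_fin_supp_univ[OF V[OF that] I c]) (use D(2-4)[OF that] x in auto)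
  then have "\<forall>j\<in>K. \<exists>L. finite L \<and> L \<subseteq> I \<and> (\<exists>e. is_cut C I B \<iota> L e \<and> e \<cdot> (x \<cdot> \<nu> j) = x \<cdot> \<nu> j)"
    unfolding fin_supp_def by blast
  then obtain L where L: "\<forall>j\<in>K. finite (L j) \<and> L j \<subseteq> I \<and> (\<exists>e. is_cut C I B \<iota> (L j) e \<and> e \<cdot> (x \<cdot> \<nu> j) = x \<cdot> \<nu> j)"
    by (rule bchoice[THEN exE])
  let ?J = "\<Union>j\<in>K. L j"
  obtain e where e: "is_cut C I B \<iota> ?J e" by (rule cut_ex[OF c])
  note E = is_cutD(1-3)[OF e]
  have "e \<cdot> x = x"
  proof (rule coproduct_eq[OF P])
    fix j assume j: "j \<in> K"
    then obtain e' where e': "is_cut C I B \<iota> (L j) e'" "e' \<cdot> (x \<cdot> \<nu> j) = x \<cdot> \<nu> j" using L by blast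
    have "e \<cdot> (x \<cdot> \<nu> j) = x \<cdot> \<nu> j"
      by (rule fin_supp_mono[OF c e'(1) e _ _ _ e'(2)]) (use j D(2-4)[OF j] x in auto)
    then show "(e \<cdot> x) \<cdot> \<nu> j = x \<cdot> \<nu> j" using E x D(2-4)[OF j] by simp
  qed (use E x in auto)
  moreover have "finite ?J" "?J \<subseteq> I" using K L by auto
  ultimately show "fin_supp C I B \<iota> x" unfolding fin_supp_def using e by blast
qed

text \<open>The image of a finite cut is the coproduct of the finitely many summands concerned. This
  turns finite support into a factorisation through a compact object.\<close>

lemma cut_split:
  fixes \<kappa>' :: "'u rel" and I :: "'i set"
  assumes "universe_card \<kappa>'" "has_direct_sums \<kappa>' C" and P: "coproduct C I Y P \<iota>"
    and Y: "\<And>i. i \<in> I \<Longrightarrow> compact_object \<kappa>' C (Y i)" and J: "finite J" "J \<subseteq> I" "is_cut C I P \<iota> J e"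
  obtains D a b where "compact_object \<kappa>' C D" "a \<in> Arr C" "Dom C a = D" "Cod C a = P"
    "b \<in> Arr C" "Dom C b = P" "Cod C b = D" "b \<cdot> a = Id C D" "a \<cdot> b = e"
proof -
  note D = coproductD[OF P] and E = is_cutD[OF J(3)]
  obtain D \<nu> where Q: "coproduct C J Y D \<nu>"
    by (rule has_direct_sums_any[OF assms(1,2) small_finite[OF assms(1) J(1)], of Y]) (use D(5) J(2) in auto)
  note DQ = coproductD[OF Q]
  obtain a where a: "a \<in> Arr C" "Dom C a = D" "Cod C a = P" "\<And>j. j \<in> J \<Longrightarrow> a \<cdot> \<nu> j = \<iota> j"
    by (rule coproduct_ex[OF Q D(1), of \<iota>]) (use D(2-4) J(2) in auto)
  obtain b where b: "b \<in> Arr C" "Dom C b = P" "Cod C b = D"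
      "\<And>i. i \<in> I \<Longrightarrow> b \<cdot> \<iota> i = (if i \<in> J then \<nu> i else Zer C (Y i) D)"
    by (rule coproduct_ex[OF P DQ(1), of "\<lambda>i. if i \<in> J then \<nu> i else Zer C (Y i) D"]) (use D DQ in auto)
  have "b \<cdot> a = Id C D"
  proof (rule coproduct_eq[OF Q])
    fix j assume j: "j \<in> J"
    have "b \<cdot> (a \<cdot> \<nu> j) = \<nu> j" using a(4)[OF j] b(4)[of j] j J(2) by auto
    then show "(b \<cdot> a) \<cdot> \<nu> j = Id C D \<cdot> \<nu> j" using a(1-3) b(1-3) DQ(2-4)[OF j] by simp
  qed (use a b DQ(1) in auto)
  moreover have "a \<cdot> b = e"
  proof (rule coproduct_eq[OF P])
    fix i assume i: "i \<in> I"
    have 1: "(a \<cdot> b) \<cdot> \<iota> i = a \<cdot> (b \<cdot> \<iota> i)" using a(1-3) b(1-3) D(2-4)[OF i] by simp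
    show "(a \<cdot> b) \<cdot> \<iota> i = e \<cdot> \<iota> i"
    proof (cases "i \<in> J")
      case True
      then show ?thesis unfolding 1 b(4)[OF i] using a(4)[OF True] E(4)[OF i True] by simp
    next
      case False
      then show ?thesis unfolding 1 b(4)[OF i] using a(1-3) D(2-5)[OF i] E(5)[OF i False] by simp
    qed
  qed (use a b E(1-3) in auto)
  ultimately show ?thesis using that compact_finite_coproduct[OF J(1) Q Y] J(2) a(1-3) b(1-3) by blast
qed

end

section \<open>Compact objects in a triangulated category\<close>

context tri_category begin

lemma ShA_full_iso:
  assumes "w \<in> Arr T" "is_iso T w" "Dom T w = ShO T V" "V \<in> Ob T" "X \<in> Ob T"
    "g \<in> Arr T" "Dom T g = ShO T X" "Cod T g = Cod T w"
  obtains g' where "g' \<in> Arr T" "Dom T g' = X" "Cod T g' = V" "w \<cdot> ShA T g' = g"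
proof -
  obtain g' where "g' \<in> Arr T" "Dom T g' = X" "Cod T g' = V" "ShA T g' = inv_arrow T w \<cdot> g"
    by (rule ShA_full[of "inv_arrow T w \<cdot> g" X V]) (use assms in auto)
  then show ?thesis using that assms by simp
qed

text \<open>An equivalence preserves coproducts. Without a chosen inverse shift, the test object is
  desuspended up to the isomorphism \<open>w\<close>.\<close>

lemma ShO_coproduct:
  assumes c: "coproduct T I Y B \<iota>"
  shows "coproduct T I (\<lambda>i. ShO T (Y i)) (ShO T B) (\<lambda>i. ShA T (\<iota> i))"
proof (rule coproductI)
  note D = coproductD[OF c]
  show "ShO T B \<in> Ob T" using D(1) by simp
  show "ShA T (\<iota> i) \<in> Arr T" "Dom T (ShA T (\<iota> i)) = ShO T (Y i)" "Cod T (ShA T (\<iota> i)) = ShO T B" if "i \<in> I" for i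
    using D(2-4)[OF that] by simp_all
  fix Z g assume Z: "Z \<in> Ob T" and g: "\<And>i. i \<in> I \<Longrightarrow> g i \<in> Arr T" "\<And>i. i \<in> I \<Longrightarrow> Dom T (g i) = ShO T (Y i)"
    "\<And>i. i \<in> I \<Longrightarrow> Cod T (g i) = Z"
  obtain V w where w: "V \<in> Ob T" "is_iso T w" "w \<in> Arr T" "Dom T w = ShO T V" "Cod T w = Z" by (rule ShO_ess[OF Z])
  have "\<exists>g'. g' \<in> Arr T \<and> Dom T g' = Y i \<and> Cod T g' = V \<and> w \<cdot> ShA T g' = g i" if i: "i \<in> I" for i
  proof -
    obtain g' where "g' \<in> Arr T" "Dom T g' = Y i" "Cod T g' = V" "w \<cdot> ShA T g' = g i"
      by (rule ShA_full_iso[OF w(3,2,4,1) D(5)[OF i] g(1,2)[OF i]]) (use g(3)[OF i] w in auto)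
    then show ?thesis by blast
  qed
  then have "\<exists>g'. \<forall>i\<in>I. g' i \<in> Arr T \<and> Dom T (g' i) = Y i \<and> Cod T (g' i) = V \<and> w \<cdot> ShA T (g' i) = g i"
    by (intro bchoice ballI)
  then obtain g' where g': "\<forall>i\<in>I. g' i \<in> Arr T \<and> Dom T (g' i) = Y i \<and> Cod T (g' i) = V \<and> w \<cdot> ShA T (g' i) = g i" ..
  obtain h where h: "h \<in> Arr T" "Dom T h = B" "Cod T h = V" "\<And>i. i \<in> I \<Longrightarrow> h \<cdot> \<iota> i = g' i"
    by (rule coproduct_ex[OF c w(1), of g']) (use g' in auto)
  have "(w \<cdot> ShA T h) \<cdot> ShA T (\<iota> i) = g i" if i: "i \<in> I" for i
  proof -
    have "(w \<cdot> ShA T h) \<cdot> ShA T (\<iota> i) = w \<cdot> ShA T (h \<cdot> \<iota> i)" using w h(1-3) D(2-4)[OF i] by simp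
    then show ?thesis unfolding h(4)[OF i] using g' i by simp
  qed
  then show "\<exists>h. h \<in> Arr T \<and> Dom T h = ShO T B \<and> Cod T h = Z \<and> (\<forall>i\<in>I. h \<cdot> ShA T (\<iota> i) = g i)"
    using w h(1-3) by (intro exI[of _ "w \<cdot> ShA T h"]) simp
next
  note D = coproductD[OF c]
  fix h h' assume h: "h \<in> Arr T" "h' \<in> Arr T" "Dom T h = ShO T B" "Dom T h' = ShO T B" "Cod T h = Cod T h'"
    and e: "\<And>i. i \<in> I \<Longrightarrow> h \<cdot> ShA T (\<iota> i) = h' \<cdot> ShA T (\<iota> i)"
  obtain V w where w: "V \<in> Ob T" "is_iso T w" "w \<in> Arr T" "Dom T w = ShO T V" "Cod T w = Cod T h'"
    by (rule ShO_ess[of "Cod T h'"]) (use h in auto)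
  obtain l where l: "l \<in> Arr T" "Dom T l = B" "Cod T l = V" "w \<cdot> ShA T l = h"
    by (rule ShA_full_iso[OF w(3,2,4,1) D(1) h(1,3)]) (use h w in auto)
  obtain l' where l': "l' \<in> Arr T" "Dom T l' = B" "Cod T l' = V" "w \<cdot> ShA T l' = h'"
    by (rule ShA_full_iso[OF w(3,2,4,1) D(1) h(2,4)]) (use h w in auto)
  have "l = l'"
  proof (rule coproduct_eq[OF c])
    fix i assume i: "i \<in> I"
    note A = D(2-4)[OF i] w l(1-3) l'(1-3)
    have "w \<cdot> ShA T (l \<cdot> \<iota> i) = (w \<cdot> ShA T l) \<cdot> ShA T (\<iota> i)" using A by simp
    also have "\<dots> = (w \<cdot> ShA T l') \<cdot> ShA T (\<iota> i)" unfolding l l' by (rule e[OF i])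
    also have "\<dots> = w \<cdot> ShA T (l' \<cdot> \<iota> i)" using A by simp
    finally have "ShA T (l \<cdot> \<iota> i) = ShA T (l' \<cdot> \<iota> i)" by (rule iso_cancel_left[OF w(2), rotated -1]) (use A in auto)
    then show "l \<cdot> \<iota> i = l' \<cdot> \<iota> i" by (rule ShA_inj[rotated -1]) (use A in auto)
  qed (use l l' in auto)
  then show "h = h'" using l(4) l'(4) by simp
qed

lemma ShA_cut:
  assumes c: "coproduct T I Y B \<iota>" and e: "is_cut T I B \<iota> J e"
  shows "is_cut T I (ShO T B) (\<lambda>i. ShA T (\<iota> i)) J (ShA T e)"
  unfolding is_cut_def
proof (intro conjI ballI)
  note E = is_cutD[OF e] and D = coproductD[OF c]
  show "ShA T e \<in> Hom T (ShO T B) (ShO T B)" using E by (simp add: in_Hom)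
  fix i assume i: "i \<in> I"
  have "ShA T e \<cdot> ShA T (\<iota> i) = ShA T (e \<cdot> \<iota> i)" using D(2-4)[OF i] E(1-3) by simp
  then show "ShA T e \<cdot> ShA T (\<iota> i) = (if i \<in> J then ShA T (\<iota> i) else Zer T (Dom T (ShA T (\<iota> i))) (ShO T B))"
    using E(4,5)[OF i] D(1) D(2-5)[OF i] by auto
qed

text \<open>Every coproduct is a shifted one up to isomorphism, with the summands desuspended one by
  one through \<open>r\<close>; cuts correspond by conjugation with \<open>w\<close>.\<close>

lemma unshift_coproduct:
  assumes c: "coproduct T I Y B \<iota>"
  obtains V v \<nu> w where "coproduct T I V v \<nu>" "w \<in> Arr T" "is_iso T w" "Dom T w = ShO T v" "Cod T w = B"
    "\<And>J e. is_cut T I v \<nu> J e \<Longrightarrow> is_cut T I B \<iota> J (w \<cdot> (ShA T e \<cdot> inv_arrow T w))"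
proof -
  note D = coproductD[OF c]
  obtain v w where w: "v \<in> Ob T" "is_iso T w" "w \<in> Arr T" "Dom T w = ShO T v" "Cod T w = B" by (rule ShO_ess[OF D(1)])
  have "\<exists>V r. V \<in> Ob T \<and> is_iso T r \<and> r \<in> Arr T \<and> Dom T r = ShO T V \<and> Cod T r = Y i" if "i \<in> I" for i
    by (rule ShO_ess[OF D(5)[OF that]]) blast
  then have "\<exists>V. \<forall>i\<in>I. \<exists>r. V i \<in> Ob T \<and> is_iso T r \<and> r \<in> Arr T \<and> Dom T r = ShO T (V i) \<and> Cod T r = Y i"
    by (intro bchoice ballI)
  then obtain V where "\<forall>i\<in>I. \<exists>r. V i \<in> Ob T \<and> is_iso T r \<and> r \<in> Arr T \<and> Dom T r = ShO T (V i) \<and> Cod T r = Y i" ..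
  then have "\<exists>r. \<forall>i\<in>I. V i \<in> Ob T \<and> is_iso T (r i) \<and> r i \<in> Arr T \<and> Dom T (r i) = ShO T (V i) \<and> Cod T (r i) = Y i"
    by (rule bchoice)
  then obtain r where r0: "\<forall>i\<in>I. V i \<in> Ob T \<and> is_iso T (r i) \<and> r i \<in> Arr T \<and> Dom T (r i) = ShO T (V i) \<and> Cod T (r i) = Y i" ..
  then have r: "V i \<in> Ob T" "is_iso T (r i)" "r i \<in> Arr T" "Dom T (r i) = ShO T (V i)" "Cod T (r i) = Y i"
    if "i \<in> I" for i using that by auto
  have "\<exists>n. n \<in> Arr T \<and> Dom T n = V i \<and> Cod T n = v \<and> w \<cdot> ShA T n = \<iota> i \<cdot> r i" if i: "i \<in> I" for i
  proof -
    obtain n where "n \<in> Arr T" "Dom T n = V i" "Cod T n = v" "w \<cdot> ShA T n = \<iota> i \<cdot> r i"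
      by (rule ShA_full_iso[OF w(3,2,4,1) r(1)[OF i], of "\<iota> i \<cdot> r i"]) (use r[OF i] D(2-4)[OF i] w in auto)
    then show ?thesis by blast
  qed
  then have "\<exists>\<nu>. \<forall>i\<in>I. \<nu> i \<in> Arr T \<and> Dom T (\<nu> i) = V i \<and> Cod T (\<nu> i) = v \<and> w \<cdot> ShA T (\<nu> i) = \<iota> i \<cdot> r i"
    by (intro bchoice ballI)
  then obtain \<nu> where "\<forall>i\<in>I. \<nu> i \<in> Arr T \<and> Dom T (\<nu> i) = V i \<and> Cod T (\<nu> i) = v \<and> w \<cdot> ShA T (\<nu> i) = \<iota> i \<cdot> r i" ..
  then have n: "\<nu> i \<in> Arr T" "Dom T (\<nu> i) = V i" "Cod T (\<nu> i) = v" and n4: "w \<cdot> ShA T (\<nu> i) = \<iota> i \<cdot> r i"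
    if "i \<in> I" for i using that by auto
  have "coproduct T I V v \<nu>"
  proof (rule coproductI)
    show "v \<in> Ob T" by fact
    show "\<And>i. i \<in> I \<Longrightarrow> \<nu> i \<in> Arr T" "\<And>i. i \<in> I \<Longrightarrow> Dom T (\<nu> i) = V i" "\<And>i. i \<in> I \<Longrightarrow> Cod T (\<nu> i) = v" using n by auto
    fix Z g assume Z: "Z \<in> Ob T" and g: "\<And>i. i \<in> I \<Longrightarrow> g i \<in> Arr T" "\<And>i. i \<in> I \<Longrightarrow> Dom T (g i) = V i"
      "\<And>i. i \<in> I \<Longrightarrow> Cod T (g i) = Z"
    obtain h where h: "h \<in> Arr T" "Dom T h = B" "Cod T h = ShO T Z" "\<And>i. i \<in> I \<Longrightarrow> h \<cdot> \<iota> i = ShA T (g i) \<cdot> inv_arrow T (r i)"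
      by (rule coproduct_ex[OF c, of "ShO T Z" "\<lambda>i. ShA T (g i) \<cdot> inv_arrow T (r i)"]) (use Z g r in auto)
    obtain h' where h': "h' \<in> Arr T" "Dom T h' = v" "Cod T h' = Z" "ShA T h' = h \<cdot> w"
      by (rule ShA_full[of "h \<cdot> w" v Z]) (use h w Z in auto)
    have "h' \<cdot> \<nu> i = g i" if i: "i \<in> I" for i
    proof -
      note A = D(2-4)[OF i] w h(1-3) h'(1-3) n[OF i] g[OF i] r[OF i]
      have "ShA T (h' \<cdot> \<nu> i) = h \<cdot> (w \<cdot> ShA T (\<nu> i))" using A h'(4) by simp
      also have "\<dots> = (h \<cdot> \<iota> i) \<cdot> r i" unfolding n4[OF i] using A by simp
      also have "\<dots> = ShA T (g i)" unfolding h(4)[OF i] using A by simp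
      finally show ?thesis by (rule ShA_inj[rotated -1]) (use A in auto)
    qed
    then show "\<exists>h. h \<in> Arr T \<and> Dom T h = v \<and> Cod T h = Z \<and> (\<forall>i\<in>I. h \<cdot> \<nu> i = g i)" using h' by blast
  next
    fix h h' assume h: "h \<in> Arr T" "h' \<in> Arr T" "Dom T h = v" "Dom T h' = v" "Cod T h = Cod T h'"
      and e: "\<And>i. i \<in> I \<Longrightarrow> h \<cdot> \<nu> i = h' \<cdot> \<nu> i"
    have "ShA T h \<cdot> inv_arrow T w = ShA T h' \<cdot> inv_arrow T w"
    proof (rule coproduct_eq[OF c])
      fix i assume i: "i \<in> I"
      note A = D(2-4)[OF i] w h n[OF i] r[OF i]
      have z: "inv_arrow T w \<cdot> (\<iota> i \<cdot> r i) = ShA T (\<nu> i)" unfolding n4[OF i, symmetric] using A by simp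
      have "((ShA T h \<cdot> inv_arrow T w) \<cdot> \<iota> i) \<cdot> r i = ShA T h \<cdot> (inv_arrow T w \<cdot> (\<iota> i \<cdot> r i))" using A by simp
      also have "\<dots> = ShA T (h \<cdot> \<nu> i)" unfolding z using A by simp
      also have "\<dots> = ShA T h' \<cdot> (inv_arrow T w \<cdot> (\<iota> i \<cdot> r i))" unfolding z e[OF i] using A by simp
      also have "\<dots> = ((ShA T h' \<cdot> inv_arrow T w) \<cdot> \<iota> i) \<cdot> r i" using A by simp
      finally show "(ShA T h \<cdot> inv_arrow T w) \<cdot> \<iota> i = (ShA T h' \<cdot> inv_arrow T w) \<cdot> \<iota> i"
        by (rule iso_cancel_right[OF r(2)[OF i], rotated -1]) (use A in auto)
    qed (use w h in auto)
    then have "ShA T h = ShA T h'" by (rule iso_cancel_right[OF iso_inv[OF w(2)], rotated -1]) (use w h in auto)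
    then show "h = h'" by (rule ShA_inj[rotated -1]) (use h in auto)
  qed
  moreover have "is_cut T I B \<iota> J (w \<cdot> (ShA T e \<cdot> inv_arrow T w))" if e: "is_cut T I v \<nu> J e" for J e
    unfolding is_cut_def
  proof (intro conjI ballI)
    note E = is_cutD[OF e]
    show "w \<cdot> (ShA T e \<cdot> inv_arrow T w) \<in> Hom T B B" using E w by (simp add: in_Hom)
    fix i assume i: "i \<in> I"
    note A = D(1) D(2-5)[OF i] w n[OF i] r[OF i] E(1-3)
    have z: "inv_arrow T w \<cdot> (\<iota> i \<cdot> r i) = ShA T (\<nu> i)" unfolding n4[OF i, symmetric] using A by simp
    have "((w \<cdot> (ShA T e \<cdot> inv_arrow T w)) \<cdot> \<iota> i) \<cdot> r i = w \<cdot> (ShA T e \<cdot> (inv_arrow T w \<cdot> (\<iota> i \<cdot> r i)))" using A by simp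
    also have "\<dots> = w \<cdot> ShA T (e \<cdot> \<nu> i)" unfolding z using A by simp
    also have "\<dots> = (if i \<in> J then \<iota> i else Zer T (Dom T (\<iota> i)) B) \<cdot> r i"
    proof (cases "i \<in> J")
      case True
      show ?thesis unfolding E(4)[OF i True] n4[OF i] using True by simp
    next
      case False
      show ?thesis unfolding E(5)[OF i False] using False A by simp
    qed
    finally show "(w \<cdot> (ShA T e \<cdot> inv_arrow T w)) \<cdot> \<iota> i = (if i \<in> J then \<iota> i else Zer T (Dom T (\<iota> i)) B)"
      by (rule iso_cancel_right[OF r(2)[OF i], rotated -1]) (use A in auto)
  qed
  ultimately show ?thesis using that w by blast
qed

text \<open>Finite supports are moved along \<open>ShO_coproduct\<close> in one direction and along
  \<open>unshift_coproduct\<close> in the other.\<close>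

lemma compact_ShO_iff:
  assumes X: "X \<in> Ob T" shows "compact_object \<kappa> T (ShO T X) \<longleftrightarrow> compact_object \<kappa> T X"
proof
  assume s: "compact_object \<kappa> T (ShO T X)"
  show "compact_object \<kappa> T X"
  proof (rule compactI[OF X])
    fix I :: "'u set" and Y B \<iota> x
    assume I: "small \<kappa> I" and c: "coproduct T I Y B \<iota>" and x: "x \<in> Arr T" "Dom T x = X" "Cod T x = B"
    obtain J e' where J: "finite J" "J \<subseteq> I" "is_cut T I (ShO T B) (\<lambda>i. ShA T (\<iota> i)) J e'" "e' \<cdot> ShA T x = ShA T x"
      using compact_fin_supp_univ[OF s I ShO_coproduct[OF c], of "ShA T x"] x unfolding fin_supp_def by auto
    obtain e where e: "is_cut T I B \<iota> J e" by (rule cut_ex[OF c])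
    have "e' = ShA T e" by (rule cut_unique[OF ShO_coproduct[OF c] J(3) ShA_cut[OF c e]])
    then have "ShA T (e \<cdot> x) = ShA T x" using J(4) is_cutD(1-3)[OF e] x by simp
    then have "e \<cdot> x = x" by (rule ShA_inj[rotated -1]) (use is_cutD(1-3)[OF e] x in auto)
    then show "fin_supp T I B \<iota> x" unfolding fin_supp_def using J e by blast
  qed
next
  assume s: "compact_object \<kappa> T X"
  show "compact_object \<kappa> T (ShO T X)"
  proof (rule compactI)
    show "ShO T X \<in> Ob T" using X by simp
    fix I :: "'u set" and Y B \<iota> x
    assume I: "small \<kappa> I" and c: "coproduct T I Y B \<iota>" and x: "x \<in> Arr T" "Dom T x = ShO T X" "Cod T x = B"
    obtain V v \<nu> w where V: "coproduct T I V v \<nu>" and w: "w \<in> Arr T" "is_iso T w" "Dom T w = ShO T v" "Cod T w = B"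
      and cut: "\<And>J e. is_cut T I v \<nu> J e \<Longrightarrow> is_cut T I B \<iota> J (w \<cdot> (ShA T e \<cdot> inv_arrow T w))"
      by (rule unshift_coproduct[OF c]) blast
    obtain x' where x': "x' \<in> Arr T" "Dom T x' = X" "Cod T x' = v" "w \<cdot> ShA T x' = x"
      by (rule ShA_full_iso[OF w(1-3) coproductD(1)[OF V] X x(1,2)]) (use x w in auto)
    obtain J e where J: "finite J" "J \<subseteq> I" "is_cut T I v \<nu> J e" "e \<cdot> x' = x'"
      using compact_fin_supp_univ[OF s I V x'(1-3)] unfolding fin_supp_def by blast
    note A = w x'(1-3) is_cutD(1-3)[OF J(3)]
    have "(w \<cdot> (ShA T e \<cdot> inv_arrow T w)) \<cdot> (w \<cdot> ShA T x') = w \<cdot> ShA T (e \<cdot> x')" using A by simp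
    then have "(w \<cdot> (ShA T e \<cdot> inv_arrow T w)) \<cdot> x = x" unfolding J(4) x'(4) .
    then show "fin_supp T I B \<iota> x" unfolding fin_supp_def using J(1,2) cut[OF J(3)] by blast
  qed
qed

text \<open>A finite cut \<open>e\<close> fixes \<open>x \<cdot> g\<close>, so
  \<open>x - e \<cdot> x\<close> factors through \<open>h\<close> and hence through the compact
  shift of \<open>Dom T f\<close>. The union of the two supports works for \<open>x\<close>.\<close>

lemma compact_cone:
  assumes t: "(f, g, h) \<in> Tri T" and c1: "compact_object \<kappa> T (Dom T f)" and c2: "compact_object \<kappa> T (Cod T f)"
  shows "compact_object \<kappa> T (Cod T g)"
proof (rule compactI)
  note t' = tri_Arr[OF t]
  show "Cod T g \<in> Ob T" using t' by simp
  have c3: "compact_object \<kappa> T (ShO T (Dom T f))" using c1 compact_ShO_iff t' by simp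
  fix I :: "'u set" and Y B \<iota> x
  assume I: "small \<kappa> I" and c: "coproduct T I Y B \<iota>" and x: "x \<in> Arr T" "Dom T x = Cod T g" "Cod T x = B"
  obtain J e where J: "finite J" "J \<subseteq> I" "is_cut T I B \<iota> J e" "e \<cdot> (x \<cdot> g) = x \<cdot> g"
    using compact_fin_supp_univ[OF c2 I c, of "x \<cdot> g"] t' x unfolding fin_supp_def by auto
  note E = is_cutD(1-3)[OF J(3)]
  let ?d = "Add T x (neg T (e \<cdot> x))"
  have d: "?d \<in> Arr T" "Dom T ?d = Cod T g" "Cod T ?d = B" using E x by auto
  have "?d \<cdot> g = Zer T (Dom T g) B" using E x t' J(4) by simp
  then obtain y where y: "y \<in> Arr T" "Dom T y = Cod T h" "Cod T y = B" "y \<cdot> h = ?d"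
    using weak_cokernel'[OF t d(1)] d t' by auto
  obtain K e' where K: "finite K" "K \<subseteq> I" "is_cut T I B \<iota> K e'" "e' \<cdot> y = y"
    using compact_fin_supp_univ[OF c3 I c, of y] t' y unfolding fin_supp_def by auto
  note E' = is_cutD(1-3)[OF K(3)]
  have "e' \<cdot> ?d = (e' \<cdot> y) \<cdot> h" unfolding y(4)[symmetric] using E' y(1-3) t' by simp
  then have d': "e' \<cdot> ?d = ?d" unfolding K(4) y(4) .
  have e2: "e \<cdot> (e \<cdot> x) = e \<cdot> x"
    using Comp_lift[OF cut_mono[OF c J(3) J(3)], of x] E x by simp
  obtain l where l: "is_cut T I B \<iota> (J \<union> K) l" by (rule cut_ex[OF c])
  note L = is_cutD(1-3)[OF l]
  have "l \<cdot> (e \<cdot> x) = e \<cdot> x" by (rule fin_supp_mono[OF c J(3) l _ _ _ e2]) (use E x in auto)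
  moreover have "l \<cdot> ?d = ?d" by (rule fin_supp_mono[OF c K(3) l _ d(1,3) d']) auto
  moreover have "Add T ?d (e \<cdot> x) = x" using E x by simp
  moreover have "l \<cdot> Add T ?d (e \<cdot> x) = Add T (l \<cdot> ?d) (l \<cdot> (e \<cdot> x))"
    by (rule Comp_Add) (use L E x d in auto)
  ultimately have "l \<cdot> x = x" by simp
  then show "fin_supp T I B \<iota> x" unfolding fin_supp_def using J K l by blast
qed

end

section \<open>Adjoint functors and compactness\<close>

locale adjoint_pair = F: lin_functor_pair \<kappa> k C D F + G: lin_functor_pair \<kappa> k D C G
  for \<kappa> :: "'u rel" and k :: "'r ring" and C :: "('r, 'o, 'm, 'y) lcat_scheme" (structure)
    and D :: "('r, 'p, 'q, 'z) lcat_scheme" and F :: "('o, 'm, 'p, 'q, 'v) ftr_scheme"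
    and G :: "('p, 'q, 'o, 'm, 'w) ftr_scheme" +
  fixes \<eta> \<epsilon>
  assumes adj: "adjunction C D F G \<eta> \<epsilon>"
begin

lemma unit_Arr [simp]:
  assumes "X \<in> Ob C" shows "\<eta> X \<in> Arr C" "Dom C (\<eta> X) = X" "Cod C (\<eta> X) = Obf G (Obf F X)"
  using adj assms by (auto simp: adjunction_def F.C.in_Hom)

lemma counit_Arr [simp]:
  assumes "Y \<in> Ob D" shows "\<epsilon> Y \<in> Arr D" "Dom D (\<epsilon> Y) = Obf F (Obf G Y)" "Cod D (\<epsilon> Y) = Y"
  using adj assms by (auto simp: adjunction_def F.D.in_Hom)

lemma unit_nat: "f \<in> Arr C \<Longrightarrow> \<eta> (Cod C f) \<cdot> f = Arf G (Arf F f) \<cdot> \<eta> (Dom C f)"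
  and counit_nat: "g \<in> Arr D \<Longrightarrow> \<epsilon> (Cod D g) \<cdot>\<^bsub>D\<^esub> Arf F (Arf G g) = g \<cdot>\<^bsub>D\<^esub> \<epsilon> (Dom D g)"
  and triangle_left: "X \<in> Ob C \<Longrightarrow> \<epsilon> (Obf F X) \<cdot>\<^bsub>D\<^esub> Arf F (\<eta> X) = Id D (Obf F X)"
  and triangle_right: "Y \<in> Ob D \<Longrightarrow> Arf G (\<epsilon> Y) \<cdot> \<eta> (Obf G Y) = Id C (Obf G Y)"
  using adj by (auto simp: adjunction_def)

lemma transpose_inj:
  assumes "\<phi> \<in> Arr D" "\<psi> \<in> Arr D" "X \<in> Ob C" "Dom D \<phi> = Obf F X" "Dom D \<psi> = Obf F X" "Cod D \<psi> = Cod D \<phi>"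
    "Arf G \<phi> \<cdot> \<eta> X = Arf G \<psi> \<cdot> \<eta> X"
  shows "\<phi> = \<psi>"
proof -
  have *: "\<chi> = \<epsilon> (Cod D \<chi>) \<cdot>\<^bsub>D\<^esub> Arf F (Arf G \<chi> \<cdot> \<eta> X)" if "\<chi> \<in> Arr D" "Dom D \<chi> = Obf F X" for \<chi>
  proof -
    have "\<epsilon> (Cod D \<chi>) \<cdot>\<^bsub>D\<^esub> Arf F (Arf G \<chi> \<cdot> \<eta> X) = (\<epsilon> (Cod D \<chi>) \<cdot>\<^bsub>D\<^esub> Arf F (Arf G \<chi>)) \<cdot>\<^bsub>D\<^esub> Arf F (\<eta> X)"
      using that assms(3) by simp
    also have "\<dots> = \<chi> \<cdot>\<^bsub>D\<^esub> (\<epsilon> (Obf F X) \<cdot>\<^bsub>D\<^esub> Arf F (\<eta> X))"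
      unfolding counit_nat[OF that(1)] using that assms(3) by simp
    also have "\<dots> = \<chi>" unfolding triangle_left[OF assms(3)] using that by simp
    finally show ?thesis by simp
  qed
  show ?thesis using *[OF assms(1,4)] *[OF assms(2,5)] assms(6,7) by simp
qed

lemma left_adjoint_coproduct:
  assumes c: "coproduct C I Y B \<iota>"
  shows "coproduct D I (\<lambda>i. Obf F (Y i)) (Obf F B) (\<lambda>i. Arf F (\<iota> i))"
proof (rule F.D.coproductI)
  note E = F.C.coproductD[OF c]
  show "Obf F B \<in> Ob D" using E by simp
  show "Arf F (\<iota> i) \<in> Arr D" "Dom D (Arf F (\<iota> i)) = Obf F (Y i)" "Cod D (Arf F (\<iota> i)) = Obf F B" if "i \<in> I" for i
    using E(2-4)[OF that] by simp_all
  fix Z g assume Z: "Z \<in> Ob D" and g: "\<And>i. i \<in> I \<Longrightarrow> g i \<in> Arr D" "\<And>i. i \<in> I \<Longrightarrow> Dom D (g i) = Obf F (Y i)"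
    "\<And>i. i \<in> I \<Longrightarrow> Cod D (g i) = Z"
  obtain h where h: "h \<in> Arr C" "Dom C h = B" "Cod C h = Obf G Z" "\<And>i. i \<in> I \<Longrightarrow> h \<cdot> \<iota> i = Arf G (g i) \<cdot> \<eta> (Y i)"
    by (rule F.C.coproduct_ex[OF c, of "Obf G Z" "\<lambda>i. Arf G (g i) \<cdot> \<eta> (Y i)"]) (use Z g E(5) in auto)
  have "(\<epsilon> Z \<cdot>\<^bsub>D\<^esub> Arf F h) \<cdot>\<^bsub>D\<^esub> Arf F (\<iota> i) = g i" if i: "i \<in> I" for i
  proof -
    note A = Z g[OF i] E(2-5)[OF i] h(1-3)
    have "(\<epsilon> Z \<cdot>\<^bsub>D\<^esub> Arf F h) \<cdot>\<^bsub>D\<^esub> Arf F (\<iota> i) = \<epsilon> Z \<cdot>\<^bsub>D\<^esub> Arf F (h \<cdot> \<iota> i)" using A by simp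
    also have "\<dots> = (\<epsilon> (Cod D (g i)) \<cdot>\<^bsub>D\<^esub> Arf F (Arf G (g i))) \<cdot>\<^bsub>D\<^esub> Arf F (\<eta> (Y i))"
      unfolding h(4)[OF i] using A by simp
    also have "\<dots> = g i \<cdot>\<^bsub>D\<^esub> (\<epsilon> (Obf F (Y i)) \<cdot>\<^bsub>D\<^esub> Arf F (\<eta> (Y i)))" unfolding counit_nat[OF g(1)[OF i]] using A by simp
    also have "\<dots> = g i" unfolding triangle_left[OF E(5)[OF i]] using A by simp
    finally show ?thesis .
  qed
  then show "\<exists>h. h \<in> Arr D \<and> Dom D h = Obf F B \<and> Cod D h = Z \<and> (\<forall>i\<in>I. h \<cdot>\<^bsub>D\<^esub> Arf F (\<iota> i) = g i)"
    using Z h(1-3) by (intro exI[of _ "\<epsilon> Z \<cdot>\<^bsub>D\<^esub> Arf F h"]) simp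
next
  note E = F.C.coproductD[OF c]
  fix h h' assume h: "h \<in> Arr D" "h' \<in> Arr D" "Dom D h = Obf F B" "Dom D h' = Obf F B" "Cod D h = Cod D h'"
    and e: "\<And>i. i \<in> I \<Longrightarrow> h \<cdot>\<^bsub>D\<^esub> Arf F (\<iota> i) = h' \<cdot>\<^bsub>D\<^esub> Arf F (\<iota> i)"
  have "Arf G h \<cdot> \<eta> B = Arf G h' \<cdot> \<eta> B"
  proof (rule F.C.coproduct_eq[OF c])
    fix i assume i: "i \<in> I"
    have *: "(Arf G \<chi> \<cdot> \<eta> B) \<cdot> \<iota> i = Arf G (\<chi> \<cdot>\<^bsub>D\<^esub> Arf F (\<iota> i)) \<cdot> \<eta> (Y i)" if "\<chi> \<in> Arr D" "Dom D \<chi> = Obf F B" for \<chi>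
    proof -
      have "(Arf G \<chi> \<cdot> \<eta> B) \<cdot> \<iota> i = Arf G \<chi> \<cdot> (\<eta> (Cod C (\<iota> i)) \<cdot> \<iota> i)" using that E(1) E(2-5)[OF i] by simp
      also have "\<dots> = Arf G (\<chi> \<cdot>\<^bsub>D\<^esub> Arf F (\<iota> i)) \<cdot> \<eta> (Y i)"
        unfolding unit_nat[OF E(2)[OF i]] using that E(1) E(2-5)[OF i] by simp
      finally show ?thesis .
    qed
    show "(Arf G h \<cdot> \<eta> B) \<cdot> \<iota> i = (Arf G h' \<cdot> \<eta> B) \<cdot> \<iota> i" unfolding *[OF h(1,3)] *[OF h(2,4)] e[OF i] ..
  qed (use h E(1) in auto)
  then show "h = h'" by (rule transpose_inj[rotated -1]) (use h E(1) in auto)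
qed

end

context lin_functor_pair begin

lemma F_cut:
  assumes c: "coproduct C I Y B \<iota>" and e: "is_cut C I B \<iota> J e"
  shows "is_cut D I (Obf F B) (\<lambda>i. Arf F (\<iota> i)) J (Arf F e)"
  unfolding is_cut_def
proof (intro conjI ballI)
  note E = C.is_cutD[OF e] and Dc = C.coproductD[OF c]
  show "Arf F e \<in> Hom D (Obf F B) (Obf F B)" using E by (simp add: D.in_Hom)
  fix i assume i: "i \<in> I"
  have "Arf F e \<cdot>\<^bsub>D\<^esub> Arf F (\<iota> i) = Arf F (e \<cdot> \<iota> i)" using Dc(2-4)[OF i] E(1-3) by simp
  then show "Arf F e \<cdot>\<^bsub>D\<^esub> Arf F (\<iota> i) = (if i \<in> J then Arf F (\<iota> i) else Zer D (Dom D (Arf F (\<iota> i))) (Obf F B))"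
    using E(4,5)[OF i] Dc(1) Dc(2-5)[OF i] by auto
qed

end

text \<open>The right adjoint \<open>G\<close> preserves coproducts because it is itself a left
  adjoint. So cuts of \<open>B\<close> go to cuts of \<open>Obf G B\<close>, and the finite support
  of the transposed arrow passes back through the adjunction.\<close>

lemma left_adjoint_compact:
  fixes \<kappa> :: "'u rel"
  assumes 1: "adjoint_pair \<kappa> k C D F G \<eta> \<epsilon>" and 2: "adjoint_pair \<kappa> k D C G H \<eta>' \<epsilon>'"
    and X: "compact_object \<kappa> C X"
  shows "compact_object \<kappa> D (Obf F X)"
proof -
  interpret FG: adjoint_pair \<kappa> k C D F G \<eta> \<epsilon> by (rule 1)
  interpret GH: adjoint_pair \<kappa> k D C G H \<eta>' \<epsilon>' by (rule 2)
  have XO: "X \<in> Ob C" using X by (simp add: compact_object_def)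
  show ?thesis
  proof (rule FG.F.D.compactI)
    show "Obf F X \<in> Ob D" using XO by simp
    fix I :: "'u set" and Y B \<iota> x
    assume I: "small \<kappa> I" and c: "coproduct D I Y B \<iota>" and x: "x \<in> Arr D" "Dom D x = Obf F X" "Cod D x = B"
    note c' = GH.left_adjoint_coproduct[OF c]
    have a: "Arf G x \<cdot>\<^bsub>C\<^esub> \<eta> X \<in> Arr C" "Dom C (Arf G x \<cdot>\<^bsub>C\<^esub> \<eta> X) = X" "Cod C (Arf G x \<cdot>\<^bsub>C\<^esub> \<eta> X) = Obf G B"
      using x XO by simp_all
    obtain J e' where J: "finite J" "J \<subseteq> I" "is_cut C I (Obf G B) (\<lambda>i. Arf G (\<iota> i)) J e'"
        "e' \<cdot>\<^bsub>C\<^esub> (Arf G x \<cdot>\<^bsub>C\<^esub> \<eta> X) = Arf G x \<cdot>\<^bsub>C\<^esub> \<eta> X"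
      using FG.F.C.compact_fin_supp_univ[OF X I c' a] unfolding fin_supp_def by blast
    obtain e where e: "is_cut D I B \<iota> J e" by (rule FG.F.D.cut_ex[OF c])
    have "e' = Arf G e" by (rule FG.F.C.cut_unique[OF c' J(3) FG.G.F_cut[OF c e]])
    then have "Arf G (e \<cdot>\<^bsub>D\<^esub> x) \<cdot>\<^bsub>C\<^esub> \<eta> X = Arf G x \<cdot>\<^bsub>C\<^esub> \<eta> X"
      using J(4) FG.F.D.is_cutD(1-3)[OF e] x XO by simp
    then have "e \<cdot>\<^bsub>D\<^esub> x = x"
      by (rule FG.transpose_inj[rotated -1]) (use FG.F.D.is_cutD(1-3)[OF e] x XO in auto)
    then show "fin_supp D I B \<iota> x" unfolding fin_supp_def using J e by blast
  qed
qed

section \<open>Approximation by compact objects\<close>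

text \<open>Enlarging the generators by all shifts and desuspensions keeps them small in number and
  compact, and lets vanishing be tested with unshifted Hom-sets only.\<close>

lemma (in tri_category) compact_generators:
  assumes "universe_card \<kappa>" "compactly_generated \<kappa> k T"
  obtains H where "small \<kappa> H" "\<And>g. g \<in> H \<Longrightarrow> compact_object \<kappa> T g"
    "\<And>g. g \<in> H \<Longrightarrow> \<exists>g0 \<in> H. isomorphic T (ShO T g0) g"
    "\<And>X. \<lbrakk>X \<in> Ob T; \<forall>g \<in> H. \<forall>\<phi> \<in> Hom T g X. \<phi> = Zer T g X\<rbrakk> \<Longrightarrow> zero_object T X"
proof -
  obtain K where K: "K \<subseteq> compacts \<kappa> T" "small \<kappa> K" "generates T K"
    using assms(2) by (auto simp: compactly_generated_def)
  \<comment> \<open>A desuspension of each object, up to isomorphism, which can then be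
    iterated.\<close>
  have "\<exists>u. u \<in> Ob T \<and> isomorphic T (ShO T u) X" if "X \<in> Ob T" for X
    by (rule ShO_ess[OF that]) (use isomorphicI in blast)
  then have "\<exists>u. \<forall>X\<in>Ob T. u X \<in> Ob T \<and> isomorphic T (ShO T (u X)) X" by (intro bchoice ballI)
  then obtain u where u: "\<forall>X\<in>Ob T. u X \<in> Ob T \<and> isomorphic T (ShO T (u X)) X" ..
  have KO: "g \<in> Ob T" "compact_object \<kappa> T g" if "g \<in> K" for g
    using K(1) that by (auto simp: compacts_def compact_object_def)
  have s: "(ShO T ^^ n) g \<in> Ob T \<and> compact_object \<kappa> T ((ShO T ^^ n) g)" if "g \<in> K" for g n
    by (induction n) (use KO[OF that] compact_ShO_iff in auto)
  have uc: "u X \<in> Ob T \<and> compact_object \<kappa> T (u X)" if "X \<in> Ob T" "compact_object \<kappa> T X" for X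
  proof -
    have "compact_object \<kappa> T (ShO T (u X))" using compact_iso[OF that(2) isomorphic_sym] u that(1) by blast
    then show ?thesis using compact_ShO_iff u that(1) by blast
  qed
  have us: "(u ^^ n) g \<in> Ob T \<and> compact_object \<kappa> T ((u ^^ n) g)" if "g \<in> K" for g n
    by (induction n) (use KO[OF that] uc in auto)
  define H where "H = (\<Union>g\<in>K. range (\<lambda>n. (ShO T ^^ n) g) \<union> range (\<lambda>n. (u ^^ n) g))"
  have "small \<kappa> H"
  proof -
    have "H = (\<Union>g\<in>K. \<Union>b\<in>{True, False}. range (\<lambda>n. if b then (ShO T ^^ n) g else (u ^^ n) g))"
      unfolding H_def by auto
    then show ?thesis
      by (simp only:) (intro small_UN[OF assms(1)] K(2) small_finite[OF assms(1)] small_image small_nat[OF assms(1)], simp)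
  qed
  moreover have HO: "g \<in> Ob T" "compact_object \<kappa> T g" if "g \<in> H" for g
    using that s us unfolding H_def by auto
  moreover have Hs: "\<exists>g0 \<in> H. isomorphic T (ShO T g0) g" if "g \<in> H" for g
  proof -
    have up: "(u ^^ n) g \<in> H" "(ShO T ^^ n) g \<in> H" if "g \<in> K" for n g unfolding H_def using that by auto
    have 1: "\<exists>g0 \<in> H. isomorphic T (ShO T g0) ((u ^^ n) g)" if "g \<in> K" for n g
      using up(1)[OF that, of "Suc n"] u us[OF that, of n] by auto
    have 2: "\<exists>g0 \<in> H. isomorphic T (ShO T g0) ((ShO T ^^ n) g)" if "g \<in> K" for n g
    proof (cases n)
      case 0
      then show ?thesis using 1[OF that, of 0] by simp
    next
      case (Suc m)
      then show ?thesis using up(2)[OF that, of m] s[OF that, of n] isomorphic_refl by auto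
    qed
    obtain g' n where "g' \<in> K" "g = (ShO T ^^ n) g' \<or> g = (u ^^ n) g'" using \<open>g \<in> H\<close> unfolding H_def by auto
    then show ?thesis using 1 2 by blast
  qed
  moreover have "zero_object T X" if X: "X \<in> Ob T" "\<forall>g \<in> H. \<forall>\<phi> \<in> Hom T g X. \<phi> = Zer T g X" for X
  proof -
    \<comment> \<open>A member of \<open>H\<close> is a shift of another one up to isomorphism, so
      arrows from it to the shift of \<open>Y\<close> come from arrows to \<open>Y\<close>.
      Induction gives the conditions on \<open>X[n]\<close> in \<open>generates\<close>.\<close>
    have step: "\<forall>g \<in> H. \<forall>\<phi> \<in> Hom T g (ShO T Y). \<phi> = Zer T g (ShO T Y)"
      if Y: "Y \<in> Ob T" "\<forall>g \<in> H. \<forall>\<phi> \<in> Hom T g Y. \<phi> = Zer T g Y" for Y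
    proof (intro ballI)
      fix g \<phi> assume g: "g \<in> H" and "\<phi> \<in> Hom T g (ShO T Y)"
      then have p: "\<phi> \<in> Arr T" "Dom T \<phi> = g" "Cod T \<phi> = ShO T Y" by (auto simp: in_Hom)
      obtain g0 where g0: "g0 \<in> H" "isomorphic T (ShO T g0) g" using Hs[OF g] by blast
      obtain w where w: "is_iso T w" "w \<in> Arr T" "Dom T w = ShO T g0" "Cod T w = g" using g0(2) by (rule isomorphicE)
      note O = HO(1)[OF g0(1)]
      obtain \<psi> where y: "\<psi> \<in> Arr T" "Dom T \<psi> = g0" "Cod T \<psi> = Y" "ShA T \<psi> = \<phi> \<cdot> w"
        by (rule ShA_full[of "\<phi> \<cdot> w" g0 Y]) (use p w O Y in auto)
      have "\<psi> = Zer T g0 Y" using Y(2) g0(1) y(1-3) by (auto simp: in_Hom)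
      then have "\<phi> \<cdot> w = Zer T g (ShO T Y) \<cdot> w" using y(4) w O Y(1) HO(1)[OF g] by simp
      then show "\<phi> = Zer T g (ShO T Y)"
        by (rule iso_cancel_right[OF w(1), rotated -1]) (use p w Y(1) HO(1)[OF g] in auto)
    qed
    have all: "(ShO T ^^ n) X \<in> Ob T \<and> (\<forall>g \<in> H. \<forall>\<phi> \<in> Hom T g ((ShO T ^^ n) X). \<phi> = Zer T g ((ShO T ^^ n) X))" for n
    proof (induction n)
      case 0
      show ?case using X by simp
    next
      case (Suc n)
      then show ?case using step[of "(ShO T ^^ n) X"] by simp
    qed
    have eq: "Hom T g Y = {Zer T g Y}" if "g \<in> Ob T" "Y \<in> Ob T" "\<forall>\<phi> \<in> Hom T g Y. \<phi> = Zer T g Y" for g Y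
    proof -
      have "Zer T g Y \<in> Hom T g Y" using that(1,2) by (simp add: in_Hom)
      then show ?thesis using that(3) by blast
    qed
    have Z: "Hom T ((ShO T ^^ n) g) X = {Zer T ((ShO T ^^ n) g) X} \<and>
        Hom T g ((ShO T ^^ n) X) = {Zer T g ((ShO T ^^ n) X)}" if g: "g \<in> K" for g n
    proof
      have "(ShO T ^^ n) g \<in> H" unfolding H_def using g by auto
      then show "Hom T ((ShO T ^^ n) g) X = {Zer T ((ShO T ^^ n) g) X}"
        using eq[OF conjunct1[OF s[OF g]] X(1)] X(2) by blast
      have "(ShO T ^^ 0) g \<in> H" unfolding H_def using g by blast
      then have "g \<in> H" by simp
      then show "Hom T g ((ShO T ^^ n) X) = {Zer T g ((ShO T ^^ n) X)}"
        using eq[OF KO(1)[OF g]] all[of n] by blast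
    qed
    from K(3)[unfolded generates_def, THEN bspec, OF X(1), THEN mp] show ?thesis using Z by blast
  qed
  ultimately show ?thesis using that by blast
qed

text \<open>
  For a coproduct preserving triangle functor \<open>F\<close> and a compact object \<open>C\<close>, the functor \<open>Hom(C, F -)\<close> is the
  left Kan extension of its restriction to the compact objects. Only surjectivity of the comparison map
  is needed: every \<open>x : C \<rightarrow> F X\<close> comes from a compact object over \<open>X\<close>.
\<close>

locale approximation = tri_functor_pair \<kappa> k T U F + adjoint_pair \<kappa> k T U F G \<eta> \<epsilon>
  for \<kappa> :: "'u rel" and k :: "'r ring" and T :: "('r, 'o, 'm, 'y) tcat_scheme" (structure)
    and U :: "('r, 'p, 'q, 'z) tcat_scheme" and F :: "('o, 'm, 'p, 'q, 'v) tftr_scheme"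
    and G :: "('p, 'q, 'o, 'm, 'w) tftr_scheme" and \<eta> \<epsilon> +
  fixes A :: 'p
  assumes univ: "universe_card \<kappa>" and gen: "compactly_generated \<kappa> k T" and A: "compact_object \<kappa> U A"
begin

definition good :: "'o \<Rightarrow> 'q \<Rightarrow> bool" where
  "good X x \<longleftrightarrow> (\<exists>d y. d \<in> Arr T \<and> compact_object \<kappa> T (Dom T d) \<and> Cod T d = X \<and>
     y \<in> Arr U \<and> Dom U y = A \<and> Cod U y = Obf F (Dom T d) \<and> Arf F d \<cdot>\<^bsub>U\<^esub> y = x)"

lemma sums: "has_direct_sums \<kappa> T"
  using gen by (simp add: compactly_generated_def)

lemma A_Ob: "A \<in> Ob U"
  using A by (simp add: compact_object_def)

text \<open>As a left adjoint \<open>F\<close> preserves coproducts, and by uniqueness every cut of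
  the image is the image of a cut in \<open>T\<close>.\<close>

lemma F_fin_supp:
  assumes c: "coproduct T I Y B \<iota>" and I: "small \<kappa> I" and x: "x \<in> Arr U" "Dom U x = A" "Cod U x = Obf F B"
  obtains J e where "finite J" "J \<subseteq> I" "is_cut T I B \<iota> J e" "Arf F e \<cdot>\<^bsub>U\<^esub> x = x"
proof -
  note c' = left_adjoint_coproduct[OF c]
  obtain J e' where J: "finite J" "J \<subseteq> I" "is_cut U I (Obf F B) (\<lambda>i. Arf F (\<iota> i)) J e'" "e' \<cdot>\<^bsub>U\<^esub> x = x"
    using U.compact_fin_supp[OF A univ I c' x] unfolding fin_supp_def by blast
  obtain e where e: "is_cut T I B \<iota> J e" by (rule T.cut_ex[OF c])
  have "e' = Arf F e" by (rule U.cut_unique[OF c' J(3) F_cut[OF c e]])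
  then show ?thesis using that J e by blast
qed

lemma good_zero: assumes "X \<in> Ob T" shows "good X (Zer U A (Obf F X))"
proof -
  obtain Z where Z: "zero_object T Z" using T.ex_zero_object by blast
  then have ZO: "Z \<in> Ob T" by (simp add: zero_object_def)
  show ?thesis unfolding good_def
    using T.compact_zero[OF Z] ZO assms A_Ob
    by (intro exI[of _ "Zer T Z X"] exI[of _ "Zer U A (Obf F Z)"]) simp
qed

text \<open>The biproduct of the two compact objects approximates the sum, with the row of
  \<open>d\<close>, \<open>d'\<close> and the column of \<open>y\<close>, \<open>y'\<close>.\<close>

lemma good_add:
  assumes "good X x" "good X x'" shows "good X (Add U x x')"
proof -
  obtain d y where d: "d \<in> Arr T" "compact_object \<kappa> T (Dom T d)" "Cod T d = X" "y \<in> Arr U" "Dom U y = A"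
    "Cod U y = Obf F (Dom T d)" "Arf F d \<cdot>\<^bsub>U\<^esub> y = x" using assms(1) unfolding good_def by blast
  obtain d' y' where d': "d' \<in> Arr T" "compact_object \<kappa> T (Dom T d')" "Cod T d' = X" "y' \<in> Arr U" "Dom U y' = A"
    "Cod U y' = Obf F (Dom T d')" "Arf F d' \<cdot>\<^bsub>U\<^esub> y' = x'" using assms(2) unfolding good_def by blast
  obtain B where "biproduct T (Dom T d) (Dom T d') B" using T.ex_biproduct[of "Dom T d" "Dom T d'"] d(1) d'(1) by auto
  then obtain i1 i2 p1 p2 where h: "i1 \<in> Hom T (Dom T d) B" "i2 \<in> Hom T (Dom T d') B"
    "p1 \<in> Hom T B (Dom T d)" "p2 \<in> Hom T B (Dom T d')"
    and e: "p1 \<cdot> i1 = Id T (Dom T d)" "p2 \<cdot> i2 = Id T (Dom T d')" "p2 \<cdot> i1 = Zer T (Dom T d) (Dom T d')"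
      "p1 \<cdot> i2 = Zer T (Dom T d') (Dom T d)" "Add T (i1 \<cdot> p1) (i2 \<cdot> p2) = Id T B"
    unfolding biproduct_def by blast
  have BO: "B \<in> Ob T" using h(1) T.Cod_in[of i1] by (simp add: T.in_Hom)
  have B: "compact_object \<kappa> T B" by (rule T.compact_biproduct[OF d(2) d'(2) h e(5)])
  note a = h[unfolded T.in_Hom]
  let ?d = "Add T (d \<cdot> p1) (d' \<cdot> p2)" and ?y = "Add U (Arf F i1 \<cdot>\<^bsub>U\<^esub> y) (Arf F i2 \<cdot>\<^bsub>U\<^esub> y')"
  note AA = a d(1-6) d'(1-6) BO
  have D: "?d \<in> Arr T" "Dom T ?d = B" "Cod T ?d = X" "?y \<in> Arr U" "Dom U ?y = A" "Cod U ?y = Obf F B"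
    using AA by simp_all
  have 1: "?d \<cdot> i1 = d" using AA e by simp
  have 2: "?d \<cdot> i2 = d'" using AA e by simp
  have "Arf F ?d \<cdot>\<^bsub>U\<^esub> ?y = Add U (Arf F ?d \<cdot>\<^bsub>U\<^esub> (Arf F i1 \<cdot>\<^bsub>U\<^esub> y)) (Arf F ?d \<cdot>\<^bsub>U\<^esub> (Arf F i2 \<cdot>\<^bsub>U\<^esub> y'))"
    by (rule U.Comp_Add) (use AA D(1-3) in simp_all)
  also have "Arf F ?d \<cdot>\<^bsub>U\<^esub> (Arf F i1 \<cdot>\<^bsub>U\<^esub> y) = Arf F (?d \<cdot> i1) \<cdot>\<^bsub>U\<^esub> y"
    using AA D(1-3) by (subst F_Comp) simp_all
  also have "Arf F ?d \<cdot>\<^bsub>U\<^esub> (Arf F i2 \<cdot>\<^bsub>U\<^esub> y') = Arf F (?d \<cdot> i2) \<cdot>\<^bsub>U\<^esub> y'"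
    using AA D(1-3) by (subst F_Comp) simp_all
  finally have "Arf F ?d \<cdot>\<^bsub>U\<^esub> ?y = Add U x x'" unfolding 1 2 d(7) d'(7) .
  then show ?thesis unfolding good_def using D B by (intro exI[of _ ?d] exI[of _ ?y]) simp
qed

text \<open>By finite support \<open>z\<close> passes through the image of a finite partial
  coproduct, which is compact.\<close>

lemma good_coproduct:
  assumes c: "coproduct T I Y P \<iota>" and I: "small \<kappa> I" and Y: "\<And>i. i \<in> I \<Longrightarrow> compact_object \<kappa> T (Y i)"
    and p: "p \<in> Arr T" "Dom T p = P" and z: "z \<in> Arr U" "Dom U z = A" "Cod U z = Obf F P"
  shows "good (Cod T p) (Arf F p \<cdot>\<^bsub>U\<^esub> z)"
proof -
  obtain J e where J: "finite J" "J \<subseteq> I" "is_cut T I P \<iota> J e" "Arf F e \<cdot>\<^bsub>U\<^esub> z = z" by (rule F_fin_supp[OF c I z])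
  obtain D a b where D: "compact_object \<kappa> T D" "a \<in> Arr T" "Dom T a = D" "Cod T a = P"
    "b \<in> Arr T" "Dom T b = P" "Cod T b = D" "a \<cdot> b = e"
    by (rule T.cut_split[OF univ sums c Y J(1-3)])
  have "Arf F (p \<cdot> a) \<cdot>\<^bsub>U\<^esub> (Arf F b \<cdot>\<^bsub>U\<^esub> z) = Arf F p \<cdot>\<^bsub>U\<^esub> (Arf F (a \<cdot> b) \<cdot>\<^bsub>U\<^esub> z)" using D(2-7) p z by simp
  then have "Arf F (p \<cdot> a) \<cdot>\<^bsub>U\<^esub> (Arf F b \<cdot>\<^bsub>U\<^esub> z) = Arf F p \<cdot>\<^bsub>U\<^esub> z" unfolding D(8) J(4) .
  then show ?thesis unfolding good_def using D p z by (intro exI[of _ "p \<cdot> a"] exI[of _ "Arf F b \<cdot>\<^bsub>U\<^esub> z"]) simp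
qed

text \<open>The approximation \<open>d\<close> of the image of \<open>x\<close> under
  \<open>q\<close> may not lift along \<open>q\<close>. The obstruction \<open>r \<cdot> d\<close>
  has finite support in a shifted coproduct of compact objects, so it disappears on a compact fibre
  \<open>m\<close>, to which \<open>y\<close> lifts. What the lifted approximation misses of
  \<open>x\<close> comes from the coproduct, where \<open>good_coproduct\<close> applies.\<close>

lemma good_step:
  assumes t: "(p, q, r) \<in> Tri T" and c: "coproduct T I Y (Dom T p) \<iota>" and I: "small \<kappa> I"
    and Y: "\<And>i. i \<in> I \<Longrightarrow> compact_object \<kappa> T (Y i)"
    and x: "x \<in> Arr U" "Dom U x = A" "Cod U x = Obf F (Cod T p)" and g: "good (Cod T q) (Arf F q \<cdot>\<^bsub>U\<^esub> x)"
  shows "good (Cod T p) x"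
proof -
  note tt = T.tri_Arr[OF t] and ft = F_Tri[OF t]
  obtain d y where d: "d \<in> Arr T" "compact_object \<kappa> T (Dom T d)" "Cod T d = Cod T q" "y \<in> Arr U" "Dom U y = A"
    "Cod U y = Obf F (Dom T d)" and dy: "Arf F d \<cdot>\<^bsub>U\<^esub> y = Arf F q \<cdot>\<^bsub>U\<^esub> x" using g unfolding good_def by blast
  let ?P = "Dom T p"
  note AA = tt x d
  have PO: "?P \<in> Ob T" using tt by simp
  \<comment> \<open>The source of \<open>d\<close> is compact and \<open>r\<close> ends in the shift
    of a coproduct of compact objects.\<close>
  obtain J e' where J: "finite J" "J \<subseteq> I" "is_cut T I (ShO T ?P) (\<lambda>i. ShA T (\<iota> i)) J e'" "e' \<cdot> (r \<cdot> d) = r \<cdot> d"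
    using T.compact_fin_supp[OF d(2) univ I T.ShO_coproduct[OF c], of "r \<cdot> d"] AA unfolding fin_supp_def by auto
  obtain e where e: "is_cut T I ?P \<iota> J e" by (rule T.cut_ex[OF c])
  have e': "e' = ShA T e" by (rule T.cut_unique[OF T.ShO_coproduct[OF c] J(3) T.ShA_cut[OF c e]])
  obtain D a b where D: "compact_object \<kappa> T D" "a \<in> Arr T" "Dom T a = D" "Cod T a = ?P"
    "b \<in> Arr T" "Dom T b = ?P" "Cod T b = D" and ba: "b \<cdot> a = Id T D" and ab: "a \<cdot> b = e"
    by (rule T.cut_split[OF univ sums c Y J(1,2) e])
  have DO: "D \<in> Ob T" using D(1) by (simp add: compact_object_def)
  \<comment> \<open>The obstruction as an arrow to the shift of the compact summand
    \<open>D\<close>; the cut fixes \<open>r \<cdot> d\<close>, so nothing is lost.\<close>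
  define v where "v = ShA T b \<cdot> (r \<cdot> d)"
  note AA = AA D DO PO
  have v: "v \<in> Arr T" "Dom T v = Dom T d" "Cod T v = ShO T D" using AA by (simp_all add: v_def)
  have av: "ShA T a \<cdot> v = r \<cdot> d"
  proof -
    have "ShA T a \<cdot> v = ShA T (a \<cdot> b) \<cdot> (r \<cdot> d)" using AA by (simp add: v_def)
    then show ?thesis unfolding ab e'[symmetric] J(4) .
  qed
  have "Arf F (r \<cdot> d) \<cdot>\<^bsub>U\<^esub> y = Arf F r \<cdot>\<^bsub>U\<^esub> (Arf F d \<cdot>\<^bsub>U\<^esub> y)" using AA by simp
  also have "\<dots> = Arf F (r \<cdot> q) \<cdot>\<^bsub>U\<^esub> x" unfolding dy using AA by simp
  also have "\<dots> = Zer U A (Obf F (Cod T r))" unfolding T.tri_comp_Zer'(1)[OF t] using AA by simp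
  finally have rdy: "Arf F (r \<cdot> d) \<cdot>\<^bsub>U\<^esub> y = Zer U A (Obf F (Cod T r))" .
  have "Arf F v \<cdot>\<^bsub>U\<^esub> y = Arf F (ShA T b) \<cdot>\<^bsub>U\<^esub> (Arf F (r \<cdot> d) \<cdot>\<^bsub>U\<^esub> y)" using AA by (simp add: v_def)
  also have "\<dots> = Zer U A (Obf F (ShO T D))" unfolding rdy using AA A_Ob by simp
  finally have vy: "Arf F v \<cdot>\<^bsub>U\<^esub> y = Zer U A (Obf F (ShO T D))" .
  \<comment> \<open>On the fibre of \<open>v\<close> the obstruction vanishes. The fibre is compact
    because both ends of \<open>v\<close> are.\<close>
  obtain m h where m: "(m, v, h) \<in> Tri T" by (rule T.fibre[OF v(1)])
  note mm = T.tri_Arr[OF m]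
  have cD: "compact_object \<kappa> T (ShO T D)" using D(1) T.compact_ShO_iff[OF DO] by simp
  have "compact_object \<kappa> T (ShO T (Dom T m))"
    using T.compact_cone[OF T.tri_rotate[OF m]] d(2) cD v mm by simp
  then have cm: "compact_object \<kappa> T (Dom T m)" using T.compact_ShO_iff mm by simp
  obtain y' where y': "y' \<in> Arr U" "Dom U y' = A" "Cod U y' = Obf F (Dom T m)" "Arf F m \<cdot>\<^bsub>U\<^esub> y' = y"
    using U.weak_kernel[OF F_Tri[OF m], of y] AA v mm vy by auto
  have "r \<cdot> (d \<cdot> m) = (ShA T a \<cdot> v) \<cdot> m" unfolding av using AA v mm by simp
  also have "\<dots> = ShA T a \<cdot> (v \<cdot> m)" using AA v mm by simp
  also have "\<dots> = Zer T (Dom T m) (Cod T r)" unfolding T.tri_comp_Zer[OF m] using AA v mm by simp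
  finally obtain d' where d': "d' \<in> Arr T" "Dom T d' = Dom T m" "Cod T d' = Dom T q" "q \<cdot> d' = d \<cdot> m"
    using T.weak_kernel'[OF t, of "d \<cdot> m"] AA v mm by auto
  have g1: "good (Cod T p) (Arf F d' \<cdot>\<^bsub>U\<^esub> y')"
    unfolding good_def using d' y' cm tt by (intro exI[of _ d'] exI[of _ y']) simp
  \<comment> \<open>The part of \<open>x\<close> that the lifted approximation misses. It is killed
    by \<open>q\<close> and hence comes from the coproduct.\<close>
  let ?n = "Add U x (neg U (Arf F d' \<cdot>\<^bsub>U\<^esub> y'))"
  note AA = AA mm v y'(1-3) d'(1-3)
  have n: "?n \<in> Arr U" "Dom U ?n = A" "Cod U ?n = Obf F (Cod T p)" using AA by simp_all
  have "Arf F q \<cdot>\<^bsub>U\<^esub> (Arf F d' \<cdot>\<^bsub>U\<^esub> y') = Arf F (q \<cdot> d') \<cdot>\<^bsub>U\<^esub> y'" using AA by simp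
  also have "\<dots> = Arf F d \<cdot>\<^bsub>U\<^esub> (Arf F m \<cdot>\<^bsub>U\<^esub> y')" unfolding d'(4) using AA by simp
  also have "\<dots> = Arf F q \<cdot>\<^bsub>U\<^esub> x" unfolding y'(4) dy ..
  finally have "Arf F q \<cdot>\<^bsub>U\<^esub> ?n = Zer U A (Obf F (Cod T q))" using AA by simp
  then obtain z where z: "z \<in> Arr U" "Dom U z = A" "Cod U z = Obf F ?P" "Arf F p \<cdot>\<^bsub>U\<^esub> z = ?n"
    using U.weak_kernel[OF ft, of ?n] n AA by auto
  have g2: "good (Cod T p) ?n" unfolding z(4)[symmetric] by (rule good_coproduct[OF c I Y _ _ z(1-3)]) (use tt in auto)
  have "Add U (Arf F d' \<cdot>\<^bsub>U\<^esub> y') ?n = x" using AA by simp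
  then show ?thesis using good_add[OF g1 g2] by simp
qed

theorem all_good:
  assumes X: "X \<in> Ob T" and x: "x \<in> Arr U" "Dom U x = A" "Cod U x = Obf F X"
  shows "good X x"
proof -
  obtain H where H: "small \<kappa> H" "\<And>g. g \<in> H \<Longrightarrow> compact_object \<kappa> T g"
    "\<And>g. g \<in> H \<Longrightarrow> \<exists>g0 \<in> H. isomorphic T (ShO T g0) g"
    "\<And>X. \<lbrakk>X \<in> Ob T; \<forall>g \<in> H. \<forall>\<phi> \<in> Hom T g X. \<phi> = Zer T g X\<rbrakk> \<Longrightarrow> zero_object T X"
    using T.compact_generators[OF univ gen] by blast
  have HO: "g \<in> Ob T" if "g \<in> H" for g using H(2)[OF that] by (simp add: compact_object_def)
  have "\<exists>q. q \<in> Arr T \<and> Dom T q = V \<and> (\<forall>\<phi> \<in> Arr T. Dom T \<phi> \<in> H \<and> Cod T \<phi> = V \<longrightarrow> q \<cdot> \<phi> = Zer T (Dom T \<phi>) (Cod T q)) \<and>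
      (\<forall>x. x \<in> Arr U \<and> Dom U x = A \<and> Cod U x = Obf F V \<and> good (Cod T q) (Arf F q \<cdot>\<^bsub>U\<^esub> x) \<longrightarrow> good V x)"
    if V: "V \<in> Ob T" for V
  proof -
    \<comment> \<open>All arrows from the generators to \<open>V\<close> form a small set. The cone
      \<open>q\<close> of the canonical arrow from the coproduct of their sources annihilates each
      of them.\<close>
    define I where "I = {\<phi> \<in> Arr T. Dom T \<phi> \<in> H \<and> Cod T \<phi> = V}"
    have "I = (\<Union>g\<in>H. Hom T g V)" unfolding I_def by (auto simp: T.in_Hom)
    then have I: "small \<kappa> I" using small_UN[OF univ H(1) T.Hom_small] HO V by simp
    obtain P \<iota> where P: "coproduct T I (Dom T) P \<iota>"
      by (rule T.has_direct_sums_any[OF univ sums I, of "Dom T"]) (use HO in \<open>auto simp: I_def\<close>)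
    note D = T.coproductD[OF P]
    obtain p where p: "p \<in> Arr T" "Dom T p = P" "Cod T p = V" "\<And>\<phi>. \<phi> \<in> I \<Longrightarrow> p \<cdot> \<iota> \<phi> = \<phi>"
      by (rule T.coproduct_ex[OF P V, of "\<lambda>\<phi>. \<phi>"]) (auto simp: I_def)
    obtain q r where t: "(p, q, r) \<in> Tri T" using T.TR1_cone[OF p(1)] by blast
    note tt = T.tri_Arr[OF t]
    have "q \<cdot> \<phi> = Zer T (Dom T \<phi>) (Cod T q)" if "\<phi> \<in> I" for \<phi>
    proof -
      have "q \<cdot> \<phi> = q \<cdot> (p \<cdot> \<iota> \<phi>)" unfolding p(4)[OF that] ..
      also have "\<dots> = (q \<cdot> p) \<cdot> \<iota> \<phi>" using p(1-3) tt D(2-4)[OF that] by simp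
      also have "\<dots> = Zer T (Dom T \<phi>) (Cod T q)" unfolding T.tri_comp_Zer[OF t] using p(1-3) tt D(2-5)[OF that] by simp
      finally show ?thesis .
    qed
    moreover have "good V x" if "x \<in> Arr U" "Dom U x = A" "Cod U x = Obf F V" "good (Cod T q) (Arf F q \<cdot>\<^bsub>U\<^esub> x)" for x
      using good_step[OF t _ I _ that(1,2) _ that(4), of "Dom T" \<iota>] P p that(3) H(2) by (auto simp: I_def)
    ultimately show ?thesis using tt p by (intro exI[of _ q]) (auto simp: I_def)
  qed
  then have "\<exists>nx. \<forall>V\<in>Ob T. nx V \<in> Arr T \<and> Dom T (nx V) = V \<and>
      (\<forall>\<phi> \<in> Arr T. Dom T \<phi> \<in> H \<and> Cod T \<phi> = V \<longrightarrow> nx V \<cdot> \<phi> = Zer T (Dom T \<phi>) (Cod T (nx V))) \<and>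
      (\<forall>x. x \<in> Arr U \<and> Dom U x = A \<and> Cod U x = Obf F V \<and> good (Cod T (nx V)) (Arf F (nx V) \<cdot>\<^bsub>U\<^esub> x) \<longrightarrow> good V x)"
    by (intro bchoice ballI)
  then obtain nx where nx0: "\<forall>V\<in>Ob T. nx V \<in> Arr T \<and> Dom T (nx V) = V \<and>
      (\<forall>\<phi> \<in> Arr T. Dom T \<phi> \<in> H \<and> Cod T \<phi> = V \<longrightarrow> nx V \<cdot> \<phi> = Zer T (Dom T \<phi>) (Cod T (nx V))) \<and>
      (\<forall>x. x \<in> Arr U \<and> Dom U x = A \<and> Cod U x = Obf F V \<and> good (Cod T (nx V)) (Arf F (nx V) \<cdot>\<^bsub>U\<^esub> x) \<longrightarrow> good V x)" ..
  \<comment> \<open>The tower, obtained by iterating the step from \<open>X\<close>;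
    \<open>sg\<close> is the descent along one stage.\<close>
  define V where "V n = ((\<lambda>X. Cod T (nx X)) ^^ n) X" for n :: nat
  define s where "s n = nx (V n)" for n
  have V0: "V 0 = X" by (simp add: V_def)
  have VO: "V n \<in> Ob T" for n
    by (induction n) (use nx0 X in \<open>auto simp: V_def\<close>)
  have s: "s n \<in> Arr T" "Dom T (s n) = V n" "Cod T (s n) = V (Suc n)" for n
    using nx0 VO[of n] by (auto simp: s_def V_def)
  have sz: "s n \<cdot> \<phi> = Zer T (Dom T \<phi>) (V (Suc n))" if "\<phi> \<in> Arr T" "Dom T \<phi> \<in> H" "Cod T \<phi> = V n" for n \<phi>
    using nx0 VO[of n] that s(3)[of n] by (auto simp: s_def)
  have sg: "good (V n) x" if "x \<in> Arr U" "Dom U x = A" "Cod U x = Obf F (V n)" "good (V (Suc n)) (Arf F (s n) \<cdot>\<^bsub>U\<^esub> x)" for n x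
    using nx0 VO[of n] that s(3)[of n] by (auto simp: s_def)
  have nat: "small \<kappa> (UNIV :: nat set)" by (rule small_nat[OF univ])
  obtain B \<iota> where B: "coproduct T UNIV V B \<iota>" by (rule T.has_direct_sums_any[OF univ sums nat, of V]) (rule VO)
  have i: "B \<in> Ob T" "\<iota> n \<in> Arr T" "Dom T (\<iota> n) = V n" "Cod T (\<iota> n) = B" for n
    using T.coproductD[OF B] by auto
  obtain \<pi> where p0: "\<forall>n\<in>UNIV. \<pi> n \<in> Arr T \<and> Dom T (\<pi> n) = B \<and> Cod T (\<pi> n) = V n \<and>
      (\<forall>m\<in>UNIV. \<pi> n \<cdot> \<iota> m = (if m = n then Id T (V n) else Zer T (V m) (V n)))" by (rule T.coproduct_proj[OF B])
  then have p: "\<pi> n \<in> Arr T" "Dom T (\<pi> n) = B" "Cod T (\<pi> n) = V n" "\<pi> n \<cdot> \<iota> n = Id T (V n)"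
    "m \<noteq> n \<Longrightarrow> \<pi> n \<cdot> \<iota> m = Zer T (V m) (V n)" for n m by auto
  \<comment> \<open>The map induced by the transition arrows; the cone of
    \<open>\<delta> = 1 - \<sigma>\<close> is the homotopy colimit of the tower.\<close>
  obtain \<sigma> where S: "\<sigma> \<in> Arr T" "Dom T \<sigma> = B" "Cod T \<sigma> = B" and S4: "\<And>n. \<sigma> \<cdot> \<iota> n = \<iota> (Suc n) \<cdot> s n"
    by (rule T.coproduct_ex[OF B i(1), of "\<lambda>n. \<iota> (Suc n) \<cdot> s n"]) (use i s in auto)
  define \<delta> where "\<delta> = Add T (Id T B) (neg T \<sigma>)"
  have d: "\<delta> \<in> Arr T" "Dom T \<delta> = B" "Cod T \<delta> = B" using S i(1) by (simp_all add: \<delta>_def)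
  \<comment> \<open>An arrow \<open>b\<close> from a generator is a finite sum of arrows into single
    stages, and each of these dies in the next stage.\<close>
  have \<sigma>b: "\<sigma> \<cdot> b = Zer T (Dom T b) B" if b: "b \<in> Arr T" "Dom T b \<in> H" "Cod T b = B" for b
  proof -
    let ?g = "Dom T b"
    have gO: "?g \<in> Ob T" "b \<in> Hom T ?g B" using b by (auto simp: T.in_Hom)
    obtain J e where J: "finite J" "is_cut T UNIV B \<iota> J e" "e \<cdot> b = b"
      using T.compact_fin_supp[OF H(2)[OF b(2)] univ nat B b(1) _ b(3)] unfolding fin_supp_def by auto
    have h: "\<iota> n \<cdot> (\<pi> n \<cdot> b) \<in> Hom T ?g B" for n using i p(1-3) b by (simp add: T.in_Hom)
    have "\<sigma> \<cdot> b = \<sigma> \<cdot> finsum (Hom_module T ?g B) (\<lambda>n. \<iota> n \<cdot> (\<pi> n \<cdot> b)) J"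
      using T.cut_hsum[OF B J(1) subset_UNIV J(2) gO(2) p(1-5)] J(3) by simp
    also have "\<dots> = finsum (Hom_module T ?g B) (\<lambda>n. \<sigma> \<cdot> (\<iota> n \<cdot> (\<pi> n \<cdot> b))) J"
      by (rule T.Comp_hsum[OF J(1) h _ gO(1)]) (use S in \<open>simp add: T.in_Hom\<close>)
    also have "\<dots> = finsum (Hom_module T ?g B) (\<lambda>n. Zer T ?g B) J"
    proof (rule T.hsum_cong)
      fix n
      have "\<sigma> \<cdot> (\<iota> n \<cdot> (\<pi> n \<cdot> b)) = \<iota> (Suc n) \<cdot> (s n \<cdot> (\<pi> n \<cdot> b))"
        using T.Comp_lift[OF S4[of n], of "\<pi> n \<cdot> b"] S i p(1-3) b s by simp
      also have "s n \<cdot> (\<pi> n \<cdot> b) = Zer T ?g (V (Suc n))" using sz[of "\<pi> n \<cdot> b" n] p(1-3) b by simp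
      finally show "\<sigma> \<cdot> (\<iota> n \<cdot> (\<pi> n \<cdot> b)) = Zer T ?g B" using i gO(1) by simp
    qed (use i(1) gO(1) in \<open>simp_all add: T.in_Hom\<close>)
    also have "\<dots> = finsum (Hom_module T ?g B) (\<lambda>n::nat. Zer T ?g B) {}"
      by (rule T.hsum_neutral[symmetric]) (use J(1) i(1) gO(1) in \<open>simp_all add: T.in_Hom\<close>)
    also have "\<dots> = Zer T ?g B" by (rule T.hsum_empty[OF gO(1) i(1)])
    finally show ?thesis .
  qed
  have \<delta>b: "\<delta> \<cdot> b = b" if b: "b \<in> Arr T" "Dom T b \<in> H" "Cod T b = B" for b
    using \<sigma>b[OF b] b S i(1) by (simp add: \<delta>_def)
  obtain c w where t: "(\<delta>, c, w) \<in> Tri T" using T.TR1_cone[OF d(1)] by blast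
  note tt = T.tri_Arr[OF t]
  \<comment> \<open>On arrows from generators \<open>\<delta>\<close> acts as the identity. Such an
    arrow to the cone therefore has zero boundary, so it comes from some
    \<open>b = \<delta> \<cdot> b\<close>, which the cone kills.\<close>
  have "zero_object T (Cod T c)"
  proof (rule H(4), goal_cases)
    case 1
    show ?case using tt by simp
  next
    case 2
    show ?case
    proof (intro ballI)
      fix g y assume g: "g \<in> H" and "y \<in> Hom T g (Cod T c)"
      then have y: "y \<in> Arr T" "Dom T y = g" "Cod T y = Cod T c" by (auto simp: T.in_Hom)
      obtain g0 where g0: "g0 \<in> H" "isomorphic T (ShO T g0) g" using H(3)[OF g] by blast
      obtain v where v: "is_iso T v" "v \<in> Arr T" "Dom T v = ShO T g0" "Cod T v = g" using g0(2) by (rule T.isomorphicE)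
      note O = HO[OF g0(1)] HO[OF g] i(1)
      note AA = O y v d tt
      \<comment> \<open>The boundary of \<open>y\<close>, desuspended along the isomorphism
        \<open>v\<close>. It is annihilated by \<open>\<delta>\<close> and also fixed by it, hence
        zero.\<close>
      obtain b0 where b0: "b0 \<in> Arr T" "Dom T b0 = g0" "Cod T b0 = B" "ShA T b0 = w \<cdot> (y \<cdot> v)"
        by (rule T.ShA_full[of "w \<cdot> (y \<cdot> v)" g0 B]) (use AA in auto)
      have "ShA T (\<delta> \<cdot> b0) = (ShA T \<delta> \<cdot> w) \<cdot> (y \<cdot> v)" using AA b0 by simp
      also have "\<dots> = Zer T (ShO T g0) (ShO T B)" unfolding T.tri_comp_Zer'(2)[OF t] using AA by simp
      finally have "w \<cdot> (y \<cdot> v) = Zer T (ShO T g0) (ShO T B)" using \<delta>b[of b0] b0 g0(1) by simp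
      then have "(w \<cdot> y) \<cdot> v = Zer T g (ShO T B) \<cdot> v" using AA by simp
      then have "w \<cdot> y = Zer T g (ShO T B)" by (rule T.iso_cancel_right[OF v(1), rotated -1]) (use AA in auto)
      then obtain b where b: "b \<in> Arr T" "Dom T b = g" "Cod T b = B" "c \<cdot> b = y"
        using T.weak_kernel'[OF t, of y] AA by auto
      have "y = c \<cdot> (\<delta> \<cdot> b)" using \<delta>b[of b] b g by simp
      also have "\<dots> = (c \<cdot> \<delta>) \<cdot> b" using AA b(1-3) by simp
      finally show "y = Zer T g (Cod T c)" unfolding T.tri_comp_Zer[OF t] using AA b(1-3) by simp
    qed
  qed
  then have \<delta>iso: "is_iso T \<delta>" by (rule T.zero_cone_iso[OF t])
  \<comment> \<open>Solve \<open>\<delta> z = x\<close>, with \<open>x\<close> placed in stage 0.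
    The telescoping equation forces the components of \<open>z\<close> to be the images of
    \<open>x\<close> along the tower, while finite support makes almost all of them vanish.\<close>
  define z where "z = Arf F (inv_arrow T \<delta>) \<cdot>\<^bsub>U\<^esub> (Arf F (\<iota> 0) \<cdot>\<^bsub>U\<^esub> x)"
  have i0: "Cod U x = Obf F (V 0)" using x(3) V0 by simp
  have z: "z \<in> Arr U" "Dom U z = A" "Cod U z = Obf F B" using x(1,2) i0 i d \<delta>iso by (simp_all add: z_def)
  have \<delta>z: "Arf F \<delta> \<cdot>\<^bsub>U\<^esub> z = Arf F (\<iota> 0) \<cdot>\<^bsub>U\<^esub> x"
  proof -
    have "Arf F \<delta> \<cdot>\<^bsub>U\<^esub> z = Arf F (\<delta> \<cdot> inv_arrow T \<delta>) \<cdot>\<^bsub>U\<^esub> (Arf F (\<iota> 0) \<cdot>\<^bsub>U\<^esub> x)"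
      using x(1,2) i0 i d \<delta>iso by (simp add: z_def del: T.inv_right)
    then show ?thesis using x(1,2) i0 i d \<delta>iso by simp
  qed
  define zz where "zz n = Arf F (\<pi> n) \<cdot>\<^bsub>U\<^esub> z" for n
  have zz: "zz n \<in> Arr U" "Dom U (zz n) = A" "Cod U (zz n) = Obf F (V n)" for n
    using z p(1-3) by (simp_all add: zz_def)
  have \<pi>\<delta>: "Arf F (\<pi> n \<cdot> \<delta>) \<cdot>\<^bsub>U\<^esub> z = Arf F (\<pi> n \<cdot> \<iota> 0) \<cdot>\<^bsub>U\<^esub> x" for n
  proof -
    have "Arf F (\<pi> n \<cdot> \<delta>) \<cdot>\<^bsub>U\<^esub> z = Arf F (\<pi> n) \<cdot>\<^bsub>U\<^esub> (Arf F \<delta> \<cdot>\<^bsub>U\<^esub> z)" using p(1-3) d z by simp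
    also have "\<dots> = Arf F (\<pi> n \<cdot> \<iota> 0) \<cdot>\<^bsub>U\<^esub> x" unfolding \<delta>z using p(1-3) i x i0 by simp
    finally show ?thesis .
  qed
  \<comment> \<open>\<open>\<sigma>\<close> raises the stage by one, so nothing reaches stage 0 and
    the component of \<open>z\<close> there is \<open>x\<close> itself.\<close>
  have "\<pi> 0 \<cdot> \<sigma> = Zer T B (V 0)"
  proof (rule T.coproduct_eq[OF B])
    fix n
    have "(\<pi> 0 \<cdot> \<sigma>) \<cdot> \<iota> n = (\<pi> 0 \<cdot> \<iota> (Suc n)) \<cdot> s n" using S4[of n] S i p(1-3) s by simp
    then show "(\<pi> 0 \<cdot> \<sigma>) \<cdot> \<iota> n = Zer T B (V 0) \<cdot> \<iota> n" using p(5)[of "Suc n" 0] s i VO by simp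
  qed (use S p VO i in auto)
  then have "\<pi> 0 \<cdot> \<delta> = \<pi> 0" using p(1-3) S i(1) VO by (simp add: \<delta>_def)
  then have zz0: "zz 0 = x" using \<pi>\<delta>[of 0] p(4)[of 0] x i0 VO by (simp add: zz_def)
  have zzS: "Arf F (s n) \<cdot>\<^bsub>U\<^esub> zz n = zz (Suc n)" for n
  proof -
    have e: "\<pi> (Suc n) \<cdot> \<sigma> = s n \<cdot> \<pi> n"
    proof (rule T.coproduct_eq[OF B])
      fix m
      have 1: "(\<pi> (Suc n) \<cdot> \<sigma>) \<cdot> \<iota> m = (\<pi> (Suc n) \<cdot> \<iota> (Suc m)) \<cdot> s m" using S4[of m] S i p(1-3) s by simp
      have 2: "(s n \<cdot> \<pi> n) \<cdot> \<iota> m = s n \<cdot> (\<pi> n \<cdot> \<iota> m)" using i p(1-3) s by simp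
      show "(\<pi> (Suc n) \<cdot> \<sigma>) \<cdot> \<iota> m = (s n \<cdot> \<pi> n) \<cdot> \<iota> m"
      proof (cases "m = n")
        case True
        then show ?thesis unfolding 1 2 using p(4)[of n] p(4)[of "Suc n"] s by simp
      next
        case False
        then show ?thesis unfolding 1 2 using p(5)[of m n] p(5)[of "Suc m" "Suc n"] s VO by simp
      qed
    qed (use S p(1-3) s in auto)
    have "\<pi> (Suc n) \<cdot> \<delta> = Add T (\<pi> (Suc n)) (neg T (s n \<cdot> \<pi> n))" using e p(1-3) S i(1) by (simp add: \<delta>_def)
    then have "Arf F (Add T (\<pi> (Suc n)) (neg T (s n \<cdot> \<pi> n))) \<cdot>\<^bsub>U\<^esub> z = Zer U A (Obf F (V (Suc n)))"
      using \<pi>\<delta>[of "Suc n"] p(5)[of 0 "Suc n"] x i0 VO by simp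
    then have "Add U (zz (Suc n)) (neg U (Arf F (s n) \<cdot>\<^bsub>U\<^esub> zz n)) = Zer U A (Obf F (V (Suc n)))"
      using p(1-3) s z by (simp add: zz_def)
    then have "zz (Suc n) = Arf F (s n) \<cdot>\<^bsub>U\<^esub> zz n"
      by (rule U.Add_neg_eq_Zer[rotated 4]) (use zz s in auto)
    then show ?thesis by simp
  qed
  obtain J e where J: "finite J" "is_cut T UNIV B \<iota> J e" "Arf F e \<cdot>\<^bsub>U\<^esub> z = z"
    using F_fin_supp[OF B nat z] by metis
  \<comment> \<open>A stage outside the finite support: the image of \<open>x\<close> there is zero,
    and zero is approximable. From it the descent starts.\<close>
  obtain n where n: "n \<notin> J" using J(1) ex_new_if_finite[of J] by auto
  note E = T.is_cutD(1-3)[OF J(2)]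
  have "\<pi> n \<cdot> e = Zer T B (V n)" by (rule T.proj_cut[OF B J(2) UNIV_I n p(1-3) p(5)])
  moreover have "Arf F (\<pi> n) \<cdot>\<^bsub>U\<^esub> (Arf F e \<cdot>\<^bsub>U\<^esub> z) = Arf F (\<pi> n \<cdot> e) \<cdot>\<^bsub>U\<^esub> z" using E z p(1-3) by simp
  ultimately have "zz n = Zer U A (Obf F (V n))" using J(3) z VO i(1) by (simp add: zz_def)
  then have "good (V n) (zz n)" using good_zero[OF VO] by simp
  then have "good (V 0) (zz 0)"
  proof (induction n)
    case (Suc n)
    have "good (V n) (zz n)" by (rule sg[OF zz]) (use Suc.prems zzS in simp)
    then show ?case by (rule Suc.IH)
  qed
  then show ?thesis unfolding zz0 V0 .
qed

end

section \<open>Subcategories containing the compact objects\<close>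

lemma full_subcat_sel [simp]: "Ob (full_subcat T S) = S" "Arr (full_subcat T S) = {f \<in> Arr T. Dom T f \<in> S \<and> Cod T f \<in> S}"
  "Dom (full_subcat T S) = Dom T" "Cod (full_subcat T S) = Cod T" "Id (full_subcat T S) = Id T"
  "Comp (full_subcat T S) = Comp T" "Zer (full_subcat T S) = Zer T" "ShO (full_subcat T S) = ShO T"
  "Tri (full_subcat T S) = {(f, g, h) \<in> Tri T. Dom T f \<in> S \<and> Dom T g \<in> S \<and> Dom T h \<in> S}"
  by (simp_all add: full_subcat_def)

text \<open>Compactness is tested in \<open>T\<close>, where the coproducts exist, while the
  quotient is formed in the subcategory. Isomorphisms, zero objects and triangles of the full
  subcategory are also ones in \<open>T\<close>, so the closure properties transfer.\<close>

lemma verdier_compacts: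
  assumes T: "tri_category \<kappa> k T" and S: "tri_category \<kappa> k (full_subcat T S)" "S \<subseteq> Ob T" "compacts \<kappa> T \<subseteq> S"
    and sk: "universe_card \<kappa>" "skeletally_small \<kappa> (full_subcat T S)"
  shows "verdier \<kappa> k (full_subcat T S) (compacts \<kappa> T)"
proof (intro verdier.intro verdier_axioms.intro S(1) sk)
  interpret tri_category \<kappa> k T by (rule T)
  show "X \<in> Ob (full_subcat T S)" if "X \<in> compacts \<kappa> T" for X using that S(3) by auto
  show "Y \<in> compacts \<kappa> T" if X: "X \<in> compacts \<kappa> T" and XY: "isomorphic (full_subcat T S) X Y" for X Y
  proof -
    obtain f g where "f \<in> Hom (full_subcat T S) X Y" "inverse_arrows (full_subcat T S) f g"
      using XY unfolding isomorphic_def is_iso_def by blast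
    then have "f \<in> Hom T X Y" "inverse_arrows T f g"
      by (simp_all add: inverse_arrows_def Hom_def)
    then have "isomorphic T X Y" unfolding isomorphic_def is_iso_def by blast
    then show ?thesis using X compact_iso unfolding compacts_def by blast
  qed
  show "Z \<in> compacts \<kappa> T" if "zero_object (full_subcat T S) Z" for Z
    using that S(2) compact_zero[of Z] by (auto simp: compacts_def zero_object_def)
  show "ShO (full_subcat T S) X \<in> compacts \<kappa> T \<longleftrightarrow> X \<in> compacts \<kappa> T" if "X \<in> Ob (full_subcat T S)" for X
    using compact_ShO_iff[of X] that S(2) by (auto simp: compacts_def)
  show "Cod (full_subcat T S) g \<in> compacts \<kappa> T"
    if "(f, g, h) \<in> Tri (full_subcat T S)" "Dom (full_subcat T S) f \<in> compacts \<kappa> T"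
      "Cod (full_subcat T S) f \<in> compacts \<kappa> T" for f g h
    using that compact_cone[of f g h] by (auto simp: compacts_def)
qed

theorem theorem1p3:
  fixes \<kappa> :: "'u rel" and k :: "'r ring"
    and T :: "('r, 'o, 'm) tcat" and T' :: "('r, 'o1, 'm1) tcat" and T'' :: "('r, 'o2, 'm2) tcat"
    and E :: "('r, 'p, 'q) ecat"
    and i_up i_shriek :: "('o, 'm, 'o1, 'm1) tftr" and i_low :: "('o1, 'm1, 'o, 'm) tftr"
    and j_shriek j_low :: "('o2, 'm2, 'o, 'm) tftr" and j_up :: "('o, 'm, 'o2, 'm2) tftr"
    and S :: "'o set" and S' :: "'o1 set" and S'' :: "'o2 set"
  assumes "universe_card \<kappa>" and "cring k"
    and "compactly_generated \<kappa> k T" and "compactly_generated \<kappa> k T'"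
    and "compactly_generated \<kappa> k T''"
    and "recollement k T T' T'' i_up i_low i_shriek j_shriek j_up j_low"
    and "algebraic_via \<kappa> k T E"
    and "tri_subcat T S" and "tri_subcat T' S'" and "tri_subcat T'' S''"
    and "skeletally_small \<kappa> (full_subcat T S)" and "skeletally_small \<kappa> (full_subcat T' S')"
    and "skeletally_small \<kappa> (full_subcat T'' S'')"
    and "compacts \<kappa> T \<subseteq> S" and "compacts \<kappa> T' \<subseteq> S'" and "compacts \<kappa> T'' \<subseteq> S''"
    and "short_exact_up_to_summands \<kappa> k
      (full_subcat T' S') i_up (full_subcat T S) j_shriek (full_subcat T'' S'')"
  shows "Obf i_up ` compacts \<kappa> T \<subseteq> compacts \<kappa> T' \<and>
    Obf j_shriek ` compacts \<kappa> T'' \<subseteq> compacts \<kappa> T \<and>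
    short_exact_up_to_summands \<kappa> k
      (verdier_quotient (full_subcat T' S') (compacts \<kappa> T'))
      (induced_functor (full_subcat T' S') (compacts \<kappa> T') i_up)
      (verdier_quotient (full_subcat T S) (compacts \<kappa> T))
      (induced_functor (full_subcat T S) (compacts \<kappa> T) j_shriek)
      (verdier_quotient (full_subcat T'' S'') (compacts \<kappa> T''))"
proof -
  note univ = assms(1) and rec = assms(6)[unfolded recollement_def] and ex = assms(17)
  have T: "tri_category \<kappa> k T" "tri_category \<kappa> k T'" "tri_category \<kappa> k T''"
    using assms(3-5) by (simp_all add: compactly_generated_def)
  \<comment> \<open>The triangulated structures on the three subcategories are read off from the
    exactness hypothesis.\<close>
  have A: "tri_category \<kappa> k (full_subcat T S)" "tri_category \<kappa> k (full_subcat T' S')"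
      "tri_category \<kappa> k (full_subcat T'' S'')"
    using ex by (simp_all add: short_exact_up_to_summands_def)
  have S: "S \<subseteq> Ob T" "S' \<subseteq> Ob T'" "S'' \<subseteq> Ob T''" using assms(8-10) by (simp_all add: tri_subcat_def)
  interpret T: tri_category \<kappa> k T by (rule T)
  interpret T': tri_category \<kappa> k T' by (rule T)
  interpret T'': tri_category \<kappa> k T'' by (rule T)
  have fs: "tri_functor k T T' i_up" "tri_functor k T' T i_low" "tri_functor k T T' i_shriek"
    "tri_functor k T'' T j_shriek" "tri_functor k T T'' j_up" "tri_functor k T'' T j_low"
    and ff: "fully_faithful T' T i_low" using rec by blast+
  obtain \<eta>1 \<epsilon>1 \<eta>2 \<epsilon>2 \<eta>3 \<epsilon>3 \<eta>4 \<epsilon>4 where adj: "adjunction T T' i_up i_low \<eta>1 \<epsilon>1" "adjunction T' T i_low i_shriek \<eta>2 \<epsilon>2"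
    "adjunction T'' T j_shriek j_up \<eta>3 \<epsilon>3" "adjunction T T'' j_up j_low \<eta>4 \<epsilon>4" using rec by blast
  have P: "tri_functor_pair \<kappa> k T T' i_up" "tri_functor_pair \<kappa> k T' T i_low" "tri_functor_pair \<kappa> k T T' i_shriek"
    "tri_functor_pair \<kappa> k T'' T j_shriek" "tri_functor_pair \<kappa> k T T'' j_up" "tri_functor_pair \<kappa> k T'' T j_low"
    by (intro tri_functor_pair.intro tri_functor_pair_axioms.intro T fs)+
  note L = P[THEN tri_functor_pair.axioms(3), unfolded tri_functor_pair_axioms_def, unfolded tri_functor_def, THEN conjunct1]
  have lin: "lin_category \<kappa> k T" "lin_category \<kappa> k T'" "lin_category \<kappa> k T''" by unfold_locales
  have LP: "lin_functor_pair \<kappa> k T T' i_up" "lin_functor_pair \<kappa> k T' T i_low" "lin_functor_pair \<kappa> k T T' i_shriek"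
    "lin_functor_pair \<kappa> k T'' T j_shriek" "lin_functor_pair \<kappa> k T T'' j_up" "lin_functor_pair \<kappa> k T'' T j_low"
    by (intro lin_functor_pair.intro lin_functor_pair_axioms.intro lin L)+
  have ad: "adjoint_pair \<kappa> k T T' i_up i_low \<eta>1 \<epsilon>1" "adjoint_pair \<kappa> k T' T i_low i_shriek \<eta>2 \<epsilon>2"
    "adjoint_pair \<kappa> k T'' T j_shriek j_up \<eta>3 \<epsilon>3" "adjoint_pair \<kappa> k T T'' j_up j_low \<eta>4 \<epsilon>4"
    by (intro adjoint_pair.intro adjoint_pair_axioms.intro LP adj)+
  \<comment> \<open>The chain of adjoints continues one step further: \<open>i_low\<close> has the
    right adjoint \<open>i_shriek\<close>, and likewise \<open>j_up\<close> has
    \<open>j_low\<close>. This is what \<open>left_adjoint_compact\<close> needs.\<close>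
  have iN: "Obf i_up ` compacts \<kappa> T \<subseteq> compacts \<kappa> T'"
    using left_adjoint_compact[OF ad(1,2)] by (auto simp: compacts_def)
  have jN: "Obf j_shriek ` compacts \<kappa> T'' \<subseteq> compacts \<kappa> T"
    using left_adjoint_compact[OF ad(3,4)] by (auto simp: compacts_def)
  have jS: "Obf j_shriek X \<in> S" if "X \<in> S''" for X
    using ex that by (simp add: short_exact_up_to_summands_def tri_functor_def lin_functor_def)
  have "quotient_sequence \<kappa> k (full_subcat T S) (compacts \<kappa> T) (full_subcat T' S') (compacts \<kappa> T')
      (full_subcat T'' S'') (compacts \<kappa> T'') i_up j_shriek"
  proof (intro quotient_sequence.intro quotient_sequence_axioms.intro ex iN jN
      verdier_compacts T A S assms(14-16) univ assms(11-13))
    fix C X f assume C: "C \<in> compacts \<kappa> T" and X: "X \<in> Ob (full_subcat T'' S'')"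
      and f: "f \<in> Arr (full_subcat T S)" "Dom (full_subcat T S) f = C" "Cod (full_subcat T S) f = Obf j_shriek X"
    \<comment> \<open>Approximation for \<open>j_shriek\<close>, with the compact object
      \<open>C\<close> of \<open>T\<close> as the test object.\<close>
    interpret approximation \<kappa> k T'' T j_shriek j_up \<eta>3 \<epsilon>3 C
      by (intro approximation.intro approximation_axioms.intro P ad univ assms(5)) (use C in \<open>simp add: compacts_def\<close>)
    have XO: "X \<in> Ob T''" using X S by auto
    obtain d y where d: "d \<in> Arr T''" "compact_object \<kappa> T'' (Dom T'' d)" "Cod T'' d = X" "y \<in> Arr T" "Dom T y = C"
        "Cod T y = Obf j_shriek (Dom T'' d)" "Arf j_shriek d \<cdot>\<^bsub>T\<^esub> y = f"
      using all_good[OF XO, of f] f unfolding good_def by auto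
    have D: "Dom T'' d \<in> compacts \<kappa> T''" using d(2) by (simp add: compacts_def)
    then have "Dom T'' d \<in> S''" using assms(16) by blast
    then show "\<exists>d g. d \<in> Arr (full_subcat T'' S'') \<and> g \<in> Arr (full_subcat T S) \<and>
        Dom (full_subcat T'' S'') d \<in> compacts \<kappa> T'' \<and> Cod (full_subcat T'' S'') d = X \<and>
        Dom (full_subcat T S) g = C \<and> Cod (full_subcat T S) g = Obf j_shriek (Dom (full_subcat T'' S'') d) \<and>
        Arf j_shriek d \<cdot>\<^bsub>full_subcat T S\<^esub> g = f"
      using d D X C assms(14) jS by (intro exI[of _ d] exI[of _ y]) auto
  next
    fix B assume B: "B \<in> compacts \<kappa> T'"
    \<comment> \<open>Approximation for \<open>i_up\<close>, with the compact object
      \<open>B\<close> of \<open>T'\<close> as the test object and \<open>Obf i_low B\<close> as the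
      object to be approximated.\<close>
    interpret approximation \<kappa> k T T' i_up i_low \<eta>1 \<epsilon>1 B
      by (intro approximation.intro approximation_axioms.intro P ad univ assms(3)) (use B in \<open>simp add: compacts_def\<close>)
    interpret low: tri_functor_pair \<kappa> k T' T i_low by (rule P)
    have BO: "B \<in> Ob T'" using B by (simp add: compacts_def compact_object_def)
    let ?X = "Obf i_low B"
    \<comment> \<open>Full faithfulness of \<open>i_low\<close> makes the unit at
      \<open>Obf i_low B\<close> the image of an arrow \<open>u\<close>; the triangle identity then
      shows that \<open>u\<close> is a section of the counit \<open>\<epsilon>1 B\<close>.\<close>
    obtain u where u: "u \<in> Arr T'" "Dom T' u = B" "Cod T' u = Obf i_up ?X" "Arf i_low u = \<eta>1 ?X"
      by (rule low.ff_full[OF ff BO, of "Obf i_up ?X" "\<eta>1 ?X"]) (use BO in auto)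
    have "Arf i_low (\<epsilon>1 B \<cdot>\<^bsub>T'\<^esub> u) = Arf i_low (Id T' B)"
      using u BO triangle_right[OF BO] by simp
    then have eu: "\<epsilon>1 B \<cdot>\<^bsub>T'\<^esub> u = Id T' B" by (rule low.ff_inj[OF ff, rotated -1]) (use u BO in auto)
    \<comment> \<open>Factoring the section through the image of a compact object exhibits
      \<open>B\<close> as a retract of that image.\<close>
    obtain d y where d: "d \<in> Arr T" "compact_object \<kappa> T (Dom T d)" "Cod T d = ?X" "y \<in> Arr T'" "Dom T' y = B"
        "Cod T' y = Obf i_up (Dom T d)" "Arf i_up d \<cdot>\<^bsub>T'\<^esub> y = u"
      using all_good[of ?X u] u BO unfolding good_def by auto
    have D: "Dom T d \<in> compacts \<kappa> T" using d(2) by (simp add: compacts_def)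
    have FD: "Obf i_up (Dom T d) \<in> S'" "B \<in> S'" using iN D B assms(15) by blast+
    have "(\<epsilon>1 B \<cdot>\<^bsub>T'\<^esub> Arf i_up d) \<cdot>\<^bsub>T'\<^esub> y = \<epsilon>1 B \<cdot>\<^bsub>T'\<^esub> (Arf i_up d \<cdot>\<^bsub>T'\<^esub> y)" using d(1-6) BO by simp
    then have py: "(\<epsilon>1 B \<cdot>\<^bsub>T'\<^esub> Arf i_up d) \<cdot>\<^bsub>T'\<^esub> y = Id T' B" unfolding d(7) eu .
    have "y \<in> Hom (full_subcat T' S') B (Obf i_up (Dom T d))"
      "\<epsilon>1 B \<cdot>\<^bsub>T'\<^esub> Arf i_up d \<in> Hom (full_subcat T' S') (Obf i_up (Dom T d)) B"
      using d(1-6) BO FD by (simp_all add: Hom_def)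
    then show "\<exists>D i p. D \<in> compacts \<kappa> T \<and> i \<in> Hom (full_subcat T' S') B (Obf i_up D) \<and>
        p \<in> Hom (full_subcat T' S') (Obf i_up D) B \<and> p \<cdot>\<^bsub>full_subcat T' S'\<^esub> i = Id (full_subcat T' S') B"
      using D py by (intro exI[of _ "Dom T d"] exI[of _ y] exI[of _ "\<epsilon>1 B \<cdot>\<^bsub>T'\<^esub> Arf i_up d"]) simp
  qed
  from quotient_sequence.quotients_exact[OF this] show ?thesis by (intro conjI iN jN)
qed

end
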